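(* Let $\theta,\rho$ be real constants with $0<\theta<\frac{1}{200}$, $\rho>32\theta$, $\rho+4\theta<\frac{11}{54}$, $\rho+\theta>0$. For a sufficiently large real $x$ put $$\delta = x^{-\theta},\quad K = \delta^{-1}\log^2 x,\quad \Delta = x^{\rho},\quad D = \frac{x^{1/2}}{\Delta K^4}.$$ Suppose $\alpha\in\mathbb{R}\setminus\mathbb{Q}$ satisfies $\left|\alpha-\frac{a}{q}\right|<\frac{1}{q^2}$ with $a\in\mathbb{Z}$, $q\in\mathbb{N}$, $(a,q)=1$. Let $\lambda(d)$, $d\le D$, be complex numbers with $\lambda(d)\ll \tau(d)$ and such that $\lambda(d)\neq 0$ only if $d$ is a well-separable number of level $D$. Let $c(k)$, $0<|k|\le K$, be complex numbers with $c(k)\ll 1$. Let $b\in\mathbb{Z}$, $\beta\in\mathbb{R}$, and define $$W(x) = \sum_{d\le D}\lambda(d)\sum_{1\le |k|\le K} c(k)\sum_{\substack{x/2\le n< x\\ n\equiv b \ (\mathrm{mod}\ d)}} e\big((\alpha n^2+\beta)k\big)\Lambda(n).$$ Then for every arbitrarily small $\varepsilon>0$, $$W \ll x^{\varepsilon}\left(\frac{xK}{\Delta^{1/32}} + \frac{xK}{q^{1/32}} + x^{15/16}K^{31/32}q^{1/32} + \frac{x\Delta^{1/2}K}{q^{1/4}} + x^{1/2}\Delta^{1/2}K^{3/4}q^{1/4}\right).$$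
   Context: A positive integer $d$ is called a well-separable number of level $D\ge 1$ if for any $H,S\ge 1$ with $HS=D$ there are integers $h\le H$, $s\le S$ with $d=hs$. $\tau(d)$ is the number of divisors of $d$, $\Lambda$ is the von Mangoldt function, $e(y)=e^{2\pi i y}$. The implied constant in the conclusion may depend on $\varepsilon$, $\theta$, $\rho$ and the implied constants in the bounds on $\lambda$ and $c$. *)

theory Defs
  imports "HOL-Analysis.Analysis" "HOL-Number_Theory.Number_Theory"
begin

definition divisor_count :: "nat \<Rightarrow> nat" where
  "divisor_count d = card {k. k dvd d}"

definition well_separable :: "real \<Rightarrow> nat \<Rightarrow> bool" where
  "well_separable D d \<longleftrightarrow> d > 0 \<and>
     (\<forall>H S. H \<ge> 1 \<longrightarrow> S \<ge> 1 \<longrightarrow> H * S = D \<longrightarrow>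
        (\<exists>h s::nat. real h \<le> H \<and> real s \<le> S \<and> d = h * s))"

definition e :: "real \<Rightarrow> complex" where
  "e y = exp (2 * of_real pi * \<i> * of_real y)"

definition W_sum :: "real \<Rightarrow> real \<Rightarrow> real \<Rightarrow> (nat \<Rightarrow> complex) \<Rightarrow> (int \<Rightarrow> complex)
                      \<Rightarrow> real \<Rightarrow> int \<Rightarrow> real \<Rightarrow> complex" where
  "W_sum x D K lam c \<alpha> b \<beta> =
     (\<Sum>d\<in>{d::nat. 1 \<le> d \<and> real d \<le> D}. lam d *
        (\<Sum>k\<in>{k::int. 1 \<le> \<bar>k\<bar> \<and> real_of_int \<bar>k\<bar> \<le> K}. c k *
           (\<Sum>n\<in>{n::nat. x / 2 \<le> real n \<and> real n < x \<and> [int n = b] (mod int d)}.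
              e ((\<alpha> * (real n)\<^sup>2 + \<beta>) * real_of_int k) * of_real (mangoldt n))))"

end

theory Submission
  imports
    Defs
    "HOL-Analysis.Kronecker_Approximation_Theorem"
    "HOL-Computational_Algebra.Squarefree"
    "HOL-Real_Asymp.Real_Asymp"
begin

text \<open>Vaughan's identity splits the sum into linear sums with a long smooth variable, which are treated by Weyl
  differencing directly, and bilinear sums. In a bilinear sum over \<open>n = m * l\<close> one factors \<open>d = h * s\<close> by
  well-separability and applies Cauchy-Schwarz with \<open>k, h, m\<close> outside, so that only \<open>s, l\<close> are doubled. The
  congruences \<open>m * l1 \<equiv> b\<close> mod \<open>h * s1\<close> and \<open>m * l2 \<equiv> b\<close> mod \<open>h * s2\<close> force \<open>h dvd l1 - l2\<close> and put \<open>m\<close> into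
  a progression modulo \<open>h * lcm s1 s2\<close>. For \<open>l1 \<noteq> l2\<close>, Weyl differencing in \<open>m\<close> gives sums of
  \<open>min N (1 / \<parallel>\<alpha> v\<parallel>)\<close> with \<open>v = 2 k f g u h\<^sup>3 s\<^sup>2\<close>, where \<open>f = \<bar>l1 - l2\<bar> / h\<close>, \<open>g = l1 + l2\<close>, \<open>s = lcm s1 s2\<close>.
  The powers \<open>h\<^sup>3\<close> and \<open>s\<^sup>2\<close> make \<open>v\<close> too sparse for the classical estimate, so the fractional parts are
  smoothed by a cubic Weyl estimate in \<open>h\<close> and a quadratic one in \<open>s\<close>; a variable that is too short for this
  is kept fixed. With \<open>\<kappa> = 1 / q + q / (x\<^sup>2 K)\<close> this saves \<open>(\<Delta> powr (-1/8) + \<Delta>\<^sup>2 * \<kappa>) powr (1/4)\<close>,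
  and if \<open>\<Delta>\<^sup>2 * \<kappa> > 1\<close> the claim is trivial.\<close>

section \<open>Distance to the nearest integer\<close>

text \<open>One product governs every estimate: range of the linear multiplier times truncation
  length times \<open>H^3 * S^2\<close> stays near \<open>Q = x^2 * K\<close>. In a bilinear block
  the multiplier \<open>k * f * g * u\<close> runs up to about \<open>K * (L / H) * L * N\<close>,
  and \<open>K * (L / H) * L * N * N * H^3 * S^2 = K * L^2 * (N * H * S)^2\<close>, with
  \<open>N * H * S\<close> near \<open>M\<close> and \<open>M * L\<close> near \<open>x\<close>. A
  Weyl step trades \<open>h\<close> or \<open>s\<close> for linear variables without changing this
  product, so the final linear estimate always loses the same \<open>q / Q\<close>.

  A range kept fixed costs a factor in front of \<open>\<kappa>\<close>. For
  \<open>H \<le> y^4\<close> and \<open>S \<le> y^2\<close> it is at most \<open>y^16\<close>, which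
  is \<open>\<Delta>^2\<close>. Longer ranges still save \<open>y\<close> under nested square and
  fourth roots.

  The factorization with \<open>H * S = D\<close> meets two opposite demands:
  \<open>H * S^2 * y\<close> at most about \<open>M\<close>, so that the progressions in
  \<open>m\<close> are long, and \<open>H * M * y\<close> at most about \<open>x\<close>, so that
  the terms with \<open>l1 = l2\<close> are few. Both can be met because
  \<open>D * \<Delta> \<le> sqrt x\<close>.\<close>

definition int_dist :: "real \<Rightarrow> real" where "int_dist y = \<bar>y - of_int (round y)\<bar>"

text \<open>This is \<open>min N (1 / \<parallel>y\<parallel>)\<close>, arranged so that integers \<open>y\<close> get the value \<open>N\<close> and not \<open>1 / 0 = 0\<close>.\<close>

definition min_recip :: "real \<Rightarrow> real \<Rightarrow> real" where
  "min_recip N y = (if N * int_dist y \<le> 1 then N else 1 / int_dist y)"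

lemma int_dist_nonneg [simp]: "0 \<le> int_dist y"
  by (simp add: int_dist_def)

lemma int_dist_le_half: "int_dist y \<le> 1/2"
  unfolding int_dist_def using of_int_round_abs_le[of y] by (simp add: abs_minus_commute)

lemma int_dist_le: "int_dist y \<le> \<bar>y - of_int m\<bar>"
  unfolding int_dist_def using round_diff_minimal[of y m] by simp

lemma int_dist_attained: obtains m :: int where "int_dist y = \<bar>y - of_int m\<bar>"
  unfolding int_dist_def by blast

lemma int_dist_minus [simp]: "int_dist (- y) = int_dist y"
proof -
  have "int_dist (-y) \<le> int_dist y" for y
  proof -
    obtain m where "int_dist y = \<bar>y - of_int m\<bar>" by (rule int_dist_attained)
    then show ?thesis using int_dist_le[of "-y" "-m"] by simp
  qed
  from this[of y] this[of "-y"] show ?thesis by simp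
qed

lemma int_dist_triangle: "int_dist (y + z) \<le> int_dist y + int_dist z"
proof -
  obtain m n where "int_dist y = \<bar>y - of_int m\<bar>" "int_dist z = \<bar>z - of_int n\<bar>"
    by (meson int_dist_attained)
  then show ?thesis using int_dist_le[of "y+z" "m+n"] by simp
qed

lemma int_dist_diff: "int_dist (y - z) \<le> int_dist y + int_dist z"
  using int_dist_triangle[of y "-z"] by simp

lemma int_dist_abs_le: "int_dist y \<le> \<bar>y\<bar>"
  using int_dist_le[of y 0] by simp

lemma int_dist_add_int [simp]: "int_dist (y + of_int m) = int_dist y"
proof -
  have "int_dist (y + of_int m) \<le> int_dist y" for y and m :: int
  proof -
    obtain n where "int_dist y = \<bar>y - of_int n\<bar>" by (rule int_dist_attained)
    then show ?thesis using int_dist_le[of "y + of_int m" "n + m"] by simp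
  qed
  from this[of y m] this[of "y + of_int m" "-m"] show ?thesis by simp
qed

lemma int_dist_int_mult_le: "int_dist (real n * y) \<le> real n * int_dist y"
proof -
  obtain m where m: "int_dist y = \<bar>y - of_int m\<bar>" by (rule int_dist_attained)
  have "int_dist (real n * y) \<le> \<bar>real n * y - of_int (int n * m)\<bar>" by (rule int_dist_le)
  also have "real n * y - of_int (int n * m) = real n * (y - of_int m)"
    by (simp add: algebra_simps)
  finally show ?thesis using m by (simp add: abs_mult)
qed

lemma min_recip_nonneg [simp]: "0 \<le> N \<Longrightarrow> 0 \<le> min_recip N y"
  by (simp add: min_recip_def)

lemma min_recip_minus [simp]: "min_recip N (-y) = min_recip N y"
  by (simp add: min_recip_def)

lemma int_dist_pos: "\<not> N * int_dist y \<le> 1 \<Longrightarrow> 0 < int_dist y"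
  using int_dist_nonneg[of y] by (metis less_eq_real_def mult_zero_right zero_less_one)

lemma min_recip_le: "min_recip N y \<le> N"
proof (cases "N * int_dist y \<le> 1")
  case False
  then have "int_dist y > 0" by (rule int_dist_pos)
  with False show ?thesis by (simp add: min_recip_def field_simps)
qed (simp add: min_recip_def)

lemma min_recip_le_inverse: "0 < int_dist y \<Longrightarrow> min_recip N y \<le> 1 / int_dist y"
  by (simp add: min_recip_def field_simps)

section \<open>The additive character and its distance from 1\<close>

lemma e_add: "e (y + z) = e y * e z"
  by (simp add: e_def distrib_left exp_add)

lemma e_cis: "e y = cis (2 * pi * y)"
  by (simp add: e_def cis_conv_exp mult_ac)

lemma norm_e [simp]: "norm (e y) = 1"
  by (simp add: e_cis)

lemma e_0 [simp]: "e 0 = 1"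
  by (simp add: e_def)

lemma e_int [simp]: "e (of_int m) = 1"
  by (simp add: e_cis cis_multiple_2pi)

lemma e_minus: "e (-y) = cnj (e y)"
  by (simp add: e_cis cis_cnj)

lemma e_add_int: "e (y + of_int m) = e y"
  by (simp add: e_add)

lemma e_nat_mult: "e (real n * y) = e y ^ n"
proof -
  have "e (real n * y) = cis (real n * (2 * pi * y))"
    by (simp add: e_cis mult_ac)
  then show ?thesis by (simp add: e_cis Complex.DeMoivre)
qed

lemma norm_e_minus_1: "norm (e y - 1) = 2 * \<bar>sin (pi * y)\<bar>"
  using dist_exp_i_1[of "2 * pi * y"] by (simp add: e_cis cis_conv_exp)

lemma norm_e_diff_le: "norm (e y - 1) \<le> 2 * pi * int_dist y"
proof -
  obtain m where m: "int_dist y = \<bar>y - of_int m\<bar>" by (rule int_dist_attained)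
  have "e y = e (y - of_int m)" using e_add_int[of "y - of_int m" m] by simp
  then show ?thesis
    using abs_sin_x_le_abs_x[of "pi * (y - of_int m)"] m by (simp add: norm_e_minus_1 abs_mult)
qed

text \<open>The cubic Taylor bound gives \<open>sin u \<ge> 5/6 * u\<close> on the unit interval;
  past it \<open>sin\<close> still increases up to \<open>pi / 2\<close>, and
  \<open>sin 1 \<ge> 5/6\<close> exceeds every admissible \<open>t\<close>. The slope 1, half the
  optimal 2, is enough for a lower bound of order \<open>int_dist y\<close>.\<close>

lemma sin_pi_mult_ge: assumes "0 \<le> t" "t \<le> 1/2" shows "t \<le> sin (pi * t)"
proof -
  have *: "5/6 * u \<le> sin u" if "0 \<le> u" "u \<le> 1" for u :: real
  proof -
    have "\<bar>sin u - (\<Sum>m<3. sin_coeff m * u ^ m)\<bar> \<le> inverse (fact 3) * \<bar>u\<bar> ^ 3"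
      by (rule Maclaurin_sin_bound)
    then have "\<bar>sin u - u\<bar> \<le> u ^ 3 / 6"
      using that by (simp add: eval_nat_numeral sin_coeff_def)
    moreover have "u ^ 3 \<le> u" using that power_decreasing[of 1 3 u] by simp
    ultimately show ?thesis by linarith
  qed
  show ?thesis
  proof (cases "pi * t \<le> 1")
    case True
    have "t * (6/5) \<le> t * pi" using pi_ge_two assms by (intro mult_left_mono) auto
    then show ?thesis using *[of "pi * t"] True assms by (simp add: mult.commute)
  next
    case False
    have "sin 1 \<le> sin (pi * t)"
      using assms False pi_ge_two by (intro sin_monotone_2pi_le) (auto simp: field_simps)
    then show ?thesis using *[of 1] assms by simp
  qed
qed

lemma norm_e_diff_ge: "2 * int_dist y \<le> norm (e y - 1)"
proof -
  obtain m where m: "int_dist y = \<bar>y - of_int m\<bar>" by (rule int_dist_attained)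
  define t where "t = y - of_int m"
  have t: "\<bar>t\<bar> \<le> 1/2" using int_dist_le_half[of y] m t_def by simp
  have "e y = e t" using e_add_int[of t m] by (simp add: t_def)
  moreover have "\<bar>t\<bar> \<le> \<bar>sin (pi * t)\<bar>"
    using sin_pi_mult_ge[of "\<bar>t\<bar>"] t by (cases "t \<ge> 0") auto
  ultimately show ?thesis using m t_def by (simp add: norm_e_minus_1)
qed

section \<open>Weyl differencing\<close>

lemma norm_sum_e_linear_le:
  assumes "real n \<le> N"
  shows "norm (\<Sum>t<n. e (real t * y + z)) \<le> min_recip N y"
proof (cases "N * int_dist y \<le> 1")
  case True
  have "norm (\<Sum>t<n. e (real t * y + z)) \<le> (\<Sum>t<n. 1)"
    by (rule order_trans[OF norm_sum]) simp
  with True assms show ?thesis by (simp add: min_recip_def)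
next
  case False
  then have p: "int_dist y > 0" by (rule int_dist_pos)
  then have ne: "e y \<noteq> 1" using norm_e_diff_ge[of y] by auto
  have "(\<Sum>t<n. e (real t * y + z)) = e z * (\<Sum>t<n. e y ^ t)"
    by (simp add: e_add e_nat_mult sum_distrib_left) (simp add: mult.commute)
  also have "\<dots> = e z * ((e y ^ n - 1) / (e y - 1))"
    using ne by (simp add: geometric_sum)
  finally have "norm (\<Sum>t<n. e (real t * y + z)) = norm (e y ^ n - 1) / norm (e y - 1)"
    by (simp add: norm_mult norm_divide)
  also have "\<dots> \<le> 2 / (2 * int_dist y)"
  proof (intro frac_le)
    show "norm (e y ^ n - 1) \<le> 2"
      using norm_triangle_ineq4[of "e y ^ n" 1] by (simp add: norm_power)
  qed (use p norm_e_diff_ge in auto)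
  finally show ?thesis using False by (simp add: min_recip_def)
qed

text \<open>Sorts index pairs by their difference \<open>u\<close>; each difference contributes both
  orders, so that a Hermitian square becomes twice a real part.\<close>

lemma sum_sum_diag_split:
  fixes f :: "nat \<Rightarrow> nat \<Rightarrow> 'a::comm_monoid_add"
  shows "(\<Sum>i<n. \<Sum>j<n. f i j) =
    (\<Sum>i<n. f i i) + (\<Sum>u\<in>{1..<n}. \<Sum>t<n-u. f (t+u) t + f t (t+u))"
proof (induction n)
  case (Suc n)
  have "(\<Sum>i<Suc n. \<Sum>j<Suc n. f i j) = (\<Sum>i<n. \<Sum>j<n. f i j) + (\<Sum>j<n. f n j + f j n) + f n n"
    by (simp add: sum.distrib algebra_simps)
  moreover have "(\<Sum>u\<in>{1..<Suc n}. \<Sum>t<Suc n-u. f (t+u) t + f t (t+u))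
     = (\<Sum>u\<in>{1..<n}. \<Sum>t<n-u. f (t+u) t + f t (t+u)) + (\<Sum>j<n. f n j + f j n)"
  proof -
    have "(\<Sum>u\<in>{1..<Suc n}. \<Sum>t<Suc n-u. f (t+u) t + f t (t+u))
      = (\<Sum>u\<in>{1..<Suc n}. (\<Sum>t<n-u. f (t+u) t + f t (t+u)) + (f n (n-u) + f (n-u) n))"
    proof (intro sum.cong refl)
      fix u assume "u \<in> {1..<Suc n}"
      then have "Suc n - u = Suc (n - u)" "n - u + u = n" by auto
      then show "(\<Sum>t<Suc n-u. f (t+u) t + f t (t+u)) =
        (\<Sum>t<n-u. f (t+u) t + f t (t+u)) + (f n (n-u) + f (n-u) n)" by simp
    qed
    also have "\<dots> = (\<Sum>u\<in>{1..<Suc n}. \<Sum>t<n-u. f (t+u) t + f t (t+u)) +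
        (\<Sum>u\<in>{1..<Suc n}. f n (n-u) + f (n-u) n)" by (rule sum.distrib)
    also have "(\<Sum>u\<in>{1..<Suc n}. f n (n-u) + f (n-u) n) = (\<Sum>j<n. f n j + f j n)"
      by (rule sum.reindex_bij_witness[of _ "\<lambda>j. n - j" "\<lambda>u. n - u"]) auto
    also have "(\<Sum>u\<in>{1..<Suc n}. \<Sum>t<n-u. f (t+u) t + f t (t+u)) = 
      (\<Sum>u\<in>{1..<n}. \<Sum>t<n-u. f (t+u) t + f t (t+u))"
      by (intro sum.mono_neutral_right) auto
    finally show ?thesis .
  qed
  ultimately show ?case using Suc by (simp add: algebra_simps)
qed simp

lemma norm_sum_squared_differencing:
  fixes z :: "nat \<Rightarrow> complex"
  assumes "\<And>t. norm (z t) \<le> 1"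
  shows "(norm (\<Sum>t<n. z t))\<^sup>2 \<le> real n + 2 * (\<Sum>u\<in>{1..<n}. norm (\<Sum>t<n-u. z (t+u) * cnj (z t)))"
proof -
  have "(norm (\<Sum>t<n. z t))\<^sup>2 = norm ((\<Sum>t<n. z t) * cnj (\<Sum>t<n. z t))"
    by (simp only: norm_mult power2_eq_square complex_mod_cnj)
  also have "(\<Sum>t<n. z t) * cnj (\<Sum>t<n. z t) = (\<Sum>i<n. \<Sum>j<n. z i * cnj (z j))"
    by (simp add: sum_product)
  also have "\<dots> = (\<Sum>i<n. z i * cnj (z i)) +
     (\<Sum>u\<in>{1..<n}. (\<Sum>t<n-u. z (t+u) * cnj (z t)) + cnj (\<Sum>t<n-u. z (t+u) * cnj (z t)))"
    by (subst sum_sum_diag_split) (simp add: sum.distrib mult.commute)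
  also have "norm \<dots> \<le> real n + (\<Sum>u\<in>{1..<n}. 2 * norm (\<Sum>t<n-u. z (t+u) * cnj (z t)))"
  proof (intro order_trans[OF norm_triangle_ineq] add_mono)
    have "norm (\<Sum>i<n. z i * cnj (z i)) \<le> (\<Sum>i<n. 1)"
      by (intro sum_norm_le) (use assms in \<open>auto simp: norm_mult intro: mult_le_one\<close>)
    then show "norm (\<Sum>i<n. z i * cnj (z i)) \<le> real n" by simp
    show "norm (\<Sum>u\<in>{1..<n}. (\<Sum>t<n-u. z (t+u) * cnj (z t)) + cnj (\<Sum>t<n-u. z (t+u) * cnj (z t)))
      \<le> (\<Sum>u\<in>{1..<n}. 2 * norm (\<Sum>t<n-u. z (t+u) * cnj (z t)))"
      by (intro sum_norm_le order_trans[OF norm_triangle_ineq]) (simp only: complex_mod_cnj mult_2 order_refl)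
  qed
  finally show ?thesis by (simp add: sum_distrib_left)
qed

text \<open>Differencing leaves a linear phase of slope \<open>2 * \<gamma> * u\<close>; the lower
  coefficients only add a constant to it, so the bound is uniform in \<open>\<delta>\<close> and
  \<open>\<zeta>\<close> and applies to any translated block.\<close>

lemma norm_sum_e_quadratic:
  assumes "n \<le> N"
  shows "(norm (\<Sum>t<n. e (\<gamma> * (real t)\<^sup>2 + \<delta> * real t + \<zeta>)))\<^sup>2 \<le>
    real N + 2 * (\<Sum>u\<in>{1..N}. min_recip (real N) (2 * \<gamma> * real u))"
proof -
  let ?z = "\<lambda>t. e (\<gamma> * (real t)\<^sup>2 + \<delta> * real t + \<zeta>)"
  have "(norm (\<Sum>t<n. ?z t))\<^sup>2 \<le> real n + 2 * (\<Sum>u\<in>{1..<n}. norm (\<Sum>t<n-u. ?z (t+u) * cnj (?z t)))"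
    by (rule norm_sum_squared_differencing) simp
  also have "(\<Sum>u\<in>{1..<n}. norm (\<Sum>t<n-u. ?z (t+u) * cnj (?z t))) \<le>
     (\<Sum>u\<in>{1..<n}. min_recip (real N) (2 * \<gamma> * real u))"
  proof (intro sum_mono)
    fix u
    have "?z (t+u) * cnj (?z t) = e (real t * (2 * \<gamma> * real u) + (\<gamma> * (real u)\<^sup>2 + \<delta> * real u))" for t
      unfolding e_minus[symmetric] e_add[symmetric]
      by (rule arg_cong[of _ _ e]) (simp add: power2_eq_square algebra_simps)
    then show "norm (\<Sum>t<n-u. ?z (t+u) * cnj (?z t)) \<le> min_recip (real N) (2 * \<gamma> * real u)"
      using norm_sum_e_linear_le[of "n - u" "real N"] assms by simp
  qed
  also have "\<dots> \<le> (\<Sum>u\<in>{1..N}. min_recip (real N) (2 * \<gamma> * real u))"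
    by (intro sum_mono2) (use assms in auto)
  finally show ?thesis using assms by simp
qed

lemma sum_squared_le_card_sum_squares:
  fixes f :: "'a \<Rightarrow> real"
  shows "(\<Sum>i\<in>A. f i)\<^sup>2 \<le> real (card A) * (\<Sum>i\<in>A. (f i)\<^sup>2)"
  using Cauchy_Schwarz_ineq_sum[of "\<lambda>_. 1" f A] by simp

text \<open>Each correlation is a quadratic sum with leading coefficient
  \<open>3 * \<gamma> * u\<close>, to which the quadratic bound applies. Cauchy-Schwarz over the
  shift between the two rounds of differencing produces the fourth power.\<close>

lemma norm_sum_e_cubic:
  assumes "n \<le> N" "1 \<le> N"
  shows "(norm (\<Sum>t<n. e (\<gamma> * (real t)^3 + \<delta> * (real t)\<^sup>2 + \<zeta> * real t + \<eta>)))^4 \<le>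
    10 * real N ^ 3 + 16 * real N * (\<Sum>u\<in>{1..N}. \<Sum>v\<in>{1..N}. min_recip (real N) (6 * \<gamma> * real u * real v))"
proof -
  let ?z = "\<lambda>t. e (\<gamma> * (real t)^3 + \<delta> * (real t)\<^sup>2 + \<zeta> * real t + \<eta>)"
  let ?R = "\<lambda>u. \<Sum>v\<in>{1..N}. min_recip (real N) (6 * \<gamma> * real u * real v)"
  let ?s = "\<lambda>u. norm (\<Sum>t<n-u. ?z (t+u) * cnj (?z t))"
  have s: "(?s u)\<^sup>2 \<le> real N + 2 * ?R u" for u
  proof -
    have "?z (t+u) * cnj (?z t) = e ((3 * \<gamma> * real u) * (real t)\<^sup>2 + (3 * \<gamma> * (real u)\<^sup>2 + 2 * \<delta> * real u) * real t
       + (\<gamma> * (real u)^3 + \<delta> * (real u)\<^sup>2 + \<zeta> * real u))" for t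
      unfolding e_minus[symmetric] e_add[symmetric]
      by (rule arg_cong[of _ _ e]) (simp add: power2_eq_square power3_eq_cube algebra_simps)
    moreover have "n - u \<le> N" using assms by simp
    ultimately show ?thesis
      using norm_sum_e_quadratic[of "n-u" N "3 * \<gamma> * real u" "3 * \<gamma> * (real u)\<^sup>2 + 2 * \<delta> * real u"
          "\<gamma> * (real u)^3 + \<delta> * (real u)\<^sup>2 + \<zeta> * real u"] by (simp only: mult_2) (simp add: algebra_simps)
  qed
  have R0: "0 \<le> ?R u" for u by (intro sum_nonneg) auto
  have "(norm (\<Sum>t<n. ?z t))\<^sup>2 \<le> real n + 2 * (\<Sum>u\<in>{1..<n}. ?s u)"
    by (rule norm_sum_squared_differencing) simp
  then have "((norm (\<Sum>t<n. ?z t))\<^sup>2)\<^sup>2 \<le> (real n + 2 * (\<Sum>u\<in>{1..<n}. ?s u))\<^sup>2"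
    by (intro power_mono) auto
  \<comment> \<open>Origin of the constants: \<open>2 * n^2 \<le> 2 * N^3\<close> joins
    \<open>8 * N^3\<close> to give 10, and \<open>8 * 2\<close> gives 16.\<close>
  also have "\<dots> \<le> 2 * (real n)\<^sup>2 + 8 * (\<Sum>u\<in>{1..<n}. ?s u)\<^sup>2"
    using sum_squares_bound[of "real n" "2 * (\<Sum>u\<in>{1..<n}. ?s u)"]
    by (simp add: power2_sum power_mult_distrib)
  also have "(\<Sum>u\<in>{1..<n}. ?s u)\<^sup>2 \<le> real (card {1..<n}) * (\<Sum>u\<in>{1..<n}. (?s u)\<^sup>2)"
    by (rule sum_squared_le_card_sum_squares)
  also have "\<dots> \<le> real N * (\<Sum>u\<in>{1..N}. real N + 2 * ?R u)"
  proof (intro mult_mono)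
    show "(\<Sum>u\<in>{1..<n}. (?s u)\<^sup>2) \<le> (\<Sum>u\<in>{1..N}. real N + 2 * ?R u)"
      using assms R0 by (intro order_trans[OF sum_mono[OF s] sum_mono2]) (auto intro!: add_nonneg_nonneg mult_nonneg_nonneg simp del: sum.atLeast1_atMost_eq)
  qed (use assms in \<open>auto intro: sum_nonneg\<close>)
  also have "\<dots> = real N ^ 3 + 2 * real N * (\<Sum>u\<in>{1..N}. ?R u)"
    by (simp add: sum.distrib sum_distrib_left algebra_simps power3_eq_cube)
  also have "2 * (real n)\<^sup>2 \<le> 2 * real N ^ 3"
  proof -
    have "(real n)\<^sup>2 \<le> (real N)\<^sup>2" using assms by (intro power_mono) auto
    also have "\<dots> \<le> real N ^ 3" using assms by (intro power_increasing) auto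
    finally show ?thesis by simp
  qed
  finally show ?thesis by (simp add: algebra_simps flip: power_mult)
qed

section \<open>Rational approximation\<close>

lemma fejer_lower_bound:
  assumes "1 \<le> n" "16 * real n * int_dist y \<le> 1"
  shows "real n / 4 \<le> (norm (\<Sum>t<n. e (real t * y)))\<^sup>2 / real n"
proof -
  \<comment> \<open>By \<open>pi < 4\<close> and \<open>16 * n * int_dist y \<le> 1\<close> every
    term stays within 1/2 of 1, so no cancellation occurs.\<close>
  have "norm (e (real t * y) - 1) \<le> 1/2" if "t < n" for t
  proof -
    have "norm (e (real t * y) - 1) \<le> 2 * pi * (real t * int_dist y)"
      using int_dist_int_mult_le[of t y] pi_ge_zero
      by (intro order_trans[OF norm_e_diff_le] mult_left_mono) auto
    also have "\<dots> \<le> 2 * 4 * (real n * int_dist y)"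
      using that pi_less_4 by (intro mult_mono) auto
    finally show ?thesis using assms by simp
  qed
  then have "norm (\<Sum>t<n. e (real t * y) - 1) \<le> (\<Sum>t<n. 1/2)"
    by (intro sum_norm_le) auto
  then have "norm ((\<Sum>t<n. e (real t * y)) - of_nat n) \<le> real n / 2"
    by (simp add: sum_subtractf)
  moreover have "real n \<le> norm (\<Sum>t<n. e (real t * y)) + norm ((\<Sum>t<n. e (real t * y)) - of_nat n)"
    using norm_triangle_ineq4[of "(\<Sum>t<n. e (real t * y))" "(\<Sum>t<n. e (real t * y)) - of_nat n"] by simp
  ultimately have "real n / 2 \<le> norm (\<Sum>t<n. e (real t * y))" by simp
  then have "(real n / 2)\<^sup>2 \<le> (norm (\<Sum>t<n. e (real t * y)))\<^sup>2"
    by (intro power_mono) auto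
  then show ?thesis using assms by (simp add: field_simps power2_eq_square)
qed

text \<open>Nonnegative kernels with explicit frequencies take the place of
  \<open>min_recip\<close>, so that a sum over \<open>y\<close> can be moved inside and becomes an
  exponential sum. Lengths that are powers of two keep the number of kernels at most
  \<open>I\<close>.\<close>

lemma min_recip_le_fejer:
  assumes "1 \<le> N" "N < 2 ^ I"
  shows "min_recip (real N) y \<le>
    128 * (\<Sum>i\<in>{i. i < I \<and> 2^i \<le> N}. (norm (\<Sum>t<2^i. e (real t * y)))\<^sup>2 / 2^i)" (is "_ \<le> 128 * (\<Sum>i\<in>?A. ?F i)")
proof -
  have "\<exists>i\<in>?A. min_recip (real N) y \<le> 128 * ?F i"
  proof (cases "16 * int_dist y \<le> 1")
    case False
    then have "1 / int_dist y \<le> 16" "0 < int_dist y" by (simp_all add: field_simps)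
    then have "min_recip (real N) y \<le> 16" using min_recip_le_inverse[of y "real N"] by linarith
    moreover have "0 < I" using assms by (cases I) auto
    ultimately show ?thesis using assms by (intro bexI[of _ 0]) auto
  next
    case True
    \<comment> \<open>A dyadic length at the edge of the region where the kernel is large:
      \<open>P 0\<close> holds and \<open>P N\<close> fails because \<open>2^N > N\<close>. Failure
      at \<open>Suc i\<close> bounds \<open>min_recip\<close> by \<open>32 * 2^i\<close>, against a
      kernel value of at least \<open>2^i / 4\<close>; hence 128.\<close>
    define P where "P i \<longleftrightarrow> 2^i \<le> N \<and> 16 * 2^i * int_dist y \<le> 1" for i :: nat
    have "\<not> P N" by (simp add: P_def not_le)
    moreover have "P 0" using True assms by (simp add: P_def)
    ultimately obtain i where i: "P i" "\<not> P (Suc i)" by (metis nat_induct)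
    have "2^i < (2::nat)^I" using i(1) assms unfolding P_def by linarith
    then have "i < I" by simp
    have "real (2^i) / 4 \<le> ?F i"
      using fejer_lower_bound[of "2^i" y] i(1) unfolding P_def by simp
    moreover have "min_recip (real N) y \<le> 32 * 2^i"
    proof (cases "2 * 2^i \<le> N")
      case True
      then have "1 < 32 * 2^i * int_dist y" using i(2) unfolding P_def by simp
      moreover from this have "0 < int_dist y" using int_dist_nonneg[of y] by (metis less_eq_real_def mult_zero_right not_one_less_zero)
      ultimately have "1 / int_dist y \<le> 32 * 2^i" by (simp add: field_simps)
      then show ?thesis using min_recip_le_inverse[OF \<open>0 < int_dist y\<close>, of "real N"] by linarith
    next
      case False
      then have "real N \<le> real (2 * 2^i)" by (intro of_nat_mono) simp
      then show ?thesis using min_recip_le[of "real N" y] by simp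
    qed
    ultimately show ?thesis using \<open>i < I\<close> i(1) unfolding P_def by (intro bexI[of _ i]) auto
  qed
  then obtain i where i: "i \<in> ?A" "min_recip (real N) y \<le> 128 * ?F i" by blast
  have "?F i \<le> (\<Sum>i\<in>?A. ?F i)" using i(1) by (intro member_le_sum) auto
  then show ?thesis using i(2) by linarith
qed

lemma norm_sum_e_squared_eq:
  "(norm (\<Sum>t<n. e (real t * y)))\<^sup>2 = real n + 2 * (\<Sum>u\<in>{1..<n}. real (n - u) * Re (e (real u * y)))"
proof -
  let ?z = "\<lambda>t. e (real t * y)"
  have zz: "?z (t+u) * cnj (?z t) = e (real u * y)" for t u
    unfolding e_minus[symmetric] e_add[symmetric] by (simp add: algebra_simps)
  have zz': "?z t * cnj (?z (t+u)) = cnj (e (real u * y))" for t u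
    by (metis zz complex_cnj_cnj complex_cnj_mult mult.commute)
  have "complex_of_real ((norm (\<Sum>t<n. ?z t))\<^sup>2) = (\<Sum>t<n. ?z t) * cnj (\<Sum>t<n. ?z t)"
    by (rule complex_norm_square)
  also have "\<dots> = (\<Sum>i<n. \<Sum>j<n. ?z i * cnj (?z j))" by (simp add: sum_product)
  also have "\<dots> = (\<Sum>i<n. ?z i * cnj (?z i)) +
     (\<Sum>u\<in>{1..<n}. \<Sum>t<n-u. e (real u * y) + cnj (e (real u * y)))"
    by (subst sum_sum_diag_split) (simp only: zz zz')
  also have "(\<Sum>i<n. ?z i * cnj (?z i)) = of_nat n" using zz[of _ 0] by simp
  also have "(\<Sum>u\<in>{1..<n}. \<Sum>t<n-u. e (real u * y) + cnj (e (real u * y))) =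
      of_real (2 * (\<Sum>u\<in>{1..<n}. real (n - u) * Re (e (real u * y))))"
    by (simp add: complex_add_cnj sum_distrib_left mult_ac)
  finally have "complex_of_real ((norm (\<Sum>t<n. ?z t))\<^sup>2) =
     of_real (real n + 2 * (\<Sum>u\<in>{1..<n}. real (n - u) * Re (e (real u * y))))" by simp
  then show ?thesis by (simp only: of_real_eq_iff)
qed

text \<open>Frequency 0 of the kernels yields \<open>card P\<close>, the others yield exponential
  sums at \<open>w < 2^i \<le> N\<close>; the triangular weights are at most \<open>2^i\<close> and
  cancel against the normalisation. Here fractional parts turn into Weyl sums.\<close>

lemma sum_min_recip_le_exponential_sums:
  assumes "1 \<le> N" "N < 2 ^ I" "finite P"
  shows "(\<Sum>p\<in>P. min_recip (real N) (g p)) \<le>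
     256 * real I * (real (card P) + (\<Sum>w\<in>{1..N}. norm (\<Sum>p\<in>P. e (real w * g p))))"
proof -
  let ?R = "\<Sum>w\<in>{1..N}. norm (\<Sum>p\<in>P. e (real w * g p))"
  let ?A = "{i. i < I \<and> 2^i \<le> N}"
  have R0: "0 \<le> ?R" by (intro sum_nonneg) auto
  have F: "(\<Sum>p\<in>P. (norm (\<Sum>t<2^i. e (real t * g p)))\<^sup>2 / 2^i) \<le> real (card P) + 2 * ?R" if "i \<in> ?A" for i
  proof -
    let ?n = "2^i :: nat"
    have "(\<Sum>p\<in>P. (norm (\<Sum>t<?n. e (real t * g p)))\<^sup>2) =
      real ?n * real (card P) + 2 * (\<Sum>p\<in>P. \<Sum>u\<in>{1..<?n}. real (?n - u) * Re (e (real u * g p)))"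
      by (simp only: norm_sum_e_squared_eq sum.distrib sum_distrib_left sum_constant) (simp add: mult_ac)
    also have "(\<Sum>p\<in>P. \<Sum>u\<in>{1..<?n}. real (?n - u) * Re (e (real u * g p))) =
       (\<Sum>u\<in>{1..<?n}. real (?n - u) * Re (\<Sum>p\<in>P. e (real u * g p)))"
      by (subst sum.swap) (simp add: sum_distrib_left)
    also have "\<dots> \<le> (\<Sum>u\<in>{1..<?n}. real ?n * norm (\<Sum>p\<in>P. e (real u * g p)))"
    proof (intro sum_mono)
      fix u
      have "real (?n - u) * Re (\<Sum>p\<in>P. e (real u * g p)) \<le> real (?n - u) * norm (\<Sum>p\<in>P. e (real u * g p))"
        by (intro mult_left_mono complex_Re_le_cmod) auto
      also have "\<dots> \<le> real ?n * norm (\<Sum>p\<in>P. e (real u * g p))"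
        by (intro mult_right_mono of_nat_mono) auto
      finally show "real (?n - u) * Re (\<Sum>p\<in>P. e (real u * g p)) \<le> real ?n * norm (\<Sum>p\<in>P. e (real u * g p))" .
    qed
    also have "\<dots> \<le> (\<Sum>u\<in>{1..N}. real ?n * norm (\<Sum>p\<in>P. e (real u * g p)))"
      using that by (intro sum_mono2) auto
    also have "\<dots> = real ?n * ?R" by (simp add: sum_distrib_left)
    finally have "(\<Sum>p\<in>P. (norm (\<Sum>t<?n. e (real t * g p)))\<^sup>2) \<le> real ?n * (real (card P) + 2 * ?R)"
      by (simp add: algebra_simps)
    then show ?thesis by (simp add: field_simps flip: sum_divide_distrib)
  qed
  have "(\<Sum>p\<in>P. min_recip (real N) (g p)) \<le>
     (\<Sum>p\<in>P. 128 * (\<Sum>i\<in>?A. (norm (\<Sum>t<2^i. e (real t * g p)))\<^sup>2 / 2^i))"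
    by (intro sum_mono min_recip_le_fejer assms)
  also have "\<dots> = 128 * (\<Sum>i\<in>?A. \<Sum>p\<in>P. (norm (\<Sum>t<2^i. e (real t * g p)))\<^sup>2 / 2^i)"
    by (subst sum.swap) (simp only: sum_distrib_left)
  also have "\<dots> \<le> 128 * (\<Sum>i\<in>?A. real (card P) + 2 * ?R)"
    by (intro mult_left_mono sum_mono F) auto
  also have "\<dots> = 128 * (real (card ?A) * (real (card P) + 2 * ?R))" by simp
  also have "\<dots> \<le> 128 * (real I * (2 * (real (card P) + ?R)))"
  proof (intro mult_left_mono mult_mono)
    have "card ?A \<le> card {..<I}" by (intro card_mono) auto
    then show "real (card ?A) \<le> real I" by simp
  qed (use R0 in auto)
  finally show ?thesis by (simp add: algebra_simps)
qed

section \<open>Fractional parts along a linear variable\<close>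

lemma of_nat_div_le_of_nat_divide: "real (m div n) \<le> real m / real n"
  by (metis floor_divide_of_nat_eq of_int_floor_le of_int_of_nat_eq)

text \<open>Within a block of length \<open>q\<close>, replacing \<open>\<alpha>\<close> by
  \<open>a / q\<close> changes a difference of phases by at most \<open>1 / q\<close>, while
  \<open>a * v\<close> takes distinct residues. Measured from one member \<open>v1\<close> of the
  set, every residue lies within \<open>2 * q * \<xi> + 1\<close> of a multiple of
  \<open>q\<close>.\<close>

lemma card_small_int_dist_block:
  fixes \<alpha> :: real and a :: int and q :: nat
  assumes q: "1 \<le> q" and cop: "coprime a (int q)" and approx: "\<bar>\<alpha> - a / q\<bar> \<le> 1 / (real q)\<^sup>2"
    and \<xi>: "0 \<le> \<xi>"
  shows "real (card {v \<in> {v0..<v0+q}. int_dist (\<alpha> * real v) \<le> \<xi>}) \<le> 8 * (1 + real q * \<xi>)" (is "real (card ?S) \<le> _")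
proof (cases "?S = {}")
  case True
  show ?thesis unfolding True using \<xi> by simp
next
  case False
  then obtain v1 where v1: "v1 \<in> ?S" by blast
  define R where "R = nat \<lfloor>2 * real q * \<xi> + 1\<rfloor>"
  have R: "real R \<le> 2 * real q * \<xi> + 1" "\<And>r::int. 0 \<le> r \<Longrightarrow> real_of_int r \<le> 2 * real q * \<xi> + 1 \<Longrightarrow> r \<le> int R"
  proof -
    show "real R \<le> 2 * real q * \<xi> + 1" using \<xi> by (simp add: R_def)
    fix r :: int assume "0 \<le> r" "real_of_int r \<le> 2 * real q * \<xi> + 1"
    then have "r \<le> \<lfloor>2 * real q * \<xi> + 1\<rfloor>" by (simp only: le_floor_iff)
    then show "r \<le> int R" unfolding R_def by linarith
  qed
  let ?f = "\<lambda>v. (a * (int v - int v1)) mod int q"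
  have inj: "inj_on ?f ?S"
  proof (rule inj_onI)
    fix v w assume v: "v \<in> ?S" and w: "w \<in> ?S" and eq: "?f v = ?f w"
    have "[a * (int v - int v1) = a * (int w - int v1)] (mod int q)" using eq by (simp add: cong_def)
    then have "[int v - int v1 = int w - int v1] (mod int q)" using cop by (simp add: cong_mult_lcancel)
    then have d: "int q dvd int v - int w" by (simp add: cong_iff_dvd_diff)
    have l: "\<bar>int v - int w\<bar> < int q" using v w by auto
    show "v = w"
    proof (rule ccontr)
      assume "v \<noteq> w"
      then have "\<bar>int q\<bar> \<le> \<bar>int v - int w\<bar>" by (intro dvd_imp_le_int d) simp
      with l show False by simp
    qed
  qed
  have img: "?f ` ?S \<subseteq> {0..int R} \<union> {int q - int R..<int q}"
  proof
    fix r assume "r \<in> ?f ` ?S"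
    then obtain v where v: "v \<in> ?S" and r: "r = ?f v" by blast
    define k where "k = (a * (int v - int v1)) div int q"
    have decomp: "a * (int v - int v1) = int q * k + r" by (simp add: k_def r)
    have r01: "0 \<le> r" "r < int q" using q by (auto simp: r)
    define t where "t = (\<alpha> - a / q) * (real v - real v1)"
    have "\<bar>t\<bar> \<le> 1 / (real q)\<^sup>2 * real q"
      unfolding t_def abs_mult using v v1 by (intro mult_mono approx) auto
    then have t: "\<bar>t\<bar> \<le> 1 / real q" using q by (simp add: power2_eq_square)
    have "real_of_int (a * (int v - int v1)) / q = real_of_int r / q + of_int k"
      using q by (simp only: decomp of_int_add of_int_mult) (simp add: field_simps)
    then have "real_of_int r / q = (\<alpha> * real v - \<alpha> * real v1) - t + of_int (-k)"
      using q by (simp add: t_def field_simps)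
    then have "int_dist (real_of_int r / q) \<le> int_dist (\<alpha> * real v) + int_dist (\<alpha> * real v1) + \<bar>t\<bar>"
      using int_dist_diff[of "\<alpha> * real v - \<alpha> * real v1" t] int_dist_diff[of "\<alpha> * real v" "\<alpha> * real v1"] int_dist_abs_le[of t]
      by (simp only: int_dist_add_int)
    then have small: "int_dist (real_of_int r / q) \<le> 2 * \<xi> + 1 / q" using v v1 t by simp
    obtain m where m: "int_dist (real_of_int r / q) = \<bar>real_of_int r / q - of_int m\<bar>" by (rule int_dist_attained)
    have "real_of_int r / q \<le> 2 * \<xi> + 1 / q \<or> 1 - real_of_int r / q \<le> 2 * \<xi> + 1 / q"
    proof (cases "m \<le> 0")
      case True
      then have "real_of_int m \<le> 0" by simp
      moreover have "0 \<le> real_of_int r / q" using r01 by simp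
      ultimately show ?thesis using small m by linarith
    next
      case False
      then have "1 \<le> real_of_int m" by simp
      moreover have "real_of_int r / q \<le> 1" using r01 q by simp
      ultimately show ?thesis using small m by linarith
    qed
    then have "real_of_int r / real q \<le> (2 * real q * \<xi> + 1) / real q \<or>
        real_of_int (int q - r) / real q \<le> (2 * real q * \<xi> + 1) / real q"
      using q by (simp add: diff_divide_distrib add_divide_distrib)
    then have "real_of_int r \<le> 2 * real q * \<xi> + 1 \<or> real_of_int (int q - r) \<le> 2 * real q * \<xi> + 1"
      using q by (simp only: divide_le_cancel) simp
    then have "r \<le> int R \<or> int q - r \<le> int R" using R(2)[of r] R(2)[of "int q - r"] r01 by auto
    then show "r \<in> {0..int R} \<union> {int q - int R..<int q}" using r01 by auto
  qed
  have "card ?S = card (?f ` ?S)" using inj by (simp add: card_image)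
  also have "\<dots> \<le> card ({0..int R} \<union> {int q - int R..<int q})" by (intro card_mono img) auto
  also have "\<dots> \<le> card {0..int R} + card {int q - int R..<int q}" by (rule card_Un_le)
  also have "\<dots> = 2 * R + 1" by simp
  finally have "real (card ?S) \<le> 2 * real R + 1" by linarith
  also have "\<dots> \<le> 8 * (1 + real q * \<xi>)" using R(1) \<xi> mult_nonneg_nonneg[of "real q" \<xi>] by simp
  finally show ?thesis .
qed

lemma card_small_int_dist:
  fixes \<alpha> :: real and a :: int and q :: nat
  assumes q: "1 \<le> q" and cop: "coprime a (int q)" and approx: "\<bar>\<alpha> - a / q\<bar> \<le> 1 / (real q)\<^sup>2"
    and \<xi>: "0 \<le> \<xi>"
  shows "real (card {v \<in> {1..V}. int_dist (\<alpha> * real v) \<le> \<xi>}) \<le> 8 * (real V / q + 1) * (1 + real q * \<xi>)" (is "real (card ?S) \<le> _")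
proof -
  let ?B = "\<lambda>i. {v \<in> {1+i*q..<1+i*q+q}. int_dist (\<alpha> * real v) \<le> \<xi>}"
  have "?S \<subseteq> (\<Union>i\<in>{..V div q}. ?B i)"
  proof
    fix v assume v: "v \<in> ?S"
    define i where "i = (v - 1) div q"
    have "i \<le> V div q" using v unfolding i_def by (intro div_le_mono) auto
    moreover have "i * q \<le> v - 1" "v - 1 < i * q + q"
      using q dividend_less_div_times[of q "v - 1"] by (simp_all add: i_def add.commute)
    ultimately show "v \<in> (\<Union>i\<in>{..V div q}. ?B i)" using v by (auto intro!: bexI[of _ i])
  qed
  then have "card ?S \<le> card (\<Union>i\<in>{..V div q}. ?B i)" by (intro card_mono) auto
  also have "\<dots> \<le> (\<Sum>i\<in>{..V div q}. card (?B i))" by (intro card_UN_le) auto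
  finally have "real (card ?S) \<le> (\<Sum>i\<in>{..V div q}. real (card (?B i)))"
    by (simp only: of_nat_le_iff flip: of_nat_sum)
  also have "\<dots> \<le> (\<Sum>i\<in>{..V div q}. 8 * (1 + real q * \<xi>))"
    using assms by (intro sum_mono card_small_int_dist_block[where a = a])
  also have "\<dots> = (real (V div q) + 1) * (8 * (1 + real q * \<xi>))" by simp
  also have "\<dots> \<le> (real V / q + 1) * (8 * (1 + real q * \<xi>))"
    using \<xi> of_nat_div_le_of_nat_divide[of V q] by (intro mult_right_mono) auto
  finally show ?thesis by (simp only: mult_ac)
qed

text \<open>Layers \<open>min_recip\<close> by dyadic height, so that its sum is controlled by
  counts of small \<open>int_dist\<close>.\<close>

lemma min_recip_dyadic:
  assumes "1 \<le> N" "N < 2 ^ I"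
  shows "\<exists>i. i < I \<and> 2^i \<le> N \<and> int_dist y \<le> 1 / 2^i \<and> min_recip (real N) y \<le> 2 * 2^i"
proof -
  define P where "P i \<longleftrightarrow> 2^i \<le> N \<and> 2^i * int_dist y \<le> 1" for i :: nat
  have "\<not> P N" by (simp add: P_def not_le)
  moreover have "P 0" using int_dist_le_half[of y] assms by (simp add: P_def)
  ultimately obtain i where i: "P i" "\<not> P (Suc i)" by (metis nat_induct)
  have "2^i < (2::nat)^I" using i(1) assms unfolding P_def by linarith
  then have "i < I" by simp
  moreover have "min_recip (real N) y \<le> 2 * 2^i"
  proof (cases "2 * 2^i \<le> N")
    case True
    then have "1 < 2 * 2^i * int_dist y" using i(2) unfolding P_def by simp
    moreover from this have "0 < int_dist y" using int_dist_nonneg[of y] by (metis less_eq_real_def mult_zero_right not_one_less_zero)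
    ultimately have "1 / int_dist y \<le> 2 * 2^i" by (simp add: field_simps)
    then show ?thesis using min_recip_le_inverse[OF \<open>0 < int_dist y\<close>, of "real N"] by linarith
  next
    case False
    then have "real N \<le> real (2 * 2^i)" by (intro of_nat_mono) simp
    then show ?thesis using min_recip_le[of "real N" y] by simp
  qed
  ultimately show ?thesis using i(1) by (auto simp: P_def field_simps)
qed

text \<open>The classical estimate, with \<open>I\<close> in place of the logarithm: at height
  \<open>2^i\<close> the counting bound contributes a multiple of \<open>2^i + q\<close>, and
  \<open>2^i \<le> N\<close>.\<close>

lemma sum_min_recip_linear:
  fixes \<alpha> :: real and a :: int and q :: nat
  assumes q: "1 \<le> q" and cop: "coprime a (int q)" and approx: "\<bar>\<alpha> - a / q\<bar> \<le> 1 / (real q)\<^sup>2"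
    and N: "1 \<le> N" "N < 2 ^ I"
  shows "(\<Sum>v\<in>{1..V}. min_recip (real N) (\<alpha> * real v)) \<le> 16 * real I * (real V / q + 1) * (real N + real q)"
proof -
  let ?A = "{i. i < I \<and> 2^i \<le> N}"
  let ?ind = "\<lambda>i v. if int_dist (\<alpha> * real v) \<le> 1 / 2^i then 2 * 2^i else (0::real)"
  have "min_recip (real N) (\<alpha> * real v) \<le> (\<Sum>i\<in>?A. ?ind i v)" for v
  proof -
    obtain i where i: "i < I" "2^i \<le> N" "int_dist (\<alpha> * real v) \<le> 1 / 2^i" "min_recip (real N) (\<alpha> * real v) \<le> 2 * 2^i"
      using min_recip_dyadic[OF N] by blast
    have "?ind i v \<le> (\<Sum>i\<in>?A. ?ind i v)" using i by (intro member_le_sum) auto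
    then show ?thesis using i by simp
  qed
  then have "(\<Sum>v\<in>{1..V}. min_recip (real N) (\<alpha> * real v)) \<le> (\<Sum>v\<in>{1..V}. \<Sum>i\<in>?A. ?ind i v)"
    by (intro sum_mono)
  also have "\<dots> = (\<Sum>i\<in>?A. 2 * 2^i * real (card {v \<in> {1..V}. int_dist (\<alpha> * real v) \<le> 1 / 2^i}))"
  proof (subst sum.swap, intro sum.cong refl)
    fix i
    have "(\<Sum>v\<in>{1..V}. ?ind i v) = (\<Sum>v\<in>{v \<in> {1..V}. int_dist (\<alpha> * real v) \<le> 1 / 2^i}. 2 * 2^i)"
      by (rule sum.inter_filter[symmetric]) simp
    then show "(\<Sum>v\<in>{1..V}. ?ind i v) = 2 * 2^i * real (card {v \<in> {1..V}. int_dist (\<alpha> * real v) \<le> 1 / 2^i})"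
      by (simp only: sum_constant mult.commute)
  qed
  also have "\<dots> \<le> (\<Sum>i\<in>?A. 2 * 2^i * (8 * (real V / q + 1) * (1 + real q * (1 / 2^i))))"
    using assms by (intro sum_mono mult_left_mono card_small_int_dist[where a = a]) auto
  also have "\<dots> = (\<Sum>i\<in>?A. 16 * (real V / q + 1) * (2^i + real q))"
    by (intro sum.cong refl) (simp add: field_simps)
  also have "\<dots> \<le> (\<Sum>i\<in>?A. 16 * (real V / q + 1) * (real N + real q))"
  proof (intro sum_mono mult_left_mono add_right_mono)
    fix i assume "i \<in> ?A"
    then have "real (2^i) \<le> real N" by (intro of_nat_mono) auto
    then show "2^i \<le> real N" by simp
  qed auto
  also have "\<dots> = real (card ?A) * (16 * (real V / q + 1) * (real N + real q))" by simp
  also have "\<dots> \<le> real I * (16 * (real V / q + 1) * (real N + real q))"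
  proof (intro mult_right_mono)
    have "card ?A \<le> card {..<I}" by (intro card_mono) auto
    then show "real (card ?A) \<le> real I" by simp
  qed auto
  finally show ?thesis by (simp add: mult_ac)
qed

text \<open>For a fixed multiplier \<open>z\<close> the number \<open>\<alpha> * z\<close> is approximated afresh by Dirichlet's theorem; its
  denominator \<open>k\<close> satisfies \<open>k * z > q / 2\<close> because \<open>\<alpha>\<close> has no good approximation of denominator below \<open>q / 2\<close>.\<close>

lemma sum_min_recip_linear_multiple:
  fixes \<alpha> :: real and a :: int and q z :: nat
  assumes q: "1 \<le> q" and cop: "coprime a (int q)" and approx: "\<bar>\<alpha> - a / q\<bar> < 1 / (real q)\<^sup>2"
    and N: "1 \<le> N" "N < 2 ^ I" and z: "1 \<le> z"
  shows "(\<Sum>v\<in>{1..V}. min_recip (real N) (\<alpha> * real z * real v)) \<le>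
    32 * real I * (real V * real N * real z / q + real V + real N + real q)"
proof -
  obtain h k :: int where hk: "coprime h k" "0 < k" "k \<le> int (2*q)"
    and hk': "\<bar>of_int k * (\<alpha> * real z) - of_int h\<bar> < 1 / real (2*q)"
    using Dirichlet_approx_coprime[of "2*q" "\<alpha> * real z"] q by auto
  define r where "r = nat k"
  have r: "k = int r" "1 \<le> r" "r \<le> 2 * q" using hk by (auto simp: r_def)
  have apr: "\<bar>\<alpha> * real z - of_int h / real r\<bar> \<le> 1 / (real r)\<^sup>2"
  proof -
    have "\<bar>\<alpha> * real z - of_int h / real r\<bar> = \<bar>of_int k * (\<alpha> * real z) - of_int h\<bar> / real r"
      using r by (simp add: field_simps abs_mult abs_divide flip: abs_mult_pos)
    also have "\<dots> \<le> (1 / real r) / real r"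
    proof (intro divide_right_mono)
      have "1 / real (2*q) \<le> 1 / real r" using r by (intro divide_left_mono) auto
      then show "\<bar>of_int k * (\<alpha> * real z) - of_int h\<bar> \<le> 1 / real r" using hk' by linarith
    qed auto
    finally show ?thesis by (simp add: power2_eq_square)
  qed
  \<comment> \<open>If \<open>2 * r * z < q\<close>, then \<open>a * r * z / q\<close> is not an
    integer and so at least \<open>1 / q\<close> away from \<open>h\<close>. The Dirichlet error for
    the parameter \<open>2 * q\<close> and \<open>r * z\<close> times the error of
    \<open>a / q\<close> are each at most half of that, the first one strictly.\<close>
  have big: "q \<le> 2 * (r * z)"
  proof (rule ccontr)
    assume "\<not> q \<le> 2 * (r * z)"
    then have lt: "2 * (r * z) < q" by simp
    have "\<not> int q dvd a * int (r * z)"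
    proof
      assume "int q dvd a * int (r * z)"
      then have "int q dvd int (r * z)" using cop by (simp add: coprime_dvd_mult_right_iff coprime_commute)
      then have "q dvd r * z" by (simp only: int_dvd_int_iff)
      then have "q \<le> r * z" using r z by (intro dvd_imp_le) auto
      then show False using lt r z by simp
    qed
    then have "a * int (r*z) - h * int q \<noteq> 0" by (metis dvd_triv_right eq_iff_diff_eq_0)
    then have "1 \<le> \<bar>a * int (r*z) - h * int q\<bar>" by linarith
    then have "1 \<le> \<bar>real_of_int (a * int (r*z) - h * int q)\<bar>" by linarith
    then have "1 / real q \<le> \<bar>real_of_int (a * int (r*z) - h * int q)\<bar> / real q"
      by (intro divide_right_mono) auto
    also have "\<dots> = \<bar>real_of_int (a * int (r*z) - h * int q) / real q\<bar>" by simp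
    also have "real_of_int (a * int (r*z) - h * int q) / real q = of_int a * real (r*z) / q - of_int h"
      using q by (simp add: field_simps)
    finally have 1: "1 / real q \<le> \<bar>of_int a * real (r*z) / q - of_int h\<bar>" .
    have "\<bar>of_int a * real (r*z) / q - of_int h\<bar> \<le> \<bar>of_int k * (\<alpha> * real z) - of_int h\<bar> + \<bar>\<alpha> - a / q\<bar> * real (r*z)"
    proof -
      have "of_int a * real (r*z) / q - of_int h = (of_int k * (\<alpha> * real z) - of_int h) - (\<alpha> - a / q) * real (r*z)"
        using r by (simp add: field_simps)
      then show ?thesis using abs_triangle_ineq4[of "of_int k * (\<alpha> * real z) - of_int h" "(\<alpha> - a / q) * real (r*z)"]
        by (simp add: abs_mult)
    qed
    also have "\<dots> < 1 / real (2*q) + 1 / (real q)\<^sup>2 * real (r*z)"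
      using approx by (intro add_less_le_mono hk' mult_right_mono) auto
    also have "1 / (real q)\<^sup>2 * real (r*z) \<le> 1 / (real q)\<^sup>2 * (real q / 2)"
    proof (intro mult_left_mono)
      have "real (2 * (r*z)) \<le> real q" using lt by (intro of_nat_mono) simp
      then show "real (r*z) \<le> real q / 2" by simp
    qed auto
    also have "1 / real (2*q) + 1 / (real q)\<^sup>2 * (real q / 2) = 1 / real q"
      using q by (simp add: field_simps power2_eq_square)
    finally show False using 1 by simp
  qed
  have "(\<Sum>v\<in>{1..V}. min_recip (real N) (\<alpha> * real z * real v)) \<le> 16 * real I * (real V / r + 1) * (real N + real r)"
    using hk(1) r apr by (intro sum_min_recip_linear[where a = h] N) auto
  also have "\<dots> = 16 * real I * (real V * real N / r + real V + real N + real r)"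
    using r by (simp add: field_simps)
  also have "\<dots> \<le> 16 * real I * (2 * (real V * real N * real z / q) + 2 * real V + 2 * real N + 2 * real q)"
  proof (intro mult_left_mono add_mono)
    have "real q \<le> real (2 * (r * z))" using big by (intro of_nat_mono)
    then have "1 / real r \<le> 2 * real z / q" using q r by (simp add: field_simps)
    then have "real V * real N * (1 / real r) \<le> real V * real N * (2 * real z / q)" by (intro mult_left_mono) auto
    then show "real V * real N / r \<le> 2 * (real V * real N * real z / q)" by (simp add: mult_ac)
    show "real r \<le> 2 * real q" using r(3) by linarith
  qed auto
  finally show ?thesis by (simp add: algebra_simps)
qed

section \<open>Fourth powers and Weyl sums over dyadic blocks\<close>

lemma sum_le_root4:
  fixes f :: "'a \<Rightarrow> real"
  assumes "finite A" "\<And>i. i \<in> A \<Longrightarrow> 0 \<le> f i"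
  shows "(\<Sum>i\<in>A. f i) ^ 4 \<le> real (card A) ^ 3 * (\<Sum>i\<in>A. f i ^ 4)"
proof -
  have "(\<Sum>i\<in>A. f i) ^ 4 = ((\<Sum>i\<in>A. f i)\<^sup>2)\<^sup>2" by simp
  also have "\<dots> \<le> (real (card A) * (\<Sum>i\<in>A. (f i)\<^sup>2))\<^sup>2"
    by (intro power_mono sum_squared_le_card_sum_squares) auto
  also have "\<dots> = (real (card A))\<^sup>2 * (\<Sum>i\<in>A. (f i)\<^sup>2)\<^sup>2" by (simp add: power_mult_distrib)
  also have "\<dots> \<le> (real (card A))\<^sup>2 * (real (card A) * (\<Sum>i\<in>A. ((f i)\<^sup>2)\<^sup>2))"
    by (intro mult_left_mono sum_squared_le_card_sum_squares) auto
  finally show ?thesis by (simp add: power2_eq_square[of "real (card A)"] power3_eq_cube mult_ac)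
qed

lemma norm_sum_e_quadratic_block:
  assumes "1 \<le> S"
  shows "(norm (\<Sum>s\<in>{S..<2*S}. e (\<gamma> * (real s)\<^sup>2)))\<^sup>2 \<le> real S + 2 * (\<Sum>u\<in>{1..S}. min_recip (real S) (2 * \<gamma> * real u))"
proof -
  have "(\<Sum>s\<in>{S..<2*S}. e (\<gamma> * (real s)\<^sup>2)) = (\<Sum>t<S. e (\<gamma> * (real t)\<^sup>2 + (2 * \<gamma> * real S) * real t + \<gamma> * (real S)\<^sup>2))"
    by (rule sum.reindex_bij_witness[of _ "\<lambda>t. S + t" "\<lambda>s. s - S"])
       (auto simp: of_nat_diff power2_eq_square algebra_simps)
  then show ?thesis using norm_sum_e_quadratic[of S S \<gamma>] by simp
qed

lemma norm_sum_e_cubic_block: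
  assumes "1 \<le> S"
  shows "(norm (\<Sum>s\<in>{S..<2*S}. e (\<gamma> * (real s)^3)))^4 \<le>
     10 * real S ^ 3 + 16 * real S * (\<Sum>u\<in>{1..S}. \<Sum>v\<in>{1..S}. min_recip (real S) (6 * \<gamma> * real u * real v))"
proof -
  have "(\<Sum>s\<in>{S..<2*S}. e (\<gamma> * (real s)^3)) =
     (\<Sum>t<S. e (\<gamma> * (real t)^3 + (3 * \<gamma> * real S) * (real t)\<^sup>2 + (3 * \<gamma> * (real S)\<^sup>2) * real t + \<gamma> * (real S)^3))"
    by (rule sum.reindex_bij_witness[of _ "\<lambda>t. S + t" "\<lambda>s. s - S"])
       (auto simp: of_nat_diff power2_eq_square power3_eq_cube algebra_simps)
  then show ?thesis using norm_sum_e_cubic[of S S \<gamma>] assms by simp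
qed

section \<open>Averages over cubes and squares\<close>

text \<open>Here \<open>T\<close> is a small power of \<open>x\<close>; each step absorbs its constants, logarithms and divisor functions into
  a further factor \<open>T\<close>. The parameter \<open>y\<close> is \<open>\<Delta> powr (1/8)\<close>.\<close>

locale minor_arc =
  fixes x T K y \<alpha> :: real and a :: int and q I :: nat
  assumes x_ge: "12 \<le> x" and T_ge: "1000 \<le> T" and I_le: "1000 * real I \<le> T" and I_pow: "x ^ 12 < 2 ^ I"
    and tau: "\<And>n. 0 < n \<Longrightarrow> real n \<le> x ^ 12 \<Longrightarrow> real (divisor_count n) \<le> T"
    and K_ge: "1 \<le> K" and K_le: "K \<le> x" and T_le: "T \<le> x" and y_ge: "1 \<le> y"
    and q_ge: "1 \<le> q" and coprime_aq: "coprime a (int q)" and approx: "\<bar>\<alpha> - a / q\<bar> < 1 / (real q)\<^sup>2"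
begin

text \<open>\<open>Q\<close> is the size of the coefficients \<open>k * n^2\<close> of
  \<open>\<alpha>\<close>. Apart from \<open>1 / N\<close>, \<open>\<kappa>\<close> is what the
  classical estimate leaves of the trivial bound once its ranges multiply to
  \<open>Q\<close>.\<close>

definition "Q = x\<^sup>2 * K"
definition "\<kappa> = 1 / real q + real q / Q"

lemma Q_pos: "0 < Q" using x_ge K_ge by (simp add: Q_def)

lemma \<kappa>_pos: "0 < \<kappa>" using q_ge Q_pos by (simp add: \<kappa>_def add_pos_nonneg)

lemma I_bound: "real N \<le> x ^ 12 \<Longrightarrow> N < 2 ^ I"
  using I_pow by (metis le_less_trans of_nat_less_iff of_nat_numeral of_nat_power)

lemma T_pos: "0 < T" "1 \<le> T" "0 \<le> T" using T_ge by auto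

lemma T_power_mono: "m \<le> n \<Longrightarrow> T ^ m \<le> T ^ n"
  using T_ge by (intro power_increasing) auto

lemma T_grow: assumes "0 \<le> X" shows "X \<le> T ^ n * X"
  using mult_right_mono[of 1 "T ^ n" X] assms T_ge by (simp add: one_le_power)

lemma T_absorb: assumes "c \<le> 1000" "0 \<le> X" shows "c * T ^ n * X \<le> T ^ Suc n * X"
proof -
  have "c * T ^ n \<le> T * T ^ n" using assms T_ge by (intro mult_right_mono) auto
  then show ?thesis using assms by (intro mult_right_mono) auto
qed

text \<open>The lower bound on \<open>V * N * z\<close> converts the additive loss \<open>q\<close>
  into a share of \<open>q / Q\<close>, and \<open>N \<le> V\<close> makes the loss
  \<open>V + N\<close> cost only \<open>1 / N\<close> relative to \<open>V * N\<close>. A fixed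
  multiplier \<open>z\<close> enters as a factor of \<open>\<kappa>\<close>.\<close>

lemma sum_min_recip_linear_normalized:
  assumes "1 \<le> N" "real N \<le> x ^ 12" "1 \<le> z" "N \<le> V" "Q \<le> T * real V * real N * real z"
  shows "(\<Sum>v\<in>{1..V}. min_recip (real N) (\<alpha> * real z * real v)) \<le> T^2 * (real V * real N) * (real z * \<kappa> + 1 / N)"
proof -
  have "(\<Sum>v\<in>{1..V}. min_recip (real N) (\<alpha> * real z * real v)) \<le>
    32 * real I * (real V * real N * real z / q + real V + real N + real q)"
    using assms by (intro sum_min_recip_linear_multiple[where a = a] q_ge coprime_aq approx I_bound)
  also have "\<dots> \<le> 32 * real I * (2 * T * real V * real N * real z * \<kappa> + 2 * (real V * real N) * (1 / N))"
  proof (intro mult_left_mono)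
    have "real q = Q * (real q / Q)" using Q_pos by simp
    also have "\<dots> \<le> (T * real V * real N * real z) * (real q / Q)"
      using Q_pos assms by (intro mult_right_mono) auto
    finally have 1: "real q \<le> (T * real V * real N * real z) * (real q / Q)" .
    have "1 * (real V * real N * real z / q) \<le> T * (real V * real N * real z / q)"
      using T_ge by (intro mult_right_mono) auto
    then have "real V * real N * real z / q + real q \<le> T * real V * real N * real z * \<kappa>"
      using 1 by (simp add: \<kappa>_def algebra_simps)
    moreover have "0 \<le> T * real V * real N * real z * \<kappa>" using T_pos \<kappa>_pos by simp
    moreover have "real V + real N \<le> 2 * (real V * real N) * (1 / N)" using assms by simp
    ultimately show "real V * real N * real z / q + real V + real N + real q \<le>
       2 * T * real V * real N * real z * \<kappa> + 2 * (real V * real N) * (1 / N)" by linarith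
  qed auto
  also have "\<dots> \<le> 32 * real I * (2 * T * ((real V * real N) * (real z * \<kappa> + 1 / N)))"
  proof (intro mult_left_mono)
    have "2 * (real V * real N) * (1 / N) \<le> 2 * T * ((real V * real N) * (1 / N))"
    proof -
      have "1 * (real V * real N * (1/N)) \<le> T * (real V * real N * (1/N))"
        using T_ge by (intro mult_right_mono) auto
      then show ?thesis by (simp only: mult_1 mult.assoc)
    qed
    then show "2 * T * real V * real N * real z * \<kappa> + 2 * (real V * real N) * (1 / N)
      \<le> 2 * T * ((real V * real N) * (real z * \<kappa> + 1 / N))"
      by (simp add: distrib_left mult_ac)
  qed auto
  also have "\<dots> = (64 * real I) * (T * ((real V * real N) * (real z * \<kappa> + 1 / N)))" by simp
  also have "\<dots> \<le> T * (T * ((real V * real N) * (real z * \<kappa> + 1 / N)))"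
    using I_le T_pos \<kappa>_pos by (intro mult_right_mono) auto
  finally show ?thesis by (simp add: power2_eq_square mult_ac)
qed

text \<open>Trades \<open>s^2\<close> for linear variables: expansion in frequencies
  \<open>w \<le> N\<close>, Cauchy-Schwarz over \<open>(p, w)\<close> and quadratic differencing
  leave phases linear in \<open>w\<close> and the shift \<open>u\<close>, truncated at
  \<open>S\<close>. A relative saving \<open>\<omega>\<close> there returns under a square root,
  beside \<open>1 / N\<close> from frequency 0.\<close>

lemma square_step:
  assumes "finite Y" "1 \<le> N" "real N \<le> x ^ 12" "1 \<le> S" "0 \<le> \<omega>"
    and "(\<Sum>p\<in>Y. \<Sum>w\<in>{1..N}. \<Sum>u\<in>{1..S}. min_recip (real S) (2 * g p * real w * real u)) \<le>
        real (card Y) * real N * (real S)\<^sup>2 * \<omega>"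
  shows "(\<Sum>p\<in>Y. \<Sum>s\<in>{S..<2*S}. min_recip (real N) (g p * (real s)\<^sup>2)) \<le>
     T * (real (card Y) * real N * real S) * (1 / N + sqrt (1 / S + 2 * \<omega>))"
proof -
  let ?X = "\<lambda>p w. norm (\<Sum>s\<in>{S..<2*S}. e (real w * (g p * (real s)\<^sup>2)))"
  let ?B = "1 / S + 2 * \<omega>"
  have "(\<Sum>p\<in>Y. \<Sum>w\<in>{1..N}. ?X p w) = (\<Sum>i\<in>Y\<times>{1..N}. ?X (fst i) (snd i))"
    by (simp add: sum.cartesian_product case_prod_beta)
  also have "\<dots> \<le> sqrt ((real (card Y) * real N * real S)\<^sup>2 * ?B)"
  proof (rule real_le_rsqrt)
    have "(\<Sum>i\<in>Y\<times>{1..N}. ?X (fst i) (snd i))\<^sup>2 \<le> real (card (Y\<times>{1..N})) * (\<Sum>i\<in>Y\<times>{1..N}. (?X (fst i) (snd i))\<^sup>2)"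
      by (rule sum_squared_le_card_sum_squares)
    also have "(\<Sum>i\<in>Y\<times>{1..N}. (?X (fst i) (snd i))\<^sup>2) = (\<Sum>p\<in>Y. \<Sum>w\<in>{1..N}. (?X p w)\<^sup>2)"
      by (simp add: sum.cartesian_product case_prod_beta)
    also have "\<dots> \<le> (\<Sum>p\<in>Y. \<Sum>w\<in>{1..N}. real S + 2 * (\<Sum>u\<in>{1..S}. min_recip (real S) (2 * g p * real w * real u)))"
    proof (intro sum_mono)
      fix p w
      show "(?X p w)\<^sup>2 \<le> real S + 2 * (\<Sum>u\<in>{1..S}. min_recip (real S) (2 * g p * real w * real u))"
        using norm_sum_e_quadratic_block[of S "real w * g p"] assms by (simp add: mult_ac)
    qed
    also have "\<dots> = real (card Y) * real N * real S +
        2 * (\<Sum>p\<in>Y. \<Sum>w\<in>{1..N}. \<Sum>u\<in>{1..S}. min_recip (real S) (2 * g p * real w * real u))"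
      by (simp add: sum.distrib sum_distrib_left)
    also have "\<dots> \<le> real (card Y) * real N * real S + 2 * (real (card Y) * real N * (real S)\<^sup>2 * \<omega>)"
      using assms by simp
    also have "\<dots> = real (card Y) * real N * (real S)\<^sup>2 * ?B"
      using assms by (simp add: field_simps power2_eq_square)
    finally show "(\<Sum>i\<in>Y\<times>{1..N}. ?X (fst i) (snd i))\<^sup>2 \<le> (real (card Y) * real N * real S)\<^sup>2 * ?B"
      using mult_left_mono by (fastforce simp: card_cartesian_product power2_eq_square mult_ac)
  qed
  also have "\<dots> = real (card Y) * real N * real S * sqrt ?B"
    by (simp add: real_sqrt_mult)
  finally have X: "(\<Sum>p\<in>Y. \<Sum>w\<in>{1..N}. ?X p w) \<le> real (card Y) * real N * real S * sqrt ?B" .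
  have "(\<Sum>p\<in>Y. \<Sum>s\<in>{S..<2*S}. min_recip (real N) (g p * (real s)\<^sup>2)) \<le>
     (\<Sum>p\<in>Y. 256 * real I * (real (card {S..<2*S}) + (\<Sum>w\<in>{1..N}. ?X p w)))"
    using assms by (intro sum_mono sum_min_recip_le_exponential_sums I_bound) auto
  also have "\<dots> = 256 * real I * (real (card Y) * real S + (\<Sum>p\<in>Y. \<Sum>w\<in>{1..N}. ?X p w))"
    by (simp add: sum.distrib algebra_simps flip: sum_distrib_left)
  also have "\<dots> \<le> T * (real (card Y) * real S + real (card Y) * real N * real S * sqrt ?B)"
    using I_le X by (intro mult_mono add_mono) (auto intro!: sum_nonneg add_nonneg_nonneg)
  also have "\<dots> = T * (real (card Y) * real N * real S) * (1 / N + sqrt ?B)"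
    using assms by (simp add: field_simps)
  finally show ?thesis .
qed

text \<open>The cubic analogue: two shifts \<open>u\<close> and \<open>v\<close> appear, and the
  fourth power in Weyl's method costs a fourth root instead of a square root.\<close>

lemma cube_step:
  assumes "finite Y" "1 \<le> N" "real N \<le> x ^ 12" "1 \<le> H" "0 \<le> \<omega>"
    and "(\<Sum>p\<in>Y. \<Sum>w\<in>{1..N}. \<Sum>u\<in>{1..H}. \<Sum>v\<in>{1..H}. min_recip (real H) (6 * g p * real w * real u * real v)) \<le>
        real (card Y) * real N * (real H)^3 * \<omega>"
  shows "(\<Sum>p\<in>Y. \<Sum>h\<in>{H..<2*H}. min_recip (real N) (g p * (real h)^3)) \<le>
     T * (real (card Y) * real N * real H) * (1 / N + root 4 (10 / H + 16 * \<omega>))"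
proof -
  let ?X = "\<lambda>p w. norm (\<Sum>s\<in>{H..<2*H}. e (real w * (g p * (real s)^3)))"
  let ?B = "10 / H + 16 * \<omega>"
  have "(\<Sum>p\<in>Y. \<Sum>w\<in>{1..N}. ?X p w) = (\<Sum>i\<in>Y\<times>{1..N}. ?X (fst i) (snd i))"
    by (simp add: sum.cartesian_product case_prod_beta)
  also have "\<dots> \<le> root 4 ((real (card Y) * real N * real H)^4 * ?B)"
  proof -
    have "(\<Sum>i\<in>Y\<times>{1..N}. ?X (fst i) (snd i))^4 \<le> real (card (Y\<times>{1..N})) ^ 3 * (\<Sum>i\<in>Y\<times>{1..N}. (?X (fst i) (snd i))^4)"
      using assms by (intro sum_le_root4) auto
    also have "(\<Sum>i\<in>Y\<times>{1..N}. (?X (fst i) (snd i))^4) = (\<Sum>p\<in>Y. \<Sum>w\<in>{1..N}. (?X p w)^4)"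
      by (simp add: sum.cartesian_product case_prod_beta)
    also have "\<dots> \<le> (\<Sum>p\<in>Y. \<Sum>w\<in>{1..N}. 10 * real H ^ 3 + 16 * real H * (\<Sum>u\<in>{1..H}. \<Sum>v\<in>{1..H}. min_recip (real H) (6 * g p * real w * real u * real v)))"
    proof (intro sum_mono)
      fix p w
      show "(?X p w)^4 \<le> 10 * real H ^ 3 + 16 * real H * (\<Sum>u\<in>{1..H}. \<Sum>v\<in>{1..H}. min_recip (real H) (6 * g p * real w * real u * real v))"
        using norm_sum_e_cubic_block[of H "real w * g p"] assms by (simp add: mult_ac)
    qed
    also have "\<dots> = real (card Y) * real N * (10 * real H ^ 3) +
        16 * real H * (\<Sum>p\<in>Y. \<Sum>w\<in>{1..N}. \<Sum>u\<in>{1..H}. \<Sum>v\<in>{1..H}. min_recip (real H) (6 * g p * real w * real u * real v))"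
      by (simp only: sum.distrib sum_distrib_left sum_constant) simp
    also have "\<dots> \<le> real (card Y) * real N * (10 * real H ^ 3) + 16 * real H * (real (card Y) * real N * (real H)^3 * \<omega>)"
      using assms by (intro add_left_mono mult_left_mono) auto
    also have "\<dots> = real (card Y) * real N * (real H)^4 * ?B"
      using assms by (simp add: field_simps eval_nat_numeral)
    finally have "(\<Sum>i\<in>Y\<times>{1..N}. ?X (fst i) (snd i))^4 \<le> real (card (Y\<times>{1..N})) ^ 3 * (real (card Y) * real N * (real H)^4 * ?B)"
      by (simp add: mult_left_mono)
    also have "\<dots> = (real (card Y) * real N * real H)^4 * ?B"
      by (simp add: card_cartesian_product eval_nat_numeral mult_ac)
    finally have "root 4 ((\<Sum>i\<in>Y\<times>{1..N}. ?X (fst i) (snd i))^4) \<le> root 4 ((real (card Y) * real N * real H)^4 * ?B)"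
      by (intro real_root_le_mono) auto
    then show ?thesis by (simp add: real_root_power_cancel sum_nonneg)
  qed
  also have "\<dots> = real (card Y) * real N * real H * root 4 ?B"
    by (simp add: real_root_mult real_root_power_cancel)
  finally have X: "(\<Sum>p\<in>Y. \<Sum>w\<in>{1..N}. ?X p w) \<le> real (card Y) * real N * real H * root 4 ?B" .
  have "(\<Sum>p\<in>Y. \<Sum>s\<in>{H..<2*H}. min_recip (real N) (g p * (real s)^3)) \<le>
     (\<Sum>p\<in>Y. 256 * real I * (real (card {H..<2*H}) + (\<Sum>w\<in>{1..N}. ?X p w)))"
    using assms by (intro sum_mono sum_min_recip_le_exponential_sums I_bound) auto
  also have "\<dots> = 256 * real I * (real (card Y) * real H + (\<Sum>p\<in>Y. \<Sum>w\<in>{1..N}. ?X p w))"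
    by (simp add: sum.distrib algebra_simps flip: sum_distrib_left)
  also have "\<dots> \<le> T * (real (card Y) * real H + real (card Y) * real N * real H * root 4 ?B)"
    using I_le X by (intro mult_mono add_mono) (auto intro!: sum_nonneg add_nonneg_nonneg)
  also have "\<dots> = T * (real (card Y) * real N * real H) * (1 / N + root 4 ?B)"
    using assms by (simp add: field_simps)
  finally show ?thesis .
qed

text \<open>Each product \<open>v\<close> has at most \<open>T\<close> factorizations, so the
  variables created by Weyl steps merge into one range for the linear estimate.\<close>

lemma sum_product_le:
  assumes "\<And>n. 0 \<le> F n" "real (A * B) \<le> x ^ 12"
  shows "(\<Sum>m\<in>{1..A}. \<Sum>n\<in>{1..B}. F (m * n)) \<le> T * (\<Sum>v\<in>{1..A*B}. F v :: real)"
proof -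
  let ?X = "{1..A} \<times> {1..B}"
  have "(\<Sum>m\<in>{1..A}. \<Sum>n\<in>{1..B}. F (m * n)) = (\<Sum>p\<in>?X. F (fst p * snd p))"
    by (simp add: sum.cartesian_product case_prod_beta)
  also have "\<dots> = (\<Sum>v\<in>{1..A*B}. \<Sum>p\<in>{p\<in>?X. fst p * snd p = v}. F (fst p * snd p))"
    by (rule sum.group[symmetric]) (auto intro: mult_le_mono)
  also have "\<dots> = (\<Sum>v\<in>{1..A*B}. real (card {p\<in>?X. fst p * snd p = v}) * F v)"
    by (intro sum.cong refl) simp
  also have "\<dots> \<le> (\<Sum>v\<in>{1..A*B}. T * F v)"
  proof (intro sum_mono mult_right_mono assms)
    fix v assume v: "v \<in> {1..A*B}"
    have "card {p\<in>?X. fst p * snd p = v} = card (fst ` {p\<in>?X. fst p * snd p = v})"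
      by (rule card_image[symmetric]) (auto simp: inj_on_def)
    also have "\<dots> \<le> card {k. k dvd v}"
      using v by (intro card_mono finite_divisors_nat) auto
    also have "real \<dots> \<le> T"
      using tau[of v] v assms(2) order_trans[of "real v" "real (A*B)" "x^12"] by (simp only: divisor_count_def of_nat_le_iff) auto
    finally show "real (card {p\<in>?X. fst p * snd p = v}) \<le> T" by simp
  qed
  finally show ?thesis by (simp add: sum_distrib_left)
qed

lemma sum_product3_le:
  assumes F: "\<And>n. 0 \<le> F n" and B: "real (A * B * C) \<le> x ^ 12" and "1 \<le> C"
  shows "(\<Sum>m\<in>{1..A}. \<Sum>n\<in>{1..B}. \<Sum>l\<in>{1..C}. F (m * n * l)) \<le> T^2 * (\<Sum>v\<in>{1..A*B*C}. F v :: real)"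
proof -
  have "A * B * 1 \<le> A * B * C" using assms by (intro mult_le_mono) auto
  then have "real (A * B) \<le> x ^ 12" using B by (metis mult.right_neutral of_nat_mono order_trans)
  then have "(\<Sum>m\<in>{1..A}. \<Sum>n\<in>{1..B}. \<Sum>l\<in>{1..C}. F (m * n * l)) \<le> T * (\<Sum>v\<in>{1..A*B}. \<Sum>l\<in>{1..C}. F (v * l))"
    using F by (intro sum_product_le) (auto intro: sum_nonneg)
  also have "\<dots> \<le> T * (T * (\<Sum>v\<in>{1..A*B*C}. F v))"
    using T_pos F B by (intro mult_left_mono sum_product_le) auto
  finally show ?thesis by (simp add: power2_eq_square mult_ac)
qed

lemma sum_product4_le:
  assumes F: "\<And>n. 0 \<le> F n" and B: "real (A * B * C * D) \<le> x ^ 12" and "1 \<le> C" "1 \<le> D"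
  shows "(\<Sum>m\<in>{1..A}. \<Sum>n\<in>{1..B}. \<Sum>l\<in>{1..C}. \<Sum>k\<in>{1..D}. F (m * n * l * k)) \<le> T^3 * (\<Sum>v\<in>{1..A*B*C*D}. F v :: real)"
proof -
  have "A * B * C * 1 \<le> A * B * C * D" using assms by (intro mult_le_mono) auto
  then have "real (A * B * C) \<le> x ^ 12" using B by (metis mult.right_neutral of_nat_mono order_trans)
  then have "(\<Sum>m\<in>{1..A}. \<Sum>n\<in>{1..B}. \<Sum>l\<in>{1..C}. \<Sum>k\<in>{1..D}. F (m * n * l * k)) \<le>
     T^2 * (\<Sum>v\<in>{1..A*B*C}. \<Sum>k\<in>{1..D}. F (v * k))"
    using F assms by (intro sum_product3_le) (auto intro: sum_nonneg)
  also have "\<dots> \<le> T^2 * (T * (\<Sum>v\<in>{1..A*B*C*D}. F v))"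
    using T_pos F B by (intro mult_left_mono sum_product_le) auto
  finally show ?thesis by (simp add: eval_nat_numeral mult_ac)
qed

end

text \<open>Collects the numerical constants in \<open>C\<close> when the bound of an inner step is
  inserted into an outer one.\<close>

lemma absorb_sum:
  fixes A B t :: real
  assumes "0 \<le> A" "0 \<le> B" "1 \<le> t" "0 \<le> c" "c + d \<le> C" "d * k \<le> C"
  shows "c * A + d * (t * (k * B + A)) \<le> C * t * (A + B)"
proof -
  have "c * A * 1 \<le> c * A * t" using assms by (intro mult_left_mono) auto
  moreover have "(c + d) * (t * A) \<le> C * (t * A)" using assms by (intro mult_right_mono) auto
  moreover have "(d * k) * (t * B) \<le> C * (t * B)" using assms by (intro mult_right_mono) auto
  ultimately show ?thesis by (simp add: algebra_simps)
qed

lemma sum_swap_inner: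
  "(\<Sum>j\<in>A. \<Sum>h\<in>B. \<Sum>s\<in>C. f j h s) = (\<Sum>j\<in>A. \<Sum>s\<in>C. \<Sum>h\<in>B. f j h s)"
  by (rule sum.cong[OF refl sum.swap])

lemma sum_rotate:
  "(\<Sum>j\<in>A. \<Sum>h\<in>B. \<Sum>s\<in>C. f j h s) = (\<Sum>h\<in>B. \<Sum>s\<in>C. \<Sum>j\<in>A. f j h s)"
  by (rule trans[OF sum.swap sum_swap_inner])

section \<open>Sums of \<open>min_recip\<close> over cubes and squares of dyadic variables\<close>

context minor_arc
begin

text \<open>The index \<open>j\<close> stands for the product of all variables that enter the phase
  linearly, \<open>h\<close> and \<open>s\<close> for the two sparse ones.\<close>

definition phase_sum :: "nat \<Rightarrow> nat \<Rightarrow> nat \<Rightarrow> nat \<Rightarrow> real" where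
  "phase_sum J N H S = (\<Sum>j\<in>{1..J}. \<Sum>h\<in>{H..<2*H}. \<Sum>s\<in>{S..<2*S}. min_recip (real N) (\<alpha> * real j * (real h)^3 * (real s)\<^sup>2))"

text \<open>The upper bound keeps every partial product within reach of the divisor bound; the lower
  bound lets the linear estimate lose no more than \<open>q / Q\<close>, whichever variables have
  been linearised.\<close>

definition "admissible J N H S \<longleftrightarrow> 1 \<le> N \<and> 1 \<le> H \<and> 1 \<le> S \<and> N \<le> J \<and>
   real (J * N * H^3 * S^2) \<le> x ^ 12 \<and> Q \<le> T * real (J * N * H^3 * S^2)"

lemma admissibleD:
  assumes "admissible J N H S"
  shows "1 \<le> N" "1 \<le> H" "1 \<le> S" "1 \<le> J" "N \<le> J" "Q \<le> T * real (J * N * H^3 * S^2)"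
  using assms by (auto simp: admissible_def)

lemma admissible_bound:
  assumes "admissible J N H S" "k \<le> J * N * H^3 * S^2"
  shows "real k \<le> x ^ 12"
proof -
  have "real k \<le> real (J * N * H^3 * S^2)" using assms by (intro of_nat_mono)
  then show ?thesis using assms(1) unfolding admissible_def by linarith
qed

lemma admissible_factor:
  assumes "admissible J N H S" "1 \<le> k" "k * l = J * N * H^3 * S^2"
  shows "real l \<le> x ^ 12"
proof -
  have "1 * l \<le> k * l" using assms by (intro mult_le_mono1)
  then show ?thesis using assms admissible_bound by simp
qed

lemma admissible_Q:
  assumes "admissible J N H S" "J * N * H^3 * S^2 \<le> k" "real k \<le> r"
  shows "Q \<le> T * r"
proof -
  have "real (J * N * H^3 * S^2) \<le> real k" using assms by (intro of_nat_mono)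
  then have "T * real (J * N * H^3 * S^2) \<le> T * r" using assms(3) T_pos by (intro mult_left_mono) auto
  then show ?thesis using assms(1) unfolding admissible_def by linarith
qed

text \<open>Without averaging over the sparse variables, \<open>h^3 * s^2\<close> acts as a fixed
  multiplier, at most \<open>32 * H^3 * S^2\<close>, and inflates \<open>\<kappa>\<close>
  accordingly.\<close>

lemma phase_sum_fix_both:
  assumes adm: "admissible J N H S"
  shows "phase_sum J N H S \<le> T^3 * (real J * real N * real H * real S) * ((real H)^3 * (real S)\<^sup>2 * \<kappa> + 1 / N)"
proof -
  note A = admissibleD[OF adm]
  have "phase_sum J N H S = (\<Sum>h\<in>{H..<2*H}. \<Sum>s\<in>{S..<2*S}. \<Sum>j\<in>{1..J}. min_recip (real N) (\<alpha> * real (h^3 * s^2) * real j))"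
    unfolding phase_sum_def by (subst sum_rotate) (simp add: mult_ac)
  also have "\<dots> \<le> (\<Sum>h\<in>{H..<2*H}. \<Sum>s\<in>{S..<2*S}. T^2 * (real J * real N) * (32 * ((real H)^3 * (real S)\<^sup>2 * \<kappa> + 1 / N)))"
  proof (intro sum_mono)
    fix h s assume h: "h \<in> {H..<2*H}" and s: "s \<in> {S..<2*S}"
    have "(\<Sum>j\<in>{1..J}. min_recip (real N) (\<alpha> * real (h^3 * s^2) * real j)) \<le>
       T^2 * (real J * real N) * (real (h^3 * s^2) * \<kappa> + 1 / N)"
    proof (rule sum_min_recip_linear_normalized)
      show "real N \<le> x ^ 12" using A by (intro admissible_factor[OF adm, of "J * H^3 * S^2"]) auto
      show "1 \<le> h^3 * s^2" using h s A by simp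
      have "H^3 * S^2 \<le> h^3 * s^2" using h s by (intro mult_le_mono power_mono) auto
      then have "J * N * H^3 * S^2 \<le> J * N * (h^3 * s^2)" by (simp add: mult.assoc)
      then show "Q \<le> T * real J * real N * real (h^3 * s^2)"
        using admissible_Q[OF adm, of "J * N * (h^3 * s^2)" "real (J * N * (h^3 * s^2))"] by (simp add: mult_ac)
    qed (use A in auto)
    also have "\<dots> \<le> T^2 * (real J * real N) * (32 * ((real H)^3 * (real S)\<^sup>2 * \<kappa> + 1 / N))"
    proof (intro mult_left_mono)
      have "h^3 * s^2 \<le> (2*H)^3 * (2*S)^2" using h s by (intro mult_le_mono power_mono) auto
      then have "real (h^3 * s^2) \<le> real ((2*H)^3 * (2*S)^2)" by (intro of_nat_mono)
      then have "real (h^3 * s^2) * \<kappa> \<le> (32 * ((real H)^3 * (real S)\<^sup>2)) * \<kappa>"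
        using \<kappa>_pos by (intro mult_right_mono) (auto simp: power_mult_distrib)
      moreover have "1 / real N \<le> 32 * (1 / real N)" using mult_right_mono[of 1 32 "1 / real N"] by simp
      ultimately have "real (h^3 * s^2) * \<kappa> + 1 / N \<le> (32 * ((real H)^3 * (real S)\<^sup>2)) * \<kappa> + 32 * (1 / real N)"
        by (rule add_mono)
      then show "real (h^3 * s^2) * \<kappa> + 1 / N \<le> 32 * ((real H)^3 * (real S)\<^sup>2 * \<kappa> + 1 / N)"
        by (simp only: distrib_left mult.assoc)
    qed (use T_pos in auto)
    finally show "(\<Sum>j\<in>{1..J}. min_recip (real N) (\<alpha> * real (h^3 * s^2) * real j)) \<le>
       T^2 * (real J * real N) * (32 * ((real H)^3 * (real S)\<^sup>2 * \<kappa> + 1 / N))" .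
  qed
  also have "\<dots> = 32 * T^2 * ((real J * real N * real H * real S) * ((real H)^3 * (real S)\<^sup>2 * \<kappa> + 1 / N))"
    by (simp add: mult_ac)
  also have "\<dots> \<le> T^Suc 2 * ((real J * real N * real H * real S) * ((real H)^3 * (real S)\<^sup>2 * \<kappa> + 1 / N))"
    using \<kappa>_pos by (intro T_absorb) auto
  finally show ?thesis by (simp add: mult_ac)
qed

text \<open>Here \<open>h\<close> stays fixed and only \<open>s\<close> is linearised; the
  multiplier of \<open>\<kappa>\<close> is \<open>2 * h^3 \<le> 16 * H^3\<close>.\<close>

lemma phase_sum_square:
  assumes adm: "admissible J N H S"
  shows "phase_sum J N H S \<le> T * (real J * real N * real H * real S) * (1 / N + sqrt (T^5 * (1 / S + (real H)^3 * \<kappa>)))"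
proof -
  note A = admissibleD[OF adm]
  let ?\<omega> = "T^4 * (16 * (real H)^3 * \<kappa> + 1 / S)"
  have \<omega>0: "0 \<le> ?\<omega>" using T_pos \<kappa>_pos by simp
  have NS: "real N \<le> x ^ 12" "real S \<le> x ^ 12"
    using A by (intro admissible_factor[OF adm, of "J * H^3 * S^2"] admissible_factor[OF adm, of "J * N * H^3 * S"]; simp add: power2_eq_square)+
  have JNS: "real (J * N * S) \<le> x ^ 12"
    using A by (intro admissible_factor[OF adm, of "H^3 * S"]) (auto simp: power2_eq_square)
  have "phase_sum J N H S = (\<Sum>h\<in>{H..<2*H}. \<Sum>j\<in>{1..J}. \<Sum>s\<in>{S..<2*S}. min_recip (real N) (\<alpha> * real j * (real h)^3 * (real s)\<^sup>2))"
    unfolding phase_sum_def by (rule sum.swap)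
  also have "\<dots> \<le> (\<Sum>h\<in>{H..<2*H}. T * (real (card {1..J}) * real N * real S) * (1 / N + sqrt (1 / S + 2 * ?\<omega>)))"
  proof (intro sum_mono square_step)
    fix h assume h: "h \<in> {H..<2*H}"
    have "(\<Sum>j\<in>{1..J}. \<Sum>w\<in>{1..N}. \<Sum>u\<in>{1..S}. min_recip (real S) (2 * (\<alpha> * real j * (real h)^3) * real w * real u))
      = (\<Sum>j\<in>{1..J}. \<Sum>w\<in>{1..N}. \<Sum>u\<in>{1..S}. min_recip (real S) (\<alpha> * real (2 * h^3) * real (j * w * u)))"
      by (simp add: mult_ac)
    also have "\<dots> \<le> T^2 * (\<Sum>v\<in>{1..J*N*S}. min_recip (real S) (\<alpha> * real (2 * h^3) * real v))"
      using A JNS by (intro sum_product3_le) auto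
    also have "\<dots> \<le> T^2 * (T^2 * (real (J*N*S) * real S) * (real (2 * h^3) * \<kappa> + 1 / S))"
    proof (intro mult_left_mono sum_min_recip_linear_normalized)
      have "1 * S \<le> J * N * S" using A by (intro mult_le_mono) auto
      then show "S \<le> J * N * S" by simp
      show "1 \<le> 2 * h^3" using h A by simp
      have "J * N * H^3 * S^2 \<le> J * N * S * S * (2 * h^3)"
      proof -
        have "H^3 \<le> h^3" using h by (intro power_mono) auto
        then have "H^3 \<le> 2 * h^3" by linarith
        then have "J * N * S^2 * H^3 \<le> J * N * S^2 * (2 * h^3)" by (intro mult_le_mono2)
        then show ?thesis by (simp add: power2_eq_square mult_ac)
      qed
      then show "Q \<le> T * real (J * N * S) * real S * real (2 * h^3)"
        using admissible_Q[OF adm, of "J * N * S * S * (2 * h^3)" "real (J * N * S * S * (2 * h^3))"] by (simp add: mult_ac)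
    qed (use A NS T_pos in auto)
    also have "\<dots> \<le> T^2 * (T^2 * (real (J*N*S) * real S) * (16 * (real H)^3 * \<kappa> + 1 / S))"
    proof (intro mult_left_mono add_right_mono mult_right_mono)
      have "h^3 \<le> (2*H)^3" using h by (intro power_mono) auto
      then have "2 * h^3 \<le> 16 * H^3" by (simp add: power_mult_distrib)
      then have "real (2 * h^3) \<le> real (16 * H^3)" by (intro of_nat_mono)
      then show "real (2 * h^3) \<le> 16 * (real H)^3" by simp
    qed (use T_pos \<kappa>_pos in auto)
    finally show "(\<Sum>j\<in>{1..J}. \<Sum>w\<in>{1..N}. \<Sum>u\<in>{1..S}. min_recip (real S) (2 * (\<alpha> * real j * (real h)^3) * real w * real u))
      \<le> real (card {1..J}) * real N * (real S)\<^sup>2 * ?\<omega>" by (simp add: power2_eq_square eval_nat_numeral mult_ac)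
  qed (use A NS \<omega>0 in auto)
  also have "\<dots> = T * (real J * real N * real H * real S) * (1 / N + sqrt (1 / S + 2 * ?\<omega>))"
    by (simp add: mult_ac)
  also have "\<dots> \<le> T * (real J * real N * real H * real S) * (1 / N + sqrt (T^5 * (1 / S + (real H)^3 * \<kappa>)))"
  proof (intro mult_left_mono add_left_mono real_sqrt_le_mono)
    have "1 / S + 2 * ?\<omega> \<le> 32 * T^4 * (1 / S + (real H)^3 * \<kappa>)"
      using absorb_sum[of "1 / real S" "(real H)^3 * \<kappa>" "T^4" 1 2 32 16] T_pos \<kappa>_pos by (simp add: mult.assoc)
    also have "\<dots> \<le> T ^ Suc 4 * (1 / S + (real H)^3 * \<kappa>)" using \<kappa>_pos by (intro T_absorb) auto
    finally show "1 / S + 2 * ?\<omega> \<le> T^5 * (1 / S + (real H)^3 * \<kappa>)" by simp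
  qed (use T_pos in auto)
  finally show ?thesis .
qed

text \<open>Here \<open>s\<close> stays fixed. Differencing a cube twice brings the factor 6, so the
  multiplier of \<open>\<kappa>\<close> is \<open>6 * s^2 \<le> 24 * S^2\<close>.\<close>

lemma phase_sum_cube:
  assumes adm: "admissible J N H S"
  shows "phase_sum J N H S \<le> T * (real J * real N * real H * real S) * (1 / N + root 4 (T^6 * (1 / H + (real S)\<^sup>2 * \<kappa>)))"
proof -
  note A = admissibleD[OF adm]
  let ?\<omega> = "T^5 * (24 * (real S)\<^sup>2 * \<kappa> + 1 / H)"
  have \<omega>0: "0 \<le> ?\<omega>" using T_pos \<kappa>_pos by simp
  have NH: "real N \<le> x ^ 12" "real H \<le> x ^ 12"
    using A by (intro admissible_factor[OF adm, of "J * H^3 * S^2"] admissible_factor[OF adm, of "J * N * H^2 * S^2"]; simp add: eval_nat_numeral)+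
  have JNH: "real (J * N * H * H) \<le> x ^ 12"
    using A by (intro admissible_factor[OF adm, of "H * S^2"]) (auto simp: eval_nat_numeral)
  have "phase_sum J N H S = (\<Sum>j\<in>{1..J}. \<Sum>s\<in>{S..<2*S}. \<Sum>h\<in>{H..<2*H}. min_recip (real N) ((\<alpha> * real j * (real s)\<^sup>2) * (real h)^3))"
    unfolding phase_sum_def by (subst sum_swap_inner) (simp add: mult_ac)
  also have "\<dots> = (\<Sum>s\<in>{S..<2*S}. \<Sum>j\<in>{1..J}. \<Sum>h\<in>{H..<2*H}. min_recip (real N) ((\<alpha> * real j * (real s)\<^sup>2) * (real h)^3))"
    by (rule sum.swap)
  also have "\<dots> \<le> (\<Sum>s\<in>{S..<2*S}. T * (real (card {1..J}) * real N * real H) * (1 / N + root 4 (10 / H + 16 * ?\<omega>)))"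
  proof (intro sum_mono cube_step)
    fix s assume s: "s \<in> {S..<2*S}"
    have "(\<Sum>j\<in>{1..J}. \<Sum>w\<in>{1..N}. \<Sum>u\<in>{1..H}. \<Sum>v\<in>{1..H}. min_recip (real H) (6 * (\<alpha> * real j * (real s)\<^sup>2) * real w * real u * real v))
      = (\<Sum>j\<in>{1..J}. \<Sum>w\<in>{1..N}. \<Sum>u\<in>{1..H}. \<Sum>v\<in>{1..H}. min_recip (real H) (\<alpha> * real (6 * s^2) * real (j * w * u * v)))"
      by (simp add: mult_ac)
    also have "\<dots> \<le> T^3 * (\<Sum>v\<in>{1..J*N*H*H}. min_recip (real H) (\<alpha> * real (6 * s^2) * real v))"
      using A JNH by (intro sum_product4_le) auto
    also have "\<dots> \<le> T^3 * (T^2 * (real (J*N*H*H) * real H) * (real (6 * s^2) * \<kappa> + 1 / H))"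
    proof (intro mult_left_mono sum_min_recip_linear_normalized)
      have "1 * H \<le> (J * N * H) * H" using A by (intro mult_le_mono) auto
      then show "H \<le> J * N * H * H" by simp
      show "1 \<le> 6 * s^2" using s A by simp
      have "J * N * H^3 * S^2 \<le> J * N * H * H * H * (6 * s^2)"
      proof -
        have "S^2 \<le> s^2" using s by (intro power_mono) auto
        then have "S^2 \<le> 6 * s^2" by linarith
        then have "J * N * H^3 * S^2 \<le> J * N * H^3 * (6 * s^2)" by (intro mult_le_mono2)
        then show ?thesis by (simp add: eval_nat_numeral mult_ac)
      qed
      then show "Q \<le> T * real (J * N * H * H) * real H * real (6 * s^2)"
        using admissible_Q[OF adm, of "J * N * H * H * H * (6 * s^2)" "real (J * N * H * H * H * (6 * s^2))"] by (simp add: mult_ac)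
    qed (use A NH T_pos in auto)
    also have "\<dots> \<le> T^3 * (T^2 * (real (J*N*H*H) * real H) * (24 * (real S)\<^sup>2 * \<kappa> + 1 / H))"
    proof (intro mult_left_mono add_right_mono mult_right_mono)
      have "s^2 \<le> (2*S)^2" using s by (intro power_mono) auto
      then have "6 * s^2 \<le> 24 * S^2" by (simp add: power_mult_distrib)
      then have "real (6 * s^2) \<le> real (24 * S^2)" by (intro of_nat_mono)
      then show "real (6 * s^2) \<le> 24 * (real S)\<^sup>2" by simp
    qed (use T_pos \<kappa>_pos in auto)
    also have "\<dots> = real (card {1..J}) * real N * (real H)^3 * ?\<omega>" by (simp add: eval_nat_numeral mult_ac)
    finally show "(\<Sum>j\<in>{1..J}. \<Sum>w\<in>{1..N}. \<Sum>u\<in>{1..H}. \<Sum>v\<in>{1..H}. min_recip (real H) (6 * (\<alpha> * real j * (real s)\<^sup>2) * real w * real u * real v))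
      \<le> real (card {1..J}) * real N * (real H)^3 * ?\<omega>" .
  qed (use A NH \<omega>0 in auto)
  also have "\<dots> = T * (real J * real N * real H * real S) * (1 / N + root 4 (10 / H + 16 * ?\<omega>))"
    by (simp add: mult_ac)
  also have "\<dots> \<le> T * (real J * real N * real H * real S) * (1 / N + root 4 (T^6 * (1 / H + (real S)\<^sup>2 * \<kappa>)))"
  proof (intro mult_left_mono add_left_mono real_root_le_mono)
    have "10 / H + 16 * ?\<omega> \<le> 400 * T^5 * (1 / H + (real S)\<^sup>2 * \<kappa>)"
      using absorb_sum[of "1 / real H" "(real S)\<^sup>2 * \<kappa>" "T^5" 10 16 400 24] T_pos \<kappa>_pos by (simp add: mult.assoc)
    also have "\<dots> \<le> T ^ Suc 5 * (1 / H + (real S)\<^sup>2 * \<kappa>)" using \<kappa>_pos by (intro T_absorb) auto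
    finally show "10 / H + 16 * ?\<omega> \<le> T^6 * (1 / H + (real S)\<^sup>2 * \<kappa>)" by simp
  qed (use T_pos in auto)
  finally show ?thesis .
qed

text \<open>Both variables are linearised, \<open>s\<close> first, so the saving in \<open>h\<close>
  sits under an inner fourth root. The remaining multiplier is \<open>12 = 2 * 6\<close>, free of
  \<open>H\<close> and \<open>S\<close>. This order suits long \<open>H\<close>, when
  \<open>S\<close> need only reach \<open>y^2\<close>.\<close>

lemma phase_sum_square_cube:
  assumes adm: "admissible J N H S"
  shows "phase_sum J N H S \<le> T * (real J * real N * real H * real S) *
     (1 / N + sqrt (T^4 * (1 / S + root 4 (T^6 * (1 / H + \<kappa>)))))"
proof -
  note A = admissibleD[OF adm]
  let ?\<omega>2 = "T^5 * (12 * \<kappa> + 1 / H)"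
  let ?R = "1 / S + root 4 (10 / H + 16 * ?\<omega>2)"
  let ?\<omega> = "T^3 * ?R"
  have R0: "0 \<le> ?R" using T_pos \<kappa>_pos by simp
  have \<omega>0: "0 \<le> ?\<omega>" using T_pos R0 by simp
  have NS: "real N \<le> x ^ 12" "real S \<le> x ^ 12" "real H \<le> x ^ 12"
    using A by (intro admissible_factor[OF adm, of "J * H^3 * S^2"] admissible_factor[OF adm, of "J * N * H^3 * S"]
       admissible_factor[OF adm, of "J * N * H^2 * S^2"]; simp add: eval_nat_numeral)+
  have JNS: "real (J * N * S) \<le> x ^ 12"
    using A by (intro admissible_factor[OF adm, of "H^3 * S"]) (auto simp: power2_eq_square)
  have JNS': "real (J * N * S * S * H * H) \<le> x ^ 12"
    using A by (intro admissible_factor[OF adm, of "H"]) (auto simp: eval_nat_numeral)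
  have inner: "(\<Sum>v\<in>{1..J*N*S}. \<Sum>h\<in>{H..<2*H}. min_recip (real S) ((2 * \<alpha> * real v) * (real h)^3)) \<le>
     T * (real (card {1..J*N*S}) * real S * real H) * ?R"
  proof (rule cube_step)
    have "(\<Sum>p\<in>{1..J*N*S}. \<Sum>w\<in>{1..S}. \<Sum>u\<in>{1..H}. \<Sum>v\<in>{1..H}. min_recip (real H) (6 * (2 * \<alpha> * real p) * real w * real u * real v))
      = (\<Sum>p\<in>{1..J*N*S}. \<Sum>w\<in>{1..S}. \<Sum>u\<in>{1..H}. \<Sum>v\<in>{1..H}. min_recip (real H) (\<alpha> * real 12 * real (p * w * u * v)))"
      by (simp add: mult_ac)
    also have "\<dots> \<le> T^3 * (\<Sum>v\<in>{1..J*N*S*S*H*H}. min_recip (real H) (\<alpha> * real 12 * real v))"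
      using A JNS' by (intro sum_product4_le) auto
    also have "\<dots> \<le> T^3 * (T^2 * (real (J*N*S*S*H*H) * real H) * (real 12 * \<kappa> + 1 / H))"
    proof (intro mult_left_mono sum_min_recip_linear_normalized)
      have "1 * H \<le> (J * N * S * S * H) * H" using A by (intro mult_le_mono) auto
      then show "H \<le> J * N * S * S * H * H" by simp
      have "J * N * H^3 * S^2 \<le> J * N * S * S * H * H * H * 12" by (simp add: eval_nat_numeral mult_ac)
      then show "Q \<le> T * real (J * N * S * S * H * H) * real H * real 12"
        using admissible_Q[OF adm, of "J * N * S * S * H * H * H * 12" "real (J * N * S * S * H * H * H * 12)"] by (simp add: mult_ac)
    qed (use A NS T_pos in auto)
    also have "\<dots> = real (card {1..J*N*S}) * real S * (real H)^3 * ?\<omega>2" by (simp add: eval_nat_numeral mult_ac)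
    finally show "(\<Sum>p\<in>{1..J*N*S}. \<Sum>w\<in>{1..S}. \<Sum>u\<in>{1..H}. \<Sum>v\<in>{1..H}. min_recip (real H) (6 * (2 * \<alpha> * real p) * real w * real u * real v))
       \<le> real (card {1..J*N*S}) * real S * (real H)^3 * ?\<omega>2" .
  qed (use A NS T_pos \<kappa>_pos in auto)
  have "phase_sum J N H S = (\<Sum>p\<in>{1..J}\<times>{H..<2*H}. \<Sum>s\<in>{S..<2*S}. min_recip (real N) ((\<alpha> * real (fst p) * (real (snd p))^3) * (real s)\<^sup>2))"
    unfolding phase_sum_def by (simp only: sum.cartesian_product' fst_conv snd_conv)
  also have "\<dots> \<le> T * (real (card ({1..J}\<times>{H..<2*H})) * real N * real S) * (1 / N + sqrt (1 / S + 2 * ?\<omega>))"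
  proof (rule square_step)
    have "(\<Sum>p\<in>{1..J}\<times>{H..<2*H}. \<Sum>w\<in>{1..N}. \<Sum>u\<in>{1..S}. min_recip (real S) (2 * (\<alpha> * real (fst p) * (real (snd p))^3) * real w * real u))
      = (\<Sum>j\<in>{1..J}. \<Sum>h\<in>{H..<2*H}. \<Sum>w\<in>{1..N}. \<Sum>u\<in>{1..S}. min_recip (real S) ((2 * \<alpha> * real (j * w * u)) * (real h)^3))"
      by (simp only: sum.cartesian_product' fst_conv snd_conv) (simp add: mult_ac)
    also have "\<dots> = (\<Sum>h\<in>{H..<2*H}. \<Sum>j\<in>{1..J}. \<Sum>w\<in>{1..N}. \<Sum>u\<in>{1..S}. min_recip (real S) ((2 * \<alpha> * real (j * w * u)) * (real h)^3))"
      by (rule sum.swap)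
    also have "\<dots> \<le> (\<Sum>h\<in>{H..<2*H}. T^2 * (\<Sum>v\<in>{1..J*N*S}. min_recip (real S) ((2 * \<alpha> * real v) * (real h)^3)))"
      using A JNS by (intro sum_mono sum_product3_le) auto
    also have "\<dots> = T^2 * (\<Sum>v\<in>{1..J*N*S}. \<Sum>h\<in>{H..<2*H}. min_recip (real S) ((2 * \<alpha> * real v) * (real h)^3))"
      by (simp only: sum_distrib_left, rule sum.swap)
    also have "\<dots> \<le> T^2 * (T * (real (card {1..J*N*S}) * real S * real H) * ?R)"
      using T_pos by (intro mult_left_mono inner) auto
    also have "\<dots> = real (card ({1..J}\<times>{H..<2*H})) * real N * (real S)\<^sup>2 * ?\<omega>"
      by (simp add: eval_nat_numeral mult_ac card_cartesian_product del: real_root_Suc_0)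
    finally show "(\<Sum>p\<in>{1..J}\<times>{H..<2*H}. \<Sum>w\<in>{1..N}. \<Sum>u\<in>{1..S}. min_recip (real S) (2 * (\<alpha> * real (fst p) * (real (snd p))^3) * real w * real u))
       \<le> real (card ({1..J}\<times>{H..<2*H})) * real N * (real S)\<^sup>2 * ?\<omega>" .
  qed (use A NS \<omega>0 in auto)
  also have "\<dots> = T * (real J * real N * real H * real S) * (1 / N + sqrt (1 / S + 2 * ?\<omega>))"
    by (simp add: mult_ac card_cartesian_product)
  also have "\<dots> \<le> T * (real J * real N * real H * real S) *
     (1 / N + sqrt (T^4 * (1 / S + root 4 (T^6 * (1 / H + \<kappa>)))))"
  proof (intro mult_left_mono add_left_mono real_sqrt_le_mono)
    let ?R' = "1 / S + root 4 (T^6 * (1 / H + \<kappa>))"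
    have "10 / H + 16 * ?\<omega>2 \<le> 400 * T^5 * (1 / H + \<kappa>)"
      using absorb_sum[of "1 / real H" \<kappa> "T^5" 10 16 400 12] T_pos \<kappa>_pos by simp
    also have "\<dots> \<le> T ^ Suc 5 * (1 / H + \<kappa>)" using \<kappa>_pos by (intro T_absorb) auto
    finally have "root 4 (10 / H + 16 * ?\<omega>2) \<le> root 4 (T^6 * (1 / H + \<kappa>))" by (intro real_root_le_mono) auto
    then have "?R \<le> ?R'" by simp
    have R'0: "0 \<le> ?R'" using T_pos \<kappa>_pos by simp
    have "1 / S \<le> T^3 * ?R'"
    proof -
      have "1 * (1 / S) \<le> T^3 * ?R'" using T_pos \<kappa>_pos by (intro mult_mono) auto
      then show ?thesis by simp
    qed
    moreover have "?\<omega> \<le> T^3 * ?R'" using \<open>?R \<le> ?R'\<close> T_pos by (intro mult_left_mono) auto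
    ultimately have "1 / S + 2 * ?\<omega> \<le> 3 * T^3 * ?R'" by simp
    also have "\<dots> \<le> T ^ Suc 3 * ?R'" using R'0 by (intro T_absorb) auto
    finally show "1 / S + 2 * ?\<omega> \<le> T^4 * ?R'" by simp
  qed (use T_pos in auto)
  finally show ?thesis .
qed

text \<open>The opposite order, for long \<open>S\<close>: the saving in \<open>s\<close> passes
  through an inner square root and the outer fourth root, so \<open>H\<close> need only reach
  \<open>y^4\<close>.\<close>

lemma phase_sum_cube_square:
  assumes adm: "admissible J N H S"
  shows "phase_sum J N H S \<le> T * (real J * real N * real H * real S) *
     (1 / N + root 4 (T^5 * (1 / H + sqrt (T^5 * (1 / S + \<kappa>)))))"
proof -
  note A = admissibleD[OF adm]
  let ?\<omega>2 = "T^4 * (12 * \<kappa> + 1 / S)"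
  let ?R = "1 / H + sqrt (1 / S + 2 * ?\<omega>2)"
  let ?\<omega> = "T^4 * ?R"
  have R0: "0 \<le> ?R" using T_pos \<kappa>_pos by simp
  have \<omega>0: "0 \<le> ?\<omega>" using T_pos R0 by simp
  have NS: "real N \<le> x ^ 12" "real S \<le> x ^ 12" "real H \<le> x ^ 12"
    using A by (intro admissible_factor[OF adm, of "J * H^3 * S^2"] admissible_factor[OF adm, of "J * N * H^3 * S"]
       admissible_factor[OF adm, of "J * N * H^2 * S^2"]; simp add: eval_nat_numeral)+
  have JNH: "real (J * N * H * H) \<le> x ^ 12"
    using A by (intro admissible_factor[OF adm, of "H * S^2"]) (auto simp: eval_nat_numeral)
  have JNH': "real (J * N * H * H * H * S) \<le> x ^ 12"
    using A by (intro admissible_factor[OF adm, of "S"]) (auto simp: eval_nat_numeral)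
  have inner: "(\<Sum>v\<in>{1..J*N*H*H}. \<Sum>s\<in>{S..<2*S}. min_recip (real H) ((6 * \<alpha> * real v) * (real s)\<^sup>2)) \<le>
     T * (real (card {1..J*N*H*H}) * real H * real S) * ?R"
  proof (rule square_step)
    have "(\<Sum>p\<in>{1..J*N*H*H}. \<Sum>w\<in>{1..H}. \<Sum>u\<in>{1..S}. min_recip (real S) (2 * (6 * \<alpha> * real p) * real w * real u))
      = (\<Sum>p\<in>{1..J*N*H*H}. \<Sum>w\<in>{1..H}. \<Sum>u\<in>{1..S}. min_recip (real S) (\<alpha> * real 12 * real (p * w * u)))"
      by (simp add: mult_ac)
    also have "\<dots> \<le> T^2 * (\<Sum>v\<in>{1..J*N*H*H*H*S}. min_recip (real S) (\<alpha> * real 12 * real v))"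
      using A JNH' by (intro sum_product3_le) auto
    also have "\<dots> \<le> T^2 * (T^2 * (real (J*N*H*H*H*S) * real S) * (real 12 * \<kappa> + 1 / S))"
    proof (intro mult_left_mono sum_min_recip_linear_normalized)
      have "1 * S \<le> (J * N * H * H * H) * S" using A by (intro mult_le_mono) auto
      then show "S \<le> J * N * H * H * H * S" by simp
      have "J * N * H^3 * S^2 \<le> J * N * H * H * H * S * S * 12" by (simp add: eval_nat_numeral mult_ac)
      then show "Q \<le> T * real (J * N * H * H * H * S) * real S * real 12"
        using admissible_Q[OF adm, of "J * N * H * H * H * S * S * 12" "real (J * N * H * H * H * S * S * 12)"] by (simp add: mult_ac)
    qed (use A NS T_pos in auto)
    also have "\<dots> = real (card {1..J*N*H*H}) * real H * (real S)\<^sup>2 * ?\<omega>2" by (simp add: eval_nat_numeral mult_ac)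
    finally show "(\<Sum>p\<in>{1..J*N*H*H}. \<Sum>w\<in>{1..H}. \<Sum>u\<in>{1..S}. min_recip (real S) (2 * (6 * \<alpha> * real p) * real w * real u))
       \<le> real (card {1..J*N*H*H}) * real H * (real S)\<^sup>2 * ?\<omega>2" .
  qed (use A NS T_pos \<kappa>_pos in auto)
  have "phase_sum J N H S = (\<Sum>j\<in>{1..J}. \<Sum>s\<in>{S..<2*S}. \<Sum>h\<in>{H..<2*H}. min_recip (real N) ((\<alpha> * real j * (real s)\<^sup>2) * (real h)^3))"
    unfolding phase_sum_def by (subst sum_swap_inner) (simp add: mult_ac)
  also have "\<dots> = (\<Sum>p\<in>{1..J}\<times>{S..<2*S}. \<Sum>h\<in>{H..<2*H}. min_recip (real N) ((\<alpha> * real (fst p) * (real (snd p))\<^sup>2) * (real h)^3))"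
    by (simp only: sum.cartesian_product' fst_conv snd_conv)
  also have "\<dots> \<le> T * (real (card ({1..J}\<times>{S..<2*S})) * real N * real H) * (1 / N + root 4 (10 / H + 16 * ?\<omega>))"
  proof (rule cube_step)
    have "(\<Sum>p\<in>{1..J}\<times>{S..<2*S}. \<Sum>w\<in>{1..N}. \<Sum>u\<in>{1..H}. \<Sum>v\<in>{1..H}. min_recip (real H) (6 * (\<alpha> * real (fst p) * (real (snd p))\<^sup>2) * real w * real u * real v))
      = (\<Sum>j\<in>{1..J}. \<Sum>s\<in>{S..<2*S}. \<Sum>w\<in>{1..N}. \<Sum>u\<in>{1..H}. \<Sum>v\<in>{1..H}. min_recip (real H) ((6 * \<alpha> * real (j * w * u * v)) * (real s)\<^sup>2))"
      by (simp only: sum.cartesian_product' fst_conv snd_conv) (simp add: mult_ac)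
    also have "\<dots> = (\<Sum>s\<in>{S..<2*S}. \<Sum>j\<in>{1..J}. \<Sum>w\<in>{1..N}. \<Sum>u\<in>{1..H}. \<Sum>v\<in>{1..H}. min_recip (real H) ((6 * \<alpha> * real (j * w * u * v)) * (real s)\<^sup>2))"
      by (rule sum.swap)
    also have "\<dots> \<le> (\<Sum>s\<in>{S..<2*S}. T^3 * (\<Sum>v\<in>{1..J*N*H*H}. min_recip (real H) ((6 * \<alpha> * real v) * (real s)\<^sup>2)))"
      using A JNH by (intro sum_mono sum_product4_le) auto
    also have "\<dots> = T^3 * (\<Sum>v\<in>{1..J*N*H*H}. \<Sum>s\<in>{S..<2*S}. min_recip (real H) ((6 * \<alpha> * real v) * (real s)\<^sup>2))"
      by (simp only: sum_distrib_left, rule sum.swap)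
    also have "\<dots> \<le> T^3 * (T * (real (card {1..J*N*H*H}) * real H * real S) * ?R)"
      using T_pos by (intro mult_left_mono inner) auto
    also have "\<dots> = real (card ({1..J}\<times>{S..<2*S})) * real N * (real H)^3 * ?\<omega>"
      by (simp add: eval_nat_numeral mult_ac card_cartesian_product)
    finally show "(\<Sum>p\<in>{1..J}\<times>{S..<2*S}. \<Sum>w\<in>{1..N}. \<Sum>u\<in>{1..H}. \<Sum>v\<in>{1..H}. min_recip (real H) (6 * (\<alpha> * real (fst p) * (real (snd p))\<^sup>2) * real w * real u * real v))
       \<le> real (card ({1..J}\<times>{S..<2*S})) * real N * (real H)^3 * ?\<omega>" .
  qed (use A NS \<omega>0 in auto)
  also have "\<dots> = T * (real J * real N * real H * real S) * (1 / N + root 4 (10 / H + 16 * ?\<omega>))"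
    by (simp add: mult_ac card_cartesian_product)
  also have "\<dots> \<le> T * (real J * real N * real H * real S) *
     (1 / N + root 4 (T^5 * (1 / H + sqrt (T^5 * (1 / S + \<kappa>)))))"
  proof (intro mult_left_mono add_left_mono real_root_le_mono)
    let ?R' = "1 / H + sqrt (T^5 * (1 / S + \<kappa>))"
    have "1 / S + 2 * ?\<omega>2 \<le> 400 * T^4 * (1 / S + \<kappa>)"
      using absorb_sum[of "1 / real S" \<kappa> "T^4" 1 2 400 12] T_pos \<kappa>_pos by simp
    also have "\<dots> \<le> T ^ Suc 4 * (1 / S + \<kappa>)" using \<kappa>_pos by (intro T_absorb) auto
    finally have "sqrt (1 / S + 2 * ?\<omega>2) \<le> sqrt (T^5 * (1 / S + \<kappa>))" by (intro real_sqrt_le_mono) auto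
    then have "?R \<le> ?R'" by simp
    have R'0: "0 \<le> ?R'" using T_pos \<kappa>_pos by simp
    have "1 / H \<le> T^4 * ?R'"
    proof -
      have "1 * (1 / H) \<le> T^4 * ?R'" using T_pos \<kappa>_pos by (intro mult_mono) auto
      then show ?thesis by simp
    qed
    moreover have "?\<omega> \<le> T^4 * ?R'" using \<open>?R \<le> ?R'\<close> T_pos by (intro mult_left_mono) auto
    ultimately have "10 / H + 16 * ?\<omega> \<le> 26 * T^4 * ?R'" by simp
    also have "\<dots> \<le> T ^ Suc 4 * ?R'" using R'0 by (intro T_absorb) auto
    finally show "10 / H + 16 * ?\<omega> \<le> T^5 * ?R'" by simp
  qed (use T_pos in auto)
  finally show ?thesis .
qed

text \<open>Common end of the cases that average over at least one sparse variable: \<open>B\<close>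
  is the root expression of the case and \<open>Z\<close> the saving to be reached.\<close>

lemma phase_sum_bound_aux:
  assumes "0 \<le> B" "0 \<le> c" "B \<le> c" "P \<le> T * X * (1 / real N + B)" "0 \<le> X" "c \<le> T^4 * Z" "0 \<le> Z"
  shows "P \<le> T^5 * X * (Z + 1 / real N)"
proof -
  have "1 * (1 / real N) \<le> T^4 * (1 / real N)" using T_pos by (intro mult_right_mono) auto
  then have "1 / real N + B \<le> T^4 * (Z + 1 / real N)" using assms by (simp add: distrib_left)
  then have "T * X * (1 / real N + B) \<le> T * X * (T^4 * (Z + 1 / real N))"
    using assms T_pos by (intro mult_left_mono) auto
  with assms show ?thesis by (simp add: eval_nat_numeral mult_ac)
qed

text \<open>Averaging over \<open>h\<close> (or \<open>s\<close>) pays off when its range is long; a short range is kept fixed at the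
  cost of a factor \<open>H ^ 3\<close> (or \<open>S ^ 2\<close>) in front of \<open>\<kappa>\<close>.\<close>

lemma phase_sum_bound:
  assumes adm: "admissible J N H S" and \<kappa>: "\<kappa> * y^16 \<le> 1"
    and good: "real S \<le> y^6 \<or> real H \<le> y^4 \<or> y^16 \<le> 4 * real H * real S"
  shows "phase_sum J N H S \<le> T^5 * (real J * real N * real H * real S) * ((1 / y + y^16 * \<kappa>) + 1 / N)"
proof -
  note A = admissibleD[OF adm]
  let ?X = "real J * real N * real H * real S"
  let ?Z = "1 / y + y^16 * \<kappa>"
  have y0: "0 < y" "1 \<le> y" using y_ge by auto
  have \<kappa>0: "0 < \<kappa>" by (rule \<kappa>_pos)
  have Z0: "0 \<le> ?Z" using y0 \<kappa>0 by simp
  have X0: "0 \<le> ?X" by simp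
  have yk: "y^k * \<kappa> \<le> 1 / y^l" if "k + l \<le> 16" for k l
  proof -
    have "y^(k+l) * \<kappa> \<le> y^16 * \<kappa>" using that y0 \<kappa>0 by (intro mult_right_mono power_increasing) auto
    then have "y^(k+l) * \<kappa> \<le> 1" using \<kappa> by (simp add: mult.commute)
    then show ?thesis using y0 by (simp add: field_simps power_add)
  qed
  have Tm: "T^m \<le> T^n" if "m \<le> n" for m n using that by (rule T_power_mono)
  have dec: "1 / y^k \<le> 1 / y^l" if "l \<le> k" for k l
    using y0 that by (intro divide_left_mono power_increasing) auto
  have inv: "1 / real n \<le> c / y^k" if "y^k \<le> c * real n" "1 \<le> n" for n k c
    using that y0 by (simp add: field_simps)
  have T2: "2 * T^n \<le> T^Suc n" for n using T_absorb[of 2 1 n] by simp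
  have yZ: "T^4 / y \<le> T^4 * ?Z" using T_pos y0 \<kappa>0 by (simp add: field_simps)
  have root4: "root 4 (T^8 / y^4) = T^2 / y"
  proof -
    have "T^8 / y^4 = (T^2 / y)^4" by (simp add: power_divide flip: power_mult)
    then show ?thesis using T_pos y0 by (simp add: real_root_power_cancel del: power_divide)
  qed
  have sqrt2: "sqrt (T^(2*n) / y^(2*k)) = T^n / y^k" for n k
  proof -
    have "T^(2*n) / y^(2*k) = (T^n / y^k)\<^sup>2" by (simp add: power_divide power_mult mult.commute[of 2])
    then show ?thesis using T_pos y0 by (simp add: real_sqrt_abs del: power_divide)
  qed
  \<comment> \<open>Each threshold is the length that leaves a saving of \<open>y\<close> after the
    roots: \<open>y^2\<close> under a square root, \<open>y^4\<close> under a fourth root,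
    \<open>y^8\<close> under both. A single fixed range costs at most \<open>y^12\<close>, and
    \<open>y^12 * \<kappa> \<le> 1 / y^4\<close>; with both fixed,
    \<open>H^3 * S^2 \<le> y^16\<close>.\<close>
  consider "real H \<le> y^4" "real S \<le> y^2" | "real H \<le> y^4" "y^2 \<le> real S"
    | "y^4 \<le> real H" "real S \<le> y^6" | "y^8 \<le> 2 * real H" "y^2 \<le> real S" | "y^4 \<le> real H" "y^8 \<le> 2 * real S"
  proof -
    have "y^2 \<le> y^6" using y0 by (intro power_increasing) auto
    moreover have "y^8 \<le> 2 * real H \<or> y^8 \<le> 2 * real S" if "y^16 \<le> 4 * real H * real S"
    proof (rule ccontr)
      assume "\<not> ?thesis"
      then have "(2 * real H) * (2 * real S) < y^8 * y^8" using A by (intro mult_strict_mono) auto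
      then show False using that by (simp flip: power_add)
    qed
    ultimately show ?thesis using good that by linarith
  qed
  then show ?thesis
  proof cases
    case 1
    have "phase_sum J N H S \<le> T^3 * ?X * ((real H)^3 * (real S)\<^sup>2 * \<kappa> + 1 / N)" by (rule phase_sum_fix_both[OF adm])
    also have "\<dots> \<le> T^5 * ?X * (?Z + 1 / N)"
    proof (intro mult_mono add_mono order_refl Tm)
      have "(real H)^3 * (real S)\<^sup>2 \<le> (y^4)^3 * (y^2)\<^sup>2" using 1 by (intro mult_mono power_mono) auto
      then have "(real H)^3 * (real S)\<^sup>2 * \<kappa> \<le> y^16 * \<kappa>" using \<kappa>0 by (intro mult_right_mono) (auto simp flip: power_mult power_add)
      then show "(real H)^3 * (real S)\<^sup>2 * \<kappa> \<le> ?Z" using y0 by (simp add: add_increasing)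
    qed (use T_pos \<kappa>0 in auto)
    finally show ?thesis .
  next
    case 2
    show ?thesis
    proof (rule phase_sum_bound_aux[OF _ _ _ phase_sum_square[OF adm] X0 yZ Z0])
      have "(real H)^3 * \<kappa> \<le> (y^4)^3 * \<kappa>" using 2 \<kappa>0 by (intro mult_right_mono power_mono) auto
      also have "\<dots> \<le> 1 / y^2" using yk[of 12 2] by (simp flip: power_mult)
      finally have "1 / S + (real H)^3 * \<kappa> \<le> 2 / y^2" using inv[of 2 1 S] 2 A by simp
      then have "T^5 * (1 / S + (real H)^3 * \<kappa>) \<le> T^5 * (2 / y^2)" using T_pos by (intro mult_left_mono) auto
      also have "\<dots> = 2 * T^5 / y^2" by simp
      also have "\<dots> \<le> T^8 / y^2" using T2[of 5] Tm[of 6 8] by (intro divide_right_mono) auto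
      finally have "sqrt (T^5 * (1 / S + (real H)^3 * \<kappa>)) \<le> sqrt (T^8 / y^2)" by (rule real_sqrt_le_mono)
      also have "\<dots> = T^4 / y" using sqrt2[of 4 1] by simp
      finally show "sqrt (T^5 * (1 / S + (real H)^3 * \<kappa>)) \<le> T^4 / y" .
    qed (use T_pos \<kappa>0 y0 in auto)
  next
    case 3
    show ?thesis
    proof (rule phase_sum_bound_aux[OF _ _ _ phase_sum_cube[OF adm] X0 yZ Z0])
      have "(real S)\<^sup>2 * \<kappa> \<le> (y^6)\<^sup>2 * \<kappa>" using 3 \<kappa>0 by (intro mult_right_mono power_mono) auto
      also have "\<dots> \<le> 1 / y^4" using yk[of 12 4] by (simp flip: power_mult)
      finally have "1 / H + (real S)\<^sup>2 * \<kappa> \<le> 2 / y^4" using inv[of 4 1 H] 3 A by simp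
      then have "T^6 * (1 / H + (real S)\<^sup>2 * \<kappa>) \<le> T^6 * (2 / y^4)" using T_pos by (intro mult_left_mono) auto
      also have "\<dots> = 2 * T^6 / y^4" by simp
      also have "\<dots> \<le> T^8 / y^4" using T2[of 6] Tm[of 7 8] y0 by (intro divide_right_mono) auto
      finally have "root 4 (T^6 * (1 / H + (real S)\<^sup>2 * \<kappa>)) \<le> T^2 / y" unfolding root4[symmetric] by (intro real_root_le_mono) auto
      also have "\<dots> \<le> T^4 / y" using Tm[of 2 4] y0 by (intro divide_right_mono) auto
      finally show "root 4 (T^6 * (1 / H + (real S)\<^sup>2 * \<kappa>)) \<le> T^4 / y" .
    qed (use T_pos \<kappa>0 y0 in auto)
  next
    case 4
    show ?thesis
    proof (rule phase_sum_bound_aux[OF _ _ _ phase_sum_square_cube[OF adm] X0 yZ Z0])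
      have "1 / H \<le> 2 / y^8" using inv[of 8 2 H] 4 A by simp
      moreover have "\<kappa> \<le> 1 / y^8" using yk[of 0 8] by simp
      ultimately have "1 / H + \<kappa> \<le> 3 / y^8" by simp
      then have "T^6 * (1 / H + \<kappa>) \<le> T^6 * (3 / y^8)" using T_pos by (intro mult_left_mono) auto
      also have "\<dots> = 3 * T^6 / y^8" by simp
      also have "\<dots> \<le> T^8 / y^8" using T_absorb[of 3 1 6] Tm[of 7 8] y0 by (intro divide_right_mono) auto
      also have "\<dots> = (T^2 / y^2)^4" by (simp add: power_divide flip: power_mult)
      finally have "root 4 (T^6 * (1 / H + \<kappa>)) \<le> root 4 ((T^2 / y^2)^4)" by (intro real_root_le_mono) auto
      then have r: "root 4 (T^6 * (1 / H + \<kappa>)) \<le> T^2 / y^2"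
        using T_pos y0 by (simp add: real_root_power_cancel del: power_divide)
      have "1 / S \<le> 1 / y^2" using inv[of 2 1 S] 4 A by simp
      also have "\<dots> \<le> T^2 / y^2" using T_pos y0 by (intro divide_right_mono) auto
      finally have "1 / S + root 4 (T^6 * (1 / H + \<kappa>)) \<le> 2 * T^2 / y^2" using r by simp
      then have "T^4 * (1 / S + root 4 (T^6 * (1 / H + \<kappa>))) \<le> T^4 * (2 * T^2 / y^2)" using T_pos by (intro mult_left_mono) auto
      also have "\<dots> = 2 * T^6 / y^2" by (simp flip: power_add)
      also have "\<dots> \<le> T^8 / y^2" using T2[of 6] Tm[of 7 8] y0 by (intro divide_right_mono) auto
      finally have "sqrt (T^4 * (1 / S + root 4 (T^6 * (1 / H + \<kappa>)))) \<le> sqrt (T^8 / y^2)" by (rule real_sqrt_le_mono)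
      also have "\<dots> = T^4 / y" using sqrt2[of 4 1] by simp
      finally show "sqrt (T^4 * (1 / S + root 4 (T^6 * (1 / H + \<kappa>)))) \<le> T^4 / y" .
    qed (use T_pos \<kappa>0 y0 in auto)
  next
    case 5
    show ?thesis
    proof (rule phase_sum_bound_aux[OF _ _ _ phase_sum_cube_square[OF adm] X0 yZ Z0])
      have "1 / S \<le> 2 / y^8" using inv[of 8 2 S] 5 A by simp
      moreover have "\<kappa> \<le> 1 / y^8" using yk[of 0 8] by simp
      ultimately have "1 / S + \<kappa> \<le> 3 / y^8" by simp
      then have "T^5 * (1 / S + \<kappa>) \<le> T^5 * (3 / y^8)" using T_pos by (intro mult_left_mono) auto
      also have "\<dots> = 3 * T^5 / y^8" by simp
      also have "\<dots> \<le> T^6 / y^8" using T_absorb[of 3 1 5] y0 by (intro divide_right_mono) auto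
      finally have "sqrt (T^5 * (1 / S + \<kappa>)) \<le> sqrt (T^6 / y^8)" by (rule real_sqrt_le_mono)
      also have "\<dots> = T^3 / y^4" using sqrt2[of 3 4] by simp
      finally have r: "sqrt (T^5 * (1 / S + \<kappa>)) \<le> T^3 / y^4" .
      have "1 / H \<le> 1 / y^4" using inv[of 4 1 H] 5 A by simp
      also have "\<dots> \<le> T^3 / y^4" using T_pos y0 by (intro divide_right_mono) auto
      finally have "1 / H + sqrt (T^5 * (1 / S + \<kappa>)) \<le> 2 * T^3 / y^4" using r by simp
      then have "T^5 * (1 / H + sqrt (T^5 * (1 / S + \<kappa>))) \<le> T^5 * (2 * T^3 / y^4)" using T_pos by (intro mult_left_mono) auto
      also have "\<dots> = 2 * T^8 / y^4" by (simp flip: power_add)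
      also have "\<dots> \<le> T^16 / y^4" using T2[of 8] Tm[of 9 16] y0 by (intro divide_right_mono) auto
      also have "\<dots> = (T^4 / y)^4" by (simp add: power_divide flip: power_mult)
      finally have "root 4 (T^5 * (1 / H + sqrt (T^5 * (1 / S + \<kappa>)))) \<le> root 4 ((T^4 / y)^4)" by (intro real_root_le_mono) auto
      then show "root 4 (T^5 * (1 / H + sqrt (T^5 * (1 / S + \<kappa>)))) \<le> T^4 / y"
        using T_pos y0 by (simp add: real_root_power_cancel del: power_divide)
    qed (use T_pos \<kappa>0 y0 in auto)
  qed
qed

end

section \<open>Bilinear sums\<close>

lemma sum_fiber_le:
  fixes F :: "'b \<Rightarrow> real"
  assumes "finite X" "finite Y" "\<Phi> ` X \<subseteq> Y"
    and "\<And>z. z \<in> Y \<Longrightarrow> real (card {p \<in> X. \<Phi> p = z}) \<le> B" and "\<And>z. z \<in> Y \<Longrightarrow> 0 \<le> F z"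
  shows "(\<Sum>p\<in>X. F (\<Phi> p)) \<le> B * (\<Sum>z\<in>Y. F z)"
proof -
  have "(\<Sum>p\<in>X. F (\<Phi> p)) = (\<Sum>z\<in>Y. \<Sum>p\<in>{p\<in>X. \<Phi> p = z}. F (\<Phi> p))"
    by (rule sum.group[symmetric]) (use assms in auto)
  also have "\<dots> = (\<Sum>z\<in>Y. real (card {p\<in>X. \<Phi> p = z}) * F z)"
    by (intro sum.cong refl) simp
  also have "\<dots> \<le> (\<Sum>z\<in>Y. B * F z)" using assms by (intro sum_mono mult_right_mono) auto
  finally show ?thesis by (simp add: sum_distrib_left)
qed

lemma card_fiber_le:
  assumes "finite X" "finite Y" "\<Phi> ` X \<subseteq> Y" "\<And>z. z \<in> Y \<Longrightarrow> real (card {p \<in> X. \<Phi> p = z}) \<le> B"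
  shows "real (card X) \<le> B * real (card Y)"
  using sum_fiber_le[OF assms, of "\<lambda>_. 1"] by simp

text \<open>Opening the square and summing over \<open>m\<close> first strips off the weights
  \<open>c\<close>: only their norms survive.\<close>

lemma sum_norm_squared_le:
  fixes g :: "'i \<Rightarrow> 'm \<Rightarrow> complex"
  assumes "finite A" "finite I"
  shows "(\<Sum>m\<in>A. (norm (\<Sum>i\<in>I. c i * g i m))\<^sup>2) \<le>
    (\<Sum>i\<in>I. \<Sum>j\<in>I. norm (c i) * norm (c j) * norm (\<Sum>m\<in>A. g i m * cnj (g j m)))"
proof -
  have "complex_of_real (\<Sum>m\<in>A. (norm (\<Sum>i\<in>I. c i * g i m))\<^sup>2) =
     (\<Sum>m\<in>A. \<Sum>i\<in>I. \<Sum>j\<in>I. c i * cnj (c j) * (g i m * cnj (g j m)))"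
    unfolding of_real_sum complex_norm_square
    by (intro sum.cong refl) (simp add: sum_product mult_ac)
  also have "\<dots> = (\<Sum>i\<in>I. \<Sum>j\<in>I. c i * cnj (c j) * (\<Sum>m\<in>A. g i m * cnj (g j m)))"
    by (subst sum_rotate) (simp add: sum_distrib_left)
  finally have eq: "complex_of_real (\<Sum>m\<in>A. (norm (\<Sum>i\<in>I. c i * g i m))\<^sup>2) =
     (\<Sum>i\<in>I. \<Sum>j\<in>I. c i * cnj (c j) * (\<Sum>m\<in>A. g i m * cnj (g j m)))" .
  have "(\<Sum>m\<in>A. (norm (\<Sum>i\<in>I. c i * g i m))\<^sup>2) = norm (complex_of_real (\<Sum>m\<in>A. (norm (\<Sum>i\<in>I. c i * g i m))\<^sup>2))"
    by (simp only: norm_of_real) (simp add: sum_nonneg)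
  also have "\<dots> \<le> (\<Sum>i\<in>I. \<Sum>j\<in>I. norm (c i) * norm (c j) * norm (\<Sum>m\<in>A. g i m * cnj (g j m)))"
    unfolding eq by (intro sum_norm_le) (simp add: norm_mult)
  finally show ?thesis .
qed

text \<open>Avoids solving for end points: inside one residue class, a set containing every class
  member between its minimum and maximum is the progression from the one to the other. Windows and
  congruences on multiples of \<open>m\<close> are easily checked in this form. The
  \<open>+ 1\<close> counts both ends.\<close>

lemma convex_progression:
  fixes X :: "nat set"
  assumes X: "X \<subseteq> {A..<A + M}" "1 \<le> r"
    and cong: "\<And>m n. m \<in> X \<Longrightarrow> n \<in> X \<Longrightarrow> [m = n] (mod r)"
    and convex: "\<And>m n k. m \<in> X \<Longrightarrow> n \<in> X \<Longrightarrow> m \<le> k \<Longrightarrow> k \<le> n \<Longrightarrow> [k = m] (mod r) \<Longrightarrow> k \<in> X"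
  obtains c n where "X = (\<lambda>t. c + r * t) ` {..<n}" "n \<le> M div r + 1" "card X = n"
proof (cases "X = {}")
  case True
  then show ?thesis using that[of 0 0] by simp
next
  case False
  have fin: "finite X" using X(1) by (rule finite_subset) simp
  define c where "c = Min X"
  define d where "d = Max X"
  have cX: "c \<in> X" and dX: "d \<in> X" and le: "\<And>m. m \<in> X \<Longrightarrow> c \<le> m \<and> m \<le> d"
    using fin False by (auto simp: c_def d_def)
  have eq: "X = (\<lambda>t. c + r * t) ` {..<(d - c) div r + 1}"
  proof (intro equalityI subsetI)
    fix m assume m: "m \<in> X"
    then have "r dvd m - c" using cong[OF m cX] le[OF m] by (metis cong_altdef_nat)
    then obtain t where t: "m - c = r * t" by blast
    have "r * t \<le> d - c" using t le[OF m] by linarith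
    then have "t \<le> (d - c) div r" using X(2) by (simp add: less_eq_div_iff_mult_less_eq mult.commute)
    moreover have "m = c + r * t" using t le[OF m] by linarith
    ultimately show "m \<in> (\<lambda>t. c + r * t) ` {..<(d - c) div r + 1}" by auto
  next
    fix m assume "m \<in> (\<lambda>t. c + r * t) ` {..<(d - c) div r + 1}"
    then obtain t where t0: "t \<in> {..<(d - c) div r + 1}" and t1: "m = c + r * t" by (rule imageE) simp
    then have t: "m = c + r * t" "t \<le> (d - c) div r" by auto
    have "r * t \<le> r * ((d - c) div r)" using t(2) by simp
    also have "\<dots> \<le> d - c" by simp
    finally have "m \<le> d" using le[OF cX] t by linarith
    then show "m \<in> X" using t by (intro convex[OF cX dX]) (auto simp: cong_def)
  qed
  have "A \<le> c" "d < A + M" using X(1) cX dX by auto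
  then have "d - c \<le> M" by linarith
  then have "(d - c) div r + 1 \<le> M div r + 1" by (simp add: div_le_mono)
  moreover have "card X = (d - c) div r + 1"
    unfolding eq using X(2) by (subst card_image) (auto simp: inj_on_def)
  ultimately show ?thesis using that[OF eq] by simp
qed

lemma norm_sum_e_square_progression:
  assumes "X \<subseteq> {A..<A + M}" "1 \<le> r"
    and "\<And>m n. m \<in> X \<Longrightarrow> n \<in> X \<Longrightarrow> [m = n] (mod r)"
    and "\<And>m n k. m \<in> X \<Longrightarrow> n \<in> X \<Longrightarrow> m \<le> k \<Longrightarrow> k \<le> n \<Longrightarrow> [k = m] (mod r) \<Longrightarrow> k \<in> X"
    and N: "M div r + 1 \<le> N"
  shows "(norm (\<Sum>m\<in>X. e (\<gamma> * (real m)\<^sup>2)))\<^sup>2 \<le> real N + 2 * (\<Sum>u\<in>{1..N}. min_recip (real N) (2 * \<gamma> * (real r)\<^sup>2 * real u))"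
proof -
  obtain c n where cn: "X = (\<lambda>t. c + r * t) ` {..<n}" "n \<le> M div r + 1"
    by (rule convex_progression[OF assms(1-4)])
  have "(\<Sum>m\<in>X. e (\<gamma> * (real m)\<^sup>2)) = (\<Sum>t<n. e (\<gamma> * (real (c + r * t))\<^sup>2))"
    unfolding cn(1) using assms(2) by (subst sum.reindex) (auto simp: inj_on_def)
  also have "\<dots> = (\<Sum>t<n. e ((\<gamma> * (real r)\<^sup>2) * (real t)\<^sup>2 + (2 * \<gamma> * real c * real r) * real t + \<gamma> * (real c)\<^sup>2))"
    by (intro sum.cong refl arg_cong[of _ _ e]) (simp add: power2_eq_square algebra_simps)
  finally have eq: "(\<Sum>m\<in>X. e (\<gamma> * (real m)\<^sup>2)) = \<dots>" .
  have "n \<le> N" using cn(2) N by simp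
  from norm_sum_e_quadratic[OF this, of "\<gamma> * (real r)\<^sup>2" "2 * \<gamma> * real c * real r" "\<gamma> * (real c)\<^sup>2"]
  show ?thesis unfolding eq by (simp only: mult.assoc)
qed

lemma card_residue_class_le:
  assumes "1 \<le> r"
  shows "card {n \<in> {1..V}. [int n = b] (mod int r)} \<le> V div r + 1"
proof -
  let ?X = "{n \<in> {1..V}. [int n = b] (mod int r)}"
  have sub: "?X \<subseteq> {1..<1 + V}" by auto
  have c1: "[m = n] (mod r)" if "m \<in> ?X" "n \<in> ?X" for m n
  proof -
    have "[int m = b] (mod int r)" "[int n = b] (mod int r)" using that by simp_all
    then have "[int m = int n] (mod int r)" using cong_sym cong_trans by blast
    then show ?thesis by (simp add: cong_int_iff)
  qed
  have c2: "k \<in> ?X" if "m \<in> ?X" "n \<in> ?X" "m \<le> k" "k \<le> n" "[k = m] (mod r)" for m n k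
  proof -
    have "[int k = int m] (mod int r)" using that(5) by (simp add: cong_int_iff)
    moreover have "[int m = b] (mod int r)" using that(1) by simp
    ultimately have "[int k = b] (mod int r)" using cong_trans by blast
    then show ?thesis using that by simp
  qed
  show ?thesis
  proof (rule convex_progression[OF sub assms c1 c2])
    fix c n assume "n \<le> V div r + 1" "card ?X = n"
    then show "card ?X \<le> V div r + 1" by (simp only:)
  qed
qed

text \<open>The congruences modulo \<open>h * s1\<close> and \<open>h * s2\<close> both determine \<open>m\<close> modulo \<open>h\<close>, whence \<open>h\<close> divides \<open>l1 - l2\<close>.\<close>

lemma double_congruence:
  fixes b :: int and h s1 s2 l1 l2 m m' :: nat
  assumes b: "coprime b (int (h * s1))" "coprime b (int (h * s2))"
    and m: "[int (m * l1) = b] (mod int (h * s1))" "[int (m * l2) = b] (mod int (h * s2))"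
  shows double_congruence_dvd: "int h dvd int l1 - int l2"
    and double_congruence_unique: "[int (m' * l1) = b] (mod int (h * s1)) \<Longrightarrow> [int (m' * l2) = b] (mod int (h * s2)) \<Longrightarrow>
       [m = m'] (mod h * lcm s1 s2)"
proof -
  \<comment> \<open>A product congruent to a unit modulo \<open>d\<close> has only units as factors;
    this permits the cancellations below.\<close>
  have cop: "coprime (int l) (int d) \<and> coprime (int m) (int d)" if "[int (m * l) = b] (mod int d)" "coprime b (int d)" for m l d :: nat
  proof -
    have "coprime (int (m * l)) (int d)" using that cong_imp_coprime cong_sym by blast
    then show ?thesis by simp
  qed
  have "[int (m * l1) = b] (mod int h)" "[int (m * l2) = b] (mod int h)"
    using m by (auto intro: cong_dvd_modulus)
  then have "[int m * int l1 = int m * int l2] (mod int h)"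
    by (metis cong_sym cong_trans of_nat_mult)
  moreover have "coprime (int m) (int h)" using cop[OF m(1) b(1)] by simp
  ultimately have "[int l1 = int l2] (mod int h)" using cong_mult_lcancel by blast
  then show "int h dvd int l1 - int l2" by (simp add: cong_iff_dvd_diff)
  assume m': "[int (m' * l1) = b] (mod int (h * s1))" "[int (m' * l2) = b] (mod int (h * s2))"
  have *: "[m = m'] (mod d)" if "[int (m * l) = b] (mod int d)" "[int (m' * l) = b] (mod int d)" "coprime b (int d)" for l d :: nat
  proof -
    have "[int m * int l = int m' * int l] (mod int d)" using that by (metis cong_sym cong_trans of_nat_mult)
    then have "[int m = int m'] (mod int d)" using cop[OF that(1,3)] cong_mult_rcancel by blast
    then show ?thesis by (simp add: cong_int_iff)
  qed
  have "[m = m'] (mod lcm (h * s1) (h * s2))"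
    using *[OF m(1) m'(1) b(1)] *[OF m(2) m'(2) b(2)] by (intro cong_cong_lcm_nat)
  then show "[m = m'] (mod h * lcm s1 s2)" by (simp add: lcm_mult_left)
qed

section \<open>Pairs of terms and their phases\<close>

context minor_arc
begin

definition "\<omega> = 1 / y + y^16 * \<kappa>"

lemma \<omega>_pos: "0 < \<omega>" using y_ge \<kappa>_pos by (simp add: \<omega>_def add_pos_pos)

lemma card_divisors_le: "0 < n \<Longrightarrow> real n \<le> x ^ 12 \<Longrightarrow> real (card {k. k dvd n}) \<le> T"
  using tau[of n] by (simp add: divisor_count_def)

lemma card_lcm_fiber:
  assumes "0 < n" "real n \<le> x ^ 12"
  shows "real (card {p. lcm (fst p) (snd p) = n}) \<le> T^2" "finite {p. lcm (fst p) (snd p) = (n::nat)}"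
proof -
  have sub: "{p. lcm (fst p) (snd p) = n} \<subseteq> {k. k dvd n} \<times> {k. k dvd n}" by auto
  have fin: "finite ({k. k dvd n} \<times> {k. k dvd n})" using assms by simp
  show "finite {p. lcm (fst p) (snd p) = n}" using sub fin by (rule finite_subset)
  have "card {p. lcm (fst p) (snd p) = n} \<le> card ({k. k dvd n} \<times> {k. k dvd n})"
    using fin sub by (rule card_mono)
  then have "real (card {p. lcm (fst p) (snd p) = n}) \<le> real (card {k. k dvd n}) * real (card {k. k dvd n})"
    by (simp add: card_cartesian_product flip: of_nat_mult)
  also have "\<dots> \<le> T * T" using card_divisors_le[OF assms] by (intro mult_mono) auto
  finally show "real (card {p. lcm (fst p) (snd p) = n}) \<le> T^2" by (simp add: power2_eq_square)
qed

text \<open>Collapses \<open>(m, l)\<close> to the product \<open>m * l < 4 * M * L\<close>, which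
  has at most \<open>T\<close> preimages and lies in one residue class modulo
  \<open>r\<close>.\<close>

lemma typeII_diagonal_count:
  assumes "1 \<le> r" "1 \<le> M" "1 \<le> L" "real (M * L) \<le> x"
  shows "real (card {p \<in> {M..<2*M} \<times> {L..<2*L}. [int (fst p * snd p) = b] (mod int r)}) \<le> T * (4 * x / real r + 1)"
proof -
  let ?X = "{p \<in> {M..<2*M} \<times> {L..<2*L}. [int (fst p * snd p) = b] (mod int r)}"
  let ?Y = "{n \<in> {1..4*(M*L)}. [int n = b] (mod int r)}"
  have V: "real (4*(M*L)) \<le> x ^ 12"
  proof -
    have "real (4*(M*L)) \<le> x * x" using assms x_ge by (simp add: mult_mono)
    also have "\<dots> \<le> x ^ 12" using x_ge power_increasing[of 2 12 x] by (simp add: power2_eq_square)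
    finally show ?thesis .
  qed
  have "real (card ?X) \<le> T * real (card ?Y)"
  proof (rule card_fiber_le[where \<Phi> = "\<lambda>p. fst p * snd p"])
    show "(\<lambda>p. fst p * snd p) ` ?X \<subseteq> ?Y"
    proof (rule image_subsetI)
      fix p assume p: "p \<in> ?X"
      obtain m l where ml: "p = (m, l)" by (cases p)
      have m: "(m, l) \<in> {M..<2*M} \<times> {L..<2*L}" and c: "[int (m * l) = b] (mod int r)" using p ml by auto
      have "m * l \<le> (2 * M) * (2 * L)" using m by (intro mult_le_mono) auto
      moreover have "1 * 1 \<le> m * l" using m assms by (intro mult_le_mono) auto
      ultimately show "fst p * snd p \<in> ?Y" using c ml by (simp add: mult_ac)
    qed
    fix z assume z: "z \<in> ?Y"
    have "card {p \<in> ?X. fst p * snd p = z} = card (fst ` {p \<in> ?X. fst p * snd p = z})"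
      using assms by (intro card_image[symmetric]) (auto simp: inj_on_def)
    also have "\<dots> \<le> card {k. k dvd z}" using z by (intro card_mono finite_divisors_nat) auto
    also have "real \<dots> \<le> T" using z V by (intro card_divisors_le) (auto intro: order_trans[of _ "real (4*(M*L))"] simp del: of_nat_mult)
    finally show "real (card {p \<in> ?X. fst p * snd p = z}) \<le> T" by simp
  qed auto
  also have "\<dots> \<le> T * (4 * x / real r + 1)"
  proof (intro mult_left_mono)
    have "real (card ?Y) \<le> real (4*(M*L) div r) + 1"
      using card_residue_class_le[OF assms(1), of "4*(M*L)" b] by linarith
    also have "real (4*(M*L) div r) \<le> real (4*(M*L)) / real r" by (rule of_nat_div_le_of_nat_divide)
    also have "\<dots> \<le> 4 * x / real r" using assms by (intro divide_right_mono) auto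
    finally show "real (card ?Y) \<le> 4 * x / real r + 1" by simp
  qed (use T_pos in auto)
  finally show ?thesis .
qed

text \<open>The dyadic size is imposed on \<open>lcm s1 s2\<close> rather than on \<open>s1\<close>
  and \<open>s2\<close>, because the lcm fixes the modulus \<open>h * lcm s1 s2\<close> and hence
  the length of the progressions in \<open>m\<close>.\<close>

definition "off_tuples K0 H S Smax L =
  {t :: nat \<times> nat \<times> (nat \<times> nat) \<times> (nat \<times> nat). case t of (k, h, (s1, s2), (l1, l2)) \<Rightarrow>
     k \<in> {1..K0} \<and> h \<in> {H..<2*H} \<and> s1 \<in> {1..Smax} \<and> s2 \<in> {1..Smax} \<and> lcm s1 s2 \<in> {S..<2*S} \<and>
     l1 \<in> {L..<2*L} \<and> l2 \<in> {L..<2*L} \<and> l1 \<noteq> l2 \<and> int h dvd int l1 - int l2}"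

lemma finite_off_tuples: "finite (off_tuples K0 H S Smax L)"
proof (rule finite_subset)
  show "off_tuples K0 H S Smax L \<subseteq> {1..K0} \<times> {H..<2*H} \<times> ({1..Smax} \<times> {1..Smax}) \<times> ({L..<2*L} \<times> {L..<2*L})"
    by (auto simp: off_tuples_def)
qed auto

text \<open>With \<open>r = h * s\<close>, \<open>s = lcm s1 s2\<close> and \<open>h * f = \<bar>l1 - l2\<bar>\<close> one has
  \<open>\<bar>k * (l1\<^sup>2 - l2\<^sup>2) * r\<^sup>2\<bar> = k * f * g * h ^ 3 * s\<^sup>2\<close>, so this tuple determines the phase up to sign. The sum of
  the two truncated differences is \<open>\<bar>l1 - l2\<bar>\<close>.\<close>

definition "off_phase = (\<lambda>(k, h, (s1, s2), (l1, l2)).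
   (k, h, lcm s1 s2, ((l1 - l2) + (l2 - l1)) div h, l1 + l2))" for k h s1 s2 l1 l2 :: nat

text \<open>\<open>f \<le> L div H\<close> because \<open>\<bar>l1 - l2\<bar> < L\<close> is a
  multiple of \<open>h \<ge> H\<close>, and \<open>g = l1 + l2 < 4 * L\<close>.\<close>

definition "off_box K0 H S L = {1..K0} \<times> {H..<2*H} \<times> {S..<2*S} \<times> {1..L div H} \<times> {1..4*L}"

lemma off_phase_in_box:
  assumes "t \<in> off_tuples K0 H S Smax L" "1 \<le> H" "1 \<le> L"
  shows "off_phase t \<in> off_box K0 H S L"
    and "off_phase t = (k, h, s, f, g) \<Longrightarrow> t = (k', h', (s1, s2), (l1, l2)) \<Longrightarrow>
       (l1 - l2) + (l2 - l1) = f * h \<and> l1 + l2 = g \<and> lcm s1 s2 = s \<and> k' = k \<and> h' = h"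
proof -
  obtain k h s1 s2 l1 l2 where t: "t = (k, h, (s1, s2), (l1, l2))" by (metis prod.exhaust)
  let ?d = "(l1 - l2) + (l2 - l1)"
  have d: "h dvd ?d" "0 < ?d" "?d < L" "H \<le> h"
  proof -
    have "int h dvd int l1 - int l2" using assms(1) t by (simp add: off_tuples_def)
    then have "int h dvd \<bar>int l1 - int l2\<bar>" by simp
    moreover have "\<bar>int l1 - int l2\<bar> = int ?d" by simp
    ultimately show "h dvd ?d" by (simp only: int_dvd_int_iff)
  qed (use assms(1) t in \<open>auto simp: off_tuples_def\<close>)
  have "?d div h \<le> L div h" using d by (intro div_le_mono) auto
  also have "\<dots> \<le> L div H" using d assms by (intro div_le_mono2) auto
  finally have "?d div h \<le> L div H" .
  moreover have "1 \<le> ?d div h" using d by (metis One_nat_def Suc_leI dvd_div_eq_0_iff gr0I neq0_conv)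
  ultimately show "off_phase t \<in> off_box K0 H S L"
    using assms(1,3) unfolding t by (auto simp: off_phase_def off_box_def off_tuples_def)
  show "off_phase t = (k', h', s, f, g) \<Longrightarrow> t = (k'', h'', (s1', s2'), (l1', l2')) \<Longrightarrow>
       (l1' - l2') + (l2' - l1') = f * h' \<and> l1' + l2' = g \<and> lcm s1' s2' = s \<and> k'' = k' \<and> h'' = h'" for k' h' s f g k'' h'' s1' s2' l1' l2'
    using d t by (auto simp: off_phase_def)
qed

text \<open>\<open>f * h\<close> and \<open>g\<close> recover \<open>l1\<close> and
  \<open>l2\<close> as \<open>(g + f * h) / 2\<close> and \<open>(g - f * h) / 2\<close> up to their
  order, whence the 2; \<open>s1\<close> and \<open>s2\<close> both divide the lcm, whence
  \<open>T^2\<close>.\<close>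

lemma off_phase_fiber:
  assumes "1 \<le> H" "1 \<le> L" "1 \<le> S" "real (2*S) \<le> x ^ 12" "z \<in> off_box K0 H S L"
  shows "real (card {t \<in> off_tuples K0 H S Smax L. off_phase t = z}) \<le> 2 * T^2"
proof -
  obtain k h s f g where z: "z = (k, h, s, f, g)" by (metis prod.exhaust)
  have s: "0 < s" "real s \<le> x ^ 12"
  proof -
    have "s < 2 * S" using assms z by (simp add: off_box_def)
    then have "real s \<le> real (2 * S)" by simp
    then show "real s \<le> x ^ 12" using assms by linarith
  qed (use assms z in \<open>simp add: off_box_def\<close>)
  let ?P = "{((g + f*h) div 2, (g - f*h) div 2), ((g - f*h) div 2, (g + f*h) div 2)}"
  have sub: "{t \<in> off_tuples K0 H S Smax L. off_phase t = z} \<subseteq> {k} \<times> {h} \<times> {p. lcm (fst p) (snd p) = s} \<times> ?P"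
  proof (rule subsetI)
    fix t assume tt: "t \<in> {t \<in> off_tuples K0 H S Smax L. off_phase t = z}"
    obtain k' h' s1 s2 l1 l2 where teq: "t = (k', h', (s1, s2), (l1, l2))" by (metis prod.exhaust)
    have t: "(k', h', (s1, s2), (l1, l2)) \<in> off_tuples K0 H S Smax L" and e: "off_phase (k', h', (s1, s2), (l1, l2)) = z"
      using tt teq by auto
    have *: "(l1 - l2) + (l2 - l1) = f * h" "l1 + l2 = g" "lcm s1 s2 = s" "k' = k" "h' = h"
      using off_phase_in_box(2)[OF t assms(1,2) e[unfolded z] refl] by auto
    have "(l1, l2) \<in> ?P"
    proof (cases "l1 \<le> l2")
      case True
      then have "g + f*h = 2 * l2" "g - f*h = 2 * l1" using * by linarith+
      then show ?thesis by simp
    next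
      case False
      then have "g + f*h = 2 * l1" "g - f*h = 2 * l2" using * by linarith+
      then show ?thesis by simp
    qed
    then show "t \<in> {k} \<times> {h} \<times> {p. lcm (fst p) (snd p) = s} \<times> ?P" using * teq by simp
  qed
  have fin: "finite ({k} \<times> {h} \<times> {p. lcm (fst p) (snd p) = s} \<times> ?P)" using card_lcm_fiber(2)[OF s] by simp
  have "card {t \<in> off_tuples K0 H S Smax L. off_phase t = z} \<le> card ({k} \<times> {h} \<times> {p. lcm (fst p) (snd p) = s} \<times> ?P)"
    using fin sub by (rule card_mono)
  also have "\<dots> = card {p. lcm (fst p) (snd p) = s} * card ?P" by (simp only: card_cartesian_product) simp
  also have "\<dots> \<le> card {p. lcm (fst p) (snd p) = s} * 2"
    by (intro mult_le_mono2 card_insert_le_m1) simp_all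
  finally have "real (card {t \<in> off_tuples K0 H S Smax L. off_phase t = z}) \<le> real (card {p. lcm (fst p) (snd p) = s} * 2)"
    by (rule of_nat_mono)
  then show ?thesis using card_lcm_fiber(1)[OF s] by simp
qed

end

section \<open>Off-diagonal pairs\<close>

context minor_arc
begin

definition "window M lo hi b h s1 s2 l1 l2 = {m \<in> {M..<2*M}.
   (lo \<le> real (m * l1) \<and> real (m * l1) < hi \<and> [int (m * l1) = b] (mod int (h * s1))) \<and>
   (lo \<le> real (m * l2) \<and> real (m * l2) < hi \<and> [int (m * l2) = b] (mod int (h * s2)))}"

lemma window_subset: "window M lo hi b h s1 s2 l1 l2 \<subseteq> {M..<M + M}"
  by (auto simp: window_def)

lemma finite_window [simp]: "finite (window M lo hi b h s1 s2 l1 l2)"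
  using window_subset by (rule finite_subset) simp

text \<open>The quadratic Weyl bound for one inner sum, expressed through the phase tuple alone, so
  that a sum over pairs becomes a sum over \<open>off_box\<close> with bounded multiplicity.\<close>

definition "off_weight N = (\<lambda>(k, h, s, f, g). real N +
   2 * (\<Sum>u\<in>{1..N}. min_recip (real N) (\<alpha> * real (2 * k * f * g * u) * (real h)^3 * (real s)\<^sup>2)))" for N k h s f g :: nat

lemma off_weight_nonneg: "0 \<le> off_weight N z"
  by (cases z) (auto simp: off_weight_def intro!: add_nonneg_nonneg sum_nonneg mult_nonneg_nonneg)

lemma norm_sum_window_le:
  assumes t: "(k, h, (s1, s2), (l1, l2)) \<in> off_tuples K0 H S Smax L" and HL: "1 \<le> H" "1 \<le> L" "1 \<le> S"
    and cop: "coprime b (int (h * s1))" "coprime b (int (h * s2))"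
  shows "(norm (\<Sum>m\<in>window M lo hi b h s1 s2 l1 l2. e (\<alpha> * real k * ((real l1)\<^sup>2 - (real l2)\<^sup>2) * (real m)\<^sup>2)))\<^sup>2 \<le>
     off_weight (M div (H * S) + 1) (off_phase (k, h, (s1, s2), (l1, l2)))"
proof -
  let ?W = "window M lo hi b h s1 s2 l1 l2" and ?N = "M div (H * S) + 1" and ?\<gamma> = "\<alpha> * real k * ((real l1)\<^sup>2 - (real l2)\<^sup>2)"
  obtain k' h' s f g where ph: "off_phase (k, h, (s1, s2), (l1, l2)) = (k', h', s, f, g)" by (metis prod.exhaust)
  have *: "(l1 - l2) + (l2 - l1) = f * h" "l1 + l2 = g" "lcm s1 s2 = s" "k = k'" "h = h'"
    using off_phase_in_box(2)[OF t HL(1,2) ph refl] by auto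
  have hs: "H \<le> h" "S \<le> s" using t * by (auto simp: off_tuples_def)
  define r where "r = h * s"
  have r: "1 \<le> r" "H * S \<le> r" using hs HL by (auto simp: r_def intro: mult_le_mono)
  have nle: "(norm (\<Sum>m\<in>?W. e (?\<gamma> * (real m)\<^sup>2)))\<^sup>2 \<le> real ?N + 2 * (\<Sum>u\<in>{1..?N}. min_recip (real ?N) (2 * ?\<gamma> * (real r)\<^sup>2 * real u))"
  proof (rule norm_sum_e_square_progression[OF window_subset r(1)])
    show "[m = n] (mod r)" if "m \<in> ?W" "n \<in> ?W" for m n
      using that cop double_congruence_unique[of b h s1 s2 m l1 l2 n] by (simp add: window_def r_def *)
    show "j \<in> ?W" if m: "m \<in> ?W" and n: "n \<in> ?W" and le: "m \<le> j" "j \<le> n" and c: "[j = m] (mod r)" for m n j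
    proof -
      have cr: "[int (j * l) = b] (mod int (h * d))" if "d dvd s" "[int (m * l) = b] (mod int (h * d))" for d l
      proof -
        have "[j = m] (mod (h * d))" using c that(1) by (auto simp: r_def intro: cong_dvd_modulus_nat)
        then have "[j * l = m * l] (mod (h * d))" by (intro cong_mult) auto
        then have "[int (j * l) = int (m * l)] (mod int (h * d))" by (simp only: cong_int_iff)
        then show ?thesis using that(2) cong_trans by blast
      qed
      have w: "lo \<le> real (j * l) \<and> real (j * l) < hi" if "lo \<le> real (m * l)" "real (n * l) < hi" for l
      proof -
        have "real (m * l) \<le> real (j * l)" "real (j * l) \<le> real (n * l)" using le by (simp_all add: mult_right_mono)
        then show ?thesis using that by linarith
      qed
      have "s1 dvd s" "s2 dvd s" using *(3) by auto
      then show ?thesis using m n le cr w by (auto simp: window_def)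
    qed
    have "M div r \<le> M div (H * S)" using r HL by (intro div_le_mono2) auto
    then show "M div r + 1 \<le> ?N" by simp
  qed
  have ueq: "min_recip (real ?N) (2 * ?\<gamma> * (real r)\<^sup>2 * real u) = min_recip (real ?N) (\<alpha> * real (2 * k' * f * g * u) * (real h')^3 * (real s)\<^sup>2)" for u
  proof -
    have "real (f * h) = \<bar>real l1 - real l2\<bar>" unfolding *(1)[symmetric] by (cases "l1 \<le> l2") (auto simp: of_nat_diff)
    then have "real l1 - real l2 = real (f * h) \<or> real l1 - real l2 = - real (f * h)" by linarith
    moreover have "(real l1)\<^sup>2 - (real l2)\<^sup>2 = (real l1 - real l2) * real g"
      unfolding *(2)[symmetric] by (simp add: power2_eq_square algebra_simps)
    ultimately have D: "(real l1)\<^sup>2 - (real l2)\<^sup>2 = real (f * h) * real g \<or> (real l1)\<^sup>2 - (real l2)\<^sup>2 = - (real (f * h) * real g)"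
      by auto
    let ?c = "\<alpha> * real (2 * k' * f * g * u) * (real h')^3 * (real s)\<^sup>2"
    have c: "2 * (\<alpha> * real k * (real (f * h) * real g)) * (real r)\<^sup>2 * real u = ?c"
      using *(4,5) by (simp add: r_def eval_nat_numeral mult_ac)
    have "2 * ?\<gamma> * (real r)\<^sup>2 * real u = ?c \<or> 2 * ?\<gamma> * (real r)\<^sup>2 * real u = - ?c"
      using D unfolding c[symmetric] by (elim disjE) simp_all
    then show ?thesis by (elim disjE) (simp_all only: min_recip_minus)
  qed
  show ?thesis using nle unfolding ph off_weight_def prod.case ueq .
qed

text \<open>\<open>2 * k * f * g * u\<close> becomes one variable \<open>j\<close>; the 8 in its
  range is the differencing factor 2 times the 4 in \<open>g \<le> 4 * L\<close>.\<close>

lemma sum_off_box_le: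
  fixes H S L K0 N :: nat
  assumes "1 \<le> H" "1 \<le> N" "1 \<le> L" and J: "real (8 * K0 * (L div H) * L * N) \<le> x ^ 12"
  shows "(\<Sum>z\<in>off_box K0 H S L. off_weight N z) \<le>
    real (K0 * H * S * (L div H) * (4 * L)) * real N + 2 * T^3 * phase_sum (8 * K0 * (L div H) * L * N) N H S"
proof -
  let ?F = "L div H"
  let ?G = "\<lambda>h s j. min_recip (real N) (\<alpha> * real j * (real h)^3 * (real s)\<^sup>2)"
  have "(\<Sum>z\<in>off_box K0 H S L. off_weight N z) =
    (\<Sum>k\<in>{1..K0}. \<Sum>h\<in>{H..<2*H}. \<Sum>s\<in>{S..<2*S}. \<Sum>f\<in>{1..?F}. \<Sum>g\<in>{1..4*L}.
       real N + 2 * (\<Sum>u\<in>{1..N}. ?G h s (2 * (k * f * g * u))))"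
    unfolding off_box_def by (simp only: sum.cartesian_product' fst_conv snd_conv off_weight_def prod.case mult.assoc)
  also have "\<dots> = real (K0 * H * S * ?F * (4 * L)) * real N +
     2 * (\<Sum>k\<in>{1..K0}. \<Sum>h\<in>{H..<2*H}. \<Sum>s\<in>{S..<2*S}. \<Sum>f\<in>{1..?F}. \<Sum>g\<in>{1..4*L}. \<Sum>u\<in>{1..N}. ?G h s (2 * (k * f * g * u)))"
    by (simp only: sum.distrib sum_distrib_left sum_constant card_atLeastAtMost card_atLeastLessThan) (simp add: mult_ac)
  finally have split: "(\<Sum>z\<in>off_box K0 H S L. off_weight N z) = \<dots>" .
  have "(\<Sum>k\<in>{1..K0}. \<Sum>h\<in>{H..<2*H}. \<Sum>s\<in>{S..<2*S}. \<Sum>f\<in>{1..?F}. \<Sum>g\<in>{1..4*L}. \<Sum>u\<in>{1..N}. ?G h s (2 * (k * f * g * u)))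
     = (\<Sum>h\<in>{H..<2*H}. \<Sum>s\<in>{S..<2*S}. \<Sum>k\<in>{1..K0}. \<Sum>f\<in>{1..?F}. \<Sum>g\<in>{1..4*L}. \<Sum>u\<in>{1..N}. ?G h s (2 * (k * f * g * u)))"
    by (rule sum_rotate)
  also have "\<dots> \<le> (\<Sum>h\<in>{H..<2*H}. \<Sum>s\<in>{S..<2*S}. T^3 * (\<Sum>v\<in>{1..8 * K0 * ?F * L * N}. ?G h s v))"
  proof (intro sum_mono)
    fix h s
    have "real (K0 * ?F * (4 * L) * N) \<le> real (8 * K0 * ?F * L * N)" by (intro of_nat_mono) simp
    then have le: "real (K0 * ?F * (4 * L) * N) \<le> x ^ 12" using J by linarith
    have "(\<Sum>k\<in>{1..K0}. \<Sum>f\<in>{1..?F}. \<Sum>g\<in>{1..4*L}. \<Sum>u\<in>{1..N}. ?G h s (2 * (k * f * g * u))) \<le>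
       T^3 * (\<Sum>v\<in>{1..K0 * ?F * (4 * L) * N}. ?G h s (2 * v))"
      using assms by (intro sum_product4_le le) auto
    also have "(\<Sum>v\<in>{1..K0 * ?F * (4 * L) * N}. ?G h s (2 * v)) = (\<Sum>v\<in>(\<lambda>v. 2 * v) ` {1..K0 * ?F * (4 * L) * N}. ?G h s v)"
      by (subst sum.reindex) (auto simp: inj_on_def)
    \<comment> \<open>Only even \<open>v\<close> occur so far; the odd ones are added by
      positivity.\<close>
    also have "\<dots> \<le> (\<Sum>v\<in>{1..8 * K0 * ?F * L * N}. ?G h s v)"
    proof (intro sum_mono2)
      show "(\<lambda>v. 2 * v) ` {1..K0 * ?F * (4 * L) * N} \<subseteq> {1..8 * K0 * ?F * L * N}"
      proof (rule image_subsetI)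
        fix v assume "v \<in> {1..K0 * ?F * (4 * L) * N}"
        moreover have "2 * (K0 * ?F * (4 * L) * N) = 8 * K0 * ?F * L * N" by simp
        ultimately show "2 * v \<in> {1..8 * K0 * ?F * L * N}" by (metis One_nat_def Suc_leI atLeastAtMost_iff mult_le_mono2 nat_0_less_mult_iff zero_less_numeral Suc_le_lessD)
      qed
    qed auto
    finally show "(\<Sum>k\<in>{1..K0}. \<Sum>f\<in>{1..?F}. \<Sum>g\<in>{1..4*L}. \<Sum>u\<in>{1..N}. ?G h s (2 * (k * f * g * u))) \<le>
       T^3 * (\<Sum>v\<in>{1..8 * K0 * ?F * L * N}. ?G h s v)" using T_pos by (simp add: mult_left_mono)
  qed
  also have "\<dots> = T^3 * phase_sum (8 * K0 * ?F * L * N) N H S"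
    unfolding phase_sum_def by (subst sum_rotate) (simp only: sum_distrib_left)
  finally show ?thesis unfolding split by (simp only: mult.assoc add_le_cancel_left mult_le_cancel_left_pos zero_less_numeral)
qed

text \<open>Cauchy-Schwarz over the tuples leads to squared inner sums, bounded on average by
  \<open>phase_sum\<close>. Up to powers of \<open>T\<close> there are at most
  \<open>K * S * L^2\<close> tuples, and on average an inner sum saves \<open>sqrt \<omega>\<close>
  against its length, about \<open>M / (H * S)\<close>.\<close>

lemma off_diagonal:
  fixes H S L M Smax K0 :: nat
  assumes pos: "1 \<le> H" "1 \<le> S" "1 \<le> L" "1 \<le> M" "1 \<le> K0" and K0: "real K0 \<le> K" "K \<le> 2 * real K0"
    and prodML: "real (M * L) \<le> x" "x \<le> 8 * real (M * L)"
    and HS: "real (H * S) * y \<le> T * real M"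
    and \<kappa>: "\<kappa> * y^16 \<le> 1"
    and good: "real S \<le> y^6 \<or> real H \<le> y^4 \<or> y^16 \<le> 4 * real H * real S"
    and X: "X \<subseteq> off_tuples K0 H S Smax L"
    and cop: "\<And>k h s1 s2 l1 l2. (k, h, (s1, s2), (l1, l2)) \<in> X \<Longrightarrow> coprime b (int (h * s1)) \<and> coprime b (int (h * s2))"
  shows "(\<Sum>(k, h, (s1, s2), (l1, l2))\<in>X.
      norm (\<Sum>m\<in>window M lo hi b h s1 s2 l1 l2. e (\<alpha> * real k * ((real l1)\<^sup>2 - (real l2)\<^sup>2) * (real m)\<^sup>2)))
    \<le> T^10 * K * (real L)\<^sup>2 * real M / real H * sqrt \<omega>"
proof (cases "X = {}")
  case True
  then show ?thesis using T_pos K_ge \<omega>_pos by simp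
next
  case False
  let ?V = "\<lambda>(k, h, (s1, s2), (l1, l2)). norm (\<Sum>m\<in>window M lo hi b h s1 s2 l1 l2. e (\<alpha> * real k * ((real l1)\<^sup>2 - (real l2)\<^sup>2) * (real m)\<^sup>2))"
  define N where "N = M div (H * S) + 1"
  define F where "F = L div H"
  define J where "J = 8 * K0 * F * L * N"
  define B where "B = real (K0 * H * S * F * (4 * L))"
  have B0: "0 \<le> B" by (simp add: B_def)
  have finX: "finite X" using X finite_off_tuples by (rule finite_subset)
  \<comment> \<open>A tuple in \<open>X\<close> has distinct \<open>l1\<close>, \<open>l2\<close>
    whose difference, below \<open>L\<close>, is a multiple of \<open>h \<ge> H\<close>.\<close>
  have F1: "1 \<le> F"
  proof -
    obtain t where "t \<in> X" using False by blast
    then have "off_phase t \<in> off_box K0 H S L" using X pos by (intro off_phase_in_box(1)) auto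
    then show ?thesis by (auto simp: off_box_def F_def)
  qed
  have HSn: "1 \<le> H * S" using pos by simp
  have N1: "1 \<le> N" by (simp add: N_def)
  have NHS: "N * (H * S) \<le> M + H * S" "M \<le> N * (H * S)"
  proof -
    have "M = M div (H*S) * (H*S) + M mod (H*S)" by (rule div_mult_mod_eq[symmetric])
    moreover have "M mod (H*S) < H*S" using HSn by (intro mod_less_divisor) simp
    ultimately show "N * (H * S) \<le> M + H * S" "M \<le> N * (H * S)" by (simp_all add: N_def add_mult_distrib)
  qed
  have HSM: "real (H * S) \<le> T * real M"
    using HS y_ge mult_left_mono[of 1 y "real (H * S)"] by simp
  have NHS': "real (N * (H * S)) \<le> 2 * T * real M"
  proof -
    have "real (N * (H * S)) \<le> real (M + H * S)" using NHS(1) by (rule of_nat_mono)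
    also have "\<dots> \<le> T * real M + T * real M" using HSM T_pos mult_right_mono[of 1 T "real M"] by simp
    finally show ?thesis by simp
  qed
  have FH: "real (F * H) \<le> real L" "real L \<le> 2 * real (F * H)"
  proof -
    have "L = F * H + L mod H" by (simp add: F_def)
    moreover have "L mod H < H" using pos by simp
    moreover have "H \<le> F * H" using F1 by simp
    ultimately have "F * H \<le> L" "L \<le> 2 * (F * H)" by linarith+
    then show "real (F * H) \<le> real L" "real L \<le> 2 * real (F * H)" by linarith+
  qed
  \<comment> \<open>The balance behind \<open>admissible\<close>: \<open>F * H\<close> is near
    \<open>L\<close> and \<open>N * (H * S)\<close> near \<open>M\<close> up to powers of
    \<open>T\<close>, so the product is near \<open>K * (M * L)^2\<close> and thus near
    \<open>Q\<close>.\<close>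
  have prod_eq: "J * N * H^3 * S^2 = 8 * K0 * L * (F * H) * (N * (H * S))^2"
    by (simp add: J_def eval_nat_numeral mult_ac)
  have le1: "real M \<le> x" "real L \<le> x" 
  proof -
    have "M * 1 \<le> M * L" "1 * L \<le> M * L" using pos by (intro mult_le_mono; simp)+
    then have "real M \<le> real (M * L)" "real L \<le> real (M * L)" by (intro of_nat_mono; simp)+
    then show "real M \<le> x" "real L \<le> x" using prodML by linarith+
  qed
  have upper: "real (J * N * H^3 * S^2) \<le> x ^ 12"
  proof -
    have "real (J * N * H^3 * S^2) = 8 * real K0 * real L * real (F * H) * (real (N * (H * S)))^2"
      unfolding prod_eq by simp
    also have "\<dots> \<le> 8 * x * real L * real L * (2 * T * real M)^2"
      using K0 K_le FH NHS' x_ge by (intro mult_mono power_mono) auto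
    also have "\<dots> = 32 * x * T^2 * (real (M * L))\<^sup>2" by (simp add: power2_eq_square)
    also have "\<dots> \<le> x^2 * x * x^2 * x\<^sup>2"
    proof -
      have "32 \<le> 12 * x" using x_ge by simp
      also have "\<dots> \<le> x^2" using x_ge by (simp add: power2_eq_square)
      finally have "32 \<le> x^2" .
      then show ?thesis using prodML x_ge T_le T_pos by (intro mult_mono power_mono) auto
    qed
    also have "\<dots> = x^7" by (simp add: eval_nat_numeral)
    also have "\<dots> \<le> x^12" using x_ge by (intro power_increasing) auto
    finally show ?thesis .
  qed
  have adm: "admissible J N H S"
    unfolding admissible_def
  proof (intro conjI)
    have "1 * N \<le> (8 * K0 * F * L) * N" using pos F1 by (intro mult_le_mono1) auto
    then show "N \<le> J" by (simp add: J_def)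
    show "Q \<le> T * real (J * N * H^3 * S^2)"
    proof -
      have "Q = K * x\<^sup>2" by (simp add: Q_def)
      also have "\<dots> \<le> (2 * real K0) * (8 * real (M * L))\<^sup>2" using K0 prodML x_ge by (intro mult_mono power_mono) auto
      also have "\<dots> = 128 * (real K0 * real L * real L * (real M)^2)" by (simp add: power2_eq_square)
      also have "\<dots> \<le> 128 * (real K0 * real L * (2 * real (F * H)) * (real (N * (H * S)))^2)"
        using FH NHS(2) by (intro mult_left_mono mult_mono power_mono of_nat_mono) auto
      also have "\<dots> = 32 * real (J * N * H^3 * S^2)" unfolding prod_eq by simp
      also have "\<dots> \<le> T * real (J * N * H^3 * S^2)" using T_ge by (intro mult_right_mono) auto
      finally show ?thesis .
    qed
  qed (use pos N1 upper in auto)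
  have Jx: "real J \<le> x ^ 12"
    using adm pos N1 by (intro admissible_factor[OF adm, of "N * H^3 * S^2"]) (auto simp: mult_ac)
  have S2: "real (2 * S) \<le> x ^ 12"
  proof (rule admissible_bound[OF adm])
    have "1 * 1 * 1 * (2 * S) \<le> (4 * K0 * F * L * N) * N * H^3 * (2 * S^2)"
      using pos F1 N1 by (intro mult_le_mono) (auto simp: power2_eq_square)
    then show "2 * S \<le> J * N * H ^ 3 * S\<^sup>2" by (simp add: J_def mult_ac)
  qed
  have fib: "\<And>z. z \<in> off_box K0 H S L \<Longrightarrow> real (card {t \<in> X. off_phase t = z}) \<le> 2 * T^2"
  proof -
    fix z assume z: "z \<in> off_box K0 H S L"
    have "card {t \<in> X. off_phase t = z} \<le> card {t \<in> off_tuples K0 H S Smax L. off_phase t = z}"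
      using X finite_off_tuples by (intro card_mono) auto
    then show "real (card {t \<in> X. off_phase t = z}) \<le> 2 * T^2"
      using off_phase_fiber[OF pos(1,3,2) S2 z, of Smax] by linarith
  qed
  have fb: "finite (off_box K0 H S L)" by (simp add: off_box_def)
  have img: "off_phase ` X \<subseteq> off_box K0 H S L" using X off_phase_in_box(1) pos by blast
  have cardbox: "real (card (off_box K0 H S L)) = B"
    by (simp add: off_box_def card_cartesian_product B_def F_def)
  have cX: "real (card X) \<le> 2 * T^2 * B"
    using card_fiber_le[OF finX fb img fib] cardbox by simp
  have JB: "real J * real N * real H * real S = 2 * B * (real N)\<^sup>2"
    by (simp add: J_def B_def power2_eq_square)
  \<comment> \<open>\<open>H * S * y \<le> T * M\<close> makes \<open>N\<close> at least
    \<open>y / T\<close>, so that \<open>1 / N\<close> is absorbed by the \<open>1 / y\<close> in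
    \<open>\<omega>\<close>.\<close>
  have "1 / real N \<le> T * \<omega>"
  proof -
    have "real M \<le> real (N * (H * S))" using NHS(2) by (rule of_nat_mono)
    then have "y * (real M) \<le> y * (real N * real (H * S))" using y_ge by (intro mult_left_mono) auto
    also have "\<dots> = real N * (real (H * S) * y)" by simp
    also have "\<dots> \<le> real N * (T * real M)" using HS by (intro mult_left_mono) auto
    finally have "y \<le> real N * T" using pos by simp
    then have "1 / real N \<le> T * (1 / y)" using N1 y_ge by (simp add: field_simps)
    also have "\<dots> \<le> T * \<omega>" using T_pos y_ge \<kappa>_pos by (intro mult_left_mono) (auto simp: \<omega>_def)
    finally show ?thesis .
  qed
  moreover have "1 * \<omega> \<le> T * \<omega>" using T_pos \<omega>_pos by (intro mult_right_mono) auto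
  ultimately have wN: "\<omega> + 1 / real N \<le> 2 * T * \<omega>" by linarith
  have V2: "(\<Sum>t\<in>X. (?V t)\<^sup>2) \<le> T^11 * (B * (real N)\<^sup>2 * (\<omega> + 1 / real N))"
  proof -
    have "(\<Sum>t\<in>X. (?V t)\<^sup>2) \<le> (\<Sum>t\<in>X. off_weight N (off_phase t))"
    proof (intro sum_mono)
      fix t assume t: "t \<in> X"
      obtain k h s1 s2 l1 l2 where teq: "t = (k, h, (s1, s2), (l1, l2))" by (metis prod.exhaust)
      show "(?V t)\<^sup>2 \<le> off_weight N (off_phase t)"
        using norm_sum_window_le[of k h s1 s2 l1 l2 K0 H S Smax L b M lo hi] t X cop[of k h s1 s2 l1 l2] pos
        unfolding teq N_def by auto
    qed
    also have "\<dots> \<le> 2 * T^2 * (\<Sum>z\<in>off_box K0 H S L. off_weight N z)"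
      using finX fb img fib off_weight_nonneg by (intro sum_fiber_le) auto
    also have "\<dots> \<le> 2 * T^2 * (B * real N + 2 * T^3 * phase_sum J N H S)"
      using sum_off_box_le[of H N L K0 S] pos N1 Jx T_pos unfolding B_def J_def F_def by (intro mult_left_mono) auto
    also have "\<dots> \<le> 2 * T^2 * (T^8 * (B * (real N)\<^sup>2 * (\<omega> + 1 / real N)) + 4 * (T^8 * (B * (real N)\<^sup>2 * (\<omega> + 1 / real N))))"
    proof (intro mult_left_mono add_mono)
      have "B * real N = B * (real N)\<^sup>2 * (1 / real N)" using N1 by (simp add: power2_eq_square)
      also have "\<dots> \<le> B * (real N)\<^sup>2 * (\<omega> + 1 / real N)" using \<omega>_pos B0 by (intro mult_left_mono) auto
      also have "\<dots> \<le> T^8 * (B * (real N)\<^sup>2 * (\<omega> + 1 / real N))" using \<omega>_pos B0 by (intro T_grow) auto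
      finally show "B * real N \<le> T^8 * (B * (real N)\<^sup>2 * (\<omega> + 1 / real N))" .
      have "2 * T^3 * phase_sum J N H S \<le> 2 * T^3 * (T^5 * (real J * real N * real H * real S) * (\<omega> + 1 / N))"
        using phase_sum_bound[OF adm \<kappa> good] T_pos unfolding \<omega>_def by (intro mult_left_mono) auto
      also have "\<dots> = 4 * (T^8 * (B * (real N)\<^sup>2 * (\<omega> + 1 / real N)))" unfolding JB by (simp add: eval_nat_numeral)
      finally show "2 * T^3 * phase_sum J N H S \<le> 4 * (T^8 * (B * (real N)\<^sup>2 * (\<omega> + 1 / real N)))" .
    qed (use T_pos in auto)
    also have "\<dots> = 10 * T^10 * (B * (real N)\<^sup>2 * (\<omega> + 1 / real N))" by (simp add: eval_nat_numeral)
    also have "\<dots> \<le> T^Suc 10 * (B * (real N)\<^sup>2 * (\<omega> + 1 / real N))" using B0 \<omega>_pos by (intro T_absorb) auto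
    finally show ?thesis by simp
  qed
  have V2': "(\<Sum>t\<in>X. (?V t)\<^sup>2) \<le> T^11 * (B * (real N)\<^sup>2 * (2 * T * \<omega>))"
  proof (rule order_trans[OF V2])
    show "T^11 * (B * (real N)\<^sup>2 * (\<omega> + 1 / real N)) \<le> T^11 * (B * (real N)\<^sup>2 * (2 * T * \<omega>))"
      using wN B0 T_pos by (intro mult_left_mono) auto
  qed
  have "(\<Sum>t\<in>X. ?V t)\<^sup>2 \<le> real (card X) * (\<Sum>t\<in>X. (?V t)\<^sup>2)" by (rule sum_squared_le_card_sum_squares)
  also have "\<dots> \<le> (2 * T^2 * B) * (T^11 * (B * (real N)\<^sup>2 * (2 * T * \<omega>)))"
    using B0 T_pos by (intro mult_mono[OF cX V2']) (auto intro: sum_nonneg)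
  also have "\<dots> = 4 * T^14 * ((B * real N)\<^sup>2 * \<omega>)" by (simp add: eval_nat_numeral)
  also have "\<dots> \<le> T^Suc 14 * ((B * real N)\<^sup>2 * \<omega>)" using \<omega>_pos by (intro T_absorb) auto
  also have "\<dots> \<le> T^16 * ((B * real N)\<^sup>2 * \<omega>)" using \<omega>_pos by (intro mult_right_mono T_power_mono) auto
  also have "\<dots> = (T^8 * (B * real N) * sqrt \<omega>)\<^sup>2" using \<omega>_pos by (simp add: power_mult_distrib flip: power_mult)
  finally have "(\<Sum>t\<in>X. ?V t) \<le> T^8 * (B * real N) * sqrt \<omega>"
    using T_pos B0 \<omega>_pos by (intro power2_le_imp_le[of "\<Sum>t\<in>X. ?V t"]) auto
  also have "\<dots> \<le> T^8 * (T^2 * (K * (real L)\<^sup>2 * real M / real H)) * sqrt \<omega>"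
  proof (intro mult_right_mono mult_left_mono)
    have "B * real N * real H = 4 * (real K0 * real L * real (F * H) * real (N * (H * S)))"
      by (simp add: B_def mult_ac)
    also have "\<dots> \<le> 4 * (K * real L * real L * (2 * T * real M))"
      using K0 FH NHS' K_ge by (intro mult_left_mono mult_mono) auto
    also have "\<dots> = 8 * T^1 * (K * (real L)\<^sup>2 * real M)" by (simp add: power2_eq_square)
    also have "\<dots> \<le> T^Suc 1 * (K * (real L)\<^sup>2 * real M)" using K_ge by (intro T_absorb) auto
    finally show "B * real N \<le> T^2 * (K * (real L)\<^sup>2 * real M / real H)"
      using pos by (simp add: field_simps eval_nat_numeral)
  qed (use T_pos \<omega>_pos in auto)
  finally show ?thesis by (simp add: case_prod_beta' power_add[symmetric] mult.assoc[symmetric])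
qed

end

lemma dyadic_exponent:
  fixes z :: nat
  assumes "1 \<le> z" "z < 2 ^ n"
  shows "\<exists>i<n. 2 ^ i \<le> z \<and> z < 2 * 2 ^ i"
  using assms
proof (induction n)
  case (Suc n)
  show ?case
  proof (cases "z < 2 ^ n")
    case True
    then show ?thesis using Suc by (meson less_SucI)
  qed (use Suc in auto)
qed simp

section \<open>Diagonal pairs and the bilinear estimate\<close>

context minor_arc
begin

definition "in_class lo hi b d n \<longleftrightarrow> lo \<le> real n \<and> real n < hi \<and> [int n = b] (mod int d)"

definition bilinear_sum :: "nat \<Rightarrow> nat \<Rightarrow> nat \<Rightarrow> nat \<Rightarrow> nat \<Rightarrow> real \<Rightarrow> real \<Rightarrow> int \<Rightarrow> (nat \<Rightarrow> complex) \<Rightarrow> (nat \<Rightarrow> nat \<Rightarrow> complex)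
    \<Rightarrow> (nat \<Rightarrow> complex) \<Rightarrow> (nat \<Rightarrow> complex) \<Rightarrow> complex" where
  "bilinear_sum K0 H Smax M L lo hi b c lam A B =
    (\<Sum>k\<in>{1..K0}. \<Sum>h\<in>{H..<2*H}. \<Sum>s\<in>{1..Smax}. \<Sum>m\<in>{M..<2*M}. \<Sum>l\<in>{L..<2*L}.
      if in_class lo hi b (h * s) (m*l) then c k * lam h s * A m * B l * e (\<alpha> * real k * (real (m*l))\<^sup>2) else 0)"

text \<open>Coefficients are replaced by the indicator of their supports. Keeping the indicator
  makes coprimality and the size of the actual moduli available for every pair that counts.\<close>

definition "pair_term lam M lo hi b = (\<lambda>(k, h, (s1, s2), (l1, l2)).
   if lam h s1 \<noteq> 0 \<and> lam h s2 \<noteq> (0::complex) then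
     norm (\<Sum>m\<in>window M lo hi b h s1 s2 l1 l2. e (\<alpha> * real k * ((real l1)\<^sup>2 - (real l2)\<^sup>2) * (real m)\<^sup>2))
   else 0)"

lemma pair_term_nonneg: "0 \<le> pair_term lam M lo hi b t"
  by (auto simp: pair_term_def split: prod.splits)

definition "pairs K0 H Smax L = {1..K0::nat} \<times> {H..<2*H::nat} \<times> ({1..Smax::nat} \<times> {1..Smax}) \<times> ({L..<2*L::nat} \<times> {L..<2*L})"

lemma finite_pairs [simp]: "finite (pairs K0 H Smax L)"
  by (simp add: pairs_def)

text \<open>For \<open>l1 = l2\<close> the phase vanishes and only counting is left: up to powers of
  \<open>T\<close> there are \<open>K * H * S\<close> choices of \<open>k, h, s1, s2\<close>, and
  each confines \<open>m * l\<close> to one class modulo \<open>h * lcm s1 s2\<close>, with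
  \<open>x / (H * S) + 1\<close> solutions.\<close>

lemma diagonal_terms:
  fixes H S L M Smax K0 :: nat
  assumes pos: "1 \<le> H" "1 \<le> S" "1 \<le> L" "1 \<le> M" and K0: "real K0 \<le> K"
    and LM: "real (M * L) \<le> x" and HS: "real (H * S) \<le> T * x"
    and S2: "real (2*S) \<le> x ^ 12"
    and X: "X \<subseteq> {t \<in> pairs K0 H Smax L. case t of (k, h, (s1, s2), (l1, l2)) \<Rightarrow> l1 = l2 \<and> lcm s1 s2 \<in> {S..<2*S}}"
  shows "(\<Sum>t\<in>X. pair_term lam M lo hi b t) \<le> T^5 * K * x"
proof -
  define R where "R = {p \<in> {1..Smax} \<times> {1..Smax}. lcm (fst p) (snd p) \<in> {S..<2*S}}"
  let ?Z = "{1..K0} \<times> {H..<2*H} \<times> R \<times> {L..<2*L}"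
  let ?\<phi> = "\<lambda>(k::nat, h::nat, p::nat\<times>nat, l::nat). (k, h, p, (l, l))"
  have finR: "finite R" by (simp add: R_def)
  have inj: "inj_on ?\<phi> ?Z" by (auto simp: inj_on_def)
  have sub: "X \<subseteq> ?\<phi> ` ?Z"
  proof
    fix t assume t: "t \<in> X"
    obtain k h s1 s2 l1 l2 where teq: "t = (k, h, (s1, s2), (l1, l2))" by (metis prod.exhaust)
    have "t \<in> pairs K0 H Smax L" "l1 = l2" "lcm s1 s2 \<in> {S..<2*S}" using subsetD[OF X t] unfolding teq by auto
    then show "t \<in> ?\<phi> ` ?Z" unfolding teq pairs_def R_def by (intro image_eqI[of _ _ "(k, h, (s1, s2), l1)"]) auto
  qed
  have cR: "real (card R) \<le> T^2 * real S"
  proof -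
    have "real (card R) \<le> T^2 * real (card {S..<2*S})"
    proof (rule card_fiber_le[OF finR, where \<Phi> = "\<lambda>p. lcm (fst p) (snd p)"])
      fix z assume z: "z \<in> {S..<2*S}"
      have z': "0 < z" "real z \<le> x ^ 12"
      proof -
        have "real z \<le> real (2 * S)" using z by simp
        then show "real z \<le> x ^ 12" using S2 by linarith
      qed (use z pos in simp)
      have "card {p \<in> R. lcm (fst p) (snd p) = z} \<le> card {p. lcm (fst p) (snd p) = z}"
        using card_lcm_fiber(2)[OF z'] by (intro card_mono) auto
      then show "real (card {p \<in> R. lcm (fst p) (snd p) = z}) \<le> T^2" using card_lcm_fiber(1)[OF z'] by linarith
    qed (auto simp: R_def)
    then show ?thesis by simp
  qed
  have inner: "(\<Sum>l\<in>{L..<2*L}. pair_term lam M lo hi b (k, h, p, (l, l))) \<le> T * (4 * x / real (H * S) + 1)"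
    if h: "h \<in> {H..<2*H}" and p: "p \<in> R" for k h p
  proof -
    obtain s1 s2 where ps: "p = (s1, s2)" by (cases p)
    define r where "r = h * lcm s1 s2"
    have "H * S \<le> h * lcm s1 s2" using h p ps by (intro mult_le_mono) (auto simp: R_def)
    then have r: "H * S \<le> r" by (simp add: r_def)
    have r1: "1 \<le> r" using r pos by (metis One_nat_def Suc_leI mult_pos_pos order_less_le_trans Suc_le_eq)
    let ?C = "{q \<in> {M..<2*M} \<times> {L..<2*L}. [int (fst q * snd q) = b] (mod int r)}"
    have "(\<Sum>l\<in>{L..<2*L}. pair_term lam M lo hi b (k, h, p, (l, l))) \<le> (\<Sum>l\<in>{L..<2*L}. real (card (window M lo hi b h s1 s2 l l)))"
      by (intro sum_mono) (auto simp: pair_term_def ps)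
    also have "\<dots> = real (\<Sum>l\<in>{L..<2*L}. card (window M lo hi b h s1 s2 l l))" by simp
    also have "(\<Sum>l\<in>{L..<2*L}. card (window M lo hi b h s1 s2 l l)) = card (SIGMA l:{L..<2*L}. window M lo hi b h s1 s2 l l)"
      by (rule card_SigmaI[symmetric]) auto
    also have "\<dots> \<le> card ?C"
    proof (rule card_inj_on_le[where f = prod.swap])
      show "prod.swap ` (SIGMA l:{L..<2*L}. window M lo hi b h s1 s2 l l) \<subseteq> ?C"
      proof (rule image_subsetI)
        fix q assume q: "q \<in> (SIGMA l:{L..<2*L}. window M lo hi b h s1 s2 l l)"
        obtain l m where lm: "q = (l, m)" by (cases q)
        have c: "[int (m * l) = b] (mod int (h * s1))" "[int (m * l) = b] (mod int (h * s2))" "m \<in> {M..<2*M}" "l \<in> {L..<2*L}"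
          using q lm by (auto simp: window_def)
        have "int (lcm (h * s1) (h * s2)) dvd int (m * l) - b"
          using c(1,2) by (metis cong_iff_dvd_diff lcm_int_int_eq lcm_least)
        then have "[int (m * l) = b] (mod int r)" by (simp add: cong_iff_dvd_diff r_def lcm_mult_left)
        then show "prod.swap q \<in> ?C" using c lm by simp
      qed
    qed (auto simp: inj_on_def)
    finally have "(\<Sum>l\<in>{L..<2*L}. pair_term lam M lo hi b (k, h, p, (l, l))) \<le> real (card ?C)" by simp
    also have "\<dots> \<le> T * (4 * x / real r + 1)" using typeII_diagonal_count[OF r1 pos(4,3) LM] .
    also have "\<dots> \<le> T * (4 * x / real (H * S) + 1)"
      using T_pos r r1 pos x_ge by (intro mult_left_mono add_right_mono divide_left_mono of_nat_mono) auto
    finally show ?thesis .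
  qed
  have "(\<Sum>t\<in>X. pair_term lam M lo hi b t) \<le> (\<Sum>t\<in>?\<phi> ` ?Z. pair_term lam M lo hi b t)"
    using sub finR pair_term_nonneg by (intro sum_mono2) auto
  also have "\<dots> = (\<Sum>z\<in>?Z. pair_term lam M lo hi b (?\<phi> z))" using inj by (simp add: sum.reindex)
  also have "\<dots> = (\<Sum>k\<in>{1..K0}. \<Sum>h\<in>{H..<2*H}. \<Sum>p\<in>R. \<Sum>l\<in>{L..<2*L}. pair_term lam M lo hi b (k, h, p, (l, l)))"
    by (simp only: sum.cartesian_product' prod.case)
  also have "\<dots> \<le> (\<Sum>k\<in>{1..K0}. \<Sum>h\<in>{H..<2*H}. \<Sum>p\<in>R. T * (4 * x / real (H * S) + 1))"
    by (intro sum_mono inner) auto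
  also have "\<dots> = real K0 * real H * real (card R) * (T * (4 * x / real (H * S) + 1))" by simp
  also have "\<dots> \<le> K * real H * (T^2 * real S) * (T * (4 * x / real (H * S) + 1))"
    using cR K0 K_ge T_pos x_ge by (intro mult_mono) auto
  also have "\<dots> = T^3 * K * (4 * x + real (H * S))" using pos by (simp add: field_simps eval_nat_numeral)
  also have "\<dots> \<le> T^3 * K * (T * x + T * x)"
    using HS T_ge x_ge K_ge by (intro mult_left_mono add_mono mult_right_mono) auto
  also have "\<dots> = 2 * T^4 * (K * x)" by (simp add: eval_nat_numeral)
  also have "\<dots> \<le> T^Suc 4 * (K * x)" using K_ge x_ge by (intro T_absorb) auto
  finally show ?thesis by (simp add: mult.assoc)
qed

lemma sum_pair_terms:
  fixes H L M Smax K0 :: nat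
  assumes pos: "1 \<le> H" "1 \<le> L" "1 \<le> M" "1 \<le> K0" and K0: "real K0 \<le> K" "K \<le> 2 * real K0"
    and LM: "real (M * L) \<le> x" "x \<le> 8 * real (M * L)"
    and HS: "real (H * Smax^2) * y \<le> T * real M"
    and \<kappa>: "\<kappa> * y^16 \<le> 1"
    and good: "\<And>h s1 s2. h \<in> {H..<2*H} \<Longrightarrow> s1 \<in> {1..Smax} \<Longrightarrow> s2 \<in> {1..Smax} \<Longrightarrow> lam h s1 \<noteq> 0 \<Longrightarrow> lam h s2 \<noteq> 0 \<Longrightarrow>
      real (lcm s1 s2) \<le> y^6 \<or> real H \<le> y^4 \<or> y^16 \<le> real h * real (lcm s1 s2)"
    and cop: "\<And>h s. lam h s \<noteq> 0 \<Longrightarrow> coprime b (int (h * s))"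
  shows "(\<Sum>t\<in>pairs K0 H Smax L. pair_term lam M lo hi b t) \<le>
     T * (T^5 * K * x + T^10 * K * (real L)\<^sup>2 * real M / real H * sqrt \<omega>)"
proof -
  define X where "X n = {t \<in> pairs K0 H Smax L. case t of (k, h, (s1, s2), (l1, l2)) \<Rightarrow>
      lcm s1 s2 \<in> {2^n..<2*2^n} \<and> pair_term lam M lo hi b t \<noteq> 0}" for n :: nat
  have finX: "finite (X n)" for n by (simp add: X_def)
  let ?bound = "T^5 * K * x + T^10 * K * (real L)\<^sup>2 * real M / real H * sqrt \<omega>"
  have bound0: "0 \<le> ?bound" using T_pos K_ge x_ge \<omega>_pos by simp
  have M_le: "real M \<le> x"
  proof -
    have "M * 1 \<le> M * L" using pos by (intro mult_le_mono2) auto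
    then have "real M \<le> real (M * L)" by (intro of_nat_mono) simp
    then show ?thesis using LM(1) by linarith
  qed
  have lcm_le: "H * lcm s1 s2 \<le> H * Smax^2" if "s1 \<in> {1..Smax}" "s2 \<in> {1..Smax}" for s1 s2
  proof -
    have "lcm s1 s2 \<le> s1 * s2" using that by (intro dvd_imp_le) auto
    also have "\<dots> \<le> Smax * Smax" using that by (intro mult_le_mono) auto
    finally show ?thesis by (simp add: power2_eq_square)
  qed
  have HSx: "real (H * Smax^2) \<le> T * x"
  proof -
    have "real (H * Smax^2) * 1 \<le> real (H * Smax^2) * y" using y_ge by (intro mult_left_mono) auto
    also have "\<dots> \<le> T * real M" by (rule HS)
    also have "\<dots> \<le> T * x" using M_le T_pos by (intro mult_left_mono) auto
    finally show ?thesis by simp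
  qed
  have Tx: "2 * (T * x) \<le> x ^ 12"
  proof -
    have "2 * (T * x) \<le> x * (x * x)" using T_le T_pos x_ge by (intro mult_mono) auto
    also have "\<dots> = x^3" by (simp add: eval_nat_numeral)
    also have "\<dots> \<le> x^12" using x_ge by (intro power_increasing) auto
    finally show ?thesis .
  qed
  have step: "(\<Sum>t\<in>X n. pair_term lam M lo hi b t) \<le> ?bound" for n
  proof (cases "X n = {}")
    case True
    then show ?thesis using bound0 by simp
  next
    case False
    define S :: nat where "S = 2^n"
    have S1: "1 \<le> S" by (simp add: S_def)
    define D where "D = {t \<in> X n. case t of (k, h, (s1, s2), (l1, l2)) \<Rightarrow> l1 = l2}"
    define Of where "Of = {t \<in> X n. case t of (k, h, (s1, s2), (l1, l2)) \<Rightarrow> l1 \<noteq> l2}"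
    have X_D: "X n = D \<union> Of" "D \<inter> Of = {}" by (auto simp: D_def Of_def)
    obtain k0 h0 s10 s20 l10 l20 where t0: "(k0, h0, (s10, s20), (l10, l20)) \<in> X n" using False by (metis equals0I prod.exhaust)
    have H0: "H * S \<le> H * Smax^2"
      using t0 lcm_le[of s10 s20] by (auto simp: X_def pairs_def S_def intro: order_trans[OF mult_le_mono2])
    then have HSr: "real (H * S) \<le> real (H * Smax^2)" by (intro of_nat_mono)
    have HSy: "real (H * S) * y \<le> T * real M"
      using HSr HS y_ge mult_right_mono[of "real (H * S)" "real (H * Smax^2)" y] by linarith
    have S2: "real (2 * S) \<le> x ^ 12"
    proof -
      have "2 * (1 * S) \<le> 2 * (H * S)" using pos by (intro mult_le_mono) auto
      then have "real (2 * S) \<le> real (2 * (H * S))" by (intro of_nat_mono) simp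
      also have "\<dots> = 2 * real (H * S)" by simp
      also have "\<dots> \<le> 2 * (T * x)" using HSr HSx by (intro mult_left_mono) auto
      finally show ?thesis using Tx by linarith
    qed
    \<comment> \<open>One pair from the nonempty range transfers \<open>good\<close> to the dyadic
      sizes, since \<open>h * lcm s1 s2 \<le> 4 * H * S\<close> and
      \<open>S \<le> lcm s1 s2\<close>.\<close>
    have gd: "real S \<le> y^6 \<or> real H \<le> y^4 \<or> y^16 \<le> 4 * real H * real S"
    proof -
      have mem: "h0 \<in> {H..<2*H}" "s10 \<in> {1..Smax}" "s20 \<in> {1..Smax}" "lam h0 s10 \<noteq> 0" "lam h0 s20 \<noteq> 0" "S \<le> lcm s10 s20" "lcm s10 s20 < 2 * S"
        using t0 by (auto simp: X_def pairs_def S_def pair_term_def split: if_splits)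
      have "real h0 * real (lcm s10 s20) \<le> (2 * real H) * (2 * real S)" using mem by (intro mult_mono) auto
      moreover have "real S \<le> real (lcm s10 s20)" using mem by (intro of_nat_mono)
      ultimately show ?thesis using good[OF mem(1-5)] by linarith
    qed
    have "(\<Sum>t\<in>D. pair_term lam M lo hi b t) \<le> T^5 * K * x"
    proof (rule diagonal_terms[OF pos(1) S1 pos(2,3) K0(1) LM(1) _ S2])
      show "real (H * S) \<le> T * x" using HSr HSx by linarith
      show "D \<subseteq> {t \<in> pairs K0 H Smax L. case t of (k, h, (s1, s2), l1, l2) \<Rightarrow> l1 = l2 \<and> lcm s1 s2 \<in> {S..<2 * S}}"
        by (auto simp: D_def X_def S_def)
    qed
    moreover have "(\<Sum>t\<in>Of. pair_term lam M lo hi b t) \<le> T^10 * K * (real L)\<^sup>2 * real M / real H * sqrt \<omega>"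
    proof -
      have mem: "(k, h, (s1, s2), (l1, l2)) \<in> off_tuples K0 H S Smax L \<and> coprime b (int (h * s1)) \<and> coprime b (int (h * s2))"
        if t: "(k, h, (s1, s2), (l1, l2)) \<in> Of" for k h s1 s2 l1 l2
      proof -
        have nz: "lam h s1 \<noteq> 0" "lam h s2 \<noteq> 0" and ne: "window M lo hi b h s1 s2 l1 l2 \<noteq> {}"
          using t by (auto simp: Of_def X_def pair_term_def split: if_splits)
        obtain m where m: "m \<in> window M lo hi b h s1 s2 l1 l2" using ne by blast
        have cp: "coprime b (int (h * s1))" "coprime b (int (h * s2))" using cop nz by auto
        \<comment> \<open>A nonzero term has an inhabited window, and a single \<open>m\<close> in
          it already forces the divisibility.\<close>
        have "int h dvd int l1 - int l2"
          using m by (intro double_congruence_dvd[OF cp, of m]) (auto simp: window_def)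
        then show ?thesis using t cp by (auto simp: Of_def X_def pairs_def off_tuples_def S_def)
      qed
      have "(\<Sum>t\<in>Of. pair_term lam M lo hi b t) \<le> (\<Sum>(k, h, (s1, s2), (l1, l2))\<in>Of.
          norm (\<Sum>m\<in>window M lo hi b h s1 s2 l1 l2. e (\<alpha> * real k * ((real l1)\<^sup>2 - (real l2)\<^sup>2) * (real m)\<^sup>2)))"
        by (intro sum_mono) (auto simp: pair_term_def)
      also have "\<dots> \<le> T^10 * K * (real L)\<^sup>2 * real M / real H * sqrt \<omega>"
      proof (rule off_diagonal[OF pos(1) S1 pos(2,3,4) K0 LM HSy \<kappa> gd])
        show "Of \<subseteq> off_tuples K0 H S Smax L" using mem by auto
      qed (use mem in blast)
      finally show ?thesis .
    qed
    ultimately show ?thesis unfolding X_D(1) using X_D finX[of n] by (subst sum.union_disjoint) auto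
  qed
  have "(\<Sum>t\<in>pairs K0 H Smax L. pair_term lam M lo hi b t) \<le> (\<Sum>t\<in>pairs K0 H Smax L. \<Sum>n<I. if t \<in> X n then pair_term lam M lo hi b t else 0)"
  proof (intro sum_mono)
    fix t assume t: "t \<in> pairs K0 H Smax L"
    obtain k h s1 s2 l1 l2 where teq: "t = (k, h, (s1, s2), (l1, l2))" by (metis prod.exhaust)
    have s: "s1 \<in> {1..Smax}" "s2 \<in> {1..Smax}" using t by (auto simp: teq pairs_def)
    show "pair_term lam M lo hi b t \<le> (\<Sum>n<I. if t \<in> X n then pair_term lam M lo hi b t else 0)"
    proof (cases "pair_term lam M lo hi b t = 0")
      case False
      have "1 * lcm s1 s2 \<le> H * lcm s1 s2" using pos by (intro mult_le_mono1) auto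
      then have "lcm s1 s2 \<le> H * Smax^2" using lcm_le[OF s] by linarith
      then have "real (lcm s1 s2) \<le> real (H * Smax^2)" by (rule of_nat_mono)
      also have "\<dots> \<le> x ^ 12" using HSx Tx by (smt (verit) T_pos(1) mult_nonneg_nonneg x_ge)
      finally have "lcm s1 s2 < 2 ^ I" by (rule I_bound)
      moreover have "1 \<le> lcm s1 s2" using s by (metis One_nat_def Suc_leI atLeastAtMost_iff lcm_pos_nat less_le_trans zero_less_one)
      ultimately obtain n where n: "n < I" "2^n \<le> lcm s1 s2" "lcm s1 s2 < 2 * 2^n" using dyadic_exponent by blast
      then have "t \<in> X n" using t False by (simp add: X_def teq)
      then have "pair_term lam M lo hi b t = (if t \<in> X n then pair_term lam M lo hi b t else 0)" by simp
      also have "\<dots> \<le> (\<Sum>n<I. if t \<in> X n then pair_term lam M lo hi b t else 0)"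
        using n pair_term_nonneg by (intro member_le_sum) auto
      finally show ?thesis .
    qed (simp add: sum_nonneg)
  qed
  also have "\<dots> = (\<Sum>n<I. \<Sum>t\<in>pairs K0 H Smax L. if t \<in> X n then pair_term lam M lo hi b t else 0)" by (rule sum.swap)
  also have "\<dots> = (\<Sum>n<I. \<Sum>t\<in>X n. pair_term lam M lo hi b t)"
  proof (rule sum.cong[OF refl])
    fix n
    have "X n \<subseteq> pairs K0 H Smax L" by (auto simp: X_def)
    then have "pairs K0 H Smax L \<inter> X n = X n" by blast
    then show "(\<Sum>t\<in>pairs K0 H Smax L. if t \<in> X n then pair_term lam M lo hi b t else 0) = (\<Sum>t\<in>X n. pair_term lam M lo hi b t)"
      by (simp add: sum.inter_restrict[symmetric])
  qed
  also have "\<dots> \<le> (\<Sum>n<I. ?bound)" by (intro sum_mono step)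
  also have "\<dots> = real I * ?bound" by simp
  also have "\<dots> \<le> T * ?bound" using I_le bound0 by (intro mult_right_mono) auto
  finally show ?thesis .
qed

text \<open>With \<open>k, h, m\<close> outside, the diagonal contributes about
  \<open>K^2 * x * H * M\<close>, acceptable by the hypothesis on \<open>H * M\<close>. Off the
  diagonal the \<open>H\<close> of the outer count cancels the \<open>H\<close> gained from
  \<open>h dvd l1 - l2\<close>, leaving about
  \<open>K^2 * (M * L)^2 * sqrt \<omega>\<close>.\<close>

lemma bilinear_sum_bound:
  fixes H L M Smax K0 :: nat
  assumes pos: "1 \<le> H" "1 \<le> L" "1 \<le> M" "1 \<le> K0" and K0: "real K0 \<le> K" "K \<le> 2 * real K0"
    and LM: "real (M * L) \<le> x" "x \<le> 8 * real (M * L)"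
    and HS: "real (H * Smax^2) * y \<le> T * real M" and HM: "real (H * M) * y \<le> T * x"
    and \<kappa>: "\<kappa> * y^16 \<le> 1"
    and good: "\<And>h s1 s2. h \<in> {H..<2*H} \<Longrightarrow> s1 \<in> {1..Smax} \<Longrightarrow> s2 \<in> {1..Smax} \<Longrightarrow> lam h s1 \<noteq> 0 \<Longrightarrow> lam h s2 \<noteq> 0 \<Longrightarrow>
      real (lcm s1 s2) \<le> y^6 \<or> real H \<le> y^4 \<or> y^16 \<le> real h * real (lcm s1 s2)"
    and cop: "\<And>h s. lam h s \<noteq> 0 \<Longrightarrow> coprime b (int (h * s))"
    and c: "\<And>k. k \<in> {1..K0} \<Longrightarrow> norm (c k) \<le> T" and lam: "\<And>h s. norm (lam h s) \<le> T"
    and A: "\<And>m. m \<in> {M..<2*M} \<Longrightarrow> norm (A m) \<le> T" and B: "\<And>l. l \<in> {L..<2*L} \<Longrightarrow> norm (B l) \<le> T"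
  shows "(norm (bilinear_sum K0 H Smax M L lo hi b c lam A B))\<^sup>2 \<le> T^20 * K\<^sup>2 * x\<^sup>2 * sqrt \<omega>"
proof -
  let ?I = "{1..Smax} \<times> {L..<2*L}"
  define g where "g k h i m = (if in_class lo hi b (h * fst i) (m * snd i) then e (\<alpha> * real k * (real (m * snd i))\<^sup>2) else 0)"
    for k h m :: nat and i :: "nat \<times> nat"
  define w where "w h i = lam h (fst i) * B (snd i)" for h and i :: "nat \<times> nat"
  define Z where "Z k h m = (\<Sum>i\<in>?I. w h i * g k h i m)" for k h m
  have "bilinear_sum K0 H Smax M L lo hi b c lam A B =
     (\<Sum>k\<in>{1..K0}. \<Sum>h\<in>{H..<2*H}. \<Sum>m\<in>{M..<2*M}. \<Sum>s\<in>{1..Smax}. \<Sum>l\<in>{L..<2*L}.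
      if in_class lo hi b (h * s) (m*l) then c k * lam h s * A m * B l * e (\<alpha> * real k * (real (m*l))\<^sup>2) else 0)"
    unfolding bilinear_sum_def by (rule sum.cong[OF refl sum_swap_inner])
  also have "\<dots> = (\<Sum>k\<in>{1..K0}. \<Sum>h\<in>{H..<2*H}. \<Sum>m\<in>{M..<2*M}. c k * A m * Z k h m)"
    unfolding Z_def sum.cartesian_product' sum_distrib_left w_def g_def fst_conv snd_conv
    by (intro sum.cong refl) simp
  also have "\<dots> = (\<Sum>p\<in>{1..K0} \<times> {H..<2*H} \<times> {M..<2*M}. c (fst p) * A (snd (snd p)) * Z (fst p) (fst (snd p)) (snd (snd p)))"
    by (simp only: sum.cartesian_product' fst_conv snd_conv)
  finally have eq: "bilinear_sum K0 H Smax M L lo hi b c lam A B = \<dots>" .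
  let ?U = "{1..K0} \<times> {H..<2*H} \<times> {M..<2*M}"
  let ?Zp = "\<lambda>p. norm (Z (fst p) (fst (snd p)) (snd (snd p)))"
  have "norm (bilinear_sum K0 H Smax M L lo hi b c lam A B) \<le> (\<Sum>p\<in>?U. T^2 * ?Zp p)"
    unfolding eq
  proof (intro sum_norm_le)
    fix p assume p: "p \<in> ?U"
    have "norm (c (fst p)) * norm (A (snd (snd p))) \<le> T * T"
      using p T_pos by (intro mult_mono c A) auto
    then show "norm (c (fst p) * A (snd (snd p)) * Z (fst p) (fst (snd p)) (snd (snd p))) \<le> T^2 * ?Zp p"
      by (simp add: norm_mult power2_eq_square mult_right_mono)
  qed
  then have "(norm (bilinear_sum K0 H Smax M L lo hi b c lam A B))\<^sup>2 \<le> (\<Sum>p\<in>?U. T^2 * ?Zp p)\<^sup>2"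
    by (intro power_mono) auto
  also have "\<dots> \<le> real (card ?U) * (\<Sum>p\<in>?U. (T^2 * ?Zp p)\<^sup>2)" by (rule sum_squared_le_card_sum_squares)
  also have "\<dots> = T^4 * (real K0 * real H * real M) * (\<Sum>p\<in>?U. (?Zp p)\<^sup>2)"
    by (simp add: card_cartesian_product power_mult_distrib sum_distrib_left mult_ac)
  also have "(\<Sum>p\<in>?U. (?Zp p)\<^sup>2) = (\<Sum>k\<in>{1..K0}. \<Sum>h\<in>{H..<2*H}. \<Sum>m\<in>{M..<2*M}. (norm (Z k h m))\<^sup>2)"
    by (simp only: sum.cartesian_product' fst_conv snd_conv)
  finally have 1: "(norm (bilinear_sum K0 H Smax M L lo hi b c lam A B))\<^sup>2 \<le>
    T^4 * (real K0 * real H * real M) * (\<Sum>k\<in>{1..K0}. \<Sum>h\<in>{H..<2*H}. \<Sum>m\<in>{M..<2*M}. (norm (Z k h m))\<^sup>2)" .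
  have "(\<Sum>k\<in>{1..K0}. \<Sum>h\<in>{H..<2*H}. \<Sum>m\<in>{M..<2*M}. (norm (Z k h m))\<^sup>2) \<le>
     (\<Sum>k\<in>{1..K0}. \<Sum>h\<in>{H..<2*H}. \<Sum>i\<in>?I. \<Sum>j\<in>?I. T^4 * pair_term lam M lo hi b (k, h, (fst i, fst j), (snd i, snd j)))"
  proof (intro sum_mono)
    fix k h
    have "(\<Sum>m\<in>{M..<2*M}. (norm (Z k h m))\<^sup>2) \<le>
       (\<Sum>i\<in>?I. \<Sum>j\<in>?I. norm (w h i) * norm (w h j) * norm (\<Sum>m\<in>{M..<2*M}. g k h i m * cnj (g k h j m)))"
      unfolding Z_def by (rule sum_norm_squared_le) auto
    also have "\<dots> \<le> (\<Sum>i\<in>?I. \<Sum>j\<in>?I. T^4 * pair_term lam M lo hi b (k, h, (fst i, fst j), (snd i, snd j)))"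
    proof (intro sum_mono)
      fix i j assume i: "i \<in> ?I" and j: "j \<in> ?I"
      have "(\<Sum>m\<in>{M..<2*M}. g k h i m * cnj (g k h j m)) =
        (\<Sum>m\<in>{M..<2*M}. if in_class lo hi b (h * fst i) (m * snd i) \<and> in_class lo hi b (h * fst j) (m * snd j)
          then e (\<alpha> * real k * ((real (snd i))\<^sup>2 - (real (snd j))\<^sup>2) * (real m)\<^sup>2) else 0)"
      proof (intro sum.cong refl)
        fix m
        have "e (\<alpha> * real k * (real (m * snd i))\<^sup>2) * cnj (e (\<alpha> * real k * (real (m * snd j))\<^sup>2)) =
           e (\<alpha> * real k * ((real (snd i))\<^sup>2 - (real (snd j))\<^sup>2) * (real m)\<^sup>2)"
          unfolding e_minus[symmetric] e_add[symmetric]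
          by (rule arg_cong[of _ _ e]) (simp add: power_mult_distrib algebra_simps)
        then show "g k h i m * cnj (g k h j m) = (if in_class lo hi b (h * fst i) (m * snd i) \<and> in_class lo hi b (h * fst j) (m * snd j)
          then e (\<alpha> * real k * ((real (snd i))\<^sup>2 - (real (snd j))\<^sup>2) * (real m)\<^sup>2) else 0)"
          by (simp add: g_def)
      qed
      also have "\<dots> = (\<Sum>m\<in>window M lo hi b h (fst i) (fst j) (snd i) (snd j). e (\<alpha> * real k * ((real (snd i))\<^sup>2 - (real (snd j))\<^sup>2) * (real m)\<^sup>2))"
        unfolding window_def in_class_def by (rule sum.inter_filter[symmetric]) simp
      finally have ip: "(\<Sum>m\<in>{M..<2*M}. g k h i m * cnj (g k h j m)) = \<dots>" .
      show "norm (w h i) * norm (w h j) * norm (\<Sum>m\<in>{M..<2*M}. g k h i m * cnj (g k h j m)) \<le>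
         T^4 * pair_term lam M lo hi b (k, h, (fst i, fst j), (snd i, snd j))"
      proof (cases "lam h (fst i) = 0 \<or> lam h (fst j) = 0")
        case True
        then have "w h i = 0 \<or> w h j = 0" by (auto simp: w_def)
        then show ?thesis using T_pos pair_term_nonneg by auto
      next
        case False
        have "norm (w h i) \<le> T * T" "norm (w h j) \<le> T * T"
          unfolding w_def norm_mult using i j T_pos by (intro mult_mono lam B; auto)+
        then have "norm (w h i) * norm (w h j) \<le> (T * T) * (T * T)" using T_pos by (intro mult_mono) auto
        then have "norm (w h i) * norm (w h j) \<le> T^4" by (simp add: eval_nat_numeral mult_ac)
        moreover have "pair_term lam M lo hi b (k, h, (fst i, fst j), (snd i, snd j)) = norm (\<Sum>m\<in>{M..<2*M}. g k h i m * cnj (g k h j m))"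
          using False unfolding ip by (simp add: pair_term_def)
        ultimately show ?thesis by (simp add: mult_right_mono)
      qed
    qed
    finally show "(\<Sum>m\<in>{M..<2*M}. (norm (Z k h m))\<^sup>2) \<le>
       (\<Sum>i\<in>?I. \<Sum>j\<in>?I. T^4 * pair_term lam M lo hi b (k, h, (fst i, fst j), (snd i, snd j)))" .
  qed
  also have "\<dots> = T^4 * (\<Sum>k\<in>{1..K0}. \<Sum>h\<in>{H..<2*H}. \<Sum>s1\<in>{1..Smax}. \<Sum>l1\<in>{L..<2*L}. \<Sum>s2\<in>{1..Smax}. \<Sum>l2\<in>{L..<2*L}.
      pair_term lam M lo hi b (k, h, (s1, s2), (l1, l2)))"
    by (simp only: sum.cartesian_product' fst_conv snd_conv sum_distrib_left)
  also have "(\<Sum>k\<in>{1..K0}. \<Sum>h\<in>{H..<2*H}. \<Sum>s1\<in>{1..Smax}. \<Sum>l1\<in>{L..<2*L}. \<Sum>s2\<in>{1..Smax}. \<Sum>l2\<in>{L..<2*L}.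
      pair_term lam M lo hi b (k, h, (s1, s2), (l1, l2))) =
     (\<Sum>k\<in>{1..K0}. \<Sum>h\<in>{H..<2*H}. \<Sum>s1\<in>{1..Smax}. \<Sum>s2\<in>{1..Smax}. \<Sum>l1\<in>{L..<2*L}. \<Sum>l2\<in>{L..<2*L}.
      pair_term lam M lo hi b (k, h, (s1, s2), (l1, l2)))"
    by (intro sum.cong[OF refl] sum.swap)
  also have "\<dots> = (\<Sum>t\<in>pairs K0 H Smax L. pair_term lam M lo hi b t)"
    unfolding pairs_def by (simp only: sum.cartesian_product')
  finally have 2: "(\<Sum>k\<in>{1..K0}. \<Sum>h\<in>{H..<2*H}. \<Sum>m\<in>{M..<2*M}. (norm (Z k h m))\<^sup>2) \<le>
    T^4 * (\<Sum>t\<in>pairs K0 H Smax L. pair_term lam M lo hi b t)" .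
  let ?R = "T^5 * K * x + T^10 * K * (real L)\<^sup>2 * real M / real H * sqrt \<omega>"
  have "(norm (bilinear_sum K0 H Smax M L lo hi b c lam A B))\<^sup>2 \<le> T^4 * (real K0 * real H * real M) * (T^4 * (T * ?R))"
  proof (rule order_trans[OF 1], rule mult_left_mono)
    have "T^4 * (\<Sum>t\<in>pairs K0 H Smax L. pair_term lam M lo hi b t) \<le> T^4 * (T * ?R)"
      using T_pos by (intro mult_left_mono sum_pair_terms[OF pos K0 LM HS \<kappa> good cop]) auto
    with 2 show "(\<Sum>k\<in>{1..K0}. \<Sum>h\<in>{H..<2*H}. \<Sum>m\<in>{M..<2*M}. (norm (Z k h m))\<^sup>2) \<le> T^4 * (T * ?R)" by linarith
  qed (use T_pos in auto)
  also have "\<dots> \<le> T^4 * (K * real H * real M) * (T^4 * (T * ?R))"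
    using K0 T_pos K_ge x_ge \<omega>_pos by (intro mult_right_mono mult_left_mono) auto
  also have "\<dots> = T^14 * K\<^sup>2 * (x * real (H * M)) + T^19 * K\<^sup>2 * (real (M * L))\<^sup>2 * sqrt \<omega>"
    using pos by (simp add: field_simps eval_nat_numeral)
  also have "\<dots> \<le> T^14 * K\<^sup>2 * (T * x\<^sup>2 * sqrt \<omega>) + T^19 * K\<^sup>2 * x\<^sup>2 * sqrt \<omega>"
  proof (intro add_mono mult_left_mono mult_right_mono power_mono LM(1))
    have y0: "0 < y" using y_ge by simp
    \<comment> \<open>As \<open>y \<ge> 1\<close>,
      \<open>1 / y^2 \<le> 1 / y \<le> \<omega>\<close>; the diagonal is thereby brought under the
      off-diagonal bound.\<close>
    have "1 / y \<le> sqrt \<omega>"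
    proof (rule real_le_rsqrt)
      have "(1 / y)\<^sup>2 \<le> (1 / y) * 1" unfolding power2_eq_square using y_ge by (intro mult_left_mono) auto
      also have "\<dots> \<le> \<omega>" using \<kappa>_pos y0 by (simp add: \<omega>_def)
      finally show "(1 / y)\<^sup>2 \<le> \<omega>" .
    qed
    have "real (H * M) \<le> T * x * (1 / y)" using HM y0 by (simp add: field_simps)
    also have "\<dots> \<le> T * x * sqrt \<omega>" using \<open>1 / y \<le> sqrt \<omega>\<close> T_pos x_ge by (intro mult_left_mono) auto
    finally have "x * real (H * M) \<le> x * (T * x * sqrt \<omega>)" using x_ge by (intro mult_left_mono) auto
    then show "x * real (H * M) \<le> T * x\<^sup>2 * sqrt \<omega>" by (simp add: power2_eq_square mult_ac)
  qed (use T_pos K_ge \<omega>_pos in auto)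
  also have "\<dots> = T^15 * (K\<^sup>2 * x\<^sup>2 * sqrt \<omega>) + T^19 * (K\<^sup>2 * x\<^sup>2 * sqrt \<omega>)" by (simp add: eval_nat_numeral mult_ac)
  also have "\<dots> \<le> T^19 * (K\<^sup>2 * x\<^sup>2 * sqrt \<omega>) + T^19 * (K\<^sup>2 * x\<^sup>2 * sqrt \<omega>)"
    using \<omega>_pos by (intro add_right_mono mult_right_mono T_power_mono) auto
  also have "\<dots> = 2 * T^19 * (K\<^sup>2 * x\<^sup>2 * sqrt \<omega>)" by simp
  also have "\<dots> \<le> T^Suc 19 * (K\<^sup>2 * x\<^sup>2 * sqrt \<omega>)" using \<omega>_pos by (intro T_absorb) auto
  finally show ?thesis by (simp add: mult.assoc)
qed

end

section \<open>Linear sums\<close>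

lemma sum_monotone_weights:
  fixes w :: "nat \<Rightarrow> real" and z :: "nat \<Rightarrow> complex"
  shows "(\<Sum>l\<le>n. of_real (w l) * z l) =
    of_real (w 0) * (\<Sum>l\<le>n. z l) + (\<Sum>t\<in>{1..n}. of_real (w t - w (t - 1)) * (\<Sum>l\<in>{t..n}. z l))"
proof (induction n)
  case (Suc n)
  have tel: "(\<Sum>t\<in>{1..n}. w t - w (t - 1)) = w n - w 0"
    by (induction n) auto
  have "(\<Sum>t\<in>{1..Suc n}. of_real (w t - w (t - 1)) * (\<Sum>l\<in>{t..Suc n}. z l)) =
    (\<Sum>t\<in>{1..n}. of_real (w t - w (t - 1)) * ((\<Sum>l\<in>{t..n}. z l) + z (Suc n))) + of_real (w (Suc n) - w n) * z (Suc n)"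
    by simp
  also have "\<dots> = (\<Sum>t\<in>{1..n}. of_real (w t - w (t - 1)) * (\<Sum>l\<in>{t..n}. z l)) +
     of_real (\<Sum>t\<in>{1..n}. w t - w (t - 1)) * z (Suc n) + of_real (w (Suc n) - w n) * z (Suc n)"
    by (simp add: distrib_left sum.distrib sum_distrib_right)
  finally show ?case unfolding tel using Suc by (simp add: algebra_simps)
qed simp

text \<open>The tails \<open>{t..n}\<close> are weighted by increments of \<open>w\<close>, which
  are nonnegative and telescope; a monotone weight such as the logarithm thus costs only its last
  value.\<close>

lemma norm_sum_monotone_weights_le:
  fixes w :: "nat \<Rightarrow> real" and z :: "nat \<Rightarrow> complex"
  assumes "mono w" "0 \<le> w 0" "\<And>t. norm (\<Sum>l\<in>{t..n}. z l) \<le> B"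
  shows "norm (\<Sum>l\<le>n. of_real (w l) * z l) \<le> w n * B"
proof -
  have "norm (\<Sum>l\<le>n. of_real (w l) * z l) \<le> w 0 * B + (\<Sum>t\<in>{1..n}. (w t - w (t - 1)) * B)"
    unfolding sum_monotone_weights
  proof (intro order_trans[OF norm_triangle_ineq] add_mono sum_norm_le)
    show "norm (of_real (w 0) * (\<Sum>l\<le>n. z l)) \<le> w 0 * B"
      using assms(2) assms(3)[of 0] by (simp add: norm_mult atMost_atLeast0 mult_left_mono)
    fix t
    have "w (t - 1) \<le> w t" using assms(1) by (simp add: mono_def)
    then show "norm (of_real (w t - w (t - 1)) * (\<Sum>l\<in>{t..n}. z l)) \<le> (w t - w (t - 1)) * B"
      using assms(3)[of t] by (simp only: norm_mult norm_of_real) (simp add: mult_left_mono)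
  qed
  also have "(\<Sum>t\<in>{1..n}. (w t - w (t - 1)) * B) = (w n - w 0) * B"
    by (induction n) (auto simp: algebra_simps)
  finally show ?thesis by (simp add: algebra_simps)
qed

section \<open>Sums over a long variable in a residue class\<close>

context minor_arc
begin

definition linear_sum :: "nat \<Rightarrow> nat \<Rightarrow> nat \<Rightarrow> nat \<Rightarrow> real \<Rightarrow> real \<Rightarrow> int \<Rightarrow> (nat \<Rightarrow> complex) \<Rightarrow> (nat \<Rightarrow> complex)
    \<Rightarrow> (nat \<Rightarrow> complex) \<Rightarrow> (nat \<Rightarrow> real) \<Rightarrow> complex" where
  "linear_sum K0 D0 M1 Lx lo hi b c lam g w =
    (\<Sum>k\<in>{1..K0}. \<Sum>d\<in>{1..D0}. \<Sum>m\<in>{1..M1}. \<Sum>l\<le>Lx.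
      if in_class lo hi b d (m*l) then c k * lam d * g m * of_real (w l) * e (\<alpha> * real k * (real (m*l))\<^sup>2) else 0)"

text \<open>The lower end \<open>t\<close> is left free because Abel summation needs every
  tail.\<close>

definition "class_sum Lx lo hi b k d m t =
   (\<Sum>l\<in>{t..Lx}. if in_class lo hi b d (m*l) then e (\<alpha> * real k * (real (m*l))\<^sup>2) else 0)"

definition "class_weight N k z = real N + 2 * (\<Sum>u\<in>{1..N}. min_recip (real N) (\<alpha> * real (2 * k * u) * (real z)\<^sup>2))" for k z :: nat

lemma class_weight_nonneg: "0 \<le> class_weight N k z"
  unfolding class_weight_def by (intro add_nonneg_nonneg mult_nonneg_nonneg sum_nonneg) auto

lemma norm_class_sum_le:
  assumes "1 \<le> d" "1 \<le> m" "1 \<le> Z" "Z \<le> d * m" "hi \<le> x" "coprime b (int d)"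
  shows "(norm (class_sum Lx lo hi b k d m t))\<^sup>2 \<le> class_weight (nat \<lfloor>x / real Z\<rfloor> + 2) k (d * m)"
proof -
  let ?N = "nat \<lfloor>x / real Z\<rfloor> + 2"
  define Len where "Len = nat \<lfloor>x / real m\<rfloor> + 1"
  define X where "X = {l \<in> {t..Lx}. in_class lo hi b d (m*l)}"
  have "class_sum Lx lo hi b k d m t = (\<Sum>l\<in>X. e (\<alpha> * real k * (real (m*l))\<^sup>2))"
    unfolding class_sum_def X_def by (rule sum.inter_filter[symmetric]) simp
  also have "\<dots> = (\<Sum>l\<in>X. e (\<alpha> * real k * (real m)\<^sup>2 * (real l)\<^sup>2))"
    by (intro sum.cong refl arg_cong[of _ _ e]) (simp add: power_mult_distrib)
  finally have eq: "class_sum Lx lo hi b k d m t = \<dots>" .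
  have "(norm (\<Sum>l\<in>X. e (\<alpha> * real k * (real m)\<^sup>2 * (real l)\<^sup>2)))\<^sup>2 \<le>
     real ?N + 2 * (\<Sum>u\<in>{1..?N}. min_recip (real ?N) (2 * (\<alpha> * real k * (real m)\<^sup>2) * (real d)\<^sup>2 * real u))"
  proof (rule norm_sum_e_square_progression[where A = 0 and M = Len, OF _ assms(1)])
    show "X \<subseteq> {0..<0 + Len}"
    proof
      fix l assume "l \<in> X"
      then have "real m * real l < x" using assms(5) by (auto simp: X_def in_class_def)
      then have "real l \<le> x / real m" using assms(2) by (simp add: field_simps)
      then have "int l \<le> \<lfloor>x / real m\<rfloor>" by (simp add: le_floor_iff)
      then show "l \<in> {0..<0 + Len}" by (simp add: Len_def)
    qed
    \<comment> \<open>Both congruences in \<open>double_congruence_unique\<close> are taken to be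
      the one modulo \<open>d\<close>, with \<open>h = 1\<close>.\<close>
    show "[l = n] (mod d)" if "l \<in> X" "n \<in> X" for l n
      using that assms(6) double_congruence_unique[of b 1 d d l m m n] by (simp add: X_def in_class_def mult.commute[of m])
    show "j \<in> X" if "l \<in> X" "n \<in> X" "l \<le> j" "j \<le> n" "[j = l] (mod d)" for l n j
    proof -
      have "[m * j = m * l] (mod d)" using that(5) by (intro cong_mult) auto
      then have "[int (m * j) = int (m * l)] (mod int d)" by (simp only: cong_int_iff)
      moreover have "[int (m * l) = b] (mod int d)" using that(1) by (simp add: X_def in_class_def)
      ultimately have c: "[int (m * j) = b] (mod int d)" by (rule cong_trans)
      have "real (m * l) \<le> real (m * j)" "real (m * j) \<le> real (m * n)" using that(3,4) by (simp_all add: mult_left_mono)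
      moreover have "lo \<le> real (m * l)" "real (m * n) < hi" using that(1,2) by (auto simp: X_def in_class_def)
      ultimately have "lo \<le> real (m * j)" "real (m * j) < hi" by linarith+
      then show ?thesis using c that by (simp add: X_def in_class_def)
    qed
    \<comment> \<open>One unit of the \<open>+ 2\<close> in \<open>?N\<close> pays for the rounding
      in \<open>Len\<close>, the other for counting both ends of a progression.\<close>
    have "real (Len div d) \<le> real Len / real d" by (rule of_nat_div_le_of_nat_divide)
    also have "\<dots> \<le> (x / real m + 1) / real d"
      using x_ge by (intro divide_right_mono) (auto simp: Len_def)
    also have "\<dots> = x / real (d * m) + 1 / real d" by (simp add: add_divide_distrib mult.commute)
    also have "\<dots> \<le> x / real Z + 1"
    proof (intro add_mono divide_left_mono of_nat_mono)
      have "0 < d * m" using assms by simp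
      then show "0 < real (d * m) * real Z" using assms(3) by (simp del: of_nat_mult)
    qed (use assms x_ge in auto)
    finally have "real (Len div d) - 1 \<le> x / real Z" by simp
    then have "int (Len div d) - 1 \<le> \<lfloor>x / real Z\<rfloor>" by (simp add: le_floor_iff)
    then show "Len div d + 1 \<le> ?N" by linarith
  qed
  then show ?thesis unfolding eq class_weight_def by (simp add: power_mult_distrib mult_ac)
qed

text \<open>With \<open>z = d * m\<close> the differenced phase is
  \<open>2 * \<alpha> * k * u * z^2\<close>: the case \<open>H = 1\<close> of
  \<open>phase_sum\<close>, where the alternative on the ranges holds because
  \<open>1 \<le> y^4\<close>. The condition \<open>Z * y \<le> x\<close> makes the length
  \<open>N\<close> at least \<open>y\<close>.\<close>

lemma linear_block:
  fixes X :: "(nat \<times> nat \<times> nat) set"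
  assumes pos: "1 \<le> K0" "1 \<le> Z" and K0: "real K0 \<le> K" "K \<le> 2 * real K0" and Z: "real Z * y \<le> x"
    and \<kappa>: "\<kappa> * y^16 \<le> 1" and hi: "hi \<le> x"
    and X: "finite X" "\<And>k d m. (k, d, m) \<in> X \<Longrightarrow> 1 \<le> d \<and> 1 \<le> m \<and> k \<in> {1..K0} \<and> d * m \<in> {Z..<2*Z} \<and> coprime b (int d)"
    and B: "\<And>k d m. (k, d, m) \<in> X \<Longrightarrow> \<exists>t. B (k, d, m) = norm (class_sum Lx lo hi b k d m t)"
  shows "(\<Sum>t\<in>X. B t) \<le> T^7 * K * x * sqrt \<omega>"
proof -
  define N where "N = nat \<lfloor>x / real Z\<rfloor> + 2"
  define J where "J = 2 * K0 * N"
  let ?Y = "{1..K0} \<times> {Z..<2*Z}"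
  let ?\<Phi> = "\<lambda>(k, d, m). (k::nat, d * m :: nat)"
  have Zx: "real Z \<le> x" using Z y_ge mult_left_mono[of 1 y "real Z"] by simp
  have NZ: "x \<le> real (N * Z)" "real (N * Z) \<le> 3 * x"
  proof -
    have "x / real Z \<le> real N" "real N \<le> x / real Z + 2"
      using x_ge by (auto simp: N_def intro: order_trans[OF real_nat_ceiling_ge]) linarith+
    then show "x \<le> real (N * Z)" "real (N * Z) \<le> 3 * x" using pos Zx by (auto simp: field_simps)
  qed
  have N1: "1 \<le> N" by (simp add: N_def)
  have adm: "admissible J N 1 Z"
    unfolding admissible_def
  proof (intro conjI)
    show "N \<le> J" using pos by (simp add: J_def)
    have eq: "J * N * 1^3 * Z^2 = 2 * K0 * (N * Z)^2" by (simp add: J_def power2_eq_square mult_ac)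
    have "real (J * N * 1^3 * Z^2) = 2 * real K0 * (real (N * Z))^2" unfolding eq by simp
    also have "\<dots> \<le> 2 * x * (3 * x)^2" using K0 K_le NZ x_ge by (intro mult_mono power_mono) auto
    also have "\<dots> = 18 * x^3" by (simp add: eval_nat_numeral)
    also have "\<dots> \<le> x^2 * x^3"
    proof (intro mult_right_mono)
      have "18 \<le> 12 * x" using x_ge by simp
      also have "\<dots> \<le> x^2" using x_ge by (simp add: power2_eq_square)
      finally show "18 \<le> x^2" .
    qed (use x_ge in auto)
    also have "\<dots> = x^5" by (simp add: eval_nat_numeral)
    also have "\<dots> \<le> x^12" using x_ge by (intro power_increasing) auto
    finally show "real (J * N * 1^3 * Z^2) \<le> x^12" .
    have "Q = K * x^2" by (simp add: Q_def)
    also have "\<dots> \<le> 2 * real K0 * (real (N * Z))^2" using K0 NZ x_ge by (intro mult_mono power_mono) auto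
    also have "\<dots> = real (J * N * 1^3 * Z^2)" unfolding eq by simp
    also have "\<dots> \<le> T * real (J * N * 1^3 * Z^2)" using T_grow[of "real (J * N * 1^3 * Z^2)" 1] by simp
    finally show "Q \<le> T * real (J * N * 1^3 * Z^2)" .
  qed (use pos N1 in auto)
  have Jx: "real J \<le> x^12" using pos N1 by (intro admissible_factor[OF adm, of "N * Z^2"]) (auto simp: mult_ac)
  have Z2: "real (2 * Z) \<le> x^12"
  proof -
    have "real (2 * Z) \<le> x * x" using Zx x_ge by (simp add: mult_mono)
    also have "\<dots> = x^2" by (simp add: power2_eq_square)
    also have "\<dots> \<le> x^12" using x_ge by (intro power_increasing) auto
    finally show ?thesis .
  qed
  have img: "?\<Phi> ` X \<subseteq> ?Y" using X(2) by force
  have fib: "real (card {t \<in> X. ?\<Phi> t = z}) \<le> T" if z: "z \<in> ?Y" for z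
  proof -
    obtain k n where kn: "z = (k, n)" by (cases z)
    have n: "0 < n" "real n \<le> x^12"
    proof -
      have "real n \<le> real (2 * Z)" using z kn by simp
      then show "real n \<le> x^12" using Z2 by linarith
    qed (use z kn pos in auto)
    have "card {t \<in> X. ?\<Phi> t = z} = card ((\<lambda>t. fst (snd t)) ` {t \<in> X. ?\<Phi> t = z})"
    proof (rule card_image[symmetric], rule inj_onI)
      fix s t assume s: "s \<in> {t \<in> X. ?\<Phi> t = z}" and t: "t \<in> {t \<in> X. ?\<Phi> t = z}" and "fst (snd s) = fst (snd t)"
      moreover obtain k1 d1 m1 where s1: "s = (k1, d1, m1)" by (metis prod.exhaust)
      moreover obtain k2 d2 m2 where t1: "t = (k2, d2, m2)" by (metis prod.exhaust)
      ultimately have "d1 = d2" by simp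
      moreover have "k1 = k2" "d1 * m1 = d2 * m2" "1 \<le> d1" using s t X(2)[of k1 d1 m1] by (auto simp: s1 t1 kn)
      ultimately show "s = t" by (simp add: s1 t1)
    qed
    also have "\<dots> \<le> card {j. j dvd n}"
      using n kn by (intro card_mono finite_divisors_nat) auto
    finally show ?thesis using card_divisors_le[OF n] by linarith
  qed
  have cX: "real (card X) \<le> T * (real K0 * real Z)"
    using card_fiber_le[OF X(1) _ img fib] by (simp add: card_cartesian_product)
  have "1 / real N \<le> \<omega>"
  proof -
    have y0: "0 < y" using y_ge by simp
    have "real Z * y \<le> real (N * Z)" using Z NZ(1) by linarith
    then have "y \<le> real N" using pos by (simp add: mult.commute)
    then have "1 / real N \<le> 1 / y" using y0 by (intro divide_left_mono) auto
    then show ?thesis using \<kappa>_pos y0 by (simp add: \<omega>_def add_increasing2)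
  qed
  then have wN: "\<omega> + 1 / real N \<le> 2 * \<omega>" by simp
  have B2: "(\<Sum>t\<in>X. (B t)\<^sup>2) \<le> T^8 * (real K0 * real Z * (real N)\<^sup>2 * (2 * \<omega>))"
  proof -
    have "(\<Sum>t\<in>X. (B t)\<^sup>2) \<le> (\<Sum>t\<in>X. (\<lambda>(k, z). class_weight N k z) (?\<Phi> t))"
    proof (intro sum_mono)
      fix t assume t: "t \<in> X"
      obtain k d m where teq: "t = (k, d, m)" by (metis prod.exhaust)
      obtain i where "B (k, d, m) = norm (class_sum Lx lo hi b k d m i)" using B t teq by blast
      then show "(B t)\<^sup>2 \<le> (\<lambda>(k, z). class_weight N k z) (?\<Phi> t)"
        using norm_class_sum_le[of d m Z hi b Lx lo k i] X(2)[of k d m] t pos hi unfolding teq N_def by simp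
    qed
    also have "\<dots> \<le> T * (\<Sum>z\<in>?Y. (\<lambda>(k, z). class_weight N k z) z)"
      using class_weight_nonneg by (intro sum_fiber_le X(1) img fib) auto
    also have "(\<Sum>z\<in>?Y. (\<lambda>(k, z). class_weight N k z) z) = (\<Sum>k\<in>{1..K0}. \<Sum>z\<in>{Z..<2*Z}. class_weight N k z)"
      by (simp only: sum.cartesian_product' prod.case)
    also have "\<dots> = real K0 * real Z * real N + 2 * (\<Sum>k\<in>{1..K0}. \<Sum>z\<in>{Z..<2*Z}. \<Sum>u\<in>{1..N}. min_recip (real N) (\<alpha> * real (2 * (k * u)) * (real z)\<^sup>2))"
      unfolding class_weight_def by (simp only: sum.distrib sum_distrib_left[symmetric] sum_constant mult.assoc) simp
    finally have e1: "(\<Sum>t\<in>X. (B t)\<^sup>2) \<le> T * (real K0 * real Z * real N +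
       2 * (\<Sum>k\<in>{1..K0}. \<Sum>z\<in>{Z..<2*Z}. \<Sum>u\<in>{1..N}. min_recip (real N) (\<alpha> * real (2 * (k * u)) * (real z)\<^sup>2)))" .
    have "(\<Sum>k\<in>{1..K0}. \<Sum>z\<in>{Z..<2*Z}. \<Sum>u\<in>{1..N}. min_recip (real N) (\<alpha> * real (2 * (k * u)) * (real z)\<^sup>2))
      = (\<Sum>z\<in>{Z..<2*Z}. \<Sum>k\<in>{1..K0}. \<Sum>u\<in>{1..N}. min_recip (real N) (\<alpha> * real (2 * (k * u)) * (real z)\<^sup>2))"
      by (rule sum.swap)
    also have "\<dots> \<le> (\<Sum>z\<in>{Z..<2*Z}. T * (\<Sum>j\<in>{1..J}. min_recip (real N) (\<alpha> * real j * (real z)\<^sup>2)))"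
    proof (intro sum_mono)
      fix z
      have "real (K0 * N) \<le> real J" by (intro of_nat_mono) (simp add: J_def)
      then have "(\<Sum>k\<in>{1..K0}. \<Sum>u\<in>{1..N}. min_recip (real N) (\<alpha> * real (2 * (k * u)) * (real z)\<^sup>2)) \<le>
        T * (\<Sum>v\<in>{1..K0*N}. min_recip (real N) (\<alpha> * real (2 * v) * (real z)\<^sup>2))"
        using Jx by (intro sum_product_le) auto
      also have "(\<Sum>v\<in>{1..K0*N}. min_recip (real N) (\<alpha> * real (2 * v) * (real z)\<^sup>2)) = (\<Sum>v\<in>(\<lambda>v. 2 * v) ` {1..K0*N}. min_recip (real N) (\<alpha> * real v * (real z)\<^sup>2))"
        by (subst sum.reindex) (auto simp: inj_on_def)
      also have "\<dots> \<le> (\<Sum>j\<in>{1..J}. min_recip (real N) (\<alpha> * real j * (real z)\<^sup>2))"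
        by (intro sum_mono2) (auto simp: J_def)
      finally show "(\<Sum>k\<in>{1..K0}. \<Sum>u\<in>{1..N}. min_recip (real N) (\<alpha> * real (2 * (k * u)) * (real z)\<^sup>2)) \<le>
        T * (\<Sum>j\<in>{1..J}. min_recip (real N) (\<alpha> * real j * (real z)\<^sup>2))" using T_pos by (simp add: mult_left_mono)
    qed
    also have "\<dots> = T * (\<Sum>j\<in>{1..J}. \<Sum>z\<in>{Z..<2*Z}. min_recip (real N) (\<alpha> * real j * (real z)\<^sup>2))"
      unfolding sum_distrib_left[symmetric] by (rule arg_cong[OF sum.swap])
    \<comment> \<open>For \<open>H = 1\<close> the range \<open>{H..<2*H}\<close> is the single
      point 1.\<close>
    also have "\<dots> = T * phase_sum J N 1 Z" by (simp add: phase_sum_def numeral_2_eq_2)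
    also have "\<dots> \<le> T * (T^5 * (real J * real N * real 1 * real Z) * (2 * \<omega>))"
    proof (intro mult_left_mono)
      have "phase_sum J N 1 Z \<le> T^5 * (real J * real N * real 1 * real Z) * (\<omega> + 1 / N)"
        using phase_sum_bound[OF adm \<kappa>] y_ge unfolding \<omega>_def by (simp add: one_le_power)
      also have "\<dots> \<le> T^5 * (real J * real N * real 1 * real Z) * (2 * \<omega>)"
        using wN T_pos by (intro mult_left_mono) auto
      finally show "phase_sum J N 1 Z \<le> T^5 * (real J * real N * real 1 * real Z) * (2 * \<omega>)" .
    qed (use T_pos in auto)
    also have "\<dots> = 2 * T^6 * (real K0 * real Z * (real N)\<^sup>2 * (2 * \<omega>))" by (simp add: J_def eval_nat_numeral)
    finally have e2: "(\<Sum>k\<in>{1..K0}. \<Sum>z\<in>{Z..<2*Z}. \<Sum>u\<in>{1..N}. min_recip (real N) (\<alpha> * real (2 * (k * u)) * (real z)\<^sup>2))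
       \<le> 2 * T^6 * (real K0 * real Z * (real N)\<^sup>2 * (2 * \<omega>))" .
    have "real K0 * real Z * real N = real K0 * real Z * (real N)\<^sup>2 * (1 / real N)" using N1 by (simp add: power2_eq_square)
    also have "\<dots> \<le> real K0 * real Z * (real N)\<^sup>2 * (2 * \<omega>)" using wN \<omega>_pos by (intro mult_left_mono) auto
    also have "\<dots> \<le> T^6 * (real K0 * real Z * (real N)\<^sup>2 * (2 * \<omega>))" using \<omega>_pos by (intro T_grow) auto
    finally have e3: "real K0 * real Z * real N \<le> T^6 * (real K0 * real Z * (real N)\<^sup>2 * (2 * \<omega>))" .
    have "(\<Sum>t\<in>X. (B t)\<^sup>2) \<le> T * (5 * T^6 * (real K0 * real Z * (real N)\<^sup>2 * (2 * \<omega>)))"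
      using e2 e3 by (intro order_trans[OF e1] mult_left_mono) (use T_pos in auto)
    also have "\<dots> \<le> T * (T^Suc 6 * (real K0 * real Z * (real N)\<^sup>2 * (2 * \<omega>)))"
      using T_pos \<omega>_pos by (intro mult_left_mono T_absorb) auto
    finally show ?thesis by (simp add: eval_nat_numeral mult.assoc)
  qed
  have "(\<Sum>t\<in>X. B t)\<^sup>2 \<le> real (card X) * (\<Sum>t\<in>X. (B t)\<^sup>2)" by (rule sum_squared_le_card_sum_squares)
  also have "\<dots> \<le> (T * (real K0 * real Z)) * (T^8 * (real K0 * real Z * (real N)\<^sup>2 * (2 * \<omega>)))"
    using T_pos by (intro mult_mono[OF cX B2]) (auto intro: sum_nonneg)
  also have "\<dots> = 2 * T^9 * ((real K0)\<^sup>2 * (real (N * Z))\<^sup>2 * \<omega>)" by (simp add: eval_nat_numeral mult_ac)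
  also have "\<dots> \<le> 2 * T^9 * (K\<^sup>2 * (3 * x)\<^sup>2 * \<omega>)"
    using K0 NZ T_pos \<omega>_pos by (intro mult_left_mono mult_right_mono mult_mono power_mono) auto
  also have "\<dots> = 18 * T^9 * (K\<^sup>2 * x\<^sup>2 * \<omega>)" by (simp add: power2_eq_square)
  also have "\<dots> \<le> T^Suc 9 * (K\<^sup>2 * x\<^sup>2 * \<omega>)" using \<omega>_pos by (intro T_absorb) auto
  also have "\<dots> \<le> T^14 * (K\<^sup>2 * x\<^sup>2 * \<omega>)" using \<omega>_pos by (intro mult_right_mono T_power_mono) auto
  also have "\<dots> = (T^7 * K * x * sqrt \<omega>)\<^sup>2" using \<omega>_pos by (simp add: power_mult_distrib flip: power_mult)
  finally show ?thesis
    using T_pos K_ge x_ge \<omega>_pos by (intro power2_le_imp_le[of "\<Sum>t\<in>X. B t"]) auto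
qed

lemma linear_sum_bound:
  assumes pos: "1 \<le> K0" and K0: "real K0 \<le> K" "K \<le> 2 * real K0" and D: "real (D0 * M1) * y \<le> x"
    and \<kappa>: "\<kappa> * y^16 \<le> 1" and hi: "hi \<le> x"
    and cop: "\<And>d. lam d \<noteq> 0 \<Longrightarrow> coprime b (int d)"
    and c: "\<And>k. k \<in> {1..K0} \<Longrightarrow> norm (c k) \<le> T" and lam: "\<And>d. norm (lam d) \<le> T"
    and g: "\<And>m. m \<in> {1..M1} \<Longrightarrow> norm (g m) \<le> T" and w: "mono w" "0 \<le> w 0" "w Lx \<le> T"
  shows "norm (linear_sum K0 D0 M1 Lx lo hi b c lam g w) \<le> T^12 * K * x * sqrt \<omega>"
proof -
  \<comment> \<open>Abel summation needs the worst tail. From \<open>Suc Lx\<close> on all tails are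
    empty, so a finite maximum covers every \<open>t\<close>.\<close>
  define B where "B = (\<lambda>(k, d, m). Max ((\<lambda>t. norm (class_sum Lx lo hi b k d m t)) ` {..Suc Lx}))"
  define Y where "Y = {t \<in> {1..K0} \<times> {1..D0} \<times> {1..M1}. lam (fst (snd t)) \<noteq> 0}"
  have Bge: "norm (class_sum Lx lo hi b k d m t) \<le> B (k, d, m)" for k d m t
  proof (cases "t \<le> Suc Lx")
    case True
    then show ?thesis unfolding B_def by (auto intro!: Max_ge)
  next
    case False
    then have "norm (class_sum Lx lo hi b k d m t) = norm (class_sum Lx lo hi b k d m (Suc Lx))"
      by (simp add: class_sum_def)
    also have "\<dots> \<le> B (k, d, m)" unfolding B_def by (auto intro!: Max_ge)
    finally show ?thesis .
  qed
  have Bex: "\<exists>t. B (k, d, m) = norm (class_sum Lx lo hi b k d m t)" for k d m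
  proof -
    have "B (k, d, m) \<in> (\<lambda>t. norm (class_sum Lx lo hi b k d m t)) ` {..Suc Lx}"
      unfolding B_def prod.case by (rule Max_in) auto
    then show ?thesis by blast
  qed
  have B0: "0 \<le> B t" for t using Bex by (metis norm_ge_zero prod.exhaust)
  have finY: "finite Y" by (simp add: Y_def)
  have "linear_sum K0 D0 M1 Lx lo hi b c lam g w =
    (\<Sum>k\<in>{1..K0}. \<Sum>d\<in>{1..D0}. \<Sum>m\<in>{1..M1}. c k * lam d * g m *
      (\<Sum>l\<le>Lx. of_real (w l) * (if in_class lo hi b d (m*l) then e (\<alpha> * real k * (real (m*l))\<^sup>2) else 0)))"
    unfolding linear_sum_def sum_distrib_left by (intro sum.cong refl) simp
  then have "norm (linear_sum K0 D0 M1 Lx lo hi b c lam g w) = norm \<dots>" by simp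
  also have "\<dots> \<le> (\<Sum>k\<in>{1..K0}. \<Sum>d\<in>{1..D0}. \<Sum>m\<in>{1..M1}. if lam d \<noteq> 0 then T^4 * B (k, d, m) else 0)"
  proof (intro sum_norm_le)
    fix k d m assume k: "k \<in> {1..K0}" and m: "m \<in> {1..M1}"
    have "norm (\<Sum>l\<le>Lx. of_real (w l) * (if in_class lo hi b d (m*l) then e (\<alpha> * real k * (real (m*l))\<^sup>2) else 0)) \<le> w Lx * B (k, d, m)"
      using Bge[of k d m] by (intro norm_sum_monotone_weights_le w) (simp add: class_sum_def)
    also have "\<dots> \<le> T * B (k, d, m)" using w B0 by (intro mult_right_mono) auto
    finally have 1: "norm (\<Sum>l\<le>Lx. of_real (w l) * (if in_class lo hi b d (m*l) then e (\<alpha> * real k * (real (m*l))\<^sup>2) else 0)) \<le> T * B (k, d, m)" .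
    have "norm (c k * lam d * g m) \<le> T * T * T"
      unfolding norm_mult using k m T_pos by (intro mult_mono c lam g) auto
    then have "norm (c k * lam d * g m) * norm (\<Sum>l\<le>Lx. of_real (w l) * (if in_class lo hi b d (m*l) then e (\<alpha> * real k * (real (m*l))\<^sup>2) else 0))
       \<le> (T * T * T) * (T * B (k, d, m))" using 1 T_pos by (intro mult_mono) auto
    then show "norm (c k * lam d * g m * (\<Sum>l\<le>Lx. of_real (w l) * (if in_class lo hi b d (m*l) then e (\<alpha> * real k * (real (m*l))\<^sup>2) else 0)))
       \<le> (if lam d \<noteq> 0 then T^4 * B (k, d, m) else 0)"
      by (simp add: norm_mult eval_nat_numeral mult_ac)
  qed
  also have "\<dots> = (\<Sum>t\<in>{1..K0} \<times> {1..D0} \<times> {1..M1}. if lam (fst (snd t)) \<noteq> 0 then T^4 * B t else 0)"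
    by (simp only: sum.cartesian_product' fst_conv snd_conv)
  also have "\<dots> = (\<Sum>t\<in>Y. T^4 * B t)" unfolding Y_def by (rule sum.inter_filter[symmetric]) simp
  also have "\<dots> \<le> (\<Sum>t\<in>Y. \<Sum>n<I. if fst (snd t) * snd (snd t) \<in> {2^n..<2*2^n} then T^4 * B t else 0)"
  proof (intro sum_mono)
    fix t assume t: "t \<in> Y"
    obtain k d m where teq: "t = (k, d, m)" by (metis prod.exhaust)
    have dm: "1 \<le> d * m" "d * m \<le> D0 * M1" using t by (auto simp: Y_def teq intro: mult_le_mono)
    have "real (d * m) \<le> real (D0 * M1)" using dm by (intro of_nat_mono)
    also have "\<dots> \<le> x" using D y_ge mult_left_mono[of 1 y "real (D0 * M1)"] by simp
    also have "\<dots> \<le> x^12" using x_ge power_increasing[of 1 12 x] by simp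
    finally have "d * m < 2 ^ I" by (rule I_bound)
    then obtain n where n: "n < I" "2^n \<le> d * m" "d * m < 2 * 2^n" using dyadic_exponent[OF dm(1)] by blast
    then have "T^4 * B t = (if fst (snd t) * snd (snd t) \<in> {2^n..<2*2^n} then T^4 * B t else 0)" by (simp add: teq)
    also have "\<dots> \<le> (\<Sum>n<I. if fst (snd t) * snd (snd t) \<in> {2^n..<2*2^n} then T^4 * B t else 0)"
      using n B0 T_pos by (intro member_le_sum) auto
    finally show "T^4 * B t \<le> (\<Sum>n<I. if fst (snd t) * snd (snd t) \<in> {2^n..<2*2^n} then T^4 * B t else 0)" .
  qed
  also have "\<dots> = (\<Sum>n<I. \<Sum>t\<in>Y. if fst (snd t) * snd (snd t) \<in> {2^n..<2*2^n} then T^4 * B t else 0)" by (rule sum.swap)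
  also have "\<dots> = (\<Sum>n<I. T^4 * (\<Sum>t\<in>{t\<in>Y. fst (snd t) * snd (snd t) \<in> {2^n..<2*2^n}}. B t))"
    by (simp only: sum.inter_filter[OF finY, symmetric] sum_distrib_left)
  also have "\<dots> \<le> (\<Sum>n<I. T^4 * (T^7 * K * x * sqrt \<omega>))"
  proof (intro sum_mono mult_left_mono)
    fix n
    let ?X = "{t\<in>Y. fst (snd t) * snd (snd t) \<in> {2^n..<2*2^n}}"
    show "(\<Sum>t\<in>?X. B t) \<le> T^7 * K * x * sqrt \<omega>"
    proof (cases "?X = {}")
      case True
      then have "(\<Sum>t\<in>?X. B t) = 0" by (simp only: sum.empty)
      then show ?thesis using T_pos K_ge x_ge \<omega>_pos by simp
    next
      case False
      then obtain t where t: "t \<in> ?X" by blast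
      obtain k d m where teq: "t = (k, d, m)" by (metis prod.exhaust)
      have "2^n \<le> d * m" "d * m \<le> D0 * M1" using t by (auto simp: Y_def teq intro: mult_le_mono)
      then have "real (2^n) \<le> real (D0 * M1)" by (intro of_nat_mono) linarith
      then have Z: "real (2^n) * y \<le> x" using D y_ge mult_right_mono[of "real (2^n)" "real (D0 * M1)" y] by linarith
      show ?thesis
      proof (rule linear_block[OF pos _ K0 Z \<kappa> hi])
        show "\<exists>t. B (k, d, m) = norm (class_sum Lx lo hi b k d m t)" if "(k, d, m) \<in> ?X" for k d m by (rule Bex)
        show "1 \<le> d \<and> 1 \<le> m \<and> k \<in> {1..K0} \<and> d * m \<in> {2^n..<2 * 2^n} \<and> coprime b (int d)" if "(k, d, m) \<in> ?X" for k d m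
          using that cop by (auto simp: Y_def)
      qed (use finY in auto)
    qed
  qed (use T_pos in auto)
  also have "\<dots> = real I * (T^11 * K * x * sqrt \<omega>)" by (simp add: eval_nat_numeral)
  also have "\<dots> \<le> T * (T^11 * K * x * sqrt \<omega>)" using I_le T_pos K_ge x_ge \<omega>_pos by (intro mult_right_mono) auto
  finally show ?thesis by (simp add: eval_nat_numeral mult.assoc)
qed

end

section \<open>Vaughan's identity\<close>

definition moebius_mu :: "nat \<Rightarrow> real" where
  "moebius_mu n = (if squarefree n then (-1) ^ card (prime_factors n) else 0)"

lemma abs_moebius_le: "\<bar>moebius_mu n\<bar> \<le> 1"
  by (simp add: moebius_mu_def power_abs)

lemma moebius_1 [simp]: "moebius_mu (Suc 0) = 1"
  by (simp add: moebius_mu_def)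

lemma moebius_prime_mult:
  assumes "prime p" "\<not> p dvd d" "d > 0"
  shows "moebius_mu (p * d) = - moebius_mu d"
proof -
  have cop: "coprime p d" using assms by (simp add: prime_imp_coprime)
  have sq: "squarefree (p * d) \<longleftrightarrow> squarefree d"
  proof
    assume "squarefree (p * d)"
    then show "squarefree d" by (rule squarefree_mono[rotated]) simp
  next
    assume "squarefree d"
    then show "squarefree (p * d)" using cop assms by (intro squarefree_mult_coprime) (auto intro: squarefree_prime)
  qed
  have "prime_factors (p * d) = insert p (prime_factors d)"
    using assms by (subst prime_factors_product) (auto simp: prime_prime_factors)
  moreover have "p \<notin> prime_factors d" using assms by auto
  ultimately show ?thesis by (simp add: moebius_mu_def sq)
qed

lemma moebius_square_dvd:
  assumes "prime p" "p\<^sup>2 dvd d"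
  shows "moebius_mu d = 0"
  using assms by (auto simp: moebius_mu_def squarefree_def)

text \<open>For a prime \<open>p\<close> dividing \<open>n\<close>, the divisors prime to
  \<open>p\<close> are paired with their multiples by \<open>p\<close>, of opposite sign; divisors
  divisible by \<open>p^2\<close> contribute 0.\<close>

lemma sum_moebius:
  assumes "n > 0"
  shows "(\<Sum>d | d dvd n. moebius_mu d) = (if n = 1 then 1 else 0)"
proof (cases "n = 1")
  case True
  then have "{d. d dvd n} = {1}" by auto
  then show ?thesis using True by simp
next
  case False
  then obtain p where p: "prime p" "p dvd n" using prime_factor_nat by blast
  have fin: "finite {d. d dvd n}" using assms by simp
  let ?A = "{d. d dvd n \<and> \<not> p dvd d}" and ?B = "{d. d dvd n \<and> p dvd d}"
  let ?B' = "{d. d dvd n \<and> p dvd d \<and> \<not> p\<^sup>2 dvd d}"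
  have "(\<Sum>d | d dvd n. moebius_mu d) = (\<Sum>d\<in>?A. moebius_mu d) + (\<Sum>d\<in>?B. moebius_mu d)"
    using fin by (subst sum.union_disjoint[symmetric]) (auto intro!: sum.cong finite_subset[OF _ fin])
  also have "(\<Sum>d\<in>?B. moebius_mu d) = (\<Sum>d\<in>?B'. moebius_mu d)"
    using fin p by (intro sum.mono_neutral_right) (auto simp: moebius_square_dvd intro: finite_subset[OF _ fin])
  also have "\<dots> = (\<Sum>d\<in>?A. - moebius_mu d)"
  proof (rule sum.reindex_bij_witness[of _ "\<lambda>d. p * d" "\<lambda>d. d div p"])
    fix d assume d: "d \<in> ?A"
    then have "coprime p d" using p by (simp add: prime_imp_coprime)
    then show "p * d \<in> ?B'" using d p by (auto simp: divides_mult power2_eq_square)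
    show "p * d div p = d" using p by (simp add: prime_gt_0_nat)
  next
    fix d assume d: "d \<in> ?B'"
    then show "p * (d div p) = d" by simp
    have "d div p dvd n" using d by (metis (mono_tags) dvd_trans dvd_mult_div_cancel dvd_triv_right mem_Collect_eq)
    moreover have "\<not> p dvd d div p"
    proof
      assume "p dvd d div p"
      then have "p * p dvd p * (d div p)" by (intro mult_dvd_mono) auto
      moreover have "p * (d div p) = d" using d by simp
      ultimately have "p\<^sup>2 dvd d" by (simp only: power2_eq_square)
      then show False using d by simp
    qed
    ultimately show "d div p \<in> ?A" by simp
    then have "moebius_mu (p * (d div p)) = - moebius_mu (d div p)"
      using p assms by (intro moebius_prime_mult) (auto intro!: Nat.gr0I)
    then show "- moebius_mu (d div p) = moebius_mu d" using d by simp
  qed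
  finally show ?thesis using False by (simp add: sum_negf)
qed

section \<open>Rearranged sums over divisors\<close>

lemma dvd_div_swap:
  fixes m n r :: nat
  assumes "n > 0" "m dvd n" "r dvd n div m"
  shows "r dvd n" "m dvd n div r"
proof -
  obtain t where t: "n = m * t" using assms by blast
  then have "m > 0" using assms by (auto intro!: Nat.gr0I)
  then obtain u where "t = r * u" using assms t by (auto elim: dvdE)
  then have n: "n = r * (m * u)" using t by simp
  then have "r > 0" using assms by (auto intro!: Nat.gr0I)
  then show "r dvd n" "m dvd n div r" using n by auto
qed

lemma sum_divisors_swap:
  fixes n :: nat and F :: "nat \<Rightarrow> nat \<Rightarrow> 'a::comm_monoid_add"
  assumes "n > 0"
  shows "(\<Sum>m | m dvd n. \<Sum>r | r dvd n div m. F m r) = (\<Sum>r | r dvd n. \<Sum>m | m dvd n div r. F m r)"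
proof -
  have fin: "finite {d. d dvd n div m}" if "m dvd n" for m
    using assms that by (intro finite_divisors_nat) (auto elim: dvdE)
  have "(\<Sum>m | m dvd n. \<Sum>r | r dvd n div m. F m r) = (\<Sum>(m, r)\<in>(SIGMA m:{m. m dvd n}. {r. r dvd n div m}). F m r)"
    using assms fin by (subst sum.Sigma) auto
  also have "\<dots> = (\<Sum>(r, m)\<in>(SIGMA r:{r. r dvd n}. {m. m dvd n div r}). F m r)"
  proof (rule sum.reindex_bij_witness[of _ prod.swap prod.swap])
    show "prod.swap p \<in> (SIGMA r:{r. r dvd n}. {m. m dvd n div r})" if "p \<in> (SIGMA m:{m. m dvd n}. {r. r dvd n div m})" for p
      using that dvd_div_swap[OF assms] by (cases p) auto
    show "prod.swap p \<in> (SIGMA m:{m. m dvd n}. {r. r dvd n div m})" if "p \<in> (SIGMA r:{r. r dvd n}. {m. m dvd n div r})" for p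
      using that dvd_div_swap[OF assms] by (cases p) auto
  qed auto
  also have "\<dots> = (\<Sum>r | r dvd n. \<Sum>m | m dvd n div r. F m r)"
    using assms fin by (subst sum.Sigma) auto
  finally show ?thesis .
qed

text \<open>Regroups a triple convolution by the product \<open>j = m * r\<close>.\<close>

lemma sum_divisors_assoc:
  fixes n :: nat and F :: "nat \<Rightarrow> nat \<Rightarrow> 'a::comm_monoid_add"
  assumes "n > 0"
  shows "(\<Sum>m | m dvd n. \<Sum>r | r dvd n div m. F m r) = (\<Sum>j | j dvd n. \<Sum>m | m dvd j. F m (j div m))"
proof -
  have fin: "finite {d. d dvd n div m}" if "m dvd n" for m
    using assms that by (intro finite_divisors_nat) (auto elim: dvdE)
  have fin': "finite {d. d dvd m}" if "m dvd n" for m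
    using assms that by (intro finite_divisors_nat) (auto intro!: Nat.gr0I)
  have "(\<Sum>m | m dvd n. \<Sum>r | r dvd n div m. F m r) = (\<Sum>(m, r)\<in>(SIGMA m:{m. m dvd n}. {r. r dvd n div m}). F m r)"
    using assms fin by (subst sum.Sigma) auto
  also have "\<dots> = (\<Sum>(j, m)\<in>(SIGMA j:{j. j dvd n}. {m. m dvd j}). F m (j div m))"
  proof (rule sum.reindex_bij_witness[of _ "\<lambda>(j, m). (m, j div m)" "\<lambda>(m, r). (m * r, m)"])
    fix p assume p: "p \<in> (SIGMA m:{m. m dvd n}. {r. r dvd n div m})"
    obtain m r where mr: "p = (m, r)" by (cases p)
    have m: "m dvd n" "r dvd n div m" using p mr by auto
    then have "m > 0" using assms by (auto intro!: Nat.gr0I)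
    then show "(case case p of (m, r) \<Rightarrow> (m * r, m) of (j, m) \<Rightarrow> (m, j div m)) = p" by (simp add: mr)
    have "m * r dvd n" using m \<open>m > 0\<close> by (simp add: dvd_div_iff_mult mult.commute)
    then show "(case p of (m, r) \<Rightarrow> (m * r, m)) \<in> (SIGMA j:{j. j dvd n}. {m. m dvd j})" by (simp add: mr)
    show "(case case p of (m, r) \<Rightarrow> (m * r, m) of (j, m) \<Rightarrow> F m (j div m)) = (case p of (m, r) \<Rightarrow> F m r)"
      using \<open>m > 0\<close> by (simp add: mr)
  next
    fix p assume p: "p \<in> (SIGMA j:{j. j dvd n}. {m. m dvd j})"
    obtain j m where jm: "p = (j, m)" by (cases p)
    have j: "j dvd n" "m dvd j" using p jm by auto
    then show "(case case p of (j, m) \<Rightarrow> (m, j div m) of (m, r) \<Rightarrow> (m * r, m)) = p" by (simp add: jm)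
    have "m dvd n" using j by (rule dvd_trans[rotated])
    moreover have "j div m dvd n div m" using j by (intro div_dvd_div[THEN iffD2]) auto
    ultimately show "(case p of (j, m) \<Rightarrow> (m, j div m)) \<in> (SIGMA m:{m. m dvd n}. {r. r dvd n div m})" by (simp add: jm)
  qed
  also have "\<dots> = (\<Sum>j | j dvd n. \<Sum>m | m dvd j. F m (j div m))"
    using assms fin' by (subst sum.Sigma) auto
  finally show ?thesis .
qed

text \<open>The Dirichlet convolution of \<open>mangoldt\<close> and \<open>moebius_mu\<close>, both
  cut off at \<open>U\<close>.\<close>

definition vaughan_head :: "nat \<Rightarrow> nat \<Rightarrow> real" where
  "vaughan_head U j = (\<Sum>m | m dvd j. if m \<le> U \<and> j div m \<le> U then mangoldt m * moebius_mu (j div m) else 0)"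

text \<open>The Dirichlet convolution of the constant 1 with \<open>moebius_mu\<close> restricted to
  arguments above \<open>U\<close>.\<close>

definition vaughan_tail :: "nat \<Rightarrow> nat \<Rightarrow> real" where
  "vaughan_tail U l = (\<Sum>r | r dvd l. if r > U then moebius_mu r else 0)"

text \<open>As \<open>n > U\<close>, \<open>mangoldt\<close> may be restricted to arguments above
  \<open>U\<close>; convolving it with \<open>moebius_mu\<close> and 1 changes nothing. Splitting
  \<open>moebius_mu\<close> at \<open>U\<close> gives the last term; in the rest the restricted
  \<open>mangoldt\<close> is all of it minus the part up to \<open>U\<close>, and
  \<open>mangoldt\<close> convolved with 1 is \<open>ln\<close>.\<close>

lemma vaughan_identity:
  assumes "U < n"
  shows "mangoldt n = (\<Sum>m | m dvd n. if m \<le> U then moebius_mu m * ln (real (n div m)) else 0)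
     - (\<Sum>j | j dvd n. vaughan_head U j) + (\<Sum>m | m dvd n. if m > U then mangoldt m * vaughan_tail U (n div m) else 0)"
proof -
  have n: "n > 0" using assms by simp
  have fin: "finite {d. d dvd n}" using n by simp
  have fin': "finite {d. d dvd n div m}" if "m dvd n" for m
    using n that by (intro finite_divisors_nat) (auto elim: dvdE)
  have pos: "n div m > 0" if "m dvd n" for m using n that by (auto elim: dvdE)
  let ?L = "\<lambda>m. if m > U then mangoldt m else (0::real)"
  have "mangoldt n = (\<Sum>m | m dvd n. if m = n then ?L n else 0)"
    using n assms fin by (subst sum.delta) auto
  also have "\<dots> = (\<Sum>m | m dvd n. ?L m * (\<Sum>r | r dvd n div m. moebius_mu r))"
  proof (intro sum.cong refl)
    fix m assume "m \<in> {m. m dvd n}"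
    then have m: "m dvd n" by simp
    have "n div m = 1 \<longleftrightarrow> m = n" using m n by (auto elim!: dvdE)
    then show "(if m = n then ?L n else 0) = ?L m * (\<Sum>r | r dvd n div m. moebius_mu r)"
      using sum_moebius[OF pos[OF m]] by auto
  qed
  also have "\<dots> = (\<Sum>m | m dvd n. \<Sum>r | r dvd n div m. ?L m * (if r \<le> U then moebius_mu r else 0)) +
     (\<Sum>m | m dvd n. ?L m * vaughan_tail U (n div m))"
    unfolding vaughan_tail_def sum_distrib_left sum.distrib[symmetric] by (intro sum.cong refl) auto
  also have "(\<Sum>m | m dvd n. \<Sum>r | r dvd n div m. ?L m * (if r \<le> U then moebius_mu r else 0)) =
     (\<Sum>m | m dvd n. \<Sum>r | r dvd n div m. mangoldt m * (if r \<le> U then moebius_mu r else 0)) -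
     (\<Sum>m | m dvd n. \<Sum>r | r dvd n div m. if m \<le> U \<and> r \<le> U then mangoldt m * moebius_mu r else 0)"
    unfolding sum_subtractf[symmetric] by (intro sum.cong refl) auto
  also have "(\<Sum>m | m dvd n. \<Sum>r | r dvd n div m. mangoldt m * (if r \<le> U then moebius_mu r else 0)) =
     (\<Sum>r | r dvd n. \<Sum>m | m dvd n div r. mangoldt m * (if r \<le> U then moebius_mu r else 0))"
    by (rule sum_divisors_swap[OF n])
  also have "\<dots> = (\<Sum>r | r dvd n. if r \<le> U then moebius_mu r * ln (real (n div r)) else 0)"
  proof (intro sum.cong refl)
    fix r assume "r \<in> {r. r dvd n}"
    then have "(\<Sum>m | m dvd n div r. mangoldt m :: real) = ln (real (n div r))"
      using mangoldt_sum[of "n div r", where ?'a = real] pos[of r] by simp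
    then show "(\<Sum>m | m dvd n div r. mangoldt m * (if r \<le> U then moebius_mu r else 0)) = (if r \<le> U then moebius_mu r * ln (real (n div r)) else 0)"
      by (simp flip: sum_distrib_right)
  qed
  also have "(\<Sum>m | m dvd n. \<Sum>r | r dvd n div m. if m \<le> U \<and> r \<le> U then mangoldt m * moebius_mu r else 0) =
     (\<Sum>j | j dvd n. vaughan_head U j)"
    unfolding vaughan_head_def by (rule sum_divisors_assoc[OF n])
  also have "(\<Sum>m | m dvd n. ?L m * vaughan_tail U (n div m)) = (\<Sum>m | m dvd n. if m > U then mangoldt m * vaughan_tail U (n div m) else 0)"
    by (intro sum.cong refl) auto
  finally show ?thesis by simp
qed

lemma abs_vaughan_head_le:
  assumes "j > 0"
  shows "\<bar>vaughan_head U j\<bar> \<le> ln (real j)"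
proof -
  have "\<bar>vaughan_head U j\<bar> \<le> (\<Sum>m | m dvd j. \<bar>if m \<le> U \<and> j div m \<le> U then mangoldt m * moebius_mu (j div m) else 0\<bar>)"
    unfolding vaughan_head_def by (rule sum_abs)
  also have "\<dots> \<le> (\<Sum>m | m dvd j. mangoldt m)"
  proof (intro sum_mono)
    fix m
    have "mangoldt m * \<bar>moebius_mu (j div m)\<bar> \<le> mangoldt m * 1" by (intro mult_left_mono abs_moebius_le mangoldt_nonneg)
    then show "\<bar>if m \<le> U \<and> j div m \<le> U then mangoldt m * moebius_mu (j div m) else 0\<bar> \<le> mangoldt m"
      by (auto simp: abs_mult mangoldt_nonneg)
  qed
  also have "\<dots> = ln (real j)" using mangoldt_sum[of j, where ?'a = real] assms by simp
  finally show ?thesis .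
qed

lemma vaughan_head_eq_0: assumes "U * U < j" shows "vaughan_head U j = 0"
  unfolding vaughan_head_def
proof (intro sum.neutral ballI)
  fix m assume m: "m \<in> {m. m dvd j}"
  show "(if m \<le> U \<and> j div m \<le> U then mangoldt m * moebius_mu (j div m) else 0) = 0"
  proof (cases "m \<le> U \<and> j div m \<le> U")
    case True
    then have "m * (j div m) \<le> U * U" by (intro mult_le_mono) auto
    then show ?thesis using m assms by simp
  qed auto
qed

lemma abs_vaughan_tail_le: "\<bar>vaughan_tail U l\<bar> \<le> real (divisor_count l)"
proof (cases "l = 0")
  case True
  then show ?thesis by (simp add: vaughan_tail_def)
next
  case False
  have "\<bar>vaughan_tail U l\<bar> \<le> (\<Sum>r | r dvd l. \<bar>if r > U then moebius_mu r else 0\<bar>)"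
    unfolding vaughan_tail_def by (rule sum_abs)
  also have "\<dots> \<le> (\<Sum>r | r dvd l. 1)" by (intro sum_mono) (auto simp: abs_moebius_le)
  finally show ?thesis by (simp add: divisor_count_def)
qed

lemma vaughan_tail_eq_0: assumes "l \<le> U" "l > 0" shows "vaughan_tail U l = 0"
  unfolding vaughan_tail_def
proof (intro sum.neutral ballI)
  fix r assume "r \<in> {r. r dvd l}"
  then have "r \<le> U" using assms dvd_imp_le[of r l] by auto
  then show "(if r > U then moebius_mu r else 0) = 0" by simp
qed

lemma sum_divisors_double:
  fixes F :: "nat \<Rightarrow> nat \<Rightarrow> 'a::comm_monoid_add"
  assumes "\<And>n. P n \<Longrightarrow> n \<le> X"
  shows "(\<Sum>n\<in>{1..X}. if P n then \<Sum>m | m dvd n. F m (n div m) else 0) =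
     (\<Sum>m\<in>{1..X}. \<Sum>l\<in>{1..X}. if P (m * l) then F m l else 0)"
proof -
  have "(\<Sum>n\<in>{1..X}. if P n then \<Sum>m | m dvd n. F m (n div m) else 0) =
     (\<Sum>n\<in>{n\<in>{1..X}. P n}. \<Sum>m | m dvd n. F m (n div m))" by (rule sum.inter_filter[symmetric]) simp
  also have "\<dots> = (\<Sum>(n, m)\<in>(SIGMA n:{n\<in>{1..X}. P n}. {m. m dvd n}). F m (n div m))"
    by (subst sum.Sigma) auto
  also have "\<dots> = (\<Sum>(m, l)\<in>{p\<in>{1..X}\<times>{1..X}. P (fst p * snd p)}. F m l)"
  proof (rule sum.reindex_bij_witness[of _ "\<lambda>(m, l). (m * l, m)" "\<lambda>(n, m). (m, n div m)"])
    fix p assume p: "p \<in> (SIGMA n:{n\<in>{1..X}. P n}. {m. m dvd n})"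
    obtain n m where nm: "p = (n, m)" by (cases p)
    have n: "1 \<le> n" "n \<le> X" "P n" "m dvd n" using p nm by auto
    then show "(case case p of (n, m) \<Rightarrow> (m, n div m) of (m, l) \<Rightarrow> (m * l, m)) = p" by (simp add: nm)
    have "1 \<le> m" "m \<le> n" using n by (auto simp: Suc_le_eq intro!: Nat.gr0I dvd_imp_le)
    moreover have "1 \<le> n div m" "n div m \<le> n" using n \<open>m \<le> n\<close> \<open>1 \<le> m\<close> by (auto simp: Suc_le_eq div_greater_zero_iff)
    moreover have "n div m \<le> X" using n(2) div_le_dividend[of n m] by linarith
    ultimately show "(case p of (n, m) \<Rightarrow> (m, n div m)) \<in> {p\<in>{1..X}\<times>{1..X}. P (fst p * snd p)}"
      using n by (auto simp: nm)
    show "(case case p of (n, m) \<Rightarrow> (m, n div m) of (m, l) \<Rightarrow> F m l) = (case p of (n, m) \<Rightarrow> F m (n div m))" by (simp add: nm)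
  next
    fix p assume p: "p \<in> {p\<in>{1..X}\<times>{1..X}. P (fst p * snd p)}"
    obtain m l where ml: "p = (m, l)" by (cases p)
    then show "(case case p of (m, l) \<Rightarrow> (m * l, m) of (n, m) \<Rightarrow> (m, n div m)) = p" using p by auto
    show "(case p of (m, l) \<Rightarrow> (m * l, m)) \<in> (SIGMA n:{n\<in>{1..X}. P n}. {m. m dvd n})"
      using p assms[of "m * l"] ml by (auto simp: Suc_le_eq)
  qed
  also have "\<dots> = (\<Sum>p\<in>{1..X}\<times>{1..X}. if P (fst p * snd p) then F (fst p) (snd p) else 0)"
    by (subst sum.inter_filter[symmetric]) (auto simp: case_prod_beta)
  finally show ?thesis by (simp only: sum.cartesian_product' fst_conv snd_conv)
qed

lemma sum_dyadic_split:
  fixes f :: "nat \<Rightarrow> 'a::comm_monoid_add"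
  shows "(\<Sum>m\<in>{1..<2^n}. f m) = (\<Sum>i<n. \<Sum>m\<in>{2^i..<2*2^i}. f m)"
proof (induction n)
  case (Suc n)
  have "(\<Sum>m\<in>{1..<2^Suc n}. f m) = (\<Sum>m\<in>{1..<2^n}. f m) + (\<Sum>m\<in>{2^n..<2^Suc n}. f m)"
    by (rule sum.atLeastLessThan_concat[symmetric]) auto
  then show ?case using Suc by simp
qed simp

section \<open>Well-separable moduli\<close>

context minor_arc
begin

lemma ln_le_T: assumes "real n \<le> x ^ 12" shows "ln (real n) \<le> T"
proof (cases "n = 0")
  case False
  have "real n < 2 ^ I" using I_bound[OF assms] by (metis of_nat_less_iff of_nat_numeral of_nat_power)
  then have "ln (real n) \<le> ln (2 ^ I)" using False by (subst ln_le_cancel_iff) auto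
  also have "\<dots> = real I * ln 2" by (simp add: ln_realpow)
  also have "\<dots> \<le> real I * 1" using ln_2_less_1 by (intro mult_left_mono) auto
  also have "\<dots> \<le> T" using I_le by simp
  finally show ?thesis .
qed (use T_pos in simp)

definition "divisor_sum K0 Ds M L lo hi b c lam A B =
    (\<Sum>k\<in>{1..K0::nat}. \<Sum>d\<in>Ds. \<Sum>m\<in>{M..<2*M}. \<Sum>l\<in>{L..<2*L}.
      if in_class lo hi b d (m*l) then c k * lam d * A m * B l * e (\<alpha> * real k * (real (m*l))\<^sup>2) else 0)"

text \<open>\<open>fac\<close> selects one factorization per modulus, so the sum over
  \<open>d\<close> becomes a sum over pairs \<open>(h, s)\<close> without repetition. The
  alternatives in \<open>good\<close> have a common purpose: large \<open>d\<close> make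
  \<open>h * lcm s1 s2\<close> large, a small \<open>Smax\<close> bounds the lcm, and
  \<open>Hmax < 2\<close> forces \<open>H = 1\<close>.\<close>

lemma factored_sum_bound:
  fixes L M Smax K0 :: nat and Hmax :: real and fac :: "nat \<Rightarrow> nat \<times> nat"
  assumes pos: "1 \<le> L" "1 \<le> M" "1 \<le> K0" and K0: "real K0 \<le> K" "K \<le> 2 * real K0"
    and LM: "real (M * L) \<le> x" "x \<le> 8 * real (M * L)"
    and HS: "Hmax * (real Smax)^2 * y \<le> T * real M" and HM: "Hmax * real M * y \<le> T * x" and Hx: "Hmax \<le> x ^ 12"
    and \<kappa>: "\<kappa> * y^16 \<le> 1"
    and Ds: "finite Ds"
    and fac: "\<And>d. d \<in> Ds \<Longrightarrow> d = fst (fac d) * snd (fac d) \<and> 1 \<le> fst (fac d) \<and> real (fst (fac d)) \<le> Hmax \<and> snd (fac d) \<in> {1..Smax}"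
    and good: "(\<forall>d\<in>Ds. y^16 \<le> real d) \<or> (real Smax)^2 \<le> y^6 \<or> Hmax < 2"
    and cop: "\<And>d. d \<in> Ds \<Longrightarrow> coprime b (int d)"
    and c: "\<And>k. k \<in> {1..K0} \<Longrightarrow> norm (c k) \<le> T" and lam: "\<And>d. d \<in> Ds \<Longrightarrow> norm (lam d) \<le> T"
    and A: "\<And>m. m \<in> {M..<2*M} \<Longrightarrow> norm (A m) \<le> T" and B: "\<And>l. l \<in> {L..<2*L} \<Longrightarrow> norm (B l) \<le> T"
  shows "norm (divisor_sum K0 Ds M L lo hi b c lam A B) \<le> T^11 * K * x * root 4 \<omega>"
proof -
  define lam' where "lam' h s = (if h * s \<in> Ds \<and> fac (h * s) = (h, s) then lam (h * s) else 0)" for h s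
  define \<Phi> where "\<Phi> k d = (\<Sum>m\<in>{M..<2*M}. \<Sum>l\<in>{L..<2*L}.
      if in_class lo hi b d (m*l) then c k * A m * B l * e (\<alpha> * real k * (real (m*l))\<^sup>2) else 0)" for k d
  have R0: "0 \<le> T^10 * K * x * root 4 \<omega>" using T_pos K_ge x_ge \<omega>_pos by simp
  have bil: "bilinear_sum K0 H Smax M L lo hi b c lam' A B = (\<Sum>k\<in>{1..K0}. \<Sum>h\<in>{H..<2*H}. \<Sum>s\<in>{1..Smax}. lam' h s * \<Phi> k (h * s))" for H
    unfolding bilinear_sum_def \<Phi>_def sum_distrib_left by (intro sum.cong refl) auto
  have "divisor_sum K0 Ds M L lo hi b c lam A B = (\<Sum>k\<in>{1..K0}. \<Sum>d\<in>Ds. lam d * \<Phi> k d)"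
    unfolding divisor_sum_def \<Phi>_def sum_distrib_left by (intro sum.cong refl) auto
  also have "\<dots> = (\<Sum>k\<in>{1..K0}. \<Sum>h\<in>{1..<2^I}. \<Sum>s\<in>{1..Smax}. lam' h s * \<Phi> k (h * s))"
  proof (rule sum.cong[OF refl])
    fix k
    let ?Z = "{p \<in> {1..<2^I} \<times> {1..Smax}. fst p * snd p \<in> Ds \<and> fac (fst p * snd p) = p}"
    have "(\<Sum>h\<in>{1..<2^I}. \<Sum>s\<in>{1..Smax}. lam' h s * \<Phi> k (h * s)) =
       (\<Sum>p\<in>{1..<2^I} \<times> {1..Smax}. if fst p * snd p \<in> Ds \<and> fac (fst p * snd p) = p then lam (fst p * snd p) * \<Phi> k (fst p * snd p) else 0)"
      unfolding sum.cartesian_product' fst_conv snd_conv lam'_def by (intro sum.cong refl) auto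
    also have "\<dots> = (\<Sum>p\<in>?Z. lam (fst p * snd p) * \<Phi> k (fst p * snd p))"
      by (rule sum.inter_filter[symmetric]) simp
    also have "\<dots> = (\<Sum>d\<in>Ds. lam d * \<Phi> k d)"
    proof (rule sum.reindex_bij_witness[of _ fac "\<lambda>p. fst p * snd p"])
      fix d assume d: "d \<in> Ds"
      have "real (fst (fac d)) \<le> x ^ 12" using fac[OF d] Hx by linarith
      then have "fst (fac d) < 2 ^ I" by (rule I_bound)
      then show "fac d \<in> ?Z" using fac[OF d] d by (auto simp: mem_Times_iff)
      show "fst (fac d) * snd (fac d) = d" using fac[OF d] by simp
    qed auto
    finally show "(\<Sum>d\<in>Ds. lam d * \<Phi> k d) = (\<Sum>h\<in>{1..<2^I}. \<Sum>s\<in>{1..Smax}. lam' h s * \<Phi> k (h * s))" by simp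
  qed
  also have "\<dots> = (\<Sum>k\<in>{1..K0}. \<Sum>n<I. \<Sum>h\<in>{2^n..<2*2^n}. \<Sum>s\<in>{1..Smax}. lam' h s * \<Phi> k (h * s))"
    by (simp only: sum_dyadic_split)
  also have "\<dots> = (\<Sum>n<I. bilinear_sum K0 (2^n) Smax M L lo hi b c lam' A B)"
    unfolding bil by (rule sum.swap)
  finally have eq: "divisor_sum K0 Ds M L lo hi b c lam A B = \<dots>" .
  have "norm (divisor_sum K0 Ds M L lo hi b c lam A B) \<le> (\<Sum>n<I. T^10 * K * x * root 4 \<omega>)"
    unfolding eq
  proof (intro sum_norm_le)
    fix n
    let ?H = "2^n :: nat"
    show "norm (bilinear_sum K0 ?H Smax M L lo hi b c lam' A B) \<le> T^10 * K * x * root 4 \<omega>"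
    proof (cases "real ?H \<le> Hmax")
      case False
      have "lam' h s = 0" if "h \<in> {?H..<2 * ?H}" for h s
      proof (rule ccontr)
        assume "lam' h s \<noteq> 0"
        then have "h * s \<in> Ds" "fac (h * s) = (h, s)" by (auto simp: lam'_def split: if_splits)
        then have "real h \<le> Hmax" using fac[of "h * s"] by simp
        moreover have "real ?H \<le> real h" using that by (intro of_nat_mono) simp
        ultimately show False using False by linarith
      qed
      then have "bilinear_sum K0 ?H Smax M L lo hi b c lam' A B = 0" unfolding bil by (intro sum.neutral) auto
      then show ?thesis using R0 by simp
    next
      case True
      have "(norm (bilinear_sum K0 ?H Smax M L lo hi b c lam' A B))\<^sup>2 \<le> T^20 * K\<^sup>2 * x\<^sup>2 * sqrt \<omega>"
      proof (rule bilinear_sum_bound[OF _ pos K0 LM _ _ \<kappa>])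
        have "real (?H * Smax^2) * y \<le> Hmax * (real Smax)^2 * y"
          using True y_ge by (simp add: mult_right_mono)
        then show "real (?H * Smax^2) * y \<le> T * real M" using HS by linarith
        have "real (?H * M) * y \<le> Hmax * real M * y" using True y_ge by (simp add: mult_right_mono)
        then show "real (?H * M) * y \<le> T * x" using HM by linarith
        show "coprime b (int (h * s))" if "lam' h s \<noteq> 0" for h s
          using that cop[of "h * s"] by (simp add: lam'_def split: if_splits del: of_nat_mult)
        fix h s1 s2 assume h: "h \<in> {?H..<2 * ?H}" and s: "s1 \<in> {1..Smax}" "s2 \<in> {1..Smax}" and nz: "lam' h s1 \<noteq> 0" "lam' h s2 \<noteq> 0"
        have d: "h * s1 \<in> Ds" using nz(1) by (auto simp: lam'_def split: if_splits)
        have l1: "s1 \<le> lcm s1 s2" using s by (intro dvd_imp_le) (auto intro: lcm_pos_nat)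
        have l2: "lcm s1 s2 \<le> Smax^2"
        proof -
          have "lcm s1 s2 \<le> s1 * s2" using s by (intro dvd_imp_le) auto
          also have "\<dots> \<le> Smax * Smax" using s by (intro mult_le_mono) auto
          finally show ?thesis by (simp add: power2_eq_square)
        qed
        consider "\<forall>d\<in>Ds. y^16 \<le> real d" | "(real Smax)^2 \<le> y^6" | "Hmax < 2" using good by blast
        then show "real (lcm s1 s2) \<le> y^6 \<or> real ?H \<le> y^4 \<or> y^16 \<le> real h * real (lcm s1 s2)"
        proof cases
          case 1
          then have "y^16 \<le> real (h * s1)" using d by blast
          also have "\<dots> \<le> real (h * lcm s1 s2)" using l1 by (intro of_nat_mono mult_le_mono2)
          finally show ?thesis by simp
        next
          case 2
          have "real (lcm s1 s2) \<le> real (Smax^2)" using l2 by (rule of_nat_mono)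
          also have "\<dots> \<le> y^6" using 2 by simp
          finally show ?thesis by blast
        next
          case 3
          then have "real ?H < real 2" using True by simp
          then have "?H < 2" by (simp only: of_nat_less_iff)
          then have "?H \<le> 1" by linarith
          then have "real ?H \<le> real 1" by (rule of_nat_mono)
          also have "\<dots> \<le> y^4" using one_le_power[OF y_ge, of 4] by simp
          finally show ?thesis by simp
        qed
      qed (use c lam A B T_pos in \<open>auto simp: lam'_def split: if_splits\<close>)
      also have "\<dots> = (T^10 * K * x * root 4 \<omega>)\<^sup>2"
      proof -
        have "(root 4 \<omega>)\<^sup>2 = sqrt \<omega>"
        proof -
          have "root 4 \<omega> = root 2 (root 2 \<omega>)" using real_root_mult_exp[of 2 2 \<omega>] by simp
          then have "root 4 \<omega> = sqrt (sqrt \<omega>)" by (simp add: sqrt_def)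
          then show ?thesis using \<omega>_pos by simp
        qed
        then show ?thesis by (simp add: power_mult_distrib flip: power_mult)
      qed
      finally show ?thesis using R0 by (rule power2_le_imp_le)
    qed
  qed
  also have "\<dots> = real I * (T^10 * K * x * root 4 \<omega>)" by simp
  also have "\<dots> \<le> T * (T^10 * K * x * root 4 \<omega>)" using I_le R0 by (intro mult_right_mono) auto
  finally show ?thesis by (simp add: eval_nat_numeral mult.assoc)
qed

lemma divisor_sum_union:
  assumes "finite D1" "finite D2" "D1 \<inter> D2 = {}"
  shows "divisor_sum K0 (D1 \<union> D2) M L lo hi b c lam A B = divisor_sum K0 D1 M L lo hi b c lam A B + divisor_sum K0 D2 M L lo hi b c lam A B"
  unfolding divisor_sum_def using assms by (simp add: sum.union_disjoint sum.distrib)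

text \<open>For \<open>d \<ge> y ^ 16\<close> the factorization \<open>d = h * s\<close> comes from well-separability, with \<open>S\<close> as small as the
  diagonal terms allow. If \<open>y\<close> is so small that the resulting \<open>S\<close> may exceed \<open>y ^ 3\<close>, the small \<open>d\<close> are
  factored trivially as \<open>d * 1\<close> or \<open>1 * d\<close>, depending on the size of \<open>M\<close>.\<close>

lemma divisor_sum_bound:
  fixes L M K0 :: nat and D :: real
  assumes pos: "1 \<le> L" "1 \<le> M" "1 \<le> K0" and K0: "real K0 \<le> K" "K \<le> 2 * real K0"
    and LM: "real (M * L) \<le> x" "x \<le> 8 * real (M * L)" and ord: "L \<le> M" and M_le: "real M \<le> 2 * x powr (2/3)"
    and D: "D * y^8 \<le> sqrt x" and y50: "y^50 \<le> x \<or> 2 * x powr (1/6) \<le> y^10" and x23: "2 * x powr (2/3) * y \<le> x"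
    and \<kappa>: "\<kappa> * y^16 \<le> 1"
    and Ds: "finite Ds" "\<And>d. d \<in> Ds \<Longrightarrow> 1 \<le> d \<and> real d \<le> D \<and> well_separable D d \<and> coprime b (int d)"
    and c: "\<And>k. k \<in> {1..K0} \<Longrightarrow> norm (c k) \<le> T" and lam: "\<And>d. d \<in> Ds \<Longrightarrow> norm (lam d) \<le> T"
    and A: "\<And>m. m \<in> {M..<2*M} \<Longrightarrow> norm (A m) \<le> T" and B: "\<And>l. l \<in> {L..<2*L} \<Longrightarrow> norm (B l) \<le> T"
  shows "norm (divisor_sum K0 Ds M L lo hi b c lam A B) \<le> T^12 * K * x * root 4 \<omega>"
proof (cases "Ds = {}")
  case True
  then show ?thesis using T_pos K_ge x_ge \<omega>_pos by (simp add: divisor_sum_def)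
next
  case False
  have y0: "0 < y" "1 \<le> y" using y_ge by auto
  have x0: "0 < x" using x_ge by simp
  have D1: "1 \<le> D"
  proof -
    obtain d where "d \<in> Ds" using False by blast
    then have "1 \<le> real d" "real d \<le> D" using Ds(2) by (auto simp: Suc_le_eq)
    then show ?thesis by linarith
  qed
  have ypow: "1 \<le> y ^ k" for k using y0 by (simp add: one_le_power)
  have M0: "0 < real M" using pos by simp
  have My: "real M * y \<le> x"
    using mult_right_mono[OF M_le, of y] y0 x23 by linarith
  \<comment> \<open>The longer variable is of size at least about \<open>sqrt x\<close>, as
    \<open>M^2 \<ge> M * L \<ge> x / 8\<close>.\<close>
  have sqx: "sqrt x \<le> 3 * real M"
  proof (rule real_le_lsqrt)
    have "real (M * L) \<le> real (M * M)" using ord by (intro of_nat_mono mult_le_mono2)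
    then have "x \<le> 8 * (real M)\<^sup>2" using LM(2) by (simp add: power2_eq_square)
    also have "\<dots> \<le> 9 * (real M)\<^sup>2" by simp
    also have "\<dots> = (3 * real M)\<^sup>2" by (simp add: power_mult_distrib)
    finally show "x \<le> (3 * real M)\<^sup>2" .
  qed (use x0 in auto)
  have D2: "D^2 * y^16 \<le> x"
  proof -
    have "(D * y^8)^2 \<le> (sqrt x)^2" using D D1 y0 by (intro power_mono) auto
    then show ?thesis using x0 by (simp add: power_mult_distrib flip: power_mult)
  qed
  \<comment> \<open>The least \<open>S \<ge> 1\<close> for which \<open>H = D / S\<close> satisfies
    \<open>H * M * y \<le> x\<close>. The other demand,
    \<open>H * S^2 * y = D * y * S \<le> 3 * M\<close>, then follows from
    \<open>D^2 * y^2 \<le> x\<close>, or from \<open>D * y \<le> sqrt x\<close> when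
    \<open>S = 1\<close>.\<close>
  define S where "S = max 1 (D * real M * y / x)"
  define H where "H = D / S"
  have S1: "1 \<le> S" "D * real M * y \<le> S * x"
    using x0 by (auto simp: S_def divide_le_eq[symmetric] max_def)
  have SD: "S \<le> D"
  proof -
    have "D * (real M * y) \<le> D * x" using My D1 by (intro mult_left_mono) auto
    then have "D * real M * y / x \<le> D" using x0 by (simp add: field_simps)
    then show ?thesis using D1 by (simp add: S_def)
  qed
  have H1: "1 \<le> H" "H * S = D" using S1 SD by (auto simp: H_def field_simps)
  define Smax where "Smax = nat \<lfloor>S\<rfloor>"
  have Smax: "real Smax \<le> S" "\<And>s::nat. real s \<le> S \<Longrightarrow> s \<le> Smax"
    using S1 by (auto simp: Smax_def le_nat_floor)
  have "\<exists>p. d = fst p * snd p \<and> real (fst p) \<le> H \<and> real (snd p) \<le> S" if d: "d \<in> Ds" for d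
    using Ds(2)[OF d] H1 S1(1) unfolding well_separable_def by (metis fst_conv snd_conv)
  then obtain fac where fac: "\<And>d. d \<in> Ds \<Longrightarrow> d = fst (fac d) * snd (fac d) \<and> real (fst (fac d)) \<le> H \<and> real (snd (fac d)) \<le> S"
    by metis
  have fac': "d = fst (fac d) * snd (fac d) \<and> 1 \<le> fst (fac d) \<and> real (fst (fac d)) \<le> H \<and> snd (fac d) \<in> {1..Smax}" if d: "d \<in> Ds" for d
  proof -
    have "0 < fst (fac d) * snd (fac d)" using fac[OF d] Ds(2)[OF d] by simp
    then have "1 \<le> fst (fac d)" "1 \<le> snd (fac d)" by auto
    then show ?thesis using fac[OF d] Smax(2) by simp
  qed
  have HS: "H * (real Smax)^2 * y \<le> T * real M"
  proof -
    have "H * (real Smax)^2 * y \<le> H * S^2 * y"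
      using Smax(1) H1 y0 by (intro mult_right_mono mult_left_mono power_mono) auto
    also have "\<dots> = D * y * S" using H1(2) by (simp add: power2_eq_square)
    also have "\<dots> \<le> 3 * real M"
    proof (cases "D * real M * y / x \<le> 1")
      case True
      then have "S = 1" by (simp add: S_def)
      moreover have "D * y \<le> D * y^8" using D1 y0 power_increasing[of 1 8 y] by (intro mult_left_mono) auto
      ultimately show ?thesis using D sqx by simp
    next
      case False
      then have "D * y * S = (D^2 * y^2) * real M / x" by (simp add: S_def power2_eq_square)
      also have "\<dots> \<le> x * real M / x"
      proof (intro divide_right_mono mult_right_mono)
        have "D^2 * y^2 \<le> D^2 * y^16" using y0 by (intro mult_left_mono power_increasing) auto
        then show "D^2 * y^2 \<le> x" using D2 by linarith
      qed (use x0 in auto)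
      also have "\<dots> = real M" using x0 by simp
      finally show ?thesis by simp
    qed
    also have "\<dots> \<le> T * real M" using T_ge by (intro mult_right_mono) auto
    finally show ?thesis .
  qed
  have Tx: "x \<le> T * x" using T_pos x0 mult_right_mono[of 1 T x] by simp
  have HM: "H * real M * y \<le> T * x"
  proof -
    have "H * real M * y * S = D * real M * y" using H1(2) by (simp add: mult_ac)
    also have "\<dots> \<le> x * S" using S1(2) by (simp add: mult.commute)
    finally have "H * real M * y \<le> x" using S1(1) by simp
    then show ?thesis using Tx by linarith
  qed
  have x12: "x \<le> x ^ 12" using x_ge power_increasing[of 1 12 x] by simp
  have sqx_le: "sqrt x \<le> x" using x_ge real_sqrt_le_mono[of x "x * x"] by simp
  have Dx: "D \<le> x"
  proof -
    have "D * 1 \<le> D * y^8" using D1 ypow by (intro mult_left_mono) auto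
    then show ?thesis using D sqx_le by linarith
  qed
  have "H \<le> D" using S1 D1 by (simp add: H_def divide_le_eq mult_left_mono[of 1 S D, simplified])
  then have Hx: "H \<le> x ^ 12" using Dx x12 by linarith
  note general = factored_sum_bound[OF pos K0 LM _ _ _ \<kappa> _ _ _ _ c _ A B]
  let ?R = "T^11 * K * x * root 4 \<omega>"
  have R0: "0 \<le> ?R" using T_pos K_ge x_ge \<omega>_pos by simp
  have sep: "norm (divisor_sum K0 D' M L lo hi b c lam A B) \<le> ?R"
    if "D' \<subseteq> Ds" "(\<forall>d\<in>D'. y^16 \<le> real d) \<or> (real Smax)^2 \<le> y^6" for D'
  proof (rule general[where fac = fac and Hmax = H and Smax = Smax])
    show "(\<forall>d\<in>D'. y^16 \<le> real d) \<or> (real Smax)^2 \<le> y^6 \<or> H < 2" using that(2) by blast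
    show "d = fst (fac d) * snd (fac d) \<and> 1 \<le> fst (fac d) \<and> real (fst (fac d)) \<le> H \<and> snd (fac d) \<in> {1..Smax}" if "d \<in> D'" for d
      using fac'[of d] that \<open>D' \<subseteq> Ds\<close> by blast
  qed (use that Ds lam HS HM Hx finite_subset in auto)
  have "norm (divisor_sum K0 Ds M L lo hi b c lam A B) \<le> 2 * ?R"
    using y50
  proof
    assume y10: "2 * x powr (1/6) \<le> y^10"
    \<comment> \<open>\<open>D * y^8 \<le> sqrt x\<close> and
      \<open>M \<le> 2 * x powr (2/3)\<close> bound \<open>(D * M * y / x) * y^7\<close> by
      \<open>2 * x powr (1/6) \<le> y^10\<close>. Then every lcm is at most \<open>y^6\<close>,
      whatever the size of \<open>d\<close>.\<close>
    have "S \<le> y^3"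
    proof -
      have "D * real M * y / x \<le> y^3"
      proof -
        have "(D * real M * y / x) * y^7 = (D * y^8) * real M / x" by (simp add: eval_nat_numeral)
        also have "\<dots> \<le> sqrt x * (2 * x powr (2/3)) / x"
          using D M_le D1 y0 x0 by (intro divide_right_mono mult_mono) auto
        also have "\<dots> = 2 * x powr (1/6)"
        proof -
          have "sqrt x * x powr (2/3) = x powr (7/6)"
            using x0 by (simp add: powr_half_sqrt[symmetric] flip: powr_add)
          also have "\<dots> = x powr (1/6) * x"
            using x0 powr_mult_base[of x "1/6"] by (simp add: mult.commute)
          finally have "sqrt x * x powr (2/3) = x powr (1/6) * x" .
          then show ?thesis using x0 by (simp add: field_simps)
        qed
        also have "\<dots> \<le> y^3 * y^7" using y10 by (simp flip: power_add)
        finally show ?thesis using y0 by (simp only: mult_le_cancel_right_pos zero_less_power)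
      qed
      then show ?thesis using ypow[of 3] by (simp add: S_def)
    qed
    then have "(real Smax)^2 \<le> (y^3)^2" using Smax(1) by (intro power_mono) auto
    then have "(real Smax)^2 \<le> y^6" by (simp flip: power_mult)
    then show ?thesis using sep[of Ds] R0 by simp
  next
    assume y50: "y^50 \<le> x"
    define D1 where "D1 = {d \<in> Ds. y^16 \<le> real d}"
    define D2 where "D2 = {d \<in> Ds. real d < y^16}"
    have split: "Ds = D1 \<union> D2" "D1 \<inter> D2 = {}" by (auto simp: D1_def D2_def)
    have fin: "finite D1" "finite D2" using Ds(1) by (auto simp: D1_def D2_def)
    have n1: "norm (divisor_sum K0 D1 M L lo hi b c lam A B) \<le> ?R"
      by (rule sep) (auto simp: D1_def)
    have y16x: "y^16 \<le> x ^ 12"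
    proof -
      have "y^16 \<le> y^50" using y0 by (intro power_increasing) auto
      then show ?thesis using y50 x12 by linarith
    qed
    have n2: "norm (divisor_sum K0 D2 M L lo hi b c lam A B) \<le> ?R"
    \<comment> \<open>If \<open>d * 1\<close> violates the diagonal demand, then
      \<open>M > x / y^17 \<ge> y^33\<close>, exactly what \<open>1 * d\<close> with
      \<open>Smax\<close> near \<open>y^16\<close> requires; this is the origin of
      \<open>y^50 \<le> x\<close>.\<close>
    proof (cases "y^16 * real M * y \<le> x")
      case True
      show ?thesis
      proof (rule general[where fac = "\<lambda>d. (d, 1)" and Hmax = "y^16" and Smax = 1])
        have "y^17 \<le> y^25" using y0 by (intro power_increasing) auto
        also have "y^25 \<le> sqrt x" using y50 by (intro real_le_rsqrt) (simp flip: power_mult)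
        also have "\<dots> \<le> 3 * real M" by (rule sqx)
        also have "\<dots> \<le> T * real M" using T_ge by (intro mult_right_mono) auto
        finally show "y^16 * (real 1)\<^sup>2 * y \<le> T * real M" by (simp add: eval_nat_numeral)
        show "y^16 * real M * y \<le> T * x" using True Tx by linarith
      qed (use Ds lam D2_def fin y16x ypow in auto)
    next
      case False
      show ?thesis
      proof (rule general[where fac = "\<lambda>d. (1::nat, d)" and Hmax = 1 and Smax = "nat \<lfloor>y^16\<rfloor>"])
        have "(real (nat \<lfloor>y^16\<rfloor>))\<^sup>2 \<le> (y^16)\<^sup>2" using ypow[of 16] by (intro power_mono) auto
        then have "1 * (real (nat \<lfloor>y^16\<rfloor>))\<^sup>2 * y \<le> y^32 * y" using y0 by (simp add: mult_right_mono flip: power_mult)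
        also have "\<dots> = y^33" by (simp add: eval_nat_numeral)
        also have "\<dots> \<le> real M"
        proof -
          have "y^33 * y^17 \<le> real M * y^17"
            using False y50 by (simp add: eval_nat_numeral mult_ac)
          then show ?thesis using y0 by (simp only: mult_le_cancel_right_pos zero_less_power)
        qed
        also have "\<dots> \<le> T * real M" using T_pos M0 mult_right_mono[of 1 T "real M"] by simp
        finally show "1 * (real (nat \<lfloor>y^16\<rfloor>))\<^sup>2 * y \<le> T * real M" .
        show "1 * real M * y \<le> T * x" using My Tx by linarith
        show "d = fst (1::nat, d) * snd (1::nat, d) \<and> 1 \<le> fst (1::nat, d) \<and> real (fst (1::nat, d)) \<le> 1 \<and> snd (1::nat, d) \<in> {1..nat \<lfloor>y^16\<rfloor>}" if "d \<in> D2" for d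
          using that Ds(2)[of d] le_nat_floor[of d "y^16"] by (auto simp: D2_def)
      qed (use Ds lam D2_def fin x12 x_ge in auto)
    qed
    have "norm (divisor_sum K0 Ds M L lo hi b c lam A B) \<le>
       norm (divisor_sum K0 D1 M L lo hi b c lam A B) + norm (divisor_sum K0 D2 M L lo hi b c lam A B)"
      unfolding split(1) divisor_sum_union[OF fin split(2)] by (rule norm_triangle_ineq)
    then show ?thesis using n1 n2 by linarith
  qed
  also have "\<dots> = 2 * T^11 * (K * x * root 4 \<omega>)" by simp
  also have "\<dots> \<le> T^Suc 11 * (K * x * root 4 \<omega>)" using K_ge x_ge \<omega>_pos by (intro T_absorb) auto
  finally show ?thesis by (simp add: mult.assoc)
qed

end

section \<open>From dyadic blocks to sums over primes\<close>

lemma norm_four_terms: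
  fixes u :: "'a::real_normed_vector"
  shows "norm (u - v - w + z) \<le> norm u + norm v + norm w + norm z"
  using norm_triangle_ineq[of "u - v - w" z] norm_triangle_ineq4[of "u - v" w] norm_triangle_ineq4[of u v]
  by linarith

context minor_arc
begin

lemma divisor_sum_swap:
  "divisor_sum K0 Ds M L lo hi b c lam A B = divisor_sum K0 Ds L M lo hi b c lam B A"
  unfolding divisor_sum_def
proof (rule sum.cong[OF refl], rule sum.cong[OF refl], rule trans[OF sum.swap], rule sum.cong[OF refl], rule sum.cong[OF refl])
  fix k d l m
  show "(if in_class lo hi b d (m * l) then c k * lam d * A m * B l * e (\<alpha> * real k * (real (m * l))\<^sup>2) else 0) =
     (if in_class lo hi b d (l * m) then c k * lam d * B l * A m * e (\<alpha> * real k * (real (l * m))\<^sup>2) else 0)"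
    by (simp add: mult.commute mult.left_commute)
qed

text \<open>On a dyadic block that meets the window, \<open>M * L\<close> is within a factor 8 of
  \<open>x\<close>. The longer variable is the one to be summed over progressions, so the roles of
  \<open>m\<close> and \<open>l\<close> are exchanged where necessary.\<close>

lemma full_bilinear_bound:
  fixes K0 X :: nat and D :: real
  assumes pos: "1 \<le> K0" and K0: "real K0 \<le> K" "K \<le> 2 * real K0"
    and D: "D * y^8 \<le> sqrt x" and y50: "y^50 \<le> x \<or> 2 * x powr (1/6) \<le> y^10" and x23: "2 * x powr (2/3) * y \<le> x"
    and \<kappa>: "\<kappa> * y^16 \<le> 1"
    and Ds: "finite Ds" "\<And>d. d \<in> Ds \<Longrightarrow> 1 \<le> d \<and> real d \<le> D \<and> well_separable D d \<and> coprime b (int d)"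
    and c: "\<And>k. k \<in> {1..K0} \<Longrightarrow> norm (c k) \<le> T" and lam: "\<And>d. d \<in> Ds \<Longrightarrow> norm (lam d) \<le> T"
    and A: "\<And>m. 1 \<le> m \<Longrightarrow> real m \<le> x^12 \<Longrightarrow> norm (A m) \<le> T" and B: "\<And>l. 1 \<le> l \<Longrightarrow> real l \<le> x^12 \<Longrightarrow> norm (B l) \<le> T"
    and X: "x < real X + 1" "real X \<le> x"
    and supp: "\<And>m l. A m \<noteq> 0 \<Longrightarrow> B l \<noteq> 0 \<Longrightarrow> x / 2 \<le> real (m * l) \<Longrightarrow> real (m * l) < x \<Longrightarrow>
       real m \<le> 2 * x powr (2/3) \<and> real l \<le> 2 * x powr (2/3)"
  shows "norm (\<Sum>k\<in>{1..K0}. \<Sum>d\<in>Ds. \<Sum>m\<in>{1..X}. \<Sum>l\<in>{1..X}.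
      if in_class (x/2) x b d (m*l) then c k * lam d * A m * B l * e (\<alpha> * real k * (real (m*l))\<^sup>2) else 0) \<le> T^14 * K * x * root 4 \<omega>"
proof -
  let ?f = "\<lambda>k d m l. if in_class (x/2) x b d (m*l) then c k * lam d * A m * B l * e (\<alpha> * real k * (real (m*l))\<^sup>2) else 0"
  have R0: "0 \<le> T^12 * K * x * root 4 \<omega>" using T_pos K_ge x_ge \<omega>_pos by simp
  have x12: "x \<le> x ^ 12" using x_ge power_increasing[of 1 12 x] by simp
  have "real X \<le> x ^ 12" using X(2) x12 by linarith
  then have XI: "X < 2 ^ I" by (rule I_bound)
  have "(\<Sum>k\<in>{1..K0}. \<Sum>d\<in>Ds. \<Sum>m\<in>{1..X}. \<Sum>l\<in>{1..X}. ?f k d m l) =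
     (\<Sum>k\<in>{1..K0}. \<Sum>d\<in>Ds. \<Sum>m\<in>{1..<2^I}. \<Sum>l\<in>{1..<2^I}. ?f k d m l)"
  proof (rule sum.cong[OF refl], rule sum.cong[OF refl])
    fix k d
    \<comment> \<open>Since \<open>X + 1 > x\<close>, a product with a factor beyond
      \<open>X\<close> leaves the window, and both ranges may be padded up to a power of
      two.\<close>
    have z: "?f k d m l = 0" if "1 \<le> m" "1 \<le> l" "X < m \<or> X < l" for m l
    proof -
      have "1 * l \<le> m * l" "m * 1 \<le> m * l" using that by (intro mult_le_mono; simp)+
      then have "X + 1 \<le> m * l" using that by linarith
      then have "real (X + 1) \<le> real (m * l)" by (rule of_nat_mono)
      then have "\<not> real (m * l) < x" using X(1) by simp
      then show ?thesis by (simp add: in_class_def)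
    qed
    have "(\<Sum>m\<in>{1..X}. \<Sum>l\<in>{1..X}. ?f k d m l) = (\<Sum>p\<in>{1..X} \<times> {1..X}. ?f k d (fst p) (snd p))"
      by (simp only: sum.cartesian_product' fst_conv snd_conv)
    also have "\<dots> = (\<Sum>p\<in>{1..<2^I} \<times> {1..<2^I}. ?f k d (fst p) (snd p))"
    proof (rule sum.mono_neutral_left)
      show "{1..X} \<times> {1..X} \<subseteq> {1..<2^I} \<times> {1..<2^I}" using XI by auto
      show "\<forall>p\<in>{1..<2^I} \<times> {1..<2^I} - {1..X} \<times> {1..X}. ?f k d (fst p) (snd p) = 0"
      proof
        fix p assume p: "p \<in> {1..<2^I} \<times> {1..<2^I} - {1..X} \<times> {1..X}"
        have "1 \<le> fst p" "1 \<le> snd p" "X < fst p \<or> X < snd p" using p by (auto simp: mem_Times_iff)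
        then show "?f k d (fst p) (snd p) = 0" by (rule z)
      qed
    qed simp
    also have "\<dots> = (\<Sum>m\<in>{1..<2^I}. \<Sum>l\<in>{1..<2^I}. ?f k d m l)"
      by (simp only: sum.cartesian_product' fst_conv snd_conv)
    finally show "(\<Sum>m\<in>{1..X}. \<Sum>l\<in>{1..X}. ?f k d m l) = (\<Sum>m\<in>{1..<2^I}. \<Sum>l\<in>{1..<2^I}. ?f k d m l)" .
  qed
  also have "\<dots> = (\<Sum>k\<in>{1..K0}. \<Sum>d\<in>Ds. \<Sum>i<I. \<Sum>m\<in>{2^i..<2*2^i}. \<Sum>j<I. \<Sum>l\<in>{2^j..<2*2^j}. ?f k d m l)"
    by (simp only: sum_dyadic_split)
  also have "\<dots> = (\<Sum>k\<in>{1..K0}. \<Sum>d\<in>Ds. \<Sum>i<I. \<Sum>j<I. \<Sum>m\<in>{2^i..<2*2^i}. \<Sum>l\<in>{2^j..<2*2^j}. ?f k d m l)"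
    by (intro sum.cong[OF refl] sum.swap)
  also have "\<dots> = (\<Sum>p\<in>{1..K0} \<times> Ds. \<Sum>q\<in>{..<I} \<times> {..<I}. \<Sum>m\<in>{2^fst q..<2*2^fst q}. \<Sum>l\<in>{2^snd q..<2*2^snd q}. ?f (fst p) (snd p) m l)"
    by (simp only: sum.cartesian_product' fst_conv snd_conv)
  also have "\<dots> = (\<Sum>q\<in>{..<I} \<times> {..<I}. \<Sum>p\<in>{1..K0} \<times> Ds. \<Sum>m\<in>{2^fst q..<2*2^fst q}. \<Sum>l\<in>{2^snd q..<2*2^snd q}. ?f (fst p) (snd p) m l)"
    by (rule sum.swap)
  also have "\<dots> = (\<Sum>q\<in>{..<I} \<times> {..<I}. divisor_sum K0 Ds (2^fst q) (2^snd q) (x/2) x b c lam A B)"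
    unfolding divisor_sum_def by (simp only: sum.cartesian_product' fst_conv snd_conv)
  finally have eq: "(\<Sum>k\<in>{1..K0}. \<Sum>d\<in>Ds. \<Sum>m\<in>{1..X}. \<Sum>l\<in>{1..X}. ?f k d m l) = \<dots>" .
  have "norm (\<Sum>q\<in>{..<I} \<times> {..<I}. divisor_sum K0 Ds (2^fst q) (2^snd q) (x/2) x b c lam A B) \<le>
     (\<Sum>q\<in>{..<I} \<times> {..<I}. T^12 * K * x * root 4 \<omega>)"
  proof (intro sum_norm_le)
    fix q :: "nat \<times> nat"
    let ?M = "2^fst q :: nat" and ?L = "2^snd q :: nat"
    show "norm (divisor_sum K0 Ds ?M ?L (x/2) x b c lam A B) \<le> T^12 * K * x * root 4 \<omega>"
    \<comment> \<open>Blocks without a contributing pair vanish; in the others one pair yields all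
      size conditions through \<open>supp\<close>.\<close>
    proof (cases "\<exists>m\<in>{?M..<2*?M}. \<exists>l\<in>{?L..<2*?L}. A m \<noteq> 0 \<and> B l \<noteq> 0 \<and> x / 2 \<le> real (m * l) \<and> real (m * l) < x")
      case False
      then have "divisor_sum K0 Ds ?M ?L (x/2) x b c lam A B = 0"
        unfolding divisor_sum_def
      proof (intro sum.neutral ballI)
        fix k d m l assume "m \<in> {?M..<2*?M}" "l \<in> {?L..<2*?L}"
        then have "\<not> (A m \<noteq> 0 \<and> B l \<noteq> 0 \<and> x / 2 \<le> real (m * l) \<and> real (m * l) < x)" using False by blast
        then show "?f k d m l = 0" by (auto simp: in_class_def simp del: of_nat_mult)
      qed
      then show ?thesis using R0 by simp
    next
      case True
      then obtain m l where ml: "m \<in> {?M..<2*?M}" "l \<in> {?L..<2*?L}" and nz: "A m \<noteq> 0" "B l \<noteq> 0" and r: "x / 2 \<le> real (m * l)" "real (m * l) < x" by blast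
      have "?M * ?L \<le> m * l" using ml by (intro mult_le_mono) auto
      then have LM1: "real (?M * ?L) \<le> x" using r(2) of_nat_mono[of "?M * ?L" "m * l", where ?'a = real] by linarith
      have "m * l \<le> (2 * ?M) * (2 * ?L)" using ml by (intro mult_le_mono) auto
      then have "real (m * l) \<le> real ((2 * ?M) * (2 * ?L))" by (rule of_nat_mono)
      then have LM2: "x \<le> 8 * real (?M * ?L)" using r(1) by simp
      have sz: "real ?M \<le> 2 * x powr (2/3)" "real ?L \<le> 2 * x powr (2/3)"
      proof -
        have "real ?M \<le> real m" using ml by (intro of_nat_mono) simp
        then show "real ?M \<le> 2 * x powr (2/3)" using supp[OF nz r] by linarith
        have "real ?L \<le> real l" using ml by (intro of_nat_mono) simp
        then show "real ?L \<le> 2 * x powr (2/3)" using supp[OF nz r] by linarith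
      qed
      have big: "real (2 * ?M) \<le> x^12" "real (2 * ?L) \<le> x^12"
      proof -
        have "?M * 1 \<le> ?M * ?L" "1 * ?L \<le> ?M * ?L" by (intro mult_le_mono; simp)+
        then have "real ?M \<le> real (?M * ?L)" "real ?L \<le> real (?M * ?L)" by (intro of_nat_mono; simp)+
        then have "real ?M \<le> x" "real ?L \<le> x" using LM1 by linarith+
        moreover have "2 * x \<le> x^12"
        proof -
          have "2 * x \<le> x * x" using x_ge by (intro mult_right_mono) auto
          also have "\<dots> \<le> x^12" using x_ge power_increasing[of 2 12 x] by (simp add: power2_eq_square)
          finally show ?thesis .
        qed
        ultimately show "real (2 * ?M) \<le> x^12" "real (2 * ?L) \<le> x^12" by simp_all
      qed
      have A': "norm (A i) \<le> T" if i: "i \<in> {?M..<2 * ?M}" for i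
      proof -
        have "real i \<le> real (2 * ?M)" using i by (intro of_nat_mono) simp
        moreover have "1 \<le> i" using i by (metis atLeastLessThan_iff le_trans one_le_power one_le_numeral)
        ultimately show ?thesis using big by (intro A) linarith+
      qed
      have B': "norm (B i) \<le> T" if i: "i \<in> {?L..<2 * ?L}" for i
      proof -
        have "real i \<le> real (2 * ?L)" using i by (intro of_nat_mono) simp
        moreover have "1 \<le> i" using i by (metis atLeastLessThan_iff le_trans one_le_power one_le_numeral)
        ultimately show ?thesis using big by (intro B) linarith+
      qed
      show ?thesis
      proof (cases "?L \<le> ?M")
        case True
        show ?thesis
          by (rule divisor_sum_bound[OF _ _ pos K0 LM1 LM2 True sz(1) D y50 x23 \<kappa> Ds c lam A' B']) auto
      next
        case False
        then have le: "?M \<le> ?L" by simp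
        show ?thesis unfolding divisor_sum_swap[of K0 Ds ?M ?L]
          by (rule divisor_sum_bound[OF _ _ pos K0 _ _ le sz(2) D y50 x23 \<kappa> Ds c lam B' A'])
             (use LM1 LM2 in \<open>auto simp: mult.commute\<close>)
      qed
    qed
  qed
  also have "\<dots> = (real I * real I) * (T^12 * K * x * root 4 \<omega>)" by (simp add: card_cartesian_product)
  also have "\<dots> \<le> (T * T) * (T^12 * K * x * root 4 \<omega>)"
    using I_le R0 T_pos by (intro mult_right_mono mult_mono) auto
  finally show ?thesis unfolding eq by (simp add: eval_nat_numeral mult.assoc)
qed

text \<open>In Vaughan's identity \<open>U\<close> is near \<open>x powr (1/3)\<close>. The head
  lives on \<open>m \<le> U^2\<close>, in general too long for a linear sum; its part beyond
  \<open>U\<close> is treated as bilinear with constant second coefficient, which keeps both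
  variables below \<open>2 * x powr (2/3)\<close>.\<close>

lemma one_sided_bound:
  fixes K0 X D0 :: nat and D :: real
  assumes pos: "1 \<le> K0" and K0: "real K0 \<le> K" "K \<le> 2 * real K0"
    and D: "D * y^8 \<le> sqrt x" "real D0 \<le> D" and y50: "y^50 \<le> x \<or> 2 * x powr (1/6) \<le> y^10" and x23: "2 * x powr (2/3) * y \<le> x"
    and \<kappa>: "\<kappa> * y^16 \<le> 1"
    and sep: "\<And>d. d \<in> {1..D0} \<Longrightarrow> lam d \<noteq> 0 \<Longrightarrow> well_separable D d \<and> coprime b (int d)"
    and c: "\<And>k. k \<in> {1..K0} \<Longrightarrow> norm (c k) \<le> T" and lam: "\<And>d. d \<in> {1..D0} \<Longrightarrow> norm (lam d) \<le> T"
    and X: "x < real X + 1" "real X \<le> x"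
  shows "norm (\<Sum>k\<in>{1..K0}. \<Sum>d\<in>{1..D0}. c k * lam d *
      (\<Sum>n\<in>{1..X}. if in_class (x/2) x b d n then of_real (mangoldt n) * e (\<alpha> * real k * (real n)\<^sup>2) else 0)) \<le> T^16 * K * x * root 4 \<omega>"
proof -
  define U where "U = nat \<lfloor>x powr (1/3)\<rfloor>"
  let ?E = "\<lambda>k n. e (\<alpha> * real k * (real n)\<^sup>2)"
  let ?P = "\<lambda>d n. in_class (x/2) x b d n"
  have x0: "0 < x" using x_ge by simp
  have y0: "0 < y" "1 \<le> y" using y_ge by auto
  have U: "real U \<le> x powr (1/3)" "x powr (1/3) \<le> 2 * real U" "1 \<le> U"
  proof -
    have 1: "1 \<le> x powr (1/3)" using x_ge by (simp add: ge_one_powr_ge_zero)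
    then show "real U \<le> x powr (1/3)" by (simp add: U_def)
    have f: "1 \<le> \<lfloor>x powr (1/3)\<rfloor>" using 1 by simp
    then show "1 \<le> U" unfolding U_def by linarith
    have "x powr (1/3) < real_of_int \<lfloor>x powr (1/3)\<rfloor> + 1" by linarith
    moreover have "real U = real_of_int \<lfloor>x powr (1/3)\<rfloor>" using f by (simp add: U_def)
    ultimately show "x powr (1/3) \<le> 2 * real U" using f by linarith
  qed
  have x13: "x powr (1/3) \<le> sqrt x" using x_ge by (simp add: powr_half_sqrt[symmetric] powr_mono)
  have sq2: "sqrt x < x / 2"
  proof -
    have "sqrt x * 2 < sqrt x * sqrt x"
    proof (rule mult_strict_left_mono)
      have "sqrt (2^2) < sqrt x" using x_ge by (intro real_sqrt_less_mono) simp
      then show "2 < sqrt x" by simp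
    qed (use x0 in simp)
    then show ?thesis using x0 by simp
  qed
  \<comment> \<open>The window starts at \<open>x / 2 > sqrt x \<ge> U\<close>, so Vaughan's
    identity applies to every \<open>n\<close> in it.\<close>
  have Un: "U < n" if "?P d n" for d n
  proof -
    have "real U < real n" using that U(1) x13 sq2 by (auto simp: in_class_def)
    then show ?thesis by simp
  qed
  have x12: "x \<le> x ^ 12" using x_ge power_increasing[of 1 12 x] by simp
  \<comment> \<open>Extended by 0 so that the bounds required by \<open>linear_sum_bound\<close>
    hold for every \<open>d\<close>.\<close>
  define lam' where "lam' d = (if d \<in> {1..D0} then lam d else 0)" for d
  define Ds where "Ds = {d \<in> {1..D0}. lam d \<noteq> 0}"
  define g1 where "g1 m = complex_of_real (moebius_mu m)" for m
  define g2 where "g2 m = complex_of_real (vaughan_head U m)" for m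
  define A1 where "A1 m = (if U < m then complex_of_real (mangoldt m) else 0)" for m
  define A2 where "A2 m = (if U < m then complex_of_real (vaughan_head U m) else 0)" for m
  define B1 where "B1 l = complex_of_real (vaughan_tail U l)" for l
  define B2 where "B2 l = (1 :: complex)" for l :: nat
  let ?lin = "\<lambda>g w. linear_sum K0 D0 U X (x/2) x b c lam' g w"
  let ?bil = "\<lambda>A B. \<Sum>k\<in>{1..K0}. \<Sum>d\<in>Ds. \<Sum>m\<in>{1..X}. \<Sum>l\<in>{1..X}. if ?P d (m*l) then c k * lam d * A m * B l * ?E k (m*l) else 0"
  have UX: "U \<le> X"
  proof -
    have "real U < real X + 1" using U(1) x13 sq2 x0 X(1) by linarith
    then show ?thesis by linarith
  qed
  have P0: "\<not> ?P d 0" for d using x0 by (simp add: in_class_def)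
  have PX: "n \<le> X" if "?P d n" for d n
  proof -
    have "real n < real X + 1" using that X(1) by (auto simp: in_class_def)
    then show ?thesis by linarith
  qed
  \<comment> \<open>The logarithmic term and the head with \<open>m \<le> U\<close> become linear
    sums; what remains has \<open>m > U\<close> and becomes bilinear.\<close>
  have key: "(\<Sum>n\<in>{1..X}. if ?P d n then of_real (mangoldt n) * ?E k n else 0) =
      (\<Sum>m\<in>{1..U}. \<Sum>l\<le>X. if ?P d (m*l) then g1 m * of_real (ln (real l)) * ?E k (m*l) else 0)
    - (\<Sum>m\<in>{1..U}. \<Sum>l\<le>X. if ?P d (m*l) then g2 m * of_real 1 * ?E k (m*l) else 0)
    - (\<Sum>m\<in>{1..X}. \<Sum>l\<in>{1..X}. if ?P d (m*l) then A2 m * B2 l * ?E k (m*l) else 0)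
    + (\<Sum>m\<in>{1..X}. \<Sum>l\<in>{1..X}. if ?P d (m*l) then A1 m * B1 l * ?E k (m*l) else 0)" for k d
  proof -
    let ?F = "\<lambda>m l. ((if m \<le> U then g1 m * of_real (ln (real l)) else 0) - g2 m + A1 m * B1 l) * ?E k (m*l)"
    have "(\<Sum>n\<in>{1..X}. if ?P d n then of_real (mangoldt n) * ?E k n else 0) =
       (\<Sum>n\<in>{1..X}. if ?P d n then \<Sum>m | m dvd n. ?F m (n div m) else 0)"
    proof (intro sum.cong refl if_cong)
      fix n assume "?P d n"
      have "complex_of_real (mangoldt n) = (\<Sum>m | m dvd n. (if m \<le> U then g1 m * of_real (ln (real (n div m))) else 0) - g2 m + A1 m * B1 (n div m))"
        unfolding vaughan_identity[OF Un[OF \<open>?P d n\<close>]] g1_def g2_def A1_def B1_def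
        by (simp add: sum.distrib sum_subtractf if_distrib[of complex_of_real] if_distrib[of "\<lambda>z. z * _"] cong: if_cong)
      then show "of_real (mangoldt n) * ?E k n = (\<Sum>m | m dvd n. ?F m (n div m))"
        by (simp add: sum_distrib_right)
    qed
    also have "\<dots> = (\<Sum>m\<in>{1..X}. \<Sum>l\<in>{1..X}. if ?P d (m*l) then ?F m l else 0)"
      using PX by (intro sum_divisors_double) auto
    also have "\<dots> = (\<Sum>m\<in>{1..X}. \<Sum>l\<in>{1..X}. if m \<le> U \<and> ?P d (m*l) then g1 m * of_real (ln (real l)) * ?E k (m*l) else 0)
      - (\<Sum>m\<in>{1..X}. \<Sum>l\<in>{1..X}. if m \<le> U \<and> ?P d (m*l) then g2 m * of_real 1 * ?E k (m*l) else 0)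
      - (\<Sum>m\<in>{1..X}. \<Sum>l\<in>{1..X}. if ?P d (m*l) then A2 m * B2 l * ?E k (m*l) else 0)
      + (\<Sum>m\<in>{1..X}. \<Sum>l\<in>{1..X}. if ?P d (m*l) then A1 m * B1 l * ?E k (m*l) else 0)"
      unfolding sum_subtractf[symmetric] sum.distrib[symmetric]
      by (intro sum.cong refl) (auto simp: A2_def B2_def g2_def algebra_simps)
    also have trunc: "(\<Sum>m\<in>{1..X}. \<Sum>l\<in>{1..X}. if m \<le> U \<and> ?P d (m*l) then h m l else 0) =
        (\<Sum>m\<in>{1..U}. \<Sum>l\<le>X. if ?P d (m*l) then h m l else 0)" for h :: "nat \<Rightarrow> nat \<Rightarrow> complex"
    proof -
      have "(\<Sum>m\<in>{1..X}. \<Sum>l\<in>{1..X}. if m \<le> U \<and> ?P d (m*l) then h m l else 0) =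
        (\<Sum>m\<in>{1..U}. \<Sum>l\<in>{1..X}. if m \<le> U \<and> ?P d (m*l) then h m l else 0)"
        using UX by (intro sum.mono_neutral_right) auto
      also have "\<dots> = (\<Sum>m\<in>{1..U}. \<Sum>l\<le>X. if ?P d (m*l) then h m l else 0)"
      proof (rule sum.cong[OF refl])
        fix m assume m: "m \<in> {1..U}"
        have "(\<Sum>l\<le>X. if ?P d (m*l) then h m l else 0) = (\<Sum>l\<in>{1..X}. if ?P d (m*l) then h m l else 0)"
          using P0 by (intro sum.mono_neutral_right) (auto simp: Suc_le_eq)
        then show "(\<Sum>l\<in>{1..X}. if m \<le> U \<and> ?P d (m*l) then h m l else 0) = (\<Sum>l\<le>X. if ?P d (m*l) then h m l else 0)"
          using m by simp
      qed
      finally show ?thesis .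
    qed
    finally show ?thesis unfolding trunc .
  qed
  have lin_eq: "(\<Sum>k\<in>{1..K0}. \<Sum>d\<in>{1..D0}. c k * lam d *
      (\<Sum>m\<in>{1..U}. \<Sum>l\<le>X. if ?P d (m*l) then g m * of_real (w l) * ?E k (m*l) else 0)) = ?lin g w" for g w
    unfolding linear_sum_def sum_distrib_left lam'_def by (intro sum.cong refl) auto
  have bil_eq: "(\<Sum>k\<in>{1..K0}. \<Sum>d\<in>{1..D0}. c k * lam d *
      (\<Sum>m\<in>{1..X}. \<Sum>l\<in>{1..X}. if ?P d (m*l) then A m * B l * ?E k (m*l) else 0)) = ?bil A B" for A B
  proof (rule sum.cong[OF refl])
    fix k
    have "(\<Sum>d\<in>{1..D0}. c k * lam d * (\<Sum>m\<in>{1..X}. \<Sum>l\<in>{1..X}. if ?P d (m*l) then A m * B l * ?E k (m*l) else 0)) =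
      (\<Sum>d\<in>Ds. c k * lam d * (\<Sum>m\<in>{1..X}. \<Sum>l\<in>{1..X}. if ?P d (m*l) then A m * B l * ?E k (m*l) else 0))"
      by (intro sum.mono_neutral_right) (auto simp: Ds_def)
    also have "\<dots> = (\<Sum>d\<in>Ds. \<Sum>m\<in>{1..X}. \<Sum>l\<in>{1..X}. if ?P d (m*l) then c k * lam d * A m * B l * ?E k (m*l) else 0)"
      unfolding sum_distrib_left by (intro sum.cong refl) auto
    finally show "(\<Sum>d\<in>{1..D0}. c k * lam d * (\<Sum>m\<in>{1..X}. \<Sum>l\<in>{1..X}. if ?P d (m*l) then A m * B l * ?E k (m*l) else 0)) = \<dots>" .
  qed
  have "(\<Sum>k\<in>{1..K0}. \<Sum>d\<in>{1..D0}. c k * lam d *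
      (\<Sum>n\<in>{1..X}. if ?P d n then of_real (mangoldt n) * ?E k n else 0)) =
     ?lin g1 (\<lambda>l. ln (real l)) - ?lin g2 (\<lambda>_. 1) - ?bil A2 B2 + ?bil A1 B1"
    by (simp only: key right_diff_distrib distrib_left sum_subtractf sum.distrib lin_eq bil_eq)
  then have "norm (\<Sum>k\<in>{1..K0}. \<Sum>d\<in>{1..D0}. c k * lam d *
      (\<Sum>n\<in>{1..X}. if ?P d n then of_real (mangoldt n) * ?E k n else 0)) \<le>
     norm (?lin g1 (\<lambda>l. ln (real l))) + norm (?lin g2 (\<lambda>_. 1)) + norm (?bil A2 B2) + norm (?bil A1 B1)"
    by (simp only: norm_four_terms)
  also have "\<dots> \<le> T^12 * K * x * sqrt \<omega> + T^12 * K * x * sqrt \<omega> + T^14 * K * x * root 4 \<omega> + T^14 * K * x * root 4 \<omega>"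
  proof (intro add_mono)
    have DU: "real (D0 * U) * y \<le> x"
    proof -
      have D0: "0 \<le> D" using D(2) by linarith
      have "real D0 * y \<le> D * y^8"
        using D(2) y0 D0 power_increasing[of 1 8 y] by (intro mult_mono) auto
      then have "(real D0 * y) * real U \<le> sqrt x * sqrt x"
        using D(1) U(1) x13 y0 x0 by (intro mult_mono) auto
      then show ?thesis using x0 by (simp add: mult_ac)
    qed
    have lam'T: "norm (lam' d) \<le> T" for d using lam T_pos by (auto simp: lam'_def)
    have cop: "coprime b (int d)" if "lam' d \<noteq> 0" for d using sep[of d] that by (auto simp: lam'_def split: if_splits)
    have lnX: "ln (real X) \<le> T" using X x12 by (intro ln_le_T) linarith
    have mono_ln: "mono (\<lambda>l. ln (real l))"
    proof (rule monoI)
      fix i j :: nat assume "i \<le> j"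
      then show "ln (real i) \<le> ln (real j)" by (cases "i = 0"; cases "j = 0") (auto simp: Suc_le_eq intro!: ln_ge_zero)
    qed
    have head_T: "norm (complex_of_real (vaughan_head U m)) \<le> T" if "1 \<le> m" "real m \<le> x^12" for m
      using abs_vaughan_head_le[of m U] ln_le_T[OF that(2)] that(1) by simp
    have U12: "real m \<le> x^12" if "m \<le> U" for m
    proof -
      have "real m \<le> real U" using that by simp
      then show ?thesis using U(1) x13 sq2 x12 x0 by linarith
    qed
    show "norm (?lin g1 (\<lambda>l. ln (real l))) \<le> T^12 * K * x * sqrt \<omega>"
    proof (rule linear_sum_bound[OF pos K0 DU \<kappa> order_refl cop c lam'T _ mono_ln _ lnX])
      fix m show "norm (g1 m) \<le> T" using abs_moebius_le[of m] T_pos by (simp add: g1_def)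
    qed simp_all
    show "norm (?lin g2 (\<lambda>_. 1)) \<le> T^12 * K * x * sqrt \<omega>"
      by (rule linear_sum_bound[OF pos K0 DU \<kappa> order_refl cop c lam'T])
         (use head_T U12 T_pos in \<open>auto simp: g2_def mono_def\<close>)
    have Dsf: "finite Ds" "1 \<le> d \<and> real d \<le> D \<and> well_separable D d \<and> coprime b (int d)" if "d \<in> Ds" for d
      using that D(2) sep by (auto simp: Ds_def)
    have finDs: "finite Ds" by (simp add: Ds_def)
    have lamD: "norm (lam d) \<le> T" if "d \<in> Ds" for d using that lam by (simp add: Ds_def)
    \<comment> \<open>A variable above \<open>U\<close>, hence above
      \<open>x powr (1/3) / 2\<close>, forces its partner below
      \<open>2 * x powr (2/3)\<close>.\<close>
    have small: "real l \<le> 2 * x powr (2/3)" if "U < m" "real (m * l) < x" for m l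
    proof -
      have "real U * real l \<le> real (m * l)" using that(1) by (simp add: mult_right_mono)
      then have "x powr (1/3) * real l \<le> 2 * (real U * real l)" "real U * real l < x"
        using that(2) mult_right_mono[OF U(2), of "real l"] by simp_all
      then have "x powr (1/3) * real l \<le> 2 * x" by linarith
      also have "\<dots> = x powr (1/3) * (2 * x powr (2/3))" using x0 by (simp flip: powr_add)
      finally show ?thesis using x0 by simp
    qed
    note bil = full_bilinear_bound[OF pos K0 D(1) y50 x23 \<kappa> finDs Dsf(2) c lamD _ _ X]
    show "norm (?bil A2 B2) \<le> T^14 * K * x * root 4 \<omega>"
    proof (rule bil)
      fix m l assume nz: "A2 m \<noteq> 0" and r: "real (m * l) < x"
      have m: "U < m" "vaughan_head U m \<noteq> 0" using nz by (auto simp: A2_def split: if_splits)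
      have "m \<le> U * U" using vaughan_head_eq_0[of U m] m(2) by (meson not_le)
      then have "real m \<le> real (U * U)" by (rule of_nat_mono)
      also have "\<dots> \<le> x powr (1/3) * x powr (1/3)" unfolding of_nat_mult using U(1) by (intro mult_mono) auto
      also have "\<dots> = x powr (2/3)" by (simp flip: powr_add)
      finally have "real m \<le> 2 * x powr (2/3)" by (smt (verit) powr_ge_zero)
      then show "real m \<le> 2 * x powr (2/3) \<and> real l \<le> 2 * x powr (2/3)" using small[OF m(1) r] by simp
    qed (use head_T T_pos in \<open>auto simp: A2_def B2_def\<close>)
    show "norm (?bil A1 B1) \<le> T^14 * K * x * root 4 \<omega>"
    proof (rule bil)
      fix m l assume nz: "A1 m \<noteq> 0" "B1 l \<noteq> 0" and r: "x / 2 \<le> real (m * l)" "real (m * l) < x"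
      have m: "U < m" using nz by (auto simp: A1_def split: if_splits)
      have "l \<noteq> 0" using r x0 by (cases "l = 0") auto
      then have l: "U < l" using nz(2) vaughan_tail_eq_0[of l U] by (auto simp: B1_def not_less[symmetric])
      show "real m \<le> 2 * x powr (2/3) \<and> real l \<le> 2 * x powr (2/3)"
        using small[OF m r(2)] small[OF l, of m] r(2) by (simp add: mult.commute)
    next
      fix m :: nat assume m: "1 \<le> m" "real m \<le> x^12"
      have "mangoldt m \<le> ln (real m)" using m by (intro mangoldt_le) simp
      then show "norm (A1 m) \<le> T" using ln_le_T[OF m(2)] T_pos by (auto simp: A1_def)
      show "norm (B1 m) \<le> T" using abs_vaughan_tail_le[of U m] tau[of m] m by (simp add: B1_def)
    qed
  qed
  \<comment> \<open>Since \<open>\<omega> \<le> 2\<close>, \<open>sqrt \<omega>\<close> is at most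
    \<open>2 * root 4 \<omega>\<close>, so each linear sum counts double:
    \<open>2 + 2 + 1 + 1 = 6\<close>.\<close>
  also have "\<dots> \<le> 6 * T^14 * (K * x * root 4 \<omega>)"
  proof -
    have \<omega>2: "\<omega> \<le> 2"
    proof -
      have "1 / y \<le> 1" using y0 by simp
      then show ?thesis using \<kappa> by (simp add: \<omega>_def mult.commute)
    qed
    have rr: "sqrt \<omega> = root 4 \<omega> * root 4 \<omega>"
    proof -
      have "root 4 \<omega> = root 2 (root 2 \<omega>)" using real_root_mult_exp[of 2 2 \<omega>] by simp
      then have "root 4 \<omega> = sqrt (sqrt \<omega>)" by (simp add: sqrt_def)
      then show ?thesis using \<omega>_pos by simp
    qed
    have "root 4 \<omega> \<le> root 4 (2^4)" using \<omega>2 by (intro real_root_le_mono) auto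
    then have "root 4 \<omega> \<le> 2" by (simp add: real_root_power_cancel)
    then have "sqrt \<omega> \<le> 2 * root 4 \<omega>" unfolding rr using \<omega>_pos by (intro mult_right_mono) auto
    then have "T^12 * K * x * sqrt \<omega> \<le> T^14 * K * x * (2 * root 4 \<omega>)"
      using T_pos K_ge x0 \<omega>_pos by (intro mult_mono mult_right_mono T_power_mono) auto
    then show ?thesis by (simp add: mult_ac)
  qed
  also have "\<dots> \<le> T^Suc 14 * (K * x * root 4 \<omega>)" using K_ge x0 \<omega>_pos by (intro T_absorb) auto
  also have "\<dots> \<le> T^16 * (K * x * root 4 \<omega>)" using K_ge x0 \<omega>_pos by (intro mult_right_mono T_power_mono) auto
  finally show ?thesis by (simp add: mult.assoc)
qed

end

section \<open>The divisor bound\<close>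

lemma divisor_count_prime_power_mult_le:
  assumes "prime p" "m > 0"
  shows "divisor_count (p ^ a * m) \<le> (a + 1) * divisor_count m"
proof -
  have fin: "finite {k. k dvd m}" using assms by simp
  have "{k. k dvd p ^ a * m} \<subseteq> (\<lambda>(i, j). p ^ i * j) ` ({..a} \<times> {k. k dvd m})"
  proof
    fix k assume "k \<in> {k. k dvd p ^ a * m}"
    then obtain u v where uv: "k = u * v" "u dvd p ^ a" "v dvd m" using division_decomp[of k "p ^ a" m] by auto
    then obtain i where "i \<le> a" "u = p ^ i" using assms divides_primepow_nat by blast
    then show "k \<in> (\<lambda>(i, j). p ^ i * j) ` ({..a} \<times> {k. k dvd m})" using uv by auto
  qed
  then have "card {k. k dvd p ^ a * m} \<le> card ((\<lambda>(i, j). p ^ i * j) ` ({..a} \<times> {k. k dvd m}))"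
    using fin by (intro card_mono) auto
  also have "\<dots> \<le> card ({..a} \<times> {k. k dvd m})" using fin by (intro card_image_le) auto
  finally show ?thesis by (simp add: divisor_count_def card_cartesian_product)
qed

text \<open>Primes are removed one at a time. A prime \<open>p \<ge> P\<close> costs nothing, since
  \<open>a + 1 \<le> 2^a \<le> (p powr \<epsilon>)^a\<close>; each of the smaller primes costs one
  factor \<open>B\<close>.\<close>

lemma divisor_count_le_powr_aux:
  fixes \<epsilon> B :: real and P :: nat
  assumes \<epsilon>: "0 < \<epsilon>" and P: "2 \<le> real P powr \<epsilon>" and B: "1 \<le> B" "\<And>a::nat. real a + 1 \<le> B * (2 ^ a) powr \<epsilon>"
    and "0 < n"
  shows "real (divisor_count n) \<le> B ^ card {p \<in> prime_factors n. p < P} * real n powr \<epsilon>"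
  using \<open>0 < n\<close>
proof (induction n rule: less_induct)
  case (less n)
  show ?case
  proof (cases "n = 1")
    case True
    then show ?thesis by (simp add: divisor_count_def)
  next
    case False
    then obtain p where p: "prime p" "p dvd n" using prime_factor_nat by blast
    have "\<not> is_unit p" using p(1) by auto
    then obtain m where m: "n = p ^ multiplicity p n * m" "\<not> p dvd m"
      using multiplicity_decompose'[of n p] less.prems by auto
    define a where "a = multiplicity p n"
    have a: "1 \<le> a" using p less.prems by (simp add: a_def multiplicity_geI Suc_le_eq prime_multiplicity_gt_zero_iff)
    have m0: "0 < m" using m less.prems by (auto intro!: Nat.gr0I)
    have nm: "n = p ^ a * m" using m(1) by (simp add: a_def)
    have p2: "2 \<le> p" using p(1) by (rule prime_ge_2_nat)
    have "2 ^ 1 \<le> (2::nat) ^ a" using a by (intro power_increasing) auto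
    also have "\<dots> \<le> p ^ a" using p2 by (intro power_mono) auto
    finally have "1 * m < p ^ a * m" using m0 by (intro mult_strict_right_mono) auto
    then have "m < n" using nm by simp
    then have IH: "real (divisor_count m) \<le> B ^ card {p \<in> prime_factors m. p < P} * real m powr \<epsilon>"
      using less.IH m0 by blast
    have pf: "prime_factors n = insert p (prime_factors m)"
    proof -
      have "prime_factors n = prime_factors (p ^ a) \<union> prime_factors m"
        unfolding nm using p2 m0 by (intro prime_factors_product) auto
      also have "prime_factors (p ^ a) = {p}" using p(1) a by (simp add: prime_factors_power prime_prime_factors)
      finally show ?thesis by simp
    qed
    have np: "p \<notin> prime_factors m" using m(2) by auto
    have split: "real n powr \<epsilon> = (real p ^ a) powr \<epsilon> * real m powr \<epsilon>" unfolding nm by (simp add: powr_mult)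
    have step: "(real a + 1) * B ^ card {p \<in> prime_factors m. p < P} \<le> B ^ card {p \<in> prime_factors n. p < P} * (real p ^ a) powr \<epsilon>"
    proof (cases "p < P")
      case True
      have "{q \<in> prime_factors n. q < P} = insert p {q \<in> prime_factors m. q < P}" using True pf by auto
      then have card: "card {q \<in> prime_factors n. q < P} = Suc (card {q \<in> prime_factors m. q < P})" using np by simp
      have "real a + 1 \<le> B * (2 ^ a) powr \<epsilon>" by (rule B(2))
      also have "\<dots> \<le> B * (real p ^ a) powr \<epsilon>"
        using B(1) p2 \<epsilon> by (intro mult_left_mono powr_mono2 power_mono) auto
      finally have "(real a + 1) * B ^ card {q \<in> prime_factors m. q < P} \<le> (B * (real p ^ a) powr \<epsilon>) * B ^ card {q \<in> prime_factors m. q < P}"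
        using B(1) by (intro mult_right_mono) auto
      then show ?thesis by (simp add: card mult_ac)
    next
      case False
      have "{q \<in> prime_factors n. q < P} = {q \<in> prime_factors m. q < P}" using False pf by auto
      moreover have "real a + 1 \<le> (real p ^ a) powr \<epsilon>"
      proof -
        have "real a + 1 \<le> 2 ^ a"
        proof -
          have "a + 1 \<le> 2 ^ a" using less_exp[of a] by linarith
          then have "real (a + 1) \<le> real (2 ^ a)" by (rule of_nat_mono)
          then show ?thesis by simp
        qed
        also have "\<dots> \<le> (real p powr \<epsilon>) ^ a"
        proof (intro power_mono)
          have "real P powr \<epsilon> \<le> real p powr \<epsilon>" using False \<epsilon> by (intro powr_mono2) auto
          then show "2 \<le> real p powr \<epsilon>" using P by linarith
        qed simp
        also have "\<dots> = (real p ^ a) powr \<epsilon>" using p2 by (simp add: powr_realpow[symmetric] powr_powr mult.commute)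
        finally show ?thesis .
      qed
      ultimately show ?thesis using B(1) by (simp add: mult.commute mult_left_mono)
    qed
    have "real (divisor_count n) \<le> real ((a + 1) * divisor_count m)"
      unfolding nm using divisor_count_prime_power_mult_le[OF p(1) m0] by (intro of_nat_mono)
    also have "\<dots> = (real a + 1) * real (divisor_count m)" by (simp add: algebra_simps)
    also have "\<dots> \<le> (real a + 1) * (B ^ card {p \<in> prime_factors m. p < P} * real m powr \<epsilon>)"
      using IH by (intro mult_left_mono) auto
    also have "\<dots> \<le> (B ^ card {p \<in> prime_factors n. p < P} * (real p ^ a) powr \<epsilon>) * real m powr \<epsilon>"
      using mult_right_mono[OF step, of "real m powr \<epsilon>"] by (simp add: mult_ac)
    finally show ?thesis unfolding split by (simp add: mult_ac)
  qed
qed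

lemma divisor_count_le_powr:
  fixes \<epsilon> :: real
  assumes "0 < \<epsilon>"
  obtains C where "1 \<le> C" "\<And>n. 0 < n \<Longrightarrow> real (divisor_count n) \<le> C * real n powr \<epsilon>"
proof -
  define P where "P = nat \<lceil>2 powr (1 / \<epsilon>)\<rceil>"
  \<comment> \<open>From \<open>(2^a) powr \<epsilon> \<ge> 1 + a * \<epsilon> * ln 2\<close>: the
    summand \<open>1 / (\<epsilon> * ln 2)\<close> turns the coefficient of \<open>a\<close> into
    1.\<close>
  define B where "B = 1 + 1 / (\<epsilon> * ln 2)"
  have B1: "1 \<le> B" using assms by (simp add: B_def)
  have P: "2 \<le> real P powr \<epsilon>"
  proof -
    have "(2 powr (1 / \<epsilon>)) powr \<epsilon> \<le> real P powr \<epsilon>"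
      using assms by (intro powr_mono2) (auto simp: P_def real_nat_ceiling_ge)
    then show ?thesis using assms by (simp add: powr_powr)
  qed
  have B2: "real a + 1 \<le> B * (2 ^ a) powr \<epsilon>" for a :: nat
  proof -
    have pos: "0 < \<epsilon> * ln 2" using assms by simp
    have "(2 ^ a) powr \<epsilon> = exp (real a * (\<epsilon> * ln 2))"
      by (simp add: powr_def ln_realpow mult_ac)
    then have ge: "1 + real a * (\<epsilon> * ln 2) \<le> (2 ^ a) powr \<epsilon>" using exp_ge_add_one_self by simp
    have "real a + 1 \<le> B * (1 + real a * (\<epsilon> * ln 2))"
    proof -
      have "B * (1 + real a * (\<epsilon> * ln 2)) = 1 + real a * (\<epsilon> * ln 2) + 1 / (\<epsilon> * ln 2) + real a"
        unfolding B_def using pos assms by (simp add: field_simps)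
      moreover have "0 \<le> real a * (\<epsilon> * ln 2)" "0 \<le> 1 / (\<epsilon> * ln 2)" using pos by simp_all
      ultimately show ?thesis by linarith
    qed
    also have "\<dots> \<le> B * (2 ^ a) powr \<epsilon>" using ge B1 by (intro mult_left_mono) auto
    finally show ?thesis .
  qed
  have "real (divisor_count n) \<le> B ^ P * real n powr \<epsilon>" if "0 < n" for n
  proof -
    have "card {p \<in> prime_factors n. p < P} \<le> card {..<P}" by (intro card_mono) auto
    then have "B ^ card {p \<in> prime_factors n. p < P} \<le> B ^ P" using B1 by (intro power_increasing) auto
    then have "B ^ card {p \<in> prime_factors n. p < P} * real n powr \<epsilon> \<le> B ^ P * real n powr \<epsilon>" by (intro mult_right_mono) auto
    with divisor_count_le_powr_aux[OF assms P B1 B2 that] show ?thesis by linarith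
  qed
  moreover have "1 \<le> B ^ P" using B1 by (rule one_le_power)
  ultimately show thesis using that by blast
qed

section \<open>Trivial bounds and moduli not coprime to \<open>b\<close>\<close>

lemma harmonic_dyadic_le: "(\<Sum>d\<in>{1..<2^n}. 1 / real d) \<le> real n"
proof -
  have "(\<Sum>d\<in>{1..<2^n}. 1 / real d) = (\<Sum>i<n. \<Sum>d\<in>{2^i..<2*2^i}. 1 / real d)" by (rule sum_dyadic_split)
  also have "\<dots> \<le> (\<Sum>i<n. 1)"
  proof (intro sum_mono)
    fix i :: nat
    have "(\<Sum>d\<in>{2^i..<2*2^i}. 1 / real d) \<le> (\<Sum>d\<in>{2^i..<2*2^i::nat}. 1 / 2^i)"
    proof (intro sum_mono divide_left_mono)
      fix d :: nat assume "d \<in> {2^i..<2*2^i}"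
      then have "real (2^i) \<le> real d" by (intro of_nat_mono) simp
      moreover have "0 < real (2^i)" by simp
      ultimately have "2^i \<le> real d" "0 < real d" by (simp, linarith)
      then show "2^i \<le> real d" "0 < real d * 2 ^ i" by simp_all
    qed simp
    then show "(\<Sum>d\<in>{2^i..<2*2^i}. 1 / real d) \<le> 1" by simp
  qed
  finally show ?thesis by simp
qed

context minor_arc
begin

definition "prime_sum X b k d = (\<Sum>n\<in>{1..X}. if in_class (x/2) x b d n then of_real (mangoldt n) * e (\<alpha> * real k * (real n)\<^sup>2) else 0)"

lemma mangoldt_le_T: "mangoldt n \<le> T" if "1 \<le> n" "real n \<le> x"
proof -
  have "x \<le> x ^ 12" using x_ge power_increasing[of 1 12 x] by simp
  then have "ln (real n) \<le> T" using that(2) by (intro ln_le_T) linarith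
  moreover have "mangoldt n \<le> ln (real n)" using that(1) by (intro mangoldt_le) simp
  ultimately show ?thesis by linarith
qed

lemma norm_prime_sum_le:
  assumes X: "real X \<le> x"
  shows "norm (prime_sum X b k d) \<le> T * real (card {n \<in> {1..X}. in_class (x/2) x b d n \<and> primepow n})"
proof -
  have "norm (prime_sum X b k d) \<le> (\<Sum>n\<in>{1..X}. if in_class (x/2) x b d n \<and> primepow n then T else 0)"
    unfolding prime_sum_def
  proof (intro sum_norm_le)
    fix n assume n: "n \<in> {1..X}"
    have "real n \<le> x" using n X by (auto intro: order_trans[of _ "real X"])
    then have "mangoldt n \<le> T" using n by (intro mangoldt_le_T) auto
    moreover have "mangoldt n = (0::real)" if "\<not> primepow n" using that by (simp add: mangoldt_def)
    ultimately show "norm (if in_class (x/2) x b d n then of_real (mangoldt n) * e (\<alpha> * real k * (real n)\<^sup>2) else 0) \<le>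
       (if in_class (x/2) x b d n \<and> primepow n then T else 0)"
      by (auto simp: norm_mult mangoldt_nonneg)
  qed
  also have "\<dots> = (\<Sum>n\<in>{n \<in> {1..X}. in_class (x/2) x b d n \<and> primepow n}. T)"
    by (rule sum.inter_filter[symmetric]) simp
  finally show ?thesis by (simp add: mult.commute)
qed

text \<open>A prime power congruent to \<open>b\<close> modulo \<open>d\<close> is divisible by
  \<open>gcd b d > 1\<close>, hence is a power of a prime dividing \<open>d\<close>. There are at
  most \<open>T\<close> such primes and fewer than \<open>I\<close> exponents; the third
  \<open>T\<close> bounds \<open>mangoldt\<close>.\<close>

lemma norm_prime_sum_not_coprime:
  assumes X: "real X \<le> x" and d: "1 \<le> d" "real d \<le> x" and ncop: "\<not> coprime b (int d)"
  shows "norm (prime_sum X b k d) \<le> T^3"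
proof -
  let ?S = "{n \<in> {1..X}. in_class (x/2) x b d n \<and> primepow n}"
  have x12: "x \<le> x ^ 12" using x_ge power_increasing[of 1 12 x] by simp
  have XI: "X < 2 ^ I" using X x12 by (intro I_bound) linarith
  have "?S \<subseteq> (\<lambda>(p, i). p ^ i) ` ({p. p dvd d} \<times> {..<I})"
  proof
    fix n assume n: "n \<in> ?S"
    then obtain p i where pi: "prime p" "0 < i" "n = p ^ i" unfolding primepow_def by auto
    define g where "g = gcd b (int d)"
    have cong: "[int n = b] (mod int d)" using n by (simp add: in_class_def)
    have "g dvd int n"
    proof -
      have "int d dvd int n - b" using cong by (simp add: cong_iff_dvd_diff)
      then have "g dvd int n - b" unfolding g_def by (rule dvd_trans[rotated]) simp
      moreover have "g dvd b" by (simp add: g_def)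
      ultimately show ?thesis by (metis diff_add_cancel dvd_add)
    qed
    then have gn: "nat \<bar>g\<bar> dvd p ^ i" unfolding pi(3)[symmetric] by (simp only: nat_abs_dvd_iff)
    then obtain j where j: "nat \<bar>g\<bar> = p ^ j" using pi(1) divides_primepow_nat by blast
    have "\<bar>g\<bar> \<noteq> 1" using ncop by (simp add: g_def coprime_iff_gcd_eq_1)
    then have "j \<noteq> 0" using j by (cases "j = 0") auto
    then have "p dvd nat \<bar>g\<bar>" using j by (simp add: dvd_power)
    then have "int p dvd g" by (metis dvd_nat_abs_iff)
    then have "int p dvd int d" unfolding g_def by simp
    then have "p dvd d" by (simp only: int_dvd_int_iff)
    moreover have "i < I"
    proof -
      have "2 ^ i \<le> p ^ i" using prime_ge_2_nat[OF pi(1)] by (intro power_mono) auto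
      also have "\<dots> < 2 ^ I" using n pi(3) XI by auto
      finally show ?thesis by simp
    qed
    ultimately show "n \<in> (\<lambda>(p, i). p ^ i) ` ({p. p dvd d} \<times> {..<I})" using pi(3) by auto
  qed
  moreover have fin: "finite ({p. p dvd d} \<times> {..<I})" using d by simp
  ultimately have "card ?S \<le> card ({p. p dvd d} \<times> {..<I})"
    by (meson card_image_le card_mono finite_imageI order_trans)
  then have "real (card ?S) \<le> real (card {p. p dvd d} * I)" by (intro of_nat_mono) (simp add: card_cartesian_product)
  also have "\<dots> = real (card {p. p dvd d}) * real I" by simp
  also have "\<dots> \<le> T * T" using card_divisors_le[of d] d x12 I_le T_pos by (intro mult_mono) auto
  finally have "T * real (card ?S) \<le> T * (T * T)" using T_pos by (intro mult_left_mono) auto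
  then show ?thesis using norm_prime_sum_le[OF X, of b k d] by (simp add: eval_nat_numeral)
qed

lemma norm_prime_sum_trivial:
  assumes X: "real X \<le> x" and d: "1 \<le> d"
  shows "norm (prime_sum X b k d) \<le> T * (x / real d + 1)"
proof -
  have "card {n \<in> {1..X}. in_class (x/2) x b d n \<and> primepow n} \<le> card {n \<in> {1..X}. [int n = b] (mod int d)}"
    by (intro card_mono) (auto simp: in_class_def)
  also have "\<dots> \<le> X div d + 1" by (rule card_residue_class_le[OF d])
  finally have "real (card {n \<in> {1..X}. in_class (x/2) x b d n \<and> primepow n}) \<le> real (X div d) + 1" by linarith
  also have "\<dots> \<le> real X / real d + 1" using of_nat_div_le_of_nat_divide by simp
  also have "\<dots> \<le> x / real d + 1" using X by (simp add: divide_right_mono)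
  finally have "T * real (card {n \<in> {1..X}. in_class (x/2) x b d n \<and> primepow n}) \<le> T * (x / real d + 1)"
    using T_pos by (intro mult_left_mono) auto
  then show ?thesis using norm_prime_sum_le[OF X, of b k d] by linarith
qed

text \<open>The main part \<open>x / d\<close> sums harmonically. This settles the range
  \<open>\<kappa> * y^16 > 1\<close>, where nothing has to be saved.\<close>

lemma one_sided_trivial_bound:
  assumes K0: "real K0 \<le> K" and X: "real X \<le> x" and D0: "real D0 \<le> x"
    and c: "\<And>k. k \<in> {1..K0} \<Longrightarrow> norm (c k) \<le> T" and lam: "\<And>d. d \<in> {1..D0} \<Longrightarrow> norm (lam d) \<le> T"
  shows "norm (\<Sum>k\<in>{1..K0}. \<Sum>d\<in>{1..D0}. c k * lam d * prime_sum X b k d) \<le> T^5 * K * x"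
proof -
  have x12: "x \<le> x ^ 12" using x_ge power_increasing[of 1 12 x] by simp
  have DI: "D0 < 2 ^ I" using D0 x12 by (intro I_bound) linarith
  have "norm (\<Sum>k\<in>{1..K0}. \<Sum>d\<in>{1..D0}. c k * lam d * prime_sum X b k d) \<le>
     (\<Sum>k\<in>{1..K0}. \<Sum>d\<in>{1..D0}. T^3 * (x / real d + 1))"
  proof (intro sum_norm_le)
    fix k d assume k: "k \<in> {1..K0}" and d: "d \<in> {1..D0}"
    have "norm (c k * lam d * prime_sum X b k d) \<le> T * T * (T * (x / real d + 1))"
      unfolding norm_mult using k d T_pos norm_prime_sum_trivial[OF X] by (intro mult_mono c lam) auto
    then show "norm (c k * lam d * prime_sum X b k d) \<le> T^3 * (x / real d + 1)"
      by (simp add: eval_nat_numeral mult_ac)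
  qed
  also have "\<dots> = real K0 * (T^3 * (x * (\<Sum>d\<in>{1..D0}. 1 / real d) + real D0))"
    by (simp add: sum.distrib sum_distrib_left[symmetric] flip: sum_divide_distrib) (simp add: sum_distrib_left)
  also have "\<dots> \<le> K * (T^3 * (x * real I + x))"
  proof (intro mult_mono mult_left_mono add_mono K0 D0)
    have "(\<Sum>d\<in>{1..D0}. 1 / real d) \<le> (\<Sum>d\<in>{1..<2^I}. 1 / real d)" using DI by (intro sum_mono2) auto
    also have "\<dots> \<le> real I" by (rule harmonic_dyadic_le)
    finally show "(\<Sum>d\<in>{1..D0}. 1 / real d) \<le> real I" .
  qed (use T_pos x_ge K_ge in \<open>auto intro!: add_nonneg_nonneg mult_nonneg_nonneg sum_nonneg\<close>)
  also have "\<dots> \<le> K * (T^3 * (x * T + x * T))"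
    using I_le T_ge x_ge K_ge by (intro mult_left_mono add_mono) auto
  also have "\<dots> = 2 * T^4 * (K * x)" by (simp add: eval_nat_numeral)
  also have "\<dots> \<le> T^Suc 4 * (K * x)" using K_ge x_ge by (intro T_absorb) auto
  finally show ?thesis by (simp add: mult.assoc)
qed

text \<open>The cancellations in the congruences require \<open>d\<close> coprime to
  \<open>b\<close>. For the other moduli each prime sum is at most \<open>T^3\<close>, and as
  \<open>D \<le> sqrt x\<close> they contribute about \<open>K * sqrt x\<close>.\<close>

lemma one_sided_total:
  fixes K0 X D0 :: nat and D :: real
  assumes pos: "1 \<le> K0" and K0: "real K0 \<le> K" "K \<le> 2 * real K0"
    and D: "D * y^8 \<le> sqrt x" "real D0 \<le> D" and y50: "y^50 \<le> x \<or> 2 * x powr (1/6) \<le> y^10" and x23: "2 * x powr (2/3) * y \<le> x"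
    and \<kappa>: "\<kappa> * y^16 \<le> 1"
    and sep: "\<And>d. d \<in> {1..D0} \<Longrightarrow> lam d \<noteq> 0 \<Longrightarrow> well_separable D d"
    and c: "\<And>k. k \<in> {1..K0} \<Longrightarrow> norm (c k) \<le> T" and lam: "\<And>d. d \<in> {1..D0} \<Longrightarrow> norm (lam d) \<le> T"
    and X: "x < real X + 1" "real X \<le> x"
  shows "norm (\<Sum>k\<in>{1..K0}. \<Sum>d\<in>{1..D0}. c k * lam d * prime_sum X b k d) \<le> T^16 * (K * x * root 4 \<omega> + K * sqrt x)"
proof -
  define l1 where "l1 d = (if coprime b (int d) then lam d else 0)" for d
  define l2 where "l2 d = (if coprime b (int d) then 0 else lam d)" for d
  have y0: "1 \<le> y" using y_ge .
  have Ds: "real D0 \<le> sqrt x"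
  proof -
    have "0 \<le> D" using D(2) by linarith
    then have "D * 1 \<le> D * y^8" using y0 by (intro mult_left_mono one_le_power) auto
    then show ?thesis using D by linarith
  qed
  have sx: "sqrt x \<le> x" using x_ge real_sqrt_le_mono[of x "x * x"] by simp
  have "(\<Sum>k\<in>{1..K0}. \<Sum>d\<in>{1..D0}. c k * lam d * prime_sum X b k d) =
    (\<Sum>k\<in>{1..K0}. \<Sum>d\<in>{1..D0}. c k * l1 d * prime_sum X b k d) + (\<Sum>k\<in>{1..K0}. \<Sum>d\<in>{1..D0}. c k * l2 d * prime_sum X b k d)"
    unfolding sum.distrib[symmetric] by (intro sum.cong refl) (auto simp: l1_def l2_def)
  then have "norm (\<Sum>k\<in>{1..K0}. \<Sum>d\<in>{1..D0}. c k * lam d * prime_sum X b k d) \<le>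
    norm (\<Sum>k\<in>{1..K0}. \<Sum>d\<in>{1..D0}. c k * l1 d * prime_sum X b k d) + norm (\<Sum>k\<in>{1..K0}. \<Sum>d\<in>{1..D0}. c k * l2 d * prime_sum X b k d)"
    by (simp only: norm_triangle_ineq)
  also have "\<dots> \<le> T^16 * K * x * root 4 \<omega> + T^5 * (K * sqrt x)"
  proof (intro add_mono)
    show "norm (\<Sum>k\<in>{1..K0}. \<Sum>d\<in>{1..D0}. c k * l1 d * prime_sum X b k d) \<le> T^16 * K * x * root 4 \<omega>"
      unfolding prime_sum_def
      by (rule one_sided_bound[OF pos K0 D y50 x23 \<kappa> _ c _ X])
         (use sep lam T_pos in \<open>auto simp: l1_def split: if_splits\<close>)
    have "norm (\<Sum>k\<in>{1..K0}. \<Sum>d\<in>{1..D0}. c k * l2 d * prime_sum X b k d) \<le> (\<Sum>k\<in>{1..K0}. \<Sum>d\<in>{1..D0}. T * T * T^3)"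
    proof (intro sum_norm_le)
      fix k d assume k: "k \<in> {1..K0}" and d: "d \<in> {1..D0}"
      show "norm (c k * l2 d * prime_sum X b k d) \<le> T * T * T^3"
      proof (cases "coprime b (int d)")
        case False
        have "real d \<le> real D0" using d by simp
        then have "real d \<le> x" using Ds sx by linarith
        then have "norm (prime_sum X b k d) \<le> T^3" using d X(2) False by (intro norm_prime_sum_not_coprime) auto
        then show ?thesis unfolding norm_mult using k d T_pos lam False by (intro mult_mono c) (auto simp: l2_def)
      qed (use T_pos in \<open>simp add: l2_def\<close>)
    qed
    also have "\<dots> = T^5 * (real K0 * real D0)" by (simp add: eval_nat_numeral)
    also have "\<dots> \<le> T^5 * (K * sqrt x)" using T_pos K0 Ds K_ge by (intro mult_left_mono mult_mono) auto
    finally show "norm (\<Sum>k\<in>{1..K0}. \<Sum>d\<in>{1..D0}. c k * l2 d * prime_sum X b k d) \<le> T^5 * (K * sqrt x)" .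
  qed
  also have "T^5 * (K * sqrt x) \<le> T^16 * (K * sqrt x)" using K_ge x_ge by (intro mult_right_mono T_power_mono) auto
  finally show ?thesis by (simp add: distrib_left mult.assoc)
qed

end

section \<open>Two-sided sums and the choice of parameters\<close>

lemma power_powr: "0 < z \<Longrightarrow> (z ^ n) powr r = z powr (real n * r)" for z :: real
  by (simp add: powr_realpow[symmetric] powr_powr)

lemma powr_pow: "0 < z \<Longrightarrow> (z powr r) ^ n = z powr (real n * r)" for z :: real
  by (simp add: powr_realpow[symmetric] powr_powr mult.commute)

text \<open>Separates the parts of \<open>\<omega>\<close> into distinct terms of the final
  bound.\<close>

lemma root4_add_le:
  assumes "0 \<le> u" "0 \<le> v"
  shows "root 4 (u + v) \<le> root 4 u + root 4 v"
proof -
  have nonneg: "0 \<le> root 4 u" "0 \<le> root 4 v" using assms by simp_all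
  have "u + v = root 4 u ^ 4 + root 4 v ^ 4" using assms by simp
  also have "\<dots> \<le> (root 4 u + root 4 v) ^ 4"
  proof -
    have "(root 4 u + root 4 v) ^ 4 = root 4 u ^ 4 + root 4 v ^ 4 +
       (4 * root 4 u ^ 3 * root 4 v + 6 * (root 4 u)\<^sup>2 * (root 4 v)\<^sup>2 + 4 * root 4 u * root 4 v ^ 3)"
      by (simp add: eval_nat_numeral algebra_simps)
    then show ?thesis using nonneg by simp
  qed
  finally have "root 4 (u + v) \<le> root 4 ((root 4 u + root 4 v) ^ 4)" by (intro real_root_le_mono) auto
  then show ?thesis using nonneg by (simp add: real_root_power_cancel)
qed

lemma root4_powr: "0 < z \<Longrightarrow> root 4 z = z powr (1/4)"
  by (simp add: root_powr_inverse)

text \<open>Negative \<open>k\<close> are positive frequencies of \<open>- \<alpha>\<close>, which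
  is approximated by \<open>- a / q\<close> with the same \<open>q\<close>.\<close>

lemma minor_arc_uminus:
  assumes "minor_arc x T K y \<alpha> a q I"
  shows "minor_arc x T K y (-\<alpha>) (-a) q I"
proof -
  interpret minor_arc x T K y \<alpha> a q I by fact
  have "\<bar>- \<alpha> - real_of_int (- a) / real q\<bar> = \<bar>\<alpha> - real_of_int a / real q\<bar>" by (simp add: abs_minus_commute)
  then show ?thesis using x_ge T_ge I_le I_pow tau K_ge K_le T_le y_ge q_ge coprime_aq approx
    by unfold_locales auto
qed

lemma sum_int_symmetric:
  fixes f :: "int \<Rightarrow> 'a::comm_monoid_add"
  assumes "0 \<le> K"
  shows "(\<Sum>k\<in>{k::int. 1 \<le> \<bar>k\<bar> \<and> real_of_int \<bar>k\<bar> \<le> K}. f k) =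
    (\<Sum>k\<in>{1..nat \<lfloor>K\<rfloor>}. f (int k)) + (\<Sum>k\<in>{1..nat \<lfloor>K\<rfloor>}. f (- int k))"
proof -
  let ?S = "{1..nat \<lfloor>K\<rfloor>}"
  have eq: "{k::int. 1 \<le> \<bar>k\<bar> \<and> real_of_int \<bar>k\<bar> \<le> K} = int ` ?S \<union> (\<lambda>k. - int k) ` ?S"
  proof (intro equalityI subsetI)
    fix k :: int assume "k \<in> {k. 1 \<le> \<bar>k\<bar> \<and> real_of_int \<bar>k\<bar> \<le> K}"
    then have k: "1 \<le> \<bar>k\<bar>" "\<bar>k\<bar> \<le> \<lfloor>K\<rfloor>" by (simp_all add: le_floor_iff)
    then have "nat \<bar>k\<bar> \<in> ?S" by auto
    moreover have "k = int (nat \<bar>k\<bar>) \<or> k = - int (nat \<bar>k\<bar>)" by auto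
    ultimately show "k \<in> int ` ?S \<union> (\<lambda>k. - int k) ` ?S" by blast
  next
    fix k assume "k \<in> int ` ?S \<union> (\<lambda>k. - int k) ` ?S"
    then obtain j where j: "j \<in> ?S" "\<bar>k\<bar> = int j" by auto
    then have "1 \<le> \<bar>k\<bar>" "\<bar>k\<bar> \<le> \<lfloor>K\<rfloor>" by auto
    then show "k \<in> {k. 1 \<le> \<bar>k\<bar> \<and> real_of_int \<bar>k\<bar> \<le> K}" by (simp add: le_floor_iff)
  qed
  have "int ` ?S \<inter> (\<lambda>k. - int k) ` ?S = {}" by auto
  then show ?thesis unfolding eq
    by (subst sum.union_disjoint) (auto simp: sum.reindex inj_on_def)
qed

text \<open>The shift \<open>\<beta>\<close> contributes only the unimodular factor
  \<open>e (\<beta> * k)\<close>, which is moved into the coefficients \<open>c\<close>.\<close>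

lemma W_sum_split:
  assumes ma: "minor_arc x T K y \<alpha> a q I" and D: "0 \<le> D"
  shows "W_sum x D K lam c \<alpha> b \<beta> =
    (\<Sum>k\<in>{1..nat \<lfloor>K\<rfloor>}. \<Sum>d\<in>{1..nat \<lfloor>D\<rfloor>}. (c (int k) * e (\<beta> * real k)) * lam d * minor_arc.prime_sum x \<alpha> (nat \<lfloor>x\<rfloor>) b k d)
  + (\<Sum>k\<in>{1..nat \<lfloor>K\<rfloor>}. \<Sum>d\<in>{1..nat \<lfloor>D\<rfloor>}. (c (- int k) * e (- \<beta> * real k)) * lam d * minor_arc.prime_sum x (-\<alpha>) (nat \<lfloor>x\<rfloor>) b k d)"
proof -
  interpret P: minor_arc x T K y \<alpha> a q I by fact
  interpret N: minor_arc x T K y "-\<alpha>" "-a" q I by (rule minor_arc_uminus[OF ma])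
  let ?X = "nat \<lfloor>x\<rfloor>"
  let ?N = "\<lambda>d. {n::nat. x / 2 \<le> real n \<and> real n < x \<and> [int n = b] (mod int d)}"
  have x0: "0 < x" using P.x_ge by simp
  have Dset: "{d::nat. 1 \<le> d \<and> real d \<le> D} = {1..nat \<lfloor>D\<rfloor>}"
    using D by (auto simp: le_nat_floor) (metis of_nat_floor of_nat_le_iff order_trans)
  have Nset: "?N d = {n \<in> {1..?X}. P.in_class (x/2) x b d n}" for d
  proof (intro equalityI subsetI)
    fix n assume n: "n \<in> ?N d"
    then have "n \<noteq> 0" using x0 by (intro notI) auto
    moreover have "n \<le> ?X" using n by (intro le_nat_floor) auto
    ultimately show "n \<in> {n \<in> {1..?X}. P.in_class (x/2) x b d n}" using n by (auto simp: P.in_class_def)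
  qed (auto simp: P.in_class_def)
  have inner: "(\<Sum>n\<in>?N d. e ((\<gamma> * (real n)\<^sup>2 + \<delta>) * r) * of_real (mangoldt n)) =
     e (\<delta> * r) * (\<Sum>n\<in>{1..?X}. if P.in_class (x/2) x b d n then of_real (mangoldt n) * e (\<gamma> * r * (real n)\<^sup>2) else 0)" for d \<gamma> \<delta> r
  proof -
    have "(\<Sum>n\<in>?N d. e ((\<gamma> * (real n)\<^sup>2 + \<delta>) * r) * of_real (mangoldt n)) =
      (\<Sum>n\<in>?N d. e (\<delta> * r) * (of_real (mangoldt n) * e (\<gamma> * r * (real n)\<^sup>2)))"
    proof (rule sum.cong[OF refl])
      fix n
      have "e ((\<gamma> * (real n)\<^sup>2 + \<delta>) * r) = e (\<delta> * r) * e (\<gamma> * r * (real n)\<^sup>2)"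
        unfolding e_add[symmetric] by (rule arg_cong[of _ _ e]) (simp add: algebra_simps)
      then show "e ((\<gamma> * (real n)\<^sup>2 + \<delta>) * r) * of_real (mangoldt n) = e (\<delta> * r) * (of_real (mangoldt n) * e (\<gamma> * r * (real n)\<^sup>2))"
        by (simp add: mult_ac)
    qed
    also have "\<dots> = e (\<delta> * r) * (\<Sum>n\<in>{n \<in> {1..?X}. P.in_class (x/2) x b d n}. of_real (mangoldt n) * e (\<gamma> * r * (real n)\<^sup>2))"
      unfolding Nset sum_distrib_left ..
    also have "\<dots> = e (\<delta> * r) * (\<Sum>n\<in>{1..?X}. if P.in_class (x/2) x b d n then of_real (mangoldt n) * e (\<gamma> * r * (real n)\<^sup>2) else 0)"
      by (subst sum.inter_filter) auto
    finally show ?thesis .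
  qed
  have pos: "(\<Sum>n\<in>?N d. e ((\<alpha> * (real n)\<^sup>2 + \<beta>) * real_of_int (int k)) * of_real (mangoldt n)) = e (\<beta> * real k) * P.prime_sum ?X b k d" for d k
    unfolding inner P.prime_sum_def of_int_of_nat_eq ..
  have neg: "(\<Sum>n\<in>?N d. e ((\<alpha> * (real n)\<^sup>2 + \<beta>) * real_of_int (- int k)) * of_real (mangoldt n)) = e (- \<beta> * real k) * N.prime_sum ?X b k d" for d k
    unfolding inner unfolding N.prime_sum_def of_int_minus of_int_of_nat_eq mult_minus_right mult_minus_left ..
  have K0: "0 \<le> K" using P.K_ge by simp
  have "W_sum x D K lam c \<alpha> b \<beta> = (\<Sum>d\<in>{1..nat \<lfloor>D\<rfloor>}. lam d *
      ((\<Sum>k\<in>{1..nat \<lfloor>K\<rfloor>}. c (int k) * (e (\<beta> * real k) * P.prime_sum ?X b k d)) +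
       (\<Sum>k\<in>{1..nat \<lfloor>K\<rfloor>}. c (- int k) * (e (- \<beta> * real k) * N.prime_sum ?X b k d))))"
    unfolding W_sum_def Dset sum_int_symmetric[OF K0] pos neg ..
  also have "\<dots> = (\<Sum>d\<in>{1..nat \<lfloor>D\<rfloor>}. \<Sum>k\<in>{1..nat \<lfloor>K\<rfloor>}. (c (int k) * e (\<beta> * real k)) * lam d * P.prime_sum ?X b k d)
    + (\<Sum>d\<in>{1..nat \<lfloor>D\<rfloor>}. \<Sum>k\<in>{1..nat \<lfloor>K\<rfloor>}. (c (- int k) * e (- \<beta> * real k)) * lam d * N.prime_sum ?X b k d)"
    unfolding sum.distrib[symmetric] distrib_left sum_distrib_left by (simp add: mult_ac)
  also have "(\<Sum>d\<in>{1..nat \<lfloor>D\<rfloor>}. \<Sum>k\<in>{1..nat \<lfloor>K\<rfloor>}. (c (int k) * e (\<beta> * real k)) * lam d * P.prime_sum ?X b k d) =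
      (\<Sum>k\<in>{1..nat \<lfloor>K\<rfloor>}. \<Sum>d\<in>{1..nat \<lfloor>D\<rfloor>}. (c (int k) * e (\<beta> * real k)) * lam d * P.prime_sum ?X b k d)"
    by (rule sum.swap)
  also have "(\<Sum>d\<in>{1..nat \<lfloor>D\<rfloor>}. \<Sum>k\<in>{1..nat \<lfloor>K\<rfloor>}. (c (- int k) * e (- \<beta> * real k)) * lam d * N.prime_sum ?X b k d) =
      (\<Sum>k\<in>{1..nat \<lfloor>K\<rfloor>}. \<Sum>d\<in>{1..nat \<lfloor>D\<rfloor>}. (c (- int k) * e (- \<beta> * real k)) * lam d * N.prime_sum ?X b k d)"
    by (rule sum.swap)
  finally show ?thesis .
qed

text \<open>The fourth roots of the parts of \<open>\<omega>\<close> are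
  \<open>\<Delta> powr (-1/32)\<close>, \<open>\<Delta> powr (1/2) / q powr (1/4)\<close> and
  \<open>\<Delta> powr (1/2) * (q / Q) powr (1/4)\<close>; multiplied by \<open>x * K\<close> they
  become the first, fourth and fifth terms of the bound.\<close>

lemma W_sum_bound:
  fixes x \<rho> :: real
  defines "\<Delta> \<equiv> x powr \<rho>" and "y \<equiv> x powr (\<rho> / 8)"
  assumes ma: "minor_arc x T K y \<alpha> a q I" and \<rho>: "0 < \<rho>" "\<rho> \<le> 16"
    and D: "0 \<le> D" "D * \<Delta> \<le> sqrt x"
    and y50: "y^50 \<le> x \<or> 2 * x powr (1/6) \<le> y^10" and x23: "2 * x powr (2/3) * y \<le> x"
    and sep: "\<And>d. 1 \<le> d \<Longrightarrow> real d \<le> D \<Longrightarrow> lam d \<noteq> 0 \<Longrightarrow> well_separable D d"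
    and c: "\<And>k. 1 \<le> \<bar>k\<bar> \<Longrightarrow> real_of_int \<bar>k\<bar> \<le> K \<Longrightarrow> norm (c k) \<le> T"
    and lam: "\<And>d. 1 \<le> d \<Longrightarrow> real d \<le> D \<Longrightarrow> norm (lam d) \<le> T"
  shows "norm (W_sum x D K lam c \<alpha> b \<beta>) \<le> 4 * T^16 *
     (x * K / \<Delta> powr (1/32) + x * K / real q powr (1/32)
           + x powr (15/16) * K powr (31/32) * real q powr (1/32)
           + x * \<Delta> powr (1/2) * K / real q powr (1/4)
           + x powr (1/2) * \<Delta> powr (1/2) * K powr (3/4) * real q powr (1/4))" (is "_ \<le> 4 * T^16 * ?B")
proof -
  interpret P: minor_arc x T K y \<alpha> a q I by fact
  interpret N: minor_arc x T K y "-\<alpha>" "-a" q I by (rule minor_arc_uminus[OF ma])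
  let ?X = "nat \<lfloor>x\<rfloor>" and ?K0 = "nat \<lfloor>K\<rfloor>" and ?D0 = "nat \<lfloor>D\<rfloor>"
  have x0: "0 < x" "1 \<le> x" using P.x_ge by auto
  have K0: "0 < K" using P.K_ge by simp
  have q0: "0 < real q" using P.q_ge by simp
  have \<Delta>0: "0 < \<Delta>" using x0 by (simp add: \<Delta>_def)
  have y0: "0 < y" using x0 by (simp add: y_def)
  have y8: "y^8 = \<Delta>" using x0 by (simp add: y_def \<Delta>_def powr_pow)
  have y16: "y^16 = \<Delta>^2" unfolding y8[symmetric] by (simp flip: power_mult)
  have Q: "P.Q = x\<^sup>2 * K" by (rule P.Q_def)
  have Q0: "0 < P.Q" by (rule P.Q_pos)
  let ?u = "\<Delta>^2 / real q" and ?v = "\<Delta>^2 * real q / P.Q"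
  have uv0: "0 < ?u" "0 < ?v" using \<Delta>0 q0 Q0 by simp_all
  have \<kappa>: "y^16 * P.\<kappa> = ?u + ?v" unfolding y16 P.\<kappa>_def by (simp add: distrib_left)
  have r1: "root 4 (1 / y) = 1 / \<Delta> powr (1/32)"
  proof -
    have "root 4 (1 / y) = (1 / y) powr (1/4)" using y0 by (intro root4_powr) simp
    also have "\<dots> = 1 / \<Delta> powr (1/32)"
      using x0 by (simp add: y_def \<Delta>_def powr_powr powr_divide)
    finally show ?thesis .
  qed
  have t1: "x * K / \<Delta> powr (1/32) = x * K * root 4 (1 / y)" by (simp add: r1)
  have \<Delta>2: "(\<Delta>^2) powr (1/4) = \<Delta> powr (1/2)" using \<Delta>0 by (simp add: power_powr)
  have t4: "x * \<Delta> powr (1/2) * K / real q powr (1/4) = x * K * root 4 ?u"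
    unfolding root4_powr[OF uv0(1)] using \<Delta>0 q0 \<Delta>2 by (simp add: powr_divide)
  have t5: "x powr (1/2) * \<Delta> powr (1/2) * K powr (3/4) * real q powr (1/4) = x * K * root 4 ?v"
  proof -
    have x2: "(x\<^sup>2) powr (1/4) = x powr (1/2)" using x0 by (simp add: power_powr)
    have "root 4 ?v = \<Delta> powr (1/2) * real q powr (1/4) / (x powr (1/2) * K powr (1/4))"
      unfolding root4_powr[OF uv0(2)] unfolding Q using \<Delta>0 q0 x0 K0 by (simp add: powr_divide powr_mult \<Delta>2 x2)
    moreover have "x = x powr (1/2) * x powr (1/2)" using x0 by (simp flip: powr_add)
    moreover have "K = K powr (3/4) * K powr (1/4)" using K0 by (simp flip: powr_add)
    ultimately have "x * K * root 4 ?v = (x powr (1/2) * x powr (1/2)) * (K powr (3/4) * K powr (1/4)) *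
        (\<Delta> powr (1/2) * real q powr (1/4) / (x powr (1/2) * K powr (1/4)))" by simp
    also have "\<dots> = x powr (1/2) * \<Delta> powr (1/2) * K powr (3/4) * real q powr (1/4)"
      using x0 K0 by (simp add: field_simps)
    finally show ?thesis by simp
  qed
  have B: "x * K * (root 4 (1 / y) + root 4 ?u + root 4 ?v) \<le> ?B"
  proof -
    have "0 \<le> x * K / real q powr (1/32)" "0 \<le> x powr (15/16) * K powr (31/32) * real q powr (1/32)" using x0 K0 by simp_all
    then show ?thesis unfolding t1 t4 t5 by (simp add: distrib_left)
  qed
  have r0: "0 \<le> root 4 (1 / y)" "0 \<le> root 4 ?u" "0 \<le> root 4 ?v" using y0 uv0 by simp_all
  have xK: "0 < x * K" using x0 K0 by simp
  have K1: "real ?K0 \<le> K" "K \<le> 2 * real ?K0" "1 \<le> ?K0"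
  proof -
    have f: "1 \<le> \<lfloor>K\<rfloor>" using P.K_ge by simp
    then show "real ?K0 \<le> K" "1 \<le> ?K0" by linarith+
    have "K < real_of_int \<lfloor>K\<rfloor> + 1" by linarith
    moreover have "real ?K0 = real_of_int \<lfloor>K\<rfloor>" using f by simp
    ultimately show "K \<le> 2 * real ?K0" using f by linarith
  qed
  have X: "x < real ?X + 1" "real ?X \<le> x" using x0 by linarith+
  have D0: "real ?D0 \<le> D" using D(1) by simp
  have D8: "D * y^8 \<le> sqrt x" using D(2) y8 by simp
  have Dx: "real ?D0 \<le> x"
  proof -
    have "D * 1 \<le> D * y^8" using D(1) P.y_ge by (intro mult_left_mono one_le_power) auto
    moreover have "sqrt x \<le> x" using P.x_ge real_sqrt_le_mono[of x "x * x"] by simp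
    ultimately show ?thesis using D0 D8 by linarith
  qed
  have dD: "1 \<le> d \<and> real d \<le> D" if "d \<in> {1..?D0}" for d
  proof -
    have "real d \<le> real ?D0" using that by simp
    then show ?thesis using D0 that by auto
  qed
  have kK: "1 \<le> \<bar>int k\<bar> \<and> real_of_int \<bar>int k\<bar> \<le> K" if "k \<in> {1..?K0}" for k
  proof -
    have "real k \<le> real ?K0" using that by simp
    then show ?thesis using K1(1) that by auto
  qed
  let ?cp = "\<lambda>k. c (int k) * e (\<beta> * real k)" and ?cn = "\<lambda>k. c (- int k) * e (- \<beta> * real k)"
  have cp: "norm (?cp k) \<le> T" "norm (?cn k) \<le> T" if "k \<in> {1..?K0}" for k
    using c[of "int k"] c[of "- int k"] kK[OF that] by (simp_all add: norm_mult)
  have lam': "norm (lam d) \<le> T" if "d \<in> {1..?D0}" for d using lam dD[OF that] by blast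
  have sep': "well_separable D d" if "d \<in> {1..?D0}" "lam d \<noteq> 0" for d using sep dD[OF that(1)] that(2) by blast
  let ?P = "\<Sum>k\<in>{1..?K0}. \<Sum>d\<in>{1..?D0}. ?cp k * lam d * P.prime_sum ?X b k d"
  let ?N = "\<Sum>k\<in>{1..?K0}. \<Sum>d\<in>{1..?D0}. ?cn k * lam d * N.prime_sum ?X b k d"
  have W: "norm (W_sum x D K lam c \<alpha> b \<beta>) \<le> norm ?P + norm ?N"
    unfolding W_sum_split[OF ma D(1)] by (rule norm_triangle_ineq)
  have B0: "0 \<le> ?B" using B xK r0 by (smt (verit) add_nonneg_nonneg mult_nonneg_nonneg)
  show ?thesis
  proof (cases "P.\<kappa> * y^16 \<le> 1")
    case True
    have "P.\<omega> = 1 / y + (?u + ?v)" unfolding P.\<omega>_def \<kappa> ..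
    then have "root 4 P.\<omega> \<le> root 4 (1 / y) + (root 4 ?u + root 4 ?v)"
      using root4_add_le[of "1 / y" "?u + ?v"] root4_add_le[of ?u ?v] y0 uv0 by simp
    then have "x * K * root 4 P.\<omega> \<le> x * K * (root 4 (1 / y) + root 4 ?u + root 4 ?v)"
      using xK by (intro mult_left_mono) auto
    then have 1: "K * x * root 4 P.\<omega> \<le> ?B" using B by (simp add: mult.commute)
    have 2: "K * sqrt x \<le> ?B"
    proof -
      have "sqrt x \<le> x * root 4 (1 / y)"
      proof -
        have "x * root 4 (1 / y) = x / \<Delta> powr (1/32)" by (simp add: r1)
        also have "\<dots> = x powr (1 - \<rho> / 32)" using x0 by (simp add: \<Delta>_def powr_powr powr_diff)
        \<comment> \<open>\<open>\<rho> \<le> 16\<close> is the condition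
          \<open>1 - \<rho> / 32 \<ge> 1 / 2\<close>.\<close>
        also have "\<dots> \<ge> x powr (1/2)" using x0 \<rho> by (intro powr_mono) auto
        finally show ?thesis using x0 by (simp add: powr_half_sqrt)
      qed
      then have "K * sqrt x \<le> x * K * root 4 (1 / y)" using K0 by (simp add: mult_ac)
      also have "\<dots> \<le> x * K * (root 4 (1 / y) + root 4 ?u + root 4 ?v)" using xK r0 by (intro mult_left_mono) auto
      finally show ?thesis using B by linarith
    qed
    have 3: "T^16 * (K * x * root 4 P.\<omega> + K * sqrt x) \<le> T^16 * (2 * ?B)"
    proof (rule mult_left_mono)
      show "K * x * root 4 P.\<omega> + K * sqrt x \<le> 2 * ?B" unfolding mult_2 by (rule add_mono[OF 1 2])
    qed (use P.T_pos in simp)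
    have "norm ?P \<le> T^16 * (K * x * root 4 P.\<omega> + K * sqrt x)"
      by (rule P.one_sided_total[OF K1(3,1,2) D8 D0 y50 x23 True sep' cp(1) lam' X])
    moreover have "norm ?N \<le> T^16 * (K * x * root 4 P.\<omega> + K * sqrt x)"
      by (rule N.one_sided_total[OF K1(3,1,2) D8 D0 y50 x23 True sep' cp(2) lam' X])
    ultimately show ?thesis using W 3 by linarith
  next
    case False
    \<comment> \<open>Here the fourth and fifth terms together already reach \<open>x * K\<close>,
      so the trivial estimate suffices.\<close>
    then have "1 \<le> ?u + ?v" using \<kappa> by (simp add: mult.commute)
    then have "root 4 1 \<le> root 4 (?u + ?v)" by (intro real_root_le_mono) auto
    also have "\<dots> \<le> root 4 ?u + root 4 ?v" using uv0 by (intro root4_add_le) auto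
    finally have "1 \<le> root 4 ?u + root 4 ?v" by (simp only: real_root_one zero_less_numeral)
    then have "1 \<le> root 4 (1 / y) + root 4 ?u + root 4 ?v" using r0(1) by linarith
    then have "x * K * 1 \<le> x * K * (root 4 (1 / y) + root 4 ?u + root 4 ?v)"
      by (rule mult_left_mono[OF _ less_imp_le[OF xK]])
    then have "K * x \<le> ?B" using B by (simp add: mult.commute)
    then have 3: "T^5 * K * x \<le> T^16 * ?B"
      unfolding mult.assoc using P.T_power_mono[of 5 16] P.T_pos xK by (intro mult_mono) (auto simp: mult.commute)
    have "norm ?P \<le> T^5 * K * x"
      by (rule P.one_sided_trivial_bound[OF K1(1) X(2) Dx cp(1) lam'])
    moreover have "norm ?N \<le> T^5 * K * x"
      by (rule N.one_sided_trivial_bound[OF K1(1) X(2) Dx cp(2) lam'])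
    ultimately have "norm (W_sum x D K lam c \<alpha> b \<beta>) \<le> T^16 * ?B + T^16 * ?B"
      using 3 by (intro order_trans[OF W] add_mono) (rule order_trans, assumption, assumption)+
    also have "\<dots> = 2 * (T^16 * ?B)" by (rule mult_2[symmetric])
    also have "\<dots> \<le> 4 * (T^16 * ?B)" using B0 P.T_pos by (intro mult_right_mono mult_nonneg_nonneg) simp_all
    finally show ?thesis by (simp only: mult.assoc)
  qed
qed

section \<open>Size conditions valid for all large \<open>x\<close>\<close>

lemma eventually_parameters:
  fixes \<theta> \<rho> \<eta> C :: real
  assumes "0 < \<theta>" "\<theta> < 1/200" "\<rho> < 11/54" "0 < \<eta>" "\<eta> \<le> 1/2"
  shows "eventually (\<lambda>x::real. 12 \<le> x \<and> 1 \<le> ln x \<and> C \<le> x powr (\<eta>/2) \<and> 1000 \<le> x powr \<eta> \<and> (ln x)\<^sup>2 * x powr \<theta> \<le> x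
     \<and> 1000 * (12 * log 2 x + 2) \<le> x powr \<eta> \<and> 2 * x powr (2/3) * x powr (\<rho> / 8) \<le> x
     \<and> 2 \<le> x powr (1/30)) at_top"
proof (intro eventually_conj)
  show "\<forall>\<^sub>F x::real in at_top. 12 \<le> x" by (rule eventually_ge_at_top)
  show "\<forall>\<^sub>F x::real in at_top. 1 \<le> ln x" by real_asymp
  have lim: "filterlim (\<lambda>x::real. x powr s) at_top at_top" if "0 < s" for s
    using that by real_asymp
  show "\<forall>\<^sub>F x in at_top. C \<le> x powr (\<eta>/2)" using lim[of "\<eta>/2"] assms by (simp add: filterlim_at_top)
  show "\<forall>\<^sub>F x in at_top. 1000 \<le> x powr \<eta>" using lim[of \<eta>] assms by (simp add: filterlim_at_top)
  show "\<forall>\<^sub>F x in at_top. 2 \<le> x powr (1/30 :: real)" using lim[of "1/30"] by (simp add: filterlim_at_top)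
  have "\<forall>\<^sub>F x::real in at_top. (ln x)\<^sup>2 * x powr (1/200) \<le> x" by real_asymp
  then show "\<forall>\<^sub>F x in at_top. (ln x)\<^sup>2 * x powr \<theta> \<le> x"
    using eventually_ge_at_top[of 1]
  proof eventually_elim
    case (elim x)
    have "(ln x)\<^sup>2 * x powr \<theta> \<le> (ln x)\<^sup>2 * x powr (1/200)" using elim assms by (intro mult_left_mono powr_mono) auto
    then show ?case using elim by linarith
  qed
  show "\<forall>\<^sub>F x in at_top. 1000 * (12 * log 2 x + 2) \<le> x powr \<eta>" using assms by real_asymp
  have "\<forall>\<^sub>F x::real in at_top. 2 * x powr (2/3) * x powr (1/30) \<le> x" by real_asymp
  then show "\<forall>\<^sub>F x in at_top. 2 * x powr (2/3) * x powr (\<rho> / 8) \<le> x"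
    using eventually_ge_at_top[of 1]
  proof eventually_elim
    case (elim x)
    \<comment> \<open>\<open>\<rho> < 11/54\<close> gives \<open>\<rho> / 8 < 1/30\<close>, and
      \<open>2/3 + 1/30 < 1\<close> leaves room for the factor 2.\<close>
    have "2 * x powr (2/3) * x powr (\<rho> / 8) \<le> 2 * x powr (2/3) * x powr (1/30)" using elim assms by (intro mult_left_mono powr_mono) auto
    then show ?case using elim by linarith
  qed
qed

theorem theorem1:
  fixes \<theta> \<rho> \<epsilon> Clam Cc :: real
  assumes "0 < \<theta>" "\<theta> < 1/200" "\<rho> > 32 * \<theta>" "\<rho> + 4 * \<theta> < 11/54" "\<rho> + \<theta> > 0"
    and "\<epsilon> > 0"
  shows "\<exists>C x0. \<forall>x \<ge> x0. \<forall>(\<alpha>::real) (a::int) (q::nat) (lam::nat \<Rightarrow> complex)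
            (c::int \<Rightarrow> complex) (b::int) (\<beta>::real).
     (let \<delta> = x powr (-\<theta>); K = (ln x)\<^sup>2 / \<delta>; \<Delta> = x powr \<rho>;
          D = sqrt x / (\<Delta> * K ^ 4) in
       \<alpha> \<notin> \<rat> \<and> q \<ge> 1 \<and> coprime a (int q) \<and> \<bar>\<alpha> - a / q\<bar> < 1 / (real q)\<^sup>2 \<and>
       (\<forall>d. 1 \<le> d \<and> real d \<le> D \<longrightarrow> norm (lam d) \<le> Clam * real (divisor_count d)) \<and>
       (\<forall>d. 1 \<le> d \<and> real d \<le> D \<and> lam d \<noteq> 0 \<longrightarrow> well_separable D d) \<and>
       (\<forall>k::int. 1 \<le> \<bar>k\<bar> \<and> real_of_int \<bar>k\<bar> \<le> K \<longrightarrow> norm (c k) \<le> Cc)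
       \<longrightarrow>
       norm (W_sum x D K lam c \<alpha> b \<beta>) \<le>
         C * x powr \<epsilon> * (x * K / \<Delta> powr (1/32) + x * K / real q powr (1/32)
           + x powr (15/16) * K powr (31/32) * real q powr (1/32)
           + x * \<Delta> powr (1/2) * K / real q powr (1/4)
           + x powr (1/2) * \<Delta> powr (1/2) * K powr (3/4) * real q powr (1/4)))"
proof -
  \<comment> \<open>With \<open>T = x powr \<eta>\<close> the final bound carries
    \<open>T^16\<close>, which \<open>16 * \<eta> \<le> \<epsilon>\<close> absorbs.\<close>
  define \<eta> where "\<eta> = min (\<epsilon> / 16) (1/2)"
  have \<eta>: "0 < \<eta>" "\<eta> \<le> 1/2" "16 * \<eta> \<le> \<epsilon>" using assms by (auto simp: \<eta>_def)
  \<comment> \<open>For integers up to \<open>x^12\<close> the exponent \<open>\<eta> / 24\<close>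
    amounts to \<open>T powr (1/2)\<close>; the other half of \<open>T\<close> absorbs
    \<open>C0\<close> and \<open>Clam\<close>.\<close>
  obtain C0 where C0: "1 \<le> C0" "\<And>n. 0 < n \<Longrightarrow> real (divisor_count n) \<le> C0 * real n powr (\<eta> / 24)"
    using divisor_count_le_powr[of "\<eta> / 24"] \<eta> by auto
  define C where "C = (1 + \<bar>Clam\<bar> + \<bar>Cc\<bar>) * C0"
  have \<rho>: "0 < \<rho>" "\<rho> < 11/54" using assms by auto
  obtain x0 where x0: "\<And>x. x0 \<le> x \<Longrightarrow> 12 \<le> x \<and> 1 \<le> ln x \<and> C \<le> x powr (\<eta>/2) \<and> 1000 \<le> x powr \<eta> \<and> (ln x)\<^sup>2 * x powr \<theta> \<le> x
     \<and> 1000 * (12 * log 2 x + 2) \<le> x powr \<eta> \<and> 2 * x powr (2/3) * x powr (\<rho> / 8) \<le> x \<and> 2 \<le> x powr (1/30)"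
    using eventually_parameters[OF assms(1,2) \<rho>(2) \<eta>(1,2), of C] unfolding eventually_at_top_linorder by blast
  show ?thesis
    unfolding Let_def
  proof (rule exI[of _ 4], rule exI[of _ x0], intro allI impI, elim conjE)
    fix x \<alpha> \<beta> :: real and a b :: int and q :: nat and lam :: "nat \<Rightarrow> complex" and c :: "int \<Rightarrow> complex"
    assume xx: "x0 \<le> x"
    let ?K = "(ln x)\<^sup>2 / x powr (-\<theta>)" and ?\<Delta> = "x powr \<rho>"
    let ?D = "sqrt x / (?\<Delta> * ?K ^ 4)" and ?T = "x powr \<eta>" and ?y = "x powr (\<rho> / 8)"
    assume q: "1 \<le> q" "coprime a (int q)" "\<bar>\<alpha> - real_of_int a / real q\<bar> < 1 / (real q)\<^sup>2"
      and lam: "\<forall>d. 1 \<le> d \<and> real d \<le> ?D \<longrightarrow> norm (lam d) \<le> Clam * real (divisor_count d)"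
      and sep: "\<forall>d. 1 \<le> d \<and> real d \<le> ?D \<and> lam d \<noteq> 0 \<longrightarrow> well_separable ?D d"
      and c: "\<forall>k::int. 1 \<le> \<bar>k\<bar> \<and> real_of_int \<bar>k\<bar> \<le> ?K \<longrightarrow> norm (c k) \<le> Cc"
    have par: "12 \<le> x" "1 \<le> ln x" "C \<le> x powr (\<eta>/2)" "1000 \<le> x powr \<eta>" "(ln x)\<^sup>2 * x powr \<theta> \<le> x"
      "1000 * (12 * log 2 x + 2) \<le> x powr \<eta>" "2 * x powr (2/3) * x powr (\<rho> / 8) \<le> x" "2 \<le> x powr (1/30)"
      using x0[OF xx] by blast+
    have xpos: "0 < x" "1 \<le> x" using par by auto
    have K: "?K = (ln x)\<^sup>2 * x powr \<theta>" by (simp add: powr_minus field_simps)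
    have K1: "1 \<le> ?K"
    proof -
      have "1 * 1 \<le> (ln x)\<^sup>2 * x powr \<theta>"
        using par xpos assms(1) by (intro mult_mono one_le_power) (auto simp: ge_one_powr_ge_zero)
      then show ?thesis unfolding K by simp
    qed
    \<comment> \<open>Enough dyadic ranges to cover the integers up to \<open>x^12\<close>; the
      extra 1 makes \<open>x^12 < 2^I\<close> strict.\<close>
    define I where "I = nat \<lceil>12 * log 2 x\<rceil> + 1"
    have log0: "0 \<le> log 2 x" using xpos by simp
    have C: "C0 \<le> ?T powr (1/2)" "\<bar>Clam\<bar> * C0 \<le> ?T powr (1/2)" "\<bar>Cc\<bar> \<le> ?T"
    proof -
      have T2: "?T powr (1/2) = x powr (\<eta>/2)" by (simp add: powr_powr)
      have "C0 \<le> C" "\<bar>Clam\<bar> * C0 \<le> C" "\<bar>Cc\<bar> \<le> C"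
      proof -
        have "1 * C0 \<le> C" "\<bar>Clam\<bar> * C0 \<le> C" "\<bar>Cc\<bar> * C0 \<le> C" unfolding C_def using C0(1) by (intro mult_right_mono; simp)+
        moreover have "\<bar>Cc\<bar> * 1 \<le> \<bar>Cc\<bar> * C0" using C0(1) by (intro mult_left_mono) auto
        ultimately show "C0 \<le> C" "\<bar>Clam\<bar> * C0 \<le> C" "\<bar>Cc\<bar> \<le> C" by linarith+
      qed
      moreover have "x powr (\<eta>/2) \<le> ?T" using xpos \<eta> by (intro powr_mono) auto
      ultimately show "C0 \<le> ?T powr (1/2)" "\<bar>Clam\<bar> * C0 \<le> ?T powr (1/2)" "\<bar>Cc\<bar> \<le> ?T"
        unfolding T2 using par by linarith+
    qed
    have TT: "?T powr (1/2) * ?T powr (1/2) = ?T" by (simp flip: powr_add)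
    have tau: "real (divisor_count n) \<le> C0 * ?T powr (1/2)" if "0 < n" "real n \<le> x ^ 12" for n
    proof -
      have "real n powr (\<eta> / 24) \<le> (x ^ 12) powr (\<eta> / 24)" using that \<eta> by (intro powr_mono2) auto
      also have "\<dots> = ?T powr (1/2)" using xpos by (simp add: powr_powr power_powr)
      finally show ?thesis using C0(2)[OF that(1)] C0(1) mult_left_mono[of "real n powr (\<eta> / 24)" "?T powr (1/2)" C0] by linarith
    qed
    have ma: "minor_arc x ?T ?K ?y \<alpha> a q I"
    proof
      show "12 \<le> x" "1000 \<le> ?T" using par by auto
      show "1 \<le> ?K" by (rule K1)
      show "?K \<le> x" unfolding K using par by simp
      have "x powr \<eta> \<le> x powr 1" using xpos \<eta> by (intro powr_mono) auto
      then show "?T \<le> x" using xpos by simp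
      show "1 \<le> ?y" using xpos \<rho> by (simp add: ge_one_powr_ge_zero)
      have "real I \<le> 12 * log 2 x + 2" using log0 by (simp add: I_def) linarith
      then have "1000 * real I \<le> 1000 * (12 * log 2 x + 2)" by (intro mult_left_mono) auto
      also have "\<dots> \<le> ?T" by (rule par(6))
      finally show "1000 * real I \<le> ?T" .
      show "x ^ 12 < 2 ^ I"
      proof -
        have "x ^ 12 = 2 powr (12 * log 2 x)"
        proof -
          have "2 powr (log 2 x * 12) = (2 powr log 2 x) powr 12" by (simp only: powr_powr)
          also have "\<dots> = x powr 12" using xpos by simp
          also have "\<dots> = x ^ 12" using xpos powr_realpow[of x 12] by simp
          finally show ?thesis by (simp add: mult.commute)
        qed
        also have "\<dots> < 2 powr real I"
        proof (rule powr_less_mono)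
          show "12 * log 2 x < real I" using log0 unfolding I_def by linarith
        qed simp
        also have "\<dots> = 2 ^ I" by (simp add: powr_realpow)
        finally show ?thesis .
      qed
      show "real (divisor_count n) \<le> ?T" if "0 < n" "real n \<le> x ^ 12" for n
        using tau[OF that] C(1) TT mult_right_mono[of C0 "?T powr (1/2)" "?T powr (1/2)"] by simp
    qed (use q in auto)
    have D0: "0 \<le> ?D" using xpos K1 by simp
    have D: "?D * ?\<Delta> \<le> sqrt x"
    proof -
      have "?D * ?\<Delta> = sqrt x / ?K ^ 4" using xpos by simp
      also have "\<dots> \<le> sqrt x / 1" using K1 xpos by (intro divide_left_mono one_le_power) auto
      finally show ?thesis by simp
    qed
    have Dx: "?D \<le> x"
    proof -
      have "?D * 1 \<le> ?D * ?\<Delta>" using D0 xpos \<rho> by (intro mult_left_mono) (auto simp: ge_one_powr_ge_zero)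
      moreover have "sqrt x \<le> x" using par real_sqrt_le_mono[of x "x * x"] by simp
      ultimately show ?thesis using D by linarith
    qed
    \<comment> \<open>As \<open>y = x powr (\<rho> / 8)\<close>, the first alternative amounts to
      \<open>\<rho> \<le> 4/25\<close>; beyond it \<open>10 * \<rho> / 8 > 1/5 = 1/6 + 1/30\<close>,
      and \<open>x powr (1/30)\<close> absorbs the 2.\<close>
    have y50: "?y ^ 50 \<le> x \<or> 2 * x powr (1/6) \<le> ?y ^ 10"
    proof (cases "\<rho> \<le> 4/25")
      case True
      have "?y ^ 50 = x powr (50 * \<rho> / 8)" using xpos by (simp add: powr_pow)
      also have "\<dots> \<le> x powr 1" using True xpos by (intro powr_mono) auto
      finally show ?thesis using xpos by simp
    next
      case False
      have "2 * x powr (1/6) \<le> x powr (1/30) * x powr (1/6)" using par by (intro mult_right_mono) auto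
      also have "\<dots> = x powr (1/5)" by (simp flip: powr_add)
      also have "\<dots> \<le> x powr (10 * \<rho> / 8)" using False xpos by (intro powr_mono) auto
      also have "\<dots> = ?y ^ 10" using xpos by (simp add: powr_pow)
      finally show ?thesis by blast
    qed
    have lamT: "norm (lam d) \<le> ?T" if d: "1 \<le> d" "real d \<le> ?D" for d
    proof -
      have "x \<le> x ^ 12" using xpos power_increasing[of 1 12 x] by simp
      then have d12: "real d \<le> x ^ 12" using d Dx by linarith
      have "norm (lam d) \<le> Clam * real (divisor_count d)" using lam d by blast
      also have "\<dots> \<le> \<bar>Clam\<bar> * real (divisor_count d)" by (intro mult_right_mono) auto
      also have "\<dots> \<le> \<bar>Clam\<bar> * (C0 * ?T powr (1/2))" using tau[OF _ d12] d by (intro mult_left_mono) auto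
      also have "\<dots> = (\<bar>Clam\<bar> * C0) * ?T powr (1/2)" by simp
      also have "\<dots> \<le> ?T powr (1/2) * ?T powr (1/2)" using C(2) by (intro mult_right_mono) auto
      finally show ?thesis unfolding TT .
    qed
    have cT: "norm (c k) \<le> ?T" if "1 \<le> \<bar>k\<bar>" "real_of_int \<bar>k\<bar> \<le> ?K" for k
    proof -
      have "norm (c k) \<le> Cc" using c that by blast
      then show ?thesis using C(3) by linarith
    qed
    have T16: "?T ^ 16 \<le> x powr \<epsilon>"
    proof -
      have "?T ^ 16 = x powr (16 * \<eta>)" using xpos by (simp add: powr_pow)
      also have "\<dots> \<le> x powr \<epsilon>" using xpos \<eta> by (intro powr_mono) auto
      finally show ?thesis .
    qed
    let ?B = "x * ?K / ?\<Delta> powr (1/32) + x * ?K / real q powr (1/32)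
           + x powr (15/16) * ?K powr (31/32) * real q powr (1/32)
           + x * ?\<Delta> powr (1/2) * ?K / real q powr (1/4)
           + x powr (1/2) * ?\<Delta> powr (1/2) * ?K powr (3/4) * real q powr (1/4)"
    have B0: "0 \<le> ?B"
      using xpos K1 by (intro add_nonneg_nonneg mult_nonneg_nonneg divide_nonneg_nonneg) (auto simp del: divide_powr_uminus)
    have "norm (W_sum x ?D ?K lam c \<alpha> b \<beta>) \<le> 4 * ?T ^ 16 * ?B"
      by (rule W_sum_bound[OF ma \<rho>(1) _ D0 D y50]) (use par \<rho> sep cT lamT in auto)
    also have "\<dots> \<le> 4 * x powr \<epsilon> * ?B" using T16 B0 by (intro mult_right_mono mult_left_mono) auto
    finally show "norm (W_sum x ?D ?K lam c \<alpha> b \<beta>) \<le> 4 * x powr \<epsilon> * ?B" .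
  qed
qed

end
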